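(* Let $\mathbf{A}\in\mathbb{R}^{k\times n}$ have rank $k<n$, let $\sigma:\mathbb{R}^k\to\mathbb{R}$ be the network $\sigma(y)=\mathbf{W}_1\phi_1(\mathbf{W}_2\phi_2(\cdots\mathbf{W}_d\phi_d(y)\cdots))$ with weight matrices $\mathbf{W}_i$ ($\mathbf{W}_1$ having one row) and activation functions $\phi_i:\mathbb{R}\to\mathbb{R}$ applied entrywise, and let $M(x)=\tau(\sigma(\mathbf{A}x))$ where $\tau(t)=1$ if $t\ge 1$ and $\tau(t)=0$ otherwise. For a subspace $V\subseteq\mathbb{R}^n$ write $\sigma_V(x)=\sigma(\mathbf{A}(\mathbb{I}_n-\mathbf{P}_V)x)$. Assume: (1) each $\phi_i$ is continuous and twice differentiable with $\phi_i(0)=0$; (2) $\sup_{t}|\phi_i'(t)|\le L_i$ and $\sup_t|\phi_i''(t)|\le L_i$; (3) for every subspace $V\subset\mathbb{R}^n$ with $\dim V<k$, $\Pr_{g\sim\mathcal{N}(0,\mathbb{I}_n)}[\sigma_V(g)\ge 1]\ge\gamma$; (4) for every subspace $V\subset\mathbb{R}^n$ with $\dim V<k$, $\Pr_{g\sim\mathcal{N}(0,\mathbb{I}_n)}\big[\,|\nabla_g\sigma_V(cg)|\ge\eta \text{ for all } c>0 \text{ with } \sigma_V(cg)=1,\ \text{and } \sigma_V(g)\ge 1\big]\ge\gamma$, for some $\gamma,\eta>0$. Let $\kappa_i$ be the condition number of $\mathbf{W}_i$, let $\epsilon,\delta>0$, and let $N=\mathrm{poly}\big(n,k,\tfrac1\gamma,\sum_i\log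 L_i,\sum_i\log\kappa_i,\log\tfrac1\eta,\log\tfrac1\epsilon,\log\tfrac1\delta\big)$. Then there is an algorithm (Algorithm 2 of the paper) with oracle access to $M$ that runs in $\mathrm{poly}(N)$ time, makes at most $\mathrm{poly}(N)$ queries to $M$, and with probability at least $1-\delta$ returns a subspace $V\subset\mathbb{R}^n$ of dimension $k$ such that every $x\in V$ satisfies $\|\mathbf{P}_{\operatorname{Span}(\mathbf{A})}x\|_2\ge(1-\epsilon)\|x\|_2$.
   Context: $\mathbf{P}_V$ is the orthogonal projection onto a subspace $V$; $\operatorname{Span}(\mathbf{A})$ is the row span of $\mathbf{A}$. $\nabla_g\sigma_V(cg)$ denotes the directional derivative of $\sigma_V$ at the point $cg$ in the direction $g$. The condition number of a matrix is the ratio of its largest to smallest singular value. The algorithm only observes the values $M(x)\in\{0,1\}$ at chosen query points $x$ (in particular it can query $M((\mathbb{I}_n-\mathbf{P}_V)x)=\tau(\sigma_V(x))$ for subspaces $V$ it has constructed).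
   Formalization: A known upper bound on the spectral norms of A and all W_i is given to the algorithm and its log is added to N (else false: φ=2 sin t, A=T·aᵀ, T→∞); each log is read as max(1, log), so N is at least the number of layers; time is unit-cost real-RAM time. *)

theory Defs
  imports "HOL-Probability.Probability" "Jordan_Normal_Form.DL_Rank"
    "Jordan_Normal_Form.Char_Poly"
begin

hide_const (open) Finite_Cartesian_Product.vec Finite_Cartesian_Product.row
  Finite_Cartesian_Product.rows Finite_Cartesian_Product.mat
no_notation Finite_Cartesian_Product.vec_nth (infixl \<open>$\<close> 90)
no_notation Inner_Product.real_inner_class.inner (infix \<open>\<bullet>\<close> 70)

section \<open>Subspaces and projections in \<open>\<real>\<^sup>n\<close>\<close>

text \<open>The dimension \<open>n\<close> is quantified inside the statement (a single algorithm serves all \<open>n\<close>),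
  hence the vectors and matrices with explicit carriers.\<close>

definition subspace_of :: "nat \<Rightarrow> real vec set \<Rightarrow> bool" where
  "subspace_of n V \<longleftrightarrow> VectorSpace.subspace class_ring V (module_vec TYPE(real) n)"

definition subspace_dim :: "nat \<Rightarrow> real vec set \<Rightarrow> nat" where
  "subspace_dim n V = vectorspace.dim class_ring ((module_vec TYPE(real) n)\<lparr>carrier := V\<rparr>)"

definition span_of :: "nat \<Rightarrow> real vec set \<Rightarrow> real vec set" where
  "span_of n S = LinearCombinations.module.span class_ring (module_vec TYPE(real) n) S"

definition euclid_norm :: "real vec \<Rightarrow> real" where
  "euclid_norm v = sqrt (v \<bullet> v)"

definition orth_proj :: "real vec set \<Rightarrow> real vec \<Rightarrow> real vec" where
  "orth_proj V x = (THE v. v \<in> V \<and> (\<forall>w\<in>V. (x - v) \<bullet> w = 0))"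


section \<open>Singular values\<close>

text \<open>An \<open>m \<times> n\<close> matrix has \<open>min m n\<close> singular values, so the smaller of the two Gram
  matrices is used; in particular a wide matrix of full rank has no singular value \<open>0\<close>.\<close>

definition gram :: "real mat \<Rightarrow> real mat" where
  "gram W = (if dim_row W \<le> dim_col W then W * W\<^sup>T else W\<^sup>T * W)"

definition singular_values :: "real mat \<Rightarrow> real set" where
  "singular_values W = {sqrt e | e. eigenvalue (gram W) e}"

definition condition_number :: "real mat \<Rightarrow> real" where
  "condition_number W = Max (singular_values W) / Min (singular_values W)"


section \<open>Networks\<close>

text \<open>The list \<open>[(W\<^sub>1, \<phi>\<^sub>1), \<dots>, (W\<^sub>d, \<phi>\<^sub>d)]\<close>, outermost layer first, is a network
  \<open>y \<mapsto> W\<^sub>1 \<phi>\<^sub>1 (W\<^sub>2 \<phi>\<^sub>2 (\<dots> W\<^sub>d \<phi>\<^sub>d (y) \<dots>))\<close>.\<close>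

type_synonym layers = "(real mat \<times> (real \<Rightarrow> real)) list"

fun apply_layers :: "layers \<Rightarrow> real vec \<Rightarrow> real vec" where
  "apply_layers [] y = y"
| "apply_layers ((W, \<phi>) # ls) y = W *\<^sub>v map_vec \<phi> (apply_layers ls y)"

fun layers_dims :: "nat \<Rightarrow> layers \<Rightarrow> nat \<Rightarrow> bool" where
  "layers_dims m [] k \<longleftrightarrow> m = k"
| "layers_dims m ((W, \<phi>) # ls) k \<longleftrightarrow> dim_row W = m \<and> layers_dims (dim_col W) ls k"

definition network :: "nat \<Rightarrow> layers \<Rightarrow> bool" where
  "network k ls \<longleftrightarrow> ls \<noteq> [] \<and> layers_dims 1 ls k"

definition net :: "layers \<Rightarrow> real vec \<Rightarrow> real" where
  "net ls y = apply_layers ls y $ 0"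

definition threshold :: "real \<Rightarrow> nat" where
  "threshold t = (if t \<ge> 1 then 1 else 0)"

definition classifier :: "real mat \<Rightarrow> layers \<Rightarrow> real vec \<Rightarrow> nat" where
  "classifier A ls x = threshold (net ls (A *\<^sub>v x))"

definition net_off :: "real mat \<Rightarrow> layers \<Rightarrow> real vec set \<Rightarrow> real vec \<Rightarrow> real" where
  "net_off A ls V x = net ls (A *\<^sub>v (x - orth_proj V x))"

definition dir_deriv :: "(real vec \<Rightarrow> real) \<Rightarrow> real vec \<Rightarrow> real vec \<Rightarrow> real" where
  "dir_deriv F g x = deriv (\<lambda>t. F (x + t \<cdot>\<^sub>v g)) 0"

definition smooth_activation :: "(real \<Rightarrow> real) \<Rightarrow> real \<Rightarrow> bool" where
  "smooth_activation \<phi> L \<longleftrightarrow>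
     continuous_on UNIV \<phi> \<and> \<phi> 0 = 0 \<and>
     (\<forall>t. \<phi> field_differentiable at t) \<and> (\<forall>t. deriv \<phi> field_differentiable at t) \<and>
     (\<forall>t. \<bar>deriv \<phi> t\<bar> \<le> L) \<and> (\<forall>t. \<bar>deriv (deriv \<phi>) t\<bar> \<le> L)"


section \<open>Gaussian sampling\<close>

definition gauss_seq :: "nat set \<Rightarrow> (nat \<Rightarrow> real) measure" where
  "gauss_seq I = PiM I (\<lambda>_. density lborel std_normal_density)"

definition gauss_prob :: "nat \<Rightarrow> (real vec \<Rightarrow> bool) \<Rightarrow> real" where
  "gauss_prob n Q = measure (gauss_seq {..<n}) {g \<in> space (gauss_seq {..<n}). Q (vec n g)}"


section \<open>Randomised oracle algorithms over the reals\<close>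

text \<open>A real random access machine at unit cost: index registers holding natural numbers, which are
  the only addresses into a memory of real cells; exact field operations and comparisons on
  cells; independent standard normal samples; 0/1-valued oracle answers. Program texts contain no
  real constants, so there are only countably many programs. Operations on real cells take their
  addresses from the named index registers. An oracle sees the memory from a given
  address on (and will look only at the first \<open>n\<close> cells).\<close>

datatype nat_op = NAdd | NSub | NMul

datatype real_op = RAdd | RSub | RMul | RDiv

datatype instr =
    Const nat nat
  | NatOp nat_op nat nat nat
  | Of_Nat nat nat
  | Copy nat nat
  | RealOp real_op nat nat nat
  | Gauss nat
  | Query nat nat

datatype test = NLess nat nat | RLess nat nat

datatype com =
    Instr instr
  | Seq com com
  | Cond test com com
  | While test com

record state =
  idx :: "nat \<Rightarrow> nat"
  mem :: "nat \<Rightarrow> real"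
  drawn :: nat
  queries :: nat
  steps :: nat

fun apply_nat_op :: "nat_op \<Rightarrow> nat \<Rightarrow> nat \<Rightarrow> nat" where
  "apply_nat_op NAdd x y = x + y"
| "apply_nat_op NSub x y = x - y"
| "apply_nat_op NMul x y = x * y"

fun apply_real_op :: "real_op \<Rightarrow> real \<Rightarrow> real \<Rightarrow> real" where
  "apply_real_op RAdd x y = x + y"
| "apply_real_op RSub x y = x - y"
| "apply_real_op RMul x y = x * y"
| "apply_real_op RDiv x y = x / y"

definition set_idx :: "nat \<Rightarrow> nat \<Rightarrow> state \<Rightarrow> state" where
  "set_idx a v s = s\<lparr>idx := (idx s)(a := v)\<rparr>"

definition set_mem :: "nat \<Rightarrow> real \<Rightarrow> state \<Rightarrow> state" where
  "set_mem a v s = s\<lparr>mem := (mem s)(idx s a := v)\<rparr>"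

definition cell :: "state \<Rightarrow> nat \<Rightarrow> real" where
  "cell s a = mem s (idx s a)"

definition tick :: "state \<Rightarrow> state" where
  "tick s = s\<lparr>steps := steps s + 1\<rparr>"

type_synonym oracle_fn = "(nat \<Rightarrow> real) \<Rightarrow> nat"
type_synonym tape = "nat \<Rightarrow> real"

fun effect :: "oracle_fn \<Rightarrow> tape \<Rightarrow> instr \<Rightarrow> state \<Rightarrow> state" where
  "effect Q \<omega> (Const a c) s = set_idx a c s"
| "effect Q \<omega> (NatOp f a b c) s = set_idx a (apply_nat_op f (idx s b) (idx s c)) s"
| "effect Q \<omega> (Of_Nat a b) s = set_mem a (real (idx s b)) s"
| "effect Q \<omega> (Copy a b) s = set_mem a (cell s b) s"
| "effect Q \<omega> (RealOp f a b c) s = set_mem a (apply_real_op f (cell s b) (cell s c)) s"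
| "effect Q \<omega> (Gauss a) s = (set_mem a (\<omega> (drawn s)) s)\<lparr>drawn := drawn s + 1\<rparr>"
| "effect Q \<omega> (Query a b) s =
     (set_idx a (Q (\<lambda>j. mem s (idx s b + j))) s)\<lparr>queries := queries s + 1\<rparr>"

fun holds :: "test \<Rightarrow> state \<Rightarrow> bool" where
  "holds (NLess a b) s \<longleftrightarrow> idx s a < idx s b"
| "holds (RLess a b) s \<longleftrightarrow> cell s a < cell s b"

inductive exec :: "oracle_fn \<Rightarrow> tape \<Rightarrow> com \<Rightarrow> state \<Rightarrow> state \<Rightarrow> bool" for Q \<omega> where
  Instr: "exec Q \<omega> (Instr i) s (tick (effect Q \<omega> i s))"
| Seq: "exec Q \<omega> c1 s s' \<Longrightarrow> exec Q \<omega> c2 s' s'' \<Longrightarrow> exec Q \<omega> (Seq c1 c2) s s''"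
| CondT: "holds b s \<Longrightarrow> exec Q \<omega> c1 (tick s) s' \<Longrightarrow> exec Q \<omega> (Cond b c1 c2) s s'"
| CondF: "\<not> holds b s \<Longrightarrow> exec Q \<omega> c2 (tick s) s' \<Longrightarrow> exec Q \<omega> (Cond b c1 c2) s s'"
| WhileT: "holds b s \<Longrightarrow> exec Q \<omega> c (tick s) s' \<Longrightarrow> exec Q \<omega> (While b c) s' s''
    \<Longrightarrow> exec Q \<omega> (While b c) s s''"
| WhileF: "\<not> holds b s \<Longrightarrow> exec Q \<omega> (While b c) s (tick s)"

text \<open>The \<open>k\<close> vectors returned are stored consecutively from the address in register \<open>0\<close> on.\<close>

definition output_space :: "nat \<Rightarrow> nat \<Rightarrow> state \<Rightarrow> real vec set" where
  "output_space n k s = span_of n {vec n (\<lambda>j. mem s (idx s 0 + i * n + j)) | i. i < k}"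


section \<open>Parameters of the algorithm\<close>

text \<open>The algorithm is given \<open>n\<close>, \<open>k\<close>, the accuracy parameters, and the bounds describing the class
  of networks (but neither \<open>A\<close> nor the network itself). \<open>par_scale\<close> is an upper bound on the
  spectral norms of \<open>A\<close> and of all \<open>W\<^sub>i\<close>. Condition numbers are invariant under scaling, so the other
  parameters do not determine the length scale on which the classifier varies: for
  \<open>k = 1\<close>, \<open>\<phi>(t) = 2 sin t\<close> and \<open>A = T a\<^sup>T\<close> they stay fixed while \<open>T\<close> grows, and \<open>2 sin (T a \<bullet> x) \<ge> 1\<close>
  becomes uninformative about the unit vector \<open>a\<close> at any bounded number of points. For weights of
  norm at most \<open>1\<close> take \<open>par_scale = 1\<close>, which adds the constant \<open>1\<close> to \<open>problem_size\<close>.\<close>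

record params =
  par_n :: nat
  par_k :: nat
  par_d :: nat
  par_gamma :: real
  par_eta :: real
  par_eps :: real
  par_delta :: real
  par_scale :: real
  par_L :: "nat \<Rightarrow> real"
  par_kappa :: "nat \<Rightarrow> real"

definition input_state :: "params \<Rightarrow> state" where
  "input_state p =
     (let d = par_d p;
          header = [par_gamma p, par_eta p, par_eps p, par_delta p, par_scale p];
          cells = header @ map (par_L p) [0..<d] @ map (par_kappa p) [0..<d];
          regs = [par_n p, par_k p, d]
      in \<lparr>idx = (\<lambda>a. if a < length regs then regs ! a else 0),
          mem = (\<lambda>a. if a < length cells then cells ! a else 0),
          drawn = 0, queries = 0, steps = 0\<rparr>)"

text \<open>As usual in complexity bounds, \<open>log x\<close> stands for \<open>max 1 (log x)\<close>, so that no summand is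
  negative and \<open>\<Sum>i. log L\<^sub>i\<close> is at least the number of layers.\<close>

definition log1 :: "real \<Rightarrow> real" where
  "log1 x = max 1 (ln x)"

text \<open>Bounds that are polynomial in all of the summands are the same as bounds that are polynomial
  in their sum.\<close>

definition problem_size :: "params \<Rightarrow> real" where
  "problem_size p = par_n p + par_k p + 1 / par_gamma p
     + (\<Sum>i<par_d p. log1 (par_L p i)) + (\<Sum>i<par_d p. log1 (par_kappa p i))
     + log1 (1 / par_eta p) + log1 (1 / par_eps p) + log1 (1 / par_delta p)
     + log1 (par_scale p)"

definition recovers :: "real mat \<Rightarrow> params \<Rightarrow> state \<Rightarrow> bool" where
  "recovers A p s \<longleftrightarrow>
     (let n = par_n p; k = par_k p; V = output_space n k s
      in subspace_dim n V = k \<and>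
         (\<forall>x\<in>V. euclid_norm (orth_proj (vec_space.row_space n A) x)
                  \<ge> (1 - par_eps p) * euclid_norm x))"

end

theory Submission
  imports Defs
begin

text \<open>A Gaussian direction \<open>g\<close> orthogonal to the directions found so far crosses the level set \<open>\<sigma> = 1\<close>
  of the network, and hypothesis (4) makes the crossing transversal. Bisection of the classifier along \<open>g\<close>
  finds the crossing \<open>x\<close>; because the network has bounded second derivatives, the level set near \<open>x\<close> is a
  graph over the directions transversal to \<open>g\<close> that is almost affine, so bisecting \<open>s \<mapsto> M (x + h z + s g)\<close> for the unit
  vectors \<open>z\<close> yields its slopes \<open>t\<close>, which are almost proportional to the gradient and hence almost in the
  row span of \<open>A\<close>.

  A round in which the crossing was not transversal may produce a wrong \<open>t\<close>. It is exposed by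
  comparing the predicted crossing \<open>s = \<langle>z, t\<rangle>\<close> with the classifier for fresh Gaussian \<open>z\<close>: for \<open>w\<close> in the kernel of \<open>A\<close>,
  replacing \<open>z\<close> by \<open>z + c w\<close> does not change the classifier but moves the prediction by \<open>c \<langle>w, t\<rangle>\<close>, so a
  single comparison succeeds with probability at most \<open>3 / 4\<close> unless \<open>\<langle>w, t\<rangle>\<close> is tiny. Only accepted \<open>t\<close>
  are orthogonalised and kept. Every constant of the construction is a power of \<open>K = 2\<^sup>E\<close>, where \<open>E\<close> is
  polynomial in the problem size; the errors accumulated in \<open>k\<close> rounds cost a factor \<open>K\<^sup>6\<^sup>k\<close>.\<close>

section \<open>The search procedure\<close>

text \<open>Soundness and progress are separated. That accepted directions are nearly normal uses
  only the invariance of the classifier along the kernel of \<open>A\<close>; smoothness and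
  transversality serve to show that a round is accepted with probability at least
  \<open>\<gamma> / 2\<close>. The scales rest on orders in the step \<open>h\<close>. Slopes are
  linear in \<open>h\<close> and Taylor errors quadratic, so a tolerance \<open>\<theta>\<close> of
  order \<open>h\<^sup>2\<close>, enlarged by a power of \<open>K\<close>, exceeds every error of a
  transversal round and is still a small relative error of an accepted vector. Candidates close to
  the span of the earlier vectors would lose this precision; \<open>thr\<close> excludes them. The
  obstacle is measurability: near normality quantifies over all invariant directions, hypothesis (4)
  over all \<open>c > 0\<close>. Bisection has finitely many outcomes, so the accepted list is a
  simple function of the tape and any predicate of it is an event. The event in (4) is measurable
  because its \<open>measure\<close> is positive, which is impossible for a non-measurable
  set.\<close>

definition dotn :: "nat \<Rightarrow> (nat \<Rightarrow> real) \<Rightarrow> (nat \<Rightarrow> real) \<Rightarrow> real" where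
  "dotn n f g = (\<Sum>i<n. f i * g i)"

text \<open>Components are removed one at a time from the already reduced vector, which is what a
  loop over the stored rows computes. This is the projection off the span only for orthogonal lists,
  see \<open>resid_eq\<close>.\<close>

fun resid :: "nat \<Rightarrow> (nat \<Rightarrow> real) list \<Rightarrow> (nat \<Rightarrow> real) \<Rightarrow> nat \<Rightarrow> real" where
  "resid n [] g = g"
| "resid n (u # us) g = resid n us (\<lambda>i. g i - dotn n g u / dotn n u u * u i)"

text \<open>The result is the left end of an interval of length \<open>D / 2 ^ b\<close>.
  \<open>P\<close> need not be monotone: what survives the halvings is a change from false to true
  between the two ends.\<close>

fun bisect :: "(real \<Rightarrow> bool) \<Rightarrow> nat \<Rightarrow> real \<Rightarrow> real \<Rightarrow> real" where
  "bisect P 0 lo D = lo"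
| "bisect P (Suc b) lo D =
    (if P (lo + D / 2) then bisect P b lo (D / 2) else bisect P b (lo + D / 2) (D / 2))"

definition unit_fn :: "nat \<Rightarrow> nat \<Rightarrow> real" where
  "unit_fn i j = (if j = i then 1 else 0)"

locale search =
  fixes n b m :: nat and h T\<^sub>0 \<theta> thr :: real and M :: "(nat \<Rightarrow> real) \<Rightarrow> bool"
begin

definition ask :: "(nat \<Rightarrow> real) \<Rightarrow> (nat \<Rightarrow> real) \<Rightarrow> (nat \<Rightarrow> real) \<Rightarrow> real \<Rightarrow> bool" where
  "ask x z g s = M (\<lambda>j. x j + h * z j + s * g j)"

definition crossing :: "(nat \<Rightarrow> real) \<Rightarrow> real" where
  "crossing g = bisect (ask (\<lambda>_. 0) (\<lambda>_. 0) g) b 0 1"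

definition base_point :: "(nat \<Rightarrow> real) \<Rightarrow> nat \<Rightarrow> real" where
  "base_point g = (\<lambda>j. crossing g * g j)"

text \<open>Setting the entries from \<open>n\<close> on to \<open>0\<close> makes the range of this
  function finite, so that it is a simple function of the tape.\<close>

definition candidate :: "(nat \<Rightarrow> real) \<Rightarrow> nat \<Rightarrow> real" where
  "candidate g = (\<lambda>i. if i < n then bisect (ask (base_point g) (unit_fn i) g) b (- T\<^sub>0) (2 * T\<^sub>0) else 0)"

text \<open>The signs encode an upward crossing: bisection from \<open>0\<close> brackets a passage
  from false to true, so the classifier should accept above the predicted position and reject below
  it.\<close>

definition passes_test :: "(nat \<Rightarrow> real) \<Rightarrow> (nat \<Rightarrow> real) \<Rightarrow> (nat \<Rightarrow> real) \<Rightarrow> (nat \<Rightarrow> real) \<Rightarrow> bool" where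
  "passes_test x t g \<zeta> \<longleftrightarrow>
     ask x \<zeta> g (dotn n \<zeta> t + \<theta>) \<and> \<not> ask x \<zeta> g (dotn n \<zeta> t - \<theta>)"

definition passes_tests :: "(nat \<Rightarrow> real) \<Rightarrow> (nat \<Rightarrow> real) \<Rightarrow> (nat \<Rightarrow> real) \<Rightarrow> nat \<Rightarrow> (nat \<Rightarrow> real) \<Rightarrow> bool" where
  "passes_tests x t g l \<omega> \<longleftrightarrow> (\<forall>j<l. passes_test x t g (\<lambda>i. \<omega> (j * n + i)))"

text \<open>The tests examine \<open>t\<close>, whose entries are the predicted slopes, while the
  residual \<open>u\<close> is stored. Since the machine has field operations but no square roots,
  \<open>u\<close> stays unnormalised and \<open>thr\<close> bounds its squared norm.\<close>

definition extend :: "(nat \<Rightarrow> real) list \<Rightarrow> (nat \<Rightarrow> real) \<Rightarrow> (nat \<Rightarrow> real) list" where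
  "extend us \<omega> = (let g = resid n us \<omega>; t = candidate g; u = resid n us t in
     if passes_tests (base_point g) t g m (\<lambda>i. \<omega> (n + i)) \<and> thr \<le> dotn n u u then us @ [u] else us)"

text \<open>A round consumes \<open>(m + 1) * n\<close> tape entries, \<open>n\<close> for the
  direction and \<open>n\<close> for each test, whether or not its candidate is accepted.\<close>

fun rounds :: "nat \<Rightarrow> nat \<Rightarrow> (nat \<Rightarrow> real) list \<Rightarrow> (nat \<Rightarrow> real) \<Rightarrow> (nat \<Rightarrow> real) list" where
  "rounds k 0 us \<omega> = us"
| "rounds k (Suc N) us \<omega> =
    (if length us < k then rounds k N (extend us \<omega>) (\<lambda>i. \<omega> ((m + 1) * n + i)) else us)"

end

section \<open>Inner products and norms on the first \<open>n\<close> coordinates\<close>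

lemma dotn_commute: "dotn n f g = dotn n g f"
  by (simp add: dotn_def mult.commute)

lemma dotn_add_left: "dotn n (\<lambda>i. f i + g i) w = dotn n f w + dotn n g w"
  by (simp add: dotn_def sum.distrib algebra_simps)

lemma dotn_diff_left: "dotn n (\<lambda>i. f i - g i) w = dotn n f w - dotn n g w"
  by (simp add: dotn_def sum_subtractf algebra_simps)

lemma dotn_scale_left: "dotn n (\<lambda>i. c * f i) w = c * dotn n f w"
  by (simp add: dotn_def sum_distrib_left algebra_simps)

lemma dotn_sum_left: "dotn n (\<lambda>i. \<Sum>j\<in>J. f j i) w = (\<Sum>j\<in>J. dotn n (f j) w)"
  unfolding dotn_def by (subst sum.swap) (simp add: sum_distrib_right)

lemmas dotn_left = dotn_add_left dotn_diff_left dotn_scale_left dotn_sum_left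

lemma dotn_add_right: "dotn n w (\<lambda>i. f i + g i) = dotn n w f + dotn n w g"
  by (simp add: dotn_def sum.distrib algebra_simps)

lemma dotn_diff_right: "dotn n w (\<lambda>i. f i - g i) = dotn n w f - dotn n w g"
  by (simp add: dotn_def sum_subtractf algebra_simps)

lemma dotn_scale_right: "dotn n w (\<lambda>i. c * f i) = c * dotn n w f"
  by (simp add: dotn_def sum_distrib_left algebra_simps)

lemma dotn_sum_right: "dotn n w (\<lambda>i. \<Sum>j\<in>J. f j i) = (\<Sum>j\<in>J. dotn n w (f j))"
  unfolding dotn_def by (subst sum.swap) (simp add: sum_distrib_left)

lemmas dotn_right = dotn_add_right dotn_diff_right dotn_scale_right dotn_sum_right

lemma dotn_cong: "(\<And>i. i < n \<Longrightarrow> f i = f' i) \<Longrightarrow> (\<And>i. i < n \<Longrightarrow> g i = g' i) \<Longrightarrow> dotn n f g = dotn n f' g'"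
  by (simp add: dotn_def)

lemma dotn_self_nonneg: "0 \<le> dotn n f f"
  by (simp add: dotn_def sum_nonneg)

abbreviation normn :: "nat \<Rightarrow> (nat \<Rightarrow> real) \<Rightarrow> real" where
  "normn n f \<equiv> L2_set f {..<n}"

lemma dotn_self: "dotn n f f = (normn n f)\<^sup>2"
  by (simp add: dotn_def L2_set_def sum_nonneg power2_eq_square)

lemma dotn_le_normn: "\<bar>dotn n f g\<bar> \<le> normn n f * normn n g"
proof -
  have "\<bar>dotn n f g\<bar> \<le> (\<Sum>i<n. \<bar>f i\<bar> * \<bar>g i\<bar>)"
    unfolding dotn_def by (rule order_trans[OF sum_abs]) (simp add: abs_mult)
  also have "\<dots> \<le> normn n f * normn n g"
    by (rule L2_set_mult_ineq)
  finally show ?thesis .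
qed

lemma normn_nonneg: "0 \<le> normn n f"
  by (simp add: L2_set_def sum_nonneg)

lemma normn_scale: "normn n (\<lambda>i. c * f i) = \<bar>c\<bar> * normn n f"
  using L2_set_right_distrib[of "\<bar>c\<bar>" f "{..<n}"]
  by (simp add: L2_set_def power_mult_distrib)

lemma abs_le_normn: "i < n \<Longrightarrow> \<bar>f i\<bar> \<le> normn n f"
  using member_le_L2_set[of "{..<n}" i "\<lambda>i. \<bar>f i\<bar>"] by (simp add: L2_set_def)

section \<open>Gram-Schmidt residuals against an orthogonal list\<close>

definition orthogonal_list :: "nat \<Rightarrow> (nat \<Rightarrow> real) list \<Rightarrow> bool" where
  "orthogonal_list n us \<longleftrightarrow>
     (\<forall>u\<in>set us. 0 < dotn n u u) \<and> sorted_wrt (\<lambda>u v. dotn n u v = 0) us"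

text \<open>Removing the component along \<open>u\<close> leaves the inner products with the later
  vectors unchanged, because these are orthogonal to \<open>u\<close>; hence successive and
  simultaneous subtraction agree.\<close>

lemma resid_eq:
  assumes "orthogonal_list n us"
  shows "resid n us g = (\<lambda>i. g i - (\<Sum>u\<leftarrow>us. dotn n g u / dotn n u u * u i))"
  using assms
proof (induction us arbitrary: g)
  case (Cons u us)
  have o: "orthogonal_list n us" and uv: "\<And>v. v \<in> set us \<Longrightarrow> dotn n u v = 0"
    using Cons.prems by (auto simp: orthogonal_list_def)
  have "dotn n (\<lambda>i. g i - c * u i) v = dotn n g v" if "v \<in> set us" for v c
    using uv[OF that] by (simp add: dotn_left)
  then have "(\<Sum>v\<leftarrow>us. dotn n (\<lambda>i. g i - c * u i) v / dotn n v v * v i)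
      = (\<Sum>v\<leftarrow>us. dotn n g v / dotn n v v * v i)" for i c
    by (intro arg_cong[of _ _ sum_list] map_cong) auto
  then show ?case
    by (simp add: Cons.IH[OF o] diff_diff_eq del: times_divide_eq_left)
qed simp

lemma dotn_sum_list_left:
  "dotn n (\<lambda>i. \<Sum>u\<leftarrow>us. c u * u i) w = (\<Sum>u\<leftarrow>us. c u * dotn n u w)"
  by (induction us) (simp_all add: dotn_left, simp add: dotn_def)

lemma dotn_sum_list_orthogonal:
  assumes "orthogonal_list n us" "v \<in> set us"
  shows "(\<Sum>u\<leftarrow>us. c u * dotn n u v) = c v * dotn n v v"
  using assms
proof (induction us)
  case (Cons u us)
  have o: "orthogonal_list n us" and uv: "\<And>v. v \<in> set us \<Longrightarrow> dotn n u v = 0"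
    using Cons.prems by (auto simp: orthogonal_list_def)
  show ?case
  proof (cases "v \<in> set us")
    case True
    then show ?thesis using Cons.IH[OF o] uv by simp
  next
    case False
    then have "v = u" using Cons.prems by auto
    have "(\<Sum>w\<leftarrow>us. c w * dotn n w u) = (\<Sum>w\<leftarrow>us. 0)"
      using uv by (intro arg_cong[of _ _ sum_list] map_cong) (auto simp: dotn_commute)
    with \<open>v = u\<close> show ?thesis by (simp add: sum_list_0)
  qed
qed simp

lemma resid_orthogonal:
  assumes "orthogonal_list n us" "v \<in> set us"
  shows "dotn n (resid n us g) v = 0"
proof -
  have "0 < dotn n v v" using assms by (auto simp: orthogonal_list_def)
  then have "(\<Sum>u\<leftarrow>us. dotn n g u / dotn n u u * dotn n u v) = dotn n g v"
    using dotn_sum_list_orthogonal[OF assms, of "\<lambda>u. dotn n g u / dotn n u u"] by simp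
  then show ?thesis
    by (simp add: resid_eq[OF assms(1)] dotn_diff_left dotn_sum_list_left del: times_divide_eq_left)
qed

lemma resid_orthogonal':
  "orthogonal_list n us \<Longrightarrow> v \<in> set us \<Longrightarrow> dotn n v (resid n us g) = 0"
  using resid_orthogonal by (simp add: dotn_commute)

lemma resid_dotn:
  assumes "orthogonal_list n us" "\<And>v. v \<in> set us \<Longrightarrow> dotn n v w = 0"
  shows "dotn n (resid n us g) w = dotn n g w"
proof -
  have "(\<Sum>u\<leftarrow>us. dotn n g u / dotn n u u * dotn n u w) = (\<Sum>u\<leftarrow>us. 0)"
    using assms(2) by (intro arg_cong[of _ _ sum_list] map_cong) auto
  then show ?thesis
    by (simp add: resid_eq[OF assms(1)] dotn_diff_left dotn_sum_list_left del: times_divide_eq_left)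
qed

lemma resid_scale: "resid n us (\<lambda>i. c * g i) = (\<lambda>i. c * resid n us g i)"
proof (induction us arbitrary: g)
  case (Cons u us)
  have "(\<lambda>i. c * g i - dotn n (\<lambda>i. c * g i) u / dotn n u u * u i)
      = (\<lambda>i. c * (g i - dotn n g u / dotn n u u * u i))"
    by (simp add: dotn_left algebra_simps)
  then show ?case by (simp add: Cons.IH)
qed simp

text \<open>The residual \<open>r\<close> is orthogonal to everything that was removed, so
  \<open>dotn n r r = dotn n g r\<close>, and Cauchy-Schwarz applies.\<close>

lemma normn_resid_le:
  assumes "orthogonal_list n us"
  shows "normn n (resid n us g) \<le> normn n g"
proof -
  let ?r = "resid n us g"
  have "dotn n ?r ?r = dotn n g ?r"
    using resid_orthogonal'[OF assms] by (intro resid_dotn[OF assms]) auto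
  then have "(normn n ?r)\<^sup>2 \<le> normn n g * normn n ?r"
    using dotn_le_normn[of n g ?r] by (simp add: dotn_self)
  then show ?thesis
    using normn_nonneg[of ?r n] normn_nonneg[of g n]
    by (cases "normn n ?r = 0") (auto simp: power2_eq_square)
qed

lemma resid_cong:
  assumes "i < n" "\<And>i. i < n \<Longrightarrow> f i = g i"
  shows "resid n us f i = resid n us g i"
  using assms
proof (induction us arbitrary: f g)
  case (Cons u us)
  have "dotn n f u = dotn n g u" using Cons.prems(2) by (intro dotn_cong) auto
  then show ?case using Cons.prems by (simp, intro Cons.IH) auto
qed auto

lemma orthogonal_list_snoc:
  assumes "orthogonal_list n us" "0 < dotn n (resid n us t) (resid n us t)"
  shows "orthogonal_list n (us @ [resid n us t])"
  using assms resid_orthogonal[OF assms(1)]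
  by (auto simp: orthogonal_list_def sorted_wrt_append dotn_commute)

section \<open>Gaussian sequences and acceptance of candidates\<close>

abbreviation std_gauss :: "real measure" where
  "std_gauss \<equiv> density lborel std_normal_density"

abbreviation iid_gauss :: "(nat \<Rightarrow> real) measure" where
  "iid_gauss \<equiv> PiM UNIV (\<lambda>_. std_gauss)"

interpretation gauss: prob_space std_gauss
  by (rule prob_space_normal_density) simp

interpretation gseq: sequence_space std_gauss
  by unfold_locales

lemma gauss_interval_le:
  assumes "0 \<le> (a::real)"
  shows "measure std_gauss {- a / 2 <.. a / 2} \<le> a"
proof -
  have "std_normal_density x \<le> 1" for x
  proof -
    have "exp (- x\<^sup>2 / 2) \<le> (1::real)" by simp
    also have "1 \<le> sqrt (2 * pi)"
      using pi_gt3 by (simp add: real_le_rsqrt)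
    finally show ?thesis
      by (simp add: std_normal_density_def)
  qed
  then have le: "ennreal (std_normal_density x) * indicator {- a / 2 <.. a / 2} x \<le> indicator {- a / 2 <.. a / 2} x" for x
    by (simp add: indicator_def)
  have "emeasure std_gauss {- a / 2 <.. a / 2}
      = (\<integral>\<^sup>+x. ennreal (std_normal_density x) * indicator {- a / 2 <.. a / 2} x \<partial>lborel)"
    by (rule emeasure_density) auto
  also have "\<dots> \<le> (\<integral>\<^sup>+x. indicator {- a / 2 <.. a / 2} x \<partial>lborel)"
    by (rule nn_integral_mono) (rule le)
  also have "\<dots> = ennreal a" using assms by simp
  finally show ?thesis
    using assms by (simp add: gauss.emeasure_eq_measure)
qed

lemma gauss_measure_integral:
  assumes [measurable]: "A \<in> sets borel"
  shows "integrable lborel (\<lambda>x. indicator A x * std_normal_density x)"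
    "measure std_gauss A = (\<integral>x. indicator A x * std_normal_density x \<partial>lborel)"
proof -
  have i: "integrable std_gauss (indicator A :: real \<Rightarrow> real)"
    by (rule integrable_real_indicator) (auto simp: gauss.emeasure_eq_measure)
  then show "integrable lborel (\<lambda>x. indicator A x * std_normal_density x)"
    by (subst (asm) integrable_density) (auto simp: mult.commute normal_density_nonneg)
  have "measure std_gauss A = (\<integral>x. indicator A x \<partial>std_gauss)" by simp
  also have "\<dots> = (\<integral>x. indicator A x * std_normal_density x \<partial>lborel)"
    by (subst integral_density) (auto simp: mult.commute normal_density_nonneg)
  finally show "measure std_gauss A = (\<integral>x. indicator A x * std_normal_density x \<partial>lborel)" .
qed

lemma gauss_shift_integral:
  assumes A[measurable]: "A \<in> sets borel"
  shows "integrable lborel (\<lambda>x. indicator A x * std_normal_density (x - a))"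
    "measure std_gauss {x. x + a \<in> A} = (\<integral>x. indicator A x * std_normal_density (x - a) \<partial>lborel)"
proof -
  have m: "{x. x + a \<in> A} \<in> sets borel" by measurable
  have e: "(\<lambda>x. indicator {x. x + a \<in> A} x * std_normal_density x)
      = (\<lambda>x. (\<lambda>y. indicator A y * std_normal_density (y - a)) (a + 1 * x))"
    by (auto simp: indicator_def add.commute)
  show "integrable lborel (\<lambda>x. indicator A x * std_normal_density (x - a))"
    using gauss_measure_integral(1)[OF m] unfolding e
    by (subst (asm) lborel_integrable_real_affine_iff) auto
  show "measure std_gauss {x. x + a \<in> A} = (\<integral>x. indicator A x * std_normal_density (x - a) \<partial>lborel)"
    unfolding gauss_measure_integral(2)[OF m] e
    by (subst lborel_integral_real_affine[where c = 1 and t = a]) auto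
qed

text \<open>Shifting by \<open>a\<close> raises the density to the right of \<open>a / 2\<close> and
  lowers it to the left, so among all sets the half-line \<open>{a / 2 <..}\<close> gains most. Its
  gain is the mass of an interval of length \<open>a\<close>, on which the density is at most
  \<open>1\<close>.\<close>

lemma gauss_shift_le_nonneg:
  assumes A[measurable]: "A \<in> sets borel" and a: "0 \<le> a"
  shows "measure std_gauss {x. x + a \<in> A} \<le> measure std_gauss A + a"
proof -
  let ?H = "{a / 2 <..}"
  have "measure std_gauss {x. x + a \<in> A} - measure std_gauss A
      = (\<integral>x. indicator A x * std_normal_density (x - a) - indicator A x * std_normal_density x \<partial>lborel)"
    using gauss_shift_integral[OF A] gauss_measure_integral[OF A] by simp
  also have "\<dots> \<le> (\<integral>x. indicator ?H x * std_normal_density (x - a) - indicator ?H x * std_normal_density x \<partial>lborel)"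
  proof (rule integral_mono)
    fix x
    have *: "(x - a)\<^sup>2 - x\<^sup>2 = 2 * a * (a / 2 - x)"
      by (simp add: power2_eq_square algebra_simps)
    have "std_normal_density x \<le> std_normal_density (x - a)" if "a / 2 < x"
    proof -
      have "(x - a)\<^sup>2 \<le> x\<^sup>2"
        using mult_nonneg_nonpos[of "2 * a" "a / 2 - x"] that a * by linarith
      then show ?thesis by (simp add: std_normal_density_def divide_right_mono)
    qed
    moreover have "std_normal_density (x - a) \<le> std_normal_density x" if "\<not> a / 2 < x"
    proof -
      have "x\<^sup>2 \<le> (x - a)\<^sup>2"
        using mult_nonneg_nonneg[of "2 * a" "a / 2 - x"] that a * by linarith
      then show ?thesis by (simp add: std_normal_density_def divide_right_mono)
    qed
    ultimately show "indicator A x * std_normal_density (x - a) - indicator A x * std_normal_density x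
        \<le> indicator ?H x * std_normal_density (x - a) - indicator ?H x * std_normal_density x"
      by (auto simp: indicator_def)
  qed (auto intro!: Bochner_Integration.integrable_diff gauss_shift_integral gauss_measure_integral)
  also have "\<dots> = measure std_gauss {x. x + a \<in> ?H} - measure std_gauss ?H"
    using gauss_shift_integral[of ?H a] gauss_measure_integral[of ?H] by simp
  also have "\<dots> = measure std_gauss ({- a / 2 <..} - ?H)"
    using a by (subst gauss.finite_measure_Diff) (auto intro!: arg_cong2[of _ _ _ _ "(-)"] arg_cong[of _ _ "measure std_gauss"])
  also have "{- a / 2 <..} - ?H = {- a / 2 <.. a / 2}" by auto
  also have "measure std_gauss {- a / 2 <.. a / 2} \<le> a" by (rule gauss_interval_le[OF a])
  finally show ?thesis by simp
qed

text \<open>For negative \<open>a\<close> the previous bound is applied to the complement of the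
  shifted set, which the opposite shift carries back to the complement of \<open>A\<close>.\<close>

lemma gauss_shift_le:
  assumes A[measurable]: "A \<in> sets borel"
  shows "measure std_gauss {x. x + a \<in> A} \<le> measure std_gauss A + \<bar>a\<bar>"
proof (cases "0 \<le> a")
  case True
  then show ?thesis using gauss_shift_le_nonneg[OF A] by simp
next
  case False
  let ?B = "{x. x + a \<notin> A}"
  have B: "?B \<in> sets borel" by measurable
  have 1: "{x. x + - a \<in> ?B} = space std_gauss - A" by auto
  have 2: "?B = space std_gauss - {x. x + a \<in> A}" by auto
  have m: "{x. x + a \<in> A} \<in> sets borel" by measurable
  have "measure std_gauss {x. x + - a \<in> ?B} = 1 - measure std_gauss A"
    unfolding 1 by (rule gauss.prob_compl) simp
  moreover have "measure std_gauss ?B = 1 - measure std_gauss {x. x + a \<in> A}"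
    unfolding 2 using m by (intro gauss.prob_compl) simp
  ultimately show ?thesis
    using gauss_shift_le_nonneg[OF B, of "- a"] False by simp
qed

lemma iid_gauss_coordinate:
  "distr (std_gauss \<Otimes>\<^sub>M PiM (UNIV - {i}) (\<lambda>_. std_gauss)) iid_gauss (\<lambda>(x, X). X(i := x)) = iid_gauss"
  using distr_pair_PiM_eq_PiM[of "UNIV - {i}" "\<lambda>_. std_gauss" i] gauss.prob_space_axioms
  by (simp add: insert_absorb)

lemma coordinate_shift_measurable:
  "(\<lambda>f. f(i := f i + a)) \<in> iid_gauss \<rightarrow>\<^sub>M iid_gauss"
proof (rule measurable_PiM_single')
  show "(\<lambda>f. (f(i := f i + a)) j) \<in> iid_gauss \<rightarrow>\<^sub>M std_gauss" for j
    by (cases "j = i") auto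
qed (auto simp: space_PiM)

lemma coordinate_shift_le:
  assumes E: "E \<in> sets iid_gauss"
  shows "measure iid_gauss {f. f(i := f i + a) \<in> E} \<le> measure iid_gauss E + \<bar>a\<bar>"
proof -
  let ?P = "PiM (UNIV - {i}) (\<lambda>_. std_gauss)"
  interpret P: prob_space ?P by (intro prob_space_PiM gauss.prob_space_axioms)
  interpret pp: pair_sigma_finite std_gauss ?P by unfold_locales
  have m: "(\<lambda>(x, X). X(i := x)) \<in> std_gauss \<Otimes>\<^sub>M ?P \<rightarrow>\<^sub>M iid_gauss"
    unfolding case_prod_beta by (rule measurable_fun_upd[where J = "UNIV - {i}"]) auto
  have F: "{f. f(i := f i + a) \<in> E} \<in> sets iid_gauss"
    using measurable_sets[OF coordinate_shift_measurable E, of i a]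
    by (simp add: vimage_def space_PiM)
  have em: "emeasure iid_gauss B = (\<integral>\<^sup>+X. emeasure std_gauss {x. X(i := x) \<in> B} \<partial>?P)"
    if B: "B \<in> sets iid_gauss" for B
  proof -
    have "emeasure iid_gauss B = emeasure (std_gauss \<Otimes>\<^sub>M ?P) ((\<lambda>(x, X). X(i := x)) -` B \<inter> space (std_gauss \<Otimes>\<^sub>M ?P))"
      by (subst iid_gauss_coordinate[of i, symmetric], subst emeasure_distr[OF m B]) simp
    also have "\<dots> = (\<integral>\<^sup>+X. emeasure std_gauss ((\<lambda>x. (x, X)) -` ((\<lambda>(x, X). X(i := x)) -` B \<inter> space (std_gauss \<Otimes>\<^sub>M ?P))) \<partial>?P)"
      by (rule pp.emeasure_pair_measure_alt2) (rule measurable_sets[OF m B])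
    also have "\<dots> = (\<integral>\<^sup>+X. emeasure std_gauss {x. X(i := x) \<in> B} \<partial>?P)"
      by (intro nn_integral_cong arg_cong[of _ _ "emeasure std_gauss"])
         (auto simp: space_pair_measure)
    finally show ?thesis .
  qed
  have sec: "{x. X(i := x) \<in> E} \<in> sets borel" if "X \<in> space ?P" for X
  proof -
    have "(\<lambda>x. X(i := x)) \<in> std_gauss \<rightarrow>\<^sub>M iid_gauss"
      using measurable_compose[OF measurable_Pair2'[OF that] m] by simp
    from measurable_sets[OF this E] show ?thesis by (simp add: vimage_def)
  qed
  have "emeasure iid_gauss {f. f(i := f i + a) \<in> E}
      = (\<integral>\<^sup>+X. emeasure std_gauss {x. x + a \<in> {y. X(i := y) \<in> E}} \<partial>?P)"
    by (subst em[OF F]) simp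
  also have "\<dots> \<le> (\<integral>\<^sup>+X. emeasure std_gauss {x. X(i := x) \<in> E} + ennreal \<bar>a\<bar> \<partial>?P)"
  proof (rule nn_integral_mono)
    fix X assume "X \<in> space ?P"
    from gauss_shift_le[OF sec[OF this], of a]
    show "emeasure std_gauss {x. x + a \<in> {y. X(i := y) \<in> E}} \<le> emeasure std_gauss {x. X(i := x) \<in> E} + ennreal \<bar>a\<bar>"
      by (simp add: gauss.emeasure_eq_measure flip: ennreal_plus)
  qed
  also have "\<dots> = emeasure iid_gauss E + ennreal \<bar>a\<bar>"
  proof (subst nn_integral_add)
    have "(\<lambda>X. emeasure std_gauss ((\<lambda>x. (x, X)) -` ((\<lambda>(x, X). X(i := x)) -` E \<inter> space (std_gauss \<Otimes>\<^sub>M ?P)))) \<in> borel_measurable ?P"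
      by (rule pp.measurable_emeasure_Pair2) (rule measurable_sets[OF m E])
    moreover have "emeasure std_gauss ((\<lambda>x. (x, X)) -` ((\<lambda>(x, X). X(i := x)) -` E \<inter> space (std_gauss \<Otimes>\<^sub>M ?P)))
        = emeasure std_gauss {x. X(i := x) \<in> E}" if "X \<in> space ?P" for X
      using that by (intro arg_cong[of _ _ "emeasure std_gauss"]) (auto simp: space_pair_measure)
    ultimately show "(\<lambda>X. emeasure std_gauss {x. X(i := x) \<in> E}) \<in> borel_measurable ?P"
      by (simp cong: measurable_cong)
  qed (simp_all add: em[OF E] P.emeasure_space_1)
  finally show ?thesis
    by (simp add: gseq.emeasure_eq_measure flip: ennreal_plus)
qed

text \<open>The coordinates are shifted one after another and the errors add up. Compared with the
  Euclidean norm of the shift this loses at most a factor \<open>n\<close>, which the constants can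
  afford.\<close>

lemma iid_shift_le:
  assumes "E \<in> sets iid_gauss"
  shows "measure iid_gauss {\<omega>. (\<lambda>j. \<omega> j + (if j < n then v j else 0)) \<in> E}
     \<le> measure iid_gauss E + (\<Sum>j<n. \<bar>v j\<bar>)"
  using assms
proof (induction n arbitrary: E)
  case (Suc n)
  let ?F = "{f. f(n := f n + v n) \<in> E}"
  have F: "?F \<in> sets iid_gauss"
    using measurable_sets[OF coordinate_shift_measurable Suc.prems, of n "v n"]
    by (simp add: vimage_def space_PiM)
  have "{\<omega>. (\<lambda>j. \<omega> j + (if j < Suc n then v j else 0)) \<in> E}
      = {\<omega>. (\<lambda>j. \<omega> j + (if j < n then v j else 0)) \<in> ?F}"
    by (auto simp: less_Suc_eq fun_upd_def elim!: back_subst[of "\<lambda>f. f \<in> E"])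
  then show ?case
    using Suc.IH[OF F] coordinate_shift_le[OF Suc.prems, of n "v n"] by simp
qed simp

text \<open>Conditioning on the first \<open>i\<close> entries: \<open>comb_seq\<close> takes these
  from \<open>\<omega>\<close> and all later ones from an independent sequence. Independence of
  rounds and of tests is always used in this form.\<close>

lemma iid_gauss_split:
  assumes E: "E \<in> sets iid_gauss"
  shows "emeasure iid_gauss E = (\<integral>\<^sup>+\<omega>. emeasure iid_gauss {\<omega>'. comb_seq i \<omega> \<omega>' \<in> E} \<partial>iid_gauss)"
proof -
  let ?c = "\<lambda>(\<omega>, \<omega>'). comb_seq i \<omega> \<omega>'"
  have "emeasure iid_gauss E = emeasure (iid_gauss \<Otimes>\<^sub>M iid_gauss) (?c -` E \<inter> space (iid_gauss \<Otimes>\<^sub>M iid_gauss))"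
    by (subst gseq.PiM_comb_seq[of i, symmetric], subst emeasure_distr[OF measurable_comb_seq E]) simp
  also have "\<dots> = (\<integral>\<^sup>+\<omega>. emeasure iid_gauss (Pair \<omega> -` (?c -` E \<inter> space (iid_gauss \<Otimes>\<^sub>M iid_gauss))) \<partial>iid_gauss)"
    by (rule gseq.emeasure_pair_measure_alt) (rule measurable_sets[OF measurable_comb_seq E])
  also have "\<dots> = (\<integral>\<^sup>+\<omega>. emeasure iid_gauss {\<omega>'. comb_seq i \<omega> \<omega>' \<in> E} \<partial>iid_gauss)"
    by (intro nn_integral_cong arg_cong[of _ _ "emeasure iid_gauss"])
       (auto simp: space_pair_measure space_PiM)
  finally show ?thesis .
qed

lemma space_iid_gauss: "space iid_gauss = UNIV"
  by (simp add: space_PiM)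

lemma measurable_coordinate: "(\<lambda>\<omega>. \<omega> j) \<in> borel_measurable iid_gauss"
  using measurable_component_singleton[of j UNIV "\<lambda>_. std_gauss"] by (simp cong: measurable_cong_sets)

lemma measurable_dotn:
  assumes "\<And>i. (\<lambda>\<omega>. X \<omega> i) \<in> borel_measurable N" "\<And>i. (\<lambda>\<omega>. Y \<omega> i) \<in> borel_measurable N"
  shows "(\<lambda>\<omega>. dotn n (X \<omega>) (Y \<omega>)) \<in> borel_measurable N"
  unfolding dotn_def using assms by (intro borel_measurable_sum borel_measurable_times)

lemma measurable_resid:
  assumes "\<And>i. (\<lambda>\<omega>. X \<omega> i) \<in> borel_measurable N"
  shows "(\<lambda>\<omega>. resid n us (X \<omega>) i) \<in> borel_measurable N"
  using assms
proof (induction us arbitrary: X)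
  case (Cons u us)
  have "(\<lambda>\<omega>. X \<omega> i - dotn n (X \<omega>) u / dotn n u u * u i) \<in> borel_measurable N" for i
    by (intro borel_measurable_diff borel_measurable_times borel_measurable_divide
        measurable_dotn Cons.prems borel_measurable_const)
  from Cons.IH[OF this] show ?case by simp
qed simp

section \<open>Soundness of the tests for an arbitrary measurable classifier\<close>

locale search_oracle = search +
  assumes M_cong: "(\<And>i. i < n \<Longrightarrow> f i = g i) \<Longrightarrow> M f = M g"
    and M_measurable: "Measurable.pred (PiM UNIV (\<lambda>_. borel)) M"
begin

text \<open>Stands in for the kernel of \<open>A\<close>, which consists of such directions for the
  actual classifier (\<open>kernel_invariant\<close>).\<close>

definition invariant_dir :: "(nat \<Rightarrow> real) \<Rightarrow> bool" where
  "invariant_dir w \<longleftrightarrow> (\<forall>f c. M (\<lambda>j. f j + c * w j) = M f)"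

text \<open>The absolute deviation of \<open>t\<close> from the orthogonal complement of the
  invariant directions, a space contained in the row span of \<open>A\<close> once the kernel is
  known to be invariant.\<close>

definition nearly_normal :: "real \<Rightarrow> (nat \<Rightarrow> real) \<Rightarrow> bool" where
  "nearly_normal e t \<longleftrightarrow> (\<forall>w. invariant_dir w \<longrightarrow> \<bar>dotn n t w\<bar> \<le> e * normn n w)"

lemma M_pred:
  assumes "\<And>j. (\<lambda>\<omega>. X \<omega> j) \<in> borel_measurable N"
  shows "Measurable.pred N (\<lambda>\<omega>. M (X \<omega>))"
proof -
  have "X \<in> N \<rightarrow>\<^sub>M PiM UNIV (\<lambda>_. borel)"
    using assms by (intro measurable_PiM_single') (auto simp: fun_eq_iff)
  from measurable_compose[OF this M_measurable] show ?thesis .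
qed

lemma ask_pred:
  assumes "\<And>j. (\<lambda>\<omega>. z \<omega> j) \<in> borel_measurable N" "\<And>j. (\<lambda>\<omega>. g \<omega> j) \<in> borel_measurable N"
    "\<And>j. (\<lambda>\<omega>. x \<omega> j) \<in> borel_measurable N" "s \<in> borel_measurable N"
  shows "Measurable.pred N (\<lambda>\<omega>. ask (x \<omega>) (z \<omega>) (g \<omega>) (s \<omega>))"
  unfolding ask_def
  by (rule M_pred) (intro borel_measurable_add borel_measurable_times assms borel_measurable_const)

lemma passes_test_pred:
  assumes "\<And>j. (\<lambda>\<omega>. z \<omega> j) \<in> borel_measurable N" "\<And>j. (\<lambda>\<omega>. g \<omega> j) \<in> borel_measurable N"
    "\<And>j. (\<lambda>\<omega>. x \<omega> j) \<in> borel_measurable N" "\<And>j. (\<lambda>\<omega>. t \<omega> j) \<in> borel_measurable N"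
  shows "Measurable.pred N (\<lambda>\<omega>. passes_test (x \<omega>) (t \<omega>) (g \<omega>) (z \<omega>))"
  unfolding passes_test_def
  by (intro pred_intros_logic ask_pred borel_measurable_add borel_measurable_diff
      measurable_dotn assms borel_measurable_const)

lemma passes_tests_pred:
  assumes "\<And>j. (\<lambda>\<omega>. z \<omega> j) \<in> borel_measurable N" "\<And>j. (\<lambda>\<omega>. g \<omega> j) \<in> borel_measurable N"
    "\<And>j. (\<lambda>\<omega>. x \<omega> j) \<in> borel_measurable N" "\<And>j. (\<lambda>\<omega>. t \<omega> j) \<in> borel_measurable N"
  shows "Measurable.pred N (\<lambda>\<omega>. passes_tests (x \<omega>) (t \<omega>) (g \<omega>) l (z \<omega>))"
  unfolding passes_tests_def
  by (intro pred_intros_countable pred_intros_logic passes_test_pred assms) auto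

lemma ask_cong:
  assumes "\<And>i. i < n \<Longrightarrow> x i = x' i" "\<And>i. i < n \<Longrightarrow> z i = z' i" "\<And>i. i < n \<Longrightarrow> g i = g' i"
  shows "ask x z g s = ask x' z' g' s"
  unfolding ask_def using assms by (intro M_cong) simp

lemma passes_test_cong:
  assumes "\<And>i. i < n \<Longrightarrow> x i = x' i" "\<And>i. i < n \<Longrightarrow> z i = z' i" "\<And>i. i < n \<Longrightarrow> g i = g' i"
    "\<And>i. i < n \<Longrightarrow> t i = t' i"
  shows "passes_test x t g z = passes_test x' t' g' z'"
proof -
  have "dotn n z t = dotn n z' t'" using assms by (intro dotn_cong)
  moreover have "ask x z g s = ask x' z' g' s" for s using assms by (intro ask_cong)
  ultimately show ?thesis unfolding passes_test_def by simp
qed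

lemma passes_tests_cong:
  assumes "\<And>i. i < n \<Longrightarrow> x i = x' i" "\<And>i. i < n \<Longrightarrow> g i = g' i" "\<And>i. i < n \<Longrightarrow> t i = t' i"
    "\<And>i. i < l * n \<Longrightarrow> z i = z' i"
  shows "passes_tests x t g l z = passes_tests x' t' g' l z'"
proof -
  have "j * n + i < l * n" if "i < n" "j < l" for i j
    using that mult_le_mono1[of "Suc j" l n] by simp
  then have "passes_test x t g (\<lambda>i. z (j * n + i)) = passes_test x' t' g' (\<lambda>i. z' (j * n + i))"
    if "j < l" for j
    using that by (intro passes_test_cong assms) auto
  then show ?thesis unfolding passes_tests_def by auto
qed

lemma crossing_cong: "(\<And>i. i < n \<Longrightarrow> g i = g' i) \<Longrightarrow> crossing g = crossing g'"
  unfolding crossing_def by (intro arg_cong[of _ _ "\<lambda>P. bisect P b 0 1"] ext ask_cong) auto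

lemma base_point_cong: "(\<And>i. i < n \<Longrightarrow> g i = g' i) \<Longrightarrow> i < n \<Longrightarrow> base_point g i = base_point g' i"
  using crossing_cong[of g g'] by (simp add: base_point_def)

lemma candidate_cong: "(\<And>i. i < n \<Longrightarrow> g i = g' i) \<Longrightarrow> candidate g = candidate g'"
proof -
  assume g: "\<And>i. i < n \<Longrightarrow> g i = g' i"
  have "ask (base_point g) z g = ask (base_point g') z g'" for z
    using g base_point_cong[OF g] by (intro ext ask_cong) auto
  then show ?thesis by (auto simp: candidate_def)
qed

text \<open>Translating \<open>\<zeta>\<close> along \<open>w\<close> changes no answer of the
  classifier but moves the prediction. Moving it by \<open>2 * \<theta>\<close> turns the upper
  query into the lower one, so the former is true with probability at most \<open>1 / 2\<close> more
  than the latter, whereas passing needs the first true and the second false.\<close>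

lemma pass_probability_le:
  assumes w: "invariant_dir w" and t: "4 * n * \<theta> * normn n w < \<bar>dotn n t w\<bar>" and th: "0 < \<theta>"
  shows "measure iid_gauss {\<zeta>. passes_test x t g \<zeta>} \<le> 3 / 4"
proof -
  \<comment> \<open>The multiple of \<open>w\<close> whose addition to \<open>\<zeta>\<close> raises
    \<open>dotn n \<zeta> t\<close> by exactly \<open>2 * \<theta>\<close>.\<close>
  define r where "r = 2 * \<theta> / dotn n t w"
  define v where "v = (\<lambda>j. r * w j)"
  let ?P = "{\<zeta>. ask x \<zeta> g (dotn n \<zeta> t + \<theta>)}" and ?N = "{\<zeta>. ask x \<zeta> g (dotn n \<zeta> t - \<theta>)}"
  have meas: "?P \<in> sets iid_gauss" "?N \<in> sets iid_gauss"
    "{\<zeta>. passes_test x t g \<zeta>} \<in> sets iid_gauss"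
    using ask_pred[of "\<lambda>\<zeta>. \<zeta>" iid_gauss "\<lambda>_. g" "\<lambda>_. x" "\<lambda>\<zeta>. dotn n \<zeta> t + \<theta>"]
      ask_pred[of "\<lambda>\<zeta>. \<zeta>" iid_gauss "\<lambda>_. g" "\<lambda>_. x" "\<lambda>\<zeta>. dotn n \<zeta> t - \<theta>"]
      passes_test_pred[of "\<lambda>\<zeta>. \<zeta>" iid_gauss "\<lambda>_. g" "\<lambda>_. x" "\<lambda>_. t"]
    by (simp_all add: measurable_coordinate measurable_dotn borel_measurable_add borel_measurable_diff pred_def space_iid_gauss)
  have nz: "dotn n t w \<noteq> 0"
  proof -
    have "0 \<le> 4 * n * \<theta> * normn n w" using th normn_nonneg[of w n] by simp
    with t show ?thesis by auto
  qed
  have inv: "M (\<lambda>j. f j + c * w j) = M f" for f c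
    using w by (simp add: invariant_dir_def)
  have "\<zeta> \<in> ?P \<longleftrightarrow> (\<lambda>j. \<zeta> j + (if j < n then v j else 0)) \<in> ?N" for \<zeta>
  proof -
    let ?z = "\<lambda>j. \<zeta> j + (if j < n then v j else 0)"
    have "dotn n ?z t = dotn n (\<lambda>j. \<zeta> j + v j) t" by (intro dotn_cong) auto
    also have "\<dots> = dotn n \<zeta> t + r * dotn n t w"
      unfolding v_def by (simp add: dotn_left dotn_commute[of n t])
    finally have z: "dotn n ?z t = dotn n \<zeta> t + 2 * \<theta>" using nz by (simp add: r_def)
    have "ask x ?z g s = M (\<lambda>j. (x j + h * \<zeta> j + s * g j) + (h * r) * w j)" for s
      unfolding ask_def by (rule M_cong) (simp add: v_def algebra_simps)
    also have "M (\<lambda>j. (x j + h * \<zeta> j + s * g j) + (h * r) * w j) = ask x \<zeta> g s" for s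
      unfolding ask_def by (rule inv)
    finally show ?thesis using z by (simp add: add.commute)
  qed
  then have "?P = {\<zeta>. (\<lambda>j. \<zeta> j + (if j < n then v j else 0)) \<in> ?N}" by blast
  then have "measure iid_gauss ?P \<le> measure iid_gauss ?N + (\<Sum>j<n. \<bar>v j\<bar>)"
    using iid_shift_le[OF meas(2), of n v] by simp
  also have "(\<Sum>j<n. \<bar>v j\<bar>) \<le> 1 / 2"
  proof -
    have "(\<Sum>j<n. \<bar>v j\<bar>) \<le> (\<Sum>j<n. \<bar>r\<bar> * normn n w)"
      by (intro sum_mono) (simp add: v_def abs_mult mult_left_mono abs_le_normn)
    also have "\<dots> = 2 * \<theta> * n * normn n w / \<bar>dotn n t w\<bar>"
      using th by (simp add: r_def abs_mult)
    also have "\<dots> \<le> 1 / 2"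
      using t nz by (simp add: divide_le_eq algebra_simps)
    finally show ?thesis .
  qed
  finally have "measure iid_gauss ?P \<le> measure iid_gauss ?N + 1 / 2" by simp
  moreover have "measure iid_gauss {\<zeta>. passes_test x t g \<zeta>} \<le> measure iid_gauss ?P"
    using meas by (intro gseq.finite_measure_mono) (auto simp: passes_test_def)
  moreover have "measure iid_gauss {\<zeta>. passes_test x t g \<zeta>} \<le> measure iid_gauss (space iid_gauss - ?N)"
    using meas(2) by (intro gseq.finite_measure_mono sets.compl_sets) (auto simp: passes_test_def space_iid_gauss)
  moreover have "measure iid_gauss (space iid_gauss - ?N) = 1 - measure iid_gauss ?N"
    using meas by (intro gseq.prob_compl) auto
  \<comment> \<open>Writing \<open>p\<close>, \<open>P\<close>, \<open>N\<close> for the three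
    probabilities: \<open>p \<le> P\<close>, \<open>p \<le> 1 - N\<close> and
    \<open>P \<le> N + 1 / 2\<close> add up to \<open>2 * p \<le> 3 / 2\<close>.\<close>
  ultimately show ?thesis by simp
qed

lemma passes_tests_Suc:
  "passes_tests x t g (Suc l) \<omega> \<longleftrightarrow>
     passes_test x t g \<omega> \<and> passes_tests x t g l (\<lambda>i. \<omega> (n + i))"
  by (auto simp: passes_tests_def less_Suc_eq_0_disj add.assoc)

text \<open>Each test reads its own block of \<open>n\<close> tape entries, so splitting off the
  first block multiplies the probabilities.\<close>

lemma pass_all_probability_le:
  assumes "invariant_dir w" "4 * n * \<theta> * normn n w < \<bar>dotn n t w\<bar>" "0 < \<theta>"
  shows "emeasure iid_gauss {\<zeta>. passes_tests x t g l \<zeta>} \<le> ennreal ((3 / 4) ^ l)"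
proof (induction l)
  case 0
  then show ?case by (simp add: passes_tests_def gseq.emeasure_le_1)
next
  case (Suc l)
  have tests: "{\<zeta>. passes_tests x t g j \<zeta>} \<in> sets iid_gauss" for j
    using passes_tests_pred[of "\<lambda>\<zeta>. \<zeta>" iid_gauss "\<lambda>_. g" "\<lambda>_. x" "\<lambda>_. t"]
    by (simp add: measurable_coordinate pred_def space_iid_gauss)
  have test: "{\<zeta>. passes_test x t g \<zeta>} \<in> sets iid_gauss"
    using passes_test_pred[of "\<lambda>\<zeta>. \<zeta>" iid_gauss "\<lambda>_. g" "\<lambda>_. x" "\<lambda>_. t"]
    by (simp add: measurable_coordinate pred_def space_iid_gauss)
  have "passes_tests x t g (Suc l) (comb_seq n \<omega> \<omega>') \<longleftrightarrow> passes_test x t g \<omega> \<and> passes_tests x t g l \<omega>'" for \<omega> \<omega>'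
  proof -
    have "(\<lambda>i. comb_seq n \<omega> \<omega>' (n + i)) = \<omega>'"
      using comb_seq_add[of n \<omega> \<omega>'] by (simp add: add.commute)
    moreover have "passes_test x t g (comb_seq n \<omega> \<omega>') = passes_test x t g \<omega>"
      by (intro passes_test_cong) (auto simp: comb_seq_less)
    ultimately show ?thesis by (simp add: passes_tests_Suc)
  qed
  then have "{\<omega>'. comb_seq n \<omega> \<omega>' \<in> {\<zeta>. passes_tests x t g (Suc l) \<zeta>}}
      = (if passes_test x t g \<omega> then {\<zeta>. passes_tests x t g l \<zeta>} else {})" for \<omega>
    by auto
  then have "emeasure iid_gauss {\<zeta>. passes_tests x t g (Suc l) \<zeta>}
      = (\<integral>\<^sup>+\<omega>. emeasure iid_gauss {\<zeta>. passes_tests x t g l \<zeta>} * indicator {\<zeta>. passes_test x t g \<zeta>} \<omega> \<partial>iid_gauss)"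
    unfolding iid_gauss_split[OF tests, of "Suc l" n]
    by (intro nn_integral_cong) (auto simp: indicator_def)
  also have "\<dots> = emeasure iid_gauss {\<zeta>. passes_tests x t g l \<zeta>} * emeasure iid_gauss {\<zeta>. passes_test x t g \<zeta>}"
    by (rule nn_integral_cmult_indicator[OF test])
  also have "\<dots> \<le> ennreal ((3 / 4) ^ l) * ennreal (3 / 4)"
    using pass_probability_le[OF assms] Suc.IH
    by (intro mult_mono) (auto simp: gseq.emeasure_eq_measure)
  also have "\<dots> = ennreal ((3 / 4) ^ Suc l)"
    by (simp add: mult.commute flip: ennreal_mult)
  finally show ?case .
qed

end

section \<open>Measurability from finitely many outcomes\<close>

lemma simple_function_bind:
  assumes c: "simple_function N c" and f: "\<And>a. simple_function N (f a)"
  shows "simple_function N (\<lambda>\<omega>. f (c \<omega>) \<omega>)"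
proof (rule simple_function_eq_measurable[THEN iffD2], intro conjI)
  have fin: "finite (c ` space N)" using c by (rule simple_functionD)
  have "(\<lambda>\<omega>. f (c \<omega>) \<omega>) ` space N \<subseteq> (\<Union>a\<in>c ` space N. f a ` space N)" by auto
  moreover have "finite \<dots>" using fin simple_functionD(1)[OF f] by (rule finite_UN_I)
  ultimately show "finite ((\<lambda>\<omega>. f (c \<omega>) \<omega>) ` space N)" by (rule finite_subset)
  show "(\<lambda>\<omega>. f (c \<omega>) \<omega>) \<in> N \<rightarrow>\<^sub>M count_space UNIV"
  proof (rule measurableI)
    fix X
    \<comment> \<open>A finite union over the values of \<open>c\<close>; on each piece the first
      argument of \<open>f\<close> is constant.\<close>
    have "(\<lambda>\<omega>. f (c \<omega>) \<omega>) -` X \<inter> space N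
        = (\<Union>a\<in>c ` space N. (c -` {a} \<inter> space N) \<inter> (f a -` X \<inter> space N))" by auto
    also have "\<dots> \<in> sets N"
      by (intro sets.finite_UN[OF fin] sets.Int simple_functionD(2)[OF c] simple_functionD(2)[OF f])
    finally show "(\<lambda>\<omega>. f (c \<omega>) \<omega>) -` X \<inter> space N \<in> sets N" .
  qed simp
qed

lemma simple_function_if_pred:
  assumes "simple_function N f" "simple_function N g" "Measurable.pred N P"
  shows "simple_function N (\<lambda>\<omega>. if P \<omega> then f \<omega> else g \<omega>)"
  using assms by (intro simple_function_If) (auto simp: pred_def)

lemma simple_function_bisect:
  assumes "\<And>s. Measurable.pred N (\<lambda>\<omega>. P \<omega> s)"
  shows "simple_function N (\<lambda>\<omega>. bisect (P \<omega>) l lo D)"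
  by (induction l arbitrary: lo D) (auto intro!: simple_function_if_pred assms)

lemma simple_function_initial:
  fixes l :: nat
  assumes "\<forall>i<l. simple_function N (r i)"
  shows "simple_function N (\<lambda>\<omega> i. if i < l then r i \<omega> else (0::real))"
  using assms
proof (induction l)
  case (Suc l)
  have e: "(\<lambda>\<omega> i. if i < Suc l then r i \<omega> else 0)
      = (\<lambda>\<omega>. (\<lambda>i. if i < l then r i \<omega> else (0::real))(l := r l \<omega>))"
    by (auto simp: fun_eq_iff less_Suc_eq)
  show ?case unfolding e
    by (rule simple_function_compose2[where h = "\<lambda>f v. f(l := v)"]) (use Suc in auto)
qed simp

context search_oracle
begin

context
  fixes N :: "'w measure" and g :: "'w \<Rightarrow> nat \<Rightarrow> real"
  assumes g: "\<And>j. (\<lambda>\<omega>. g \<omega> j) \<in> borel_measurable N"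
begin

lemma simple_function_crossing: "simple_function N (\<lambda>\<omega>. crossing (g \<omega>))"
  unfolding crossing_def by (intro simple_function_bisect ask_pred g borel_measurable_const)

lemma measurable_base_point: "(\<lambda>\<omega>. base_point (g \<omega>) j) \<in> borel_measurable N"
  unfolding base_point_def
  by (intro borel_measurable_times g borel_measurable_simple_function simple_function_crossing)

lemma simple_function_candidate: "simple_function N (\<lambda>\<omega>. candidate (g \<omega>))"
  unfolding candidate_def
proof (rule simple_function_initial, intro allI impI)
  fix i
  show "simple_function N (\<lambda>\<omega>. bisect (ask (base_point (g \<omega>)) (unit_fn i) (g \<omega>)) b (- T\<^sub>0) (2 * T\<^sub>0))"
    by (intro simple_function_bisect ask_pred g borel_measurable_const measurable_base_point)
qed

end

text \<open>Determined by the first \<open>n\<close> tape entries (\<open>trial_cong\<close>), hence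
  a fixed vector once the direction is drawn, while the test vectors are still random.\<close>

definition trial :: "(nat \<Rightarrow> real) list \<Rightarrow> (nat \<Rightarrow> real) \<Rightarrow> nat \<Rightarrow> real" where
  "trial us \<omega> = candidate (resid n us \<omega>)"

lemma extend_trial:
  "extend us \<omega> = (let g = resid n us \<omega>; u = resid n us (trial us \<omega>) in
     if passes_tests (base_point g) (trial us \<omega>) g m (\<lambda>i. \<omega> (n + i)) \<and> thr \<le> dotn n u u
     then us @ [u] else us)"
  by (simp add: extend_def trial_def Let_def)

lemma extend_neqD:
  assumes "extend us \<omega> \<noteq> us"
  shows "extend us \<omega> = us @ [resid n us (trial us \<omega>)]"
    "passes_tests (base_point (resid n us \<omega>)) (trial us \<omega>) (resid n us \<omega>) m (\<lambda>i. \<omega> (n + i))"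
    "thr \<le> dotn n (resid n us (trial us \<omega>)) (resid n us (trial us \<omega>))"
  using assms by (auto simp: extend_trial Let_def split: if_splits)

lemma simple_function_trial: "simple_function iid_gauss (trial us)"
  unfolding trial_def
  by (intro simple_function_candidate measurable_resid measurable_coordinate)

text \<open>For a fixed value \<open>t\<close> of the trial there are only two outcomes, separated
  by a measurable condition; \<open>simple_function_bind\<close> then lets \<open>t\<close> run
  through its finitely many values.\<close>

lemma simple_function_extend: "simple_function iid_gauss (extend us)"
proof -
  let ?f = "\<lambda>t \<omega>. let g = resid n us \<omega>; u = resid n us t in
     if passes_tests (base_point g) t g m (\<lambda>i. \<omega> (n + i)) \<and> thr \<le> dotn n u u
     then us @ [u] else us"
  have "simple_function iid_gauss (?f t)" for t
    unfolding Let_def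
    by (intro simple_function_if_pred simple_function_const pred_intros_logic passes_tests_pred
        measurable_base_point measurable_resid measurable_coordinate borel_measurable_const) auto
  from simple_function_bind[OF simple_function_trial[of us] this]
  have "simple_function iid_gauss (\<lambda>\<omega>. ?f (trial us \<omega>) \<omega>)" .
  then show ?thesis
    by (simp add: extend_trial[abs_def])
qed

lemma drop_measurable: "(\<lambda>\<omega> i. \<omega> (c + i)) \<in> iid_gauss \<rightarrow>\<^sub>M iid_gauss"
  by (rule measurable_PiM_single') (auto simp: space_PiM)

lemma simple_function_rounds: "simple_function iid_gauss (rounds k N us)"
proof (induction N arbitrary: us)
  case (Suc N)
  show ?case
  proof (cases "length us < k")
    case True
    have "simple_function iid_gauss (\<lambda>\<omega>. rounds k N us' (\<lambda>i. \<omega> ((m + 1) * n + i)))" for us'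
      by (rule simple_function_comp[OF drop_measurable Suc.IH])
    from simple_function_bind[OF simple_function_extend[of us] this] True show ?thesis by simp
  qed (simp add: fun_eq_iff)
next
  case 0
  have "rounds k 0 us = (\<lambda>_. us)" by auto
  then show ?case by simp
qed

section \<open>Failure probability of the whole search\<close>

lemma trial_cong:
  assumes "\<And>i. i < n \<Longrightarrow> \<omega> i = \<omega>' i"
  shows "trial us \<omega> = trial us \<omega>'"
  unfolding trial_def using assms by (intro candidate_cong resid_cong)

lemma extend_cong:
  assumes "\<And>i. i < (m + 1) * n \<Longrightarrow> \<omega> i = \<omega>' i"
  shows "extend us \<omega> = extend us \<omega>'"
proof -
  have a: "\<And>i. i < n \<Longrightarrow> \<omega> i = \<omega>' i" using assms by simp
  have "passes_tests (base_point (resid n us \<omega>)) t (resid n us \<omega>) m (\<lambda>i. \<omega> (n + i))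
      = passes_tests (base_point (resid n us \<omega>')) t (resid n us \<omega>') m (\<lambda>i. \<omega>' (n + i))" for t
    using a assms by (intro passes_tests_cong base_point_cong resid_cong) auto
  moreover have "trial us \<omega> = trial us \<omega>'" using a by (rule trial_cong)
  ultimately show ?thesis
    unfolding extend_trial Let_def by simp
qed

text \<open>Given the first \<open>n\<close> entries the candidate is a fixed vector. If it is not
  nearly normal, some invariant \<open>w\<close> witnesses this, and the fresh test vectors all pass
  with probability at most \<open>(3 / 4) ^ m\<close>.\<close>

lemma bad_extend_probability:
  assumes "0 < \<theta>"
  shows "emeasure iid_gauss {\<omega>. extend us \<omega> \<noteq> us \<and> \<not> nearly_normal (4 * n * \<theta>) (trial us \<omega>)}
     \<le> ennreal ((3 / 4) ^ m)"
proof -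
  let ?B = "{\<omega>. extend us \<omega> \<noteq> us \<and> \<not> nearly_normal (4 * n * \<theta>) (trial us \<omega>)}"
  have "?B \<in> sets iid_gauss"
  proof -
    have "simple_function iid_gauss (\<lambda>\<omega>. extend us \<omega> \<noteq> us \<and> \<not> nearly_normal (4 * n * \<theta>) (trial us \<omega>))"
      by (rule simple_function_compose2[OF simple_function_extend simple_function_trial,
          where h = "\<lambda>x t. x \<noteq> us \<and> \<not> nearly_normal (4 * n * \<theta>) t"])
    from simple_functionD(2)[OF this, of "{True}"] show ?thesis
      by (simp add: vimage_def space_iid_gauss)
  qed
  note split = iid_gauss_split[OF this, of n]
  have "emeasure iid_gauss {\<omega>'. comb_seq n \<omega> \<omega>' \<in> ?B} \<le> ennreal ((3 / 4) ^ m)" for \<omega>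
  proof -
    let ?t = "trial us \<omega>" and ?g = "resid n us \<omega>"
    have t: "trial us (comb_seq n \<omega> \<omega>') = ?t" for \<omega>'
      by (rule trial_cong) (simp add: comb_seq_less)
    show ?thesis
    proof (cases "nearly_normal (4 * n * \<theta>) ?t")
      case False
      then obtain w where w: "invariant_dir w" "4 * n * \<theta> * normn n w < \<bar>dotn n ?t w\<bar>"
        by (auto simp: nearly_normal_def not_le)
      have "passes_tests (base_point ?g) ?t ?g m \<omega>'" if "comb_seq n \<omega> \<omega>' \<in> ?B" for \<omega>'
      proof -
        let ?c = "comb_seq n \<omega> \<omega>'"
        have "extend us ?c \<noteq> us" using that by simp
        from extend_neqD(2)[OF this]
        have "passes_tests (base_point (resid n us ?c)) ?t (resid n us ?c) m (\<lambda>i. ?c (n + i))"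
          unfolding t .
        also have "(\<lambda>i. ?c (n + i)) = \<omega>'"
          using comb_seq_add[of n \<omega> \<omega>'] by (simp add: add.commute)
        also have "passes_tests (base_point (resid n us ?c)) ?t (resid n us ?c) m \<omega>'
            = passes_tests (base_point ?g) ?t ?g m \<omega>'"
          by (intro passes_tests_cong base_point_cong resid_cong) (auto simp: comb_seq_less)
        finally show ?thesis .
      qed
      then have "{\<omega>'. comb_seq n \<omega> \<omega>' \<in> ?B} \<subseteq> {\<omega>'. passes_tests (base_point ?g) ?t ?g m \<omega>'}" by blast
      moreover have "{\<zeta>. passes_tests (base_point ?g) ?t ?g m \<zeta>} \<in> sets iid_gauss"
        using passes_tests_pred[of "\<lambda>\<zeta>. \<zeta>" iid_gauss "\<lambda>_. ?g" "\<lambda>_. base_point ?g" "\<lambda>_. ?t"]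
        by (simp add: measurable_coordinate pred_def space_iid_gauss)
      ultimately have "emeasure iid_gauss {\<omega>'. comb_seq n \<omega> \<omega>' \<in> ?B}
          \<le> emeasure iid_gauss {\<zeta>. passes_tests (base_point ?g) ?t ?g m \<zeta>}"
        by (rule emeasure_mono)
      also have "\<dots> \<le> ennreal ((3 / 4) ^ m)"
        by (rule pass_all_probability_le[OF w assms])
      finally show ?thesis .
    qed (simp add: t)
  qed
  then have "emeasure iid_gauss ?B \<le> (\<integral>\<^sup>+\<omega>. ennreal ((3 / 4) ^ m) \<partial>iid_gauss)"
    unfolding split by (intro nn_integral_mono)
  then show ?thesis by (simp add: gseq.emeasure_space_1)
qed

text \<open>The potential \<open>2 ^ (k - length us)\<close> halves with each accepted vector, which
  happens with probability at least \<open>\<gamma> / 2\<close>. Its expectation therefore shrinks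
  by the factor \<open>1 - \<gamma> / 4\<close> in each round, and it bounds the probability of
  ending with fewer than \<open>k\<close> vectors. The second summand is a union bound over false
  acceptances.\<close>

lemma failure_probability:
  fixes \<gamma> :: real
  assumes th: "0 < \<theta>" and \<gamma>: "0 \<le> \<gamma>" "\<gamma> \<le> 1"
    and good: "\<And>us \<omega>. good us \<Longrightarrow> length us < k \<Longrightarrow> extend us \<omega> \<noteq> us \<Longrightarrow>
      nearly_normal (4 * n * \<theta>) (trial us \<omega>) \<Longrightarrow> good (extend us \<omega>)"
    and progress: "\<And>us. good us \<Longrightarrow> length us < k \<Longrightarrow>
      \<gamma> / 2 \<le> measure iid_gauss {\<omega>. extend us \<omega> \<noteq> us}"
    and us: "good us" "length us \<le> k"
  shows "measure iid_gauss {\<omega>. \<not> (good (rounds k N us \<omega>) \<and> length (rounds k N us \<omega>) = k)}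
     \<le> 2 ^ (k - length us) * (1 - \<gamma> / 4) ^ N + N * (3 / 4) ^ m"
  using us
proof (induction N arbitrary: us)
  case 0
  have "measure iid_gauss X \<le> 2 ^ (k - length us)" for X
    by (rule order_trans[OF gseq.prob_le_1]) simp
  then show ?case by simp
next
  case (Suc N)
  let ?F = "\<lambda>N us. {\<omega>. \<not> (good (rounds k N us \<omega>) \<and> length (rounds k N us \<omega>) = k)}"
  let ?b = "\<lambda>r. 2 ^ (k - r) * (1 - \<gamma> / 4) ^ N + N * (3 / 4) ^ m :: real"
  have F: "?F N us \<in> sets iid_gauss" for N us
    using simple_functionD(2)[OF simple_function_rounds, of k N us "{vs. \<not> (good vs \<and> length vs = k)}"]
    by (simp add: vimage_def space_iid_gauss)
  have b0: "0 \<le> ?b r" for r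
    using \<gamma> by (intro add_nonneg_nonneg mult_nonneg_nonneg zero_le_power) auto
  show ?case
  proof (cases "length us < k")
    case False
    then have "?F (Suc N) us = {}" using Suc.prems by auto
    moreover have "0 \<le> 2 ^ (k - length us) * (1 - \<gamma> / 4) ^ Suc N + Suc N * (3 / 4) ^ m"
      using \<gamma> by (intro add_nonneg_nonneg mult_nonneg_nonneg zero_le_power) auto
    ultimately show ?thesis by simp
  next
    case True
    let ?A = "{\<omega>. extend us \<omega> \<noteq> us}"
    let ?B = "{\<omega>. extend us \<omega> \<noteq> us \<and> \<not> nearly_normal (4 * n * \<theta>) (trial us \<omega>)}"
    let ?r = "length us"
    have A: "?A \<in> sets iid_gauss"
      using simple_functionD(2)[OF simple_function_extend, of us "- {us}"]
      by (simp add: vimage_def space_iid_gauss)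
    have B: "?B \<in> sets iid_gauss"
    proof -
      have "simple_function iid_gauss (\<lambda>\<omega>. extend us \<omega> \<noteq> us \<and> \<not> nearly_normal (4 * n * \<theta>) (trial us \<omega>))"
        by (rule simple_function_compose2[OF simple_function_extend simple_function_trial,
            where h = "\<lambda>x t. x \<noteq> us \<and> \<not> nearly_normal (4 * n * \<theta>) t"])
      from simple_functionD(2)[OF this, of "{True}"] show ?thesis
        by (simp add: vimage_def space_iid_gauss)
    qed
    define p where "p = measure iid_gauss ?A"
    have p: "\<gamma> / 2 \<le> p" "p \<le> 1" using progress[OF Suc.prems(1) True] by (auto simp: p_def)
    have cb: "comb_seq ((m + 1) * n) \<omega> \<omega>' \<in> ?F (Suc N) us \<longleftrightarrow> \<omega>' \<in> ?F N (extend us \<omega>)" for \<omega> \<omega>'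
    proof -
      have "extend us (comb_seq ((m + 1) * n) \<omega> \<omega>') = extend us \<omega>"
        by (rule extend_cong) (simp add: comb_seq_less)
      moreover have "(\<lambda>i. comb_seq ((m + 1) * n) \<omega> \<omega>' ((m + 1) * n + i)) = \<omega>'"
        using comb_seq_add[of "(m + 1) * n" \<omega> \<omega>'] by (simp only: add.commute)
      ultimately show ?thesis using True by simp
    qed
    have "emeasure iid_gauss (?F (Suc N) us) = (\<integral>\<^sup>+\<omega>. emeasure iid_gauss (?F N (extend us \<omega>)) \<partial>iid_gauss)"
      unfolding iid_gauss_split[OF F, of "Suc N" us "(m + 1) * n"] cb by simp
    \<comment> \<open>A false acceptance in the first round is charged in full; otherwise the
      induction hypothesis applies, with the old list or with one more vector.\<close>
    also have "\<dots> \<le> (\<integral>\<^sup>+\<omega>. indicator ?B \<omega> + (ennreal (?b ?r) * indicator (space iid_gauss - ?A) \<omega>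
        + ennreal (?b (Suc ?r)) * indicator ?A \<omega>) \<partial>iid_gauss)"
    proof (rule nn_integral_mono)
      fix \<omega> :: "nat \<Rightarrow> real"
      consider "extend us \<omega> = us" | "\<omega> \<in> ?B" | "extend us \<omega> \<noteq> us" "nearly_normal (4 * n * \<theta>) (trial us \<omega>)"
        by blast
      then show "emeasure iid_gauss (?F N (extend us \<omega>)) \<le> indicator ?B \<omega>
          + (ennreal (?b ?r) * indicator (space iid_gauss - ?A) \<omega> + ennreal (?b (Suc ?r)) * indicator ?A \<omega>)"
      proof cases
        case 1
        then show ?thesis using Suc.IH[OF Suc.prems] b0[of ?r]
          by (simp add: space_iid_gauss gseq.emeasure_eq_measure ennreal_le_iff)
      next
        case 2
        then have "emeasure iid_gauss (?F N (extend us \<omega>)) \<le> indicator ?B \<omega>"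
          by (simp add: gseq.emeasure_le_1)
        then show ?thesis by (rule order_trans) simp
      next
        case 3
        have "good (extend us \<omega>)" "length (extend us \<omega>) = Suc ?r"
          using good[OF Suc.prems(1) True 3] extend_neqD(1)[OF 3(1)] by auto
        with Suc.IH[of "extend us \<omega>"] True 3 b0[of "Suc ?r"] show ?thesis
          by (simp add: gseq.emeasure_eq_measure ennreal_le_iff)
      qed
    qed
    also have "\<dots> = emeasure iid_gauss ?B + (ennreal (?b ?r) * emeasure iid_gauss (space iid_gauss - ?A)
        + ennreal (?b (Suc ?r)) * emeasure iid_gauss ?A)"
      using A B by (simp add: nn_integral_add nn_integral_cmult_indicator del: ennreal_plus)
    also have "\<dots> \<le> ennreal ((3 / 4) ^ m) + (ennreal (?b ?r) * ennreal (1 - p) + ennreal (?b (Suc ?r)) * ennreal p)"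
      using bad_extend_probability[OF th, of us] A
      by (intro add_mono mult_mono) (auto simp: gseq.emeasure_eq_measure gseq.prob_compl p_def)
    also have "\<dots> = ennreal ((3 / 4) ^ m + (?b ?r * (1 - p) + ?b (Suc ?r) * p))"
      using p \<gamma> b0[of ?r] b0[of "Suc ?r"]
      by (subst ennreal_mult[symmetric] | subst ennreal_plus[symmetric] | simp)+
    finally have "measure iid_gauss (?F (Suc N) us) \<le> (3 / 4) ^ m + (?b ?r * (1 - p) + ?b (Suc ?r) * p)"
      using p \<gamma> b0[of ?r] b0[of "Suc ?r"] unfolding gseq.emeasure_eq_measure
      by (subst (asm) ennreal_le_iff) (auto intro!: add_nonneg_nonneg mult_nonneg_nonneg)
    also have "\<dots> \<le> 2 ^ (k - ?r) * (1 - \<gamma> / 4) ^ Suc N + Suc N * (3 / 4) ^ m"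
    proof -
      let ?c = "2 ^ (k - ?r) * (1 - \<gamma> / 4) ^ N"
      have c: "0 \<le> ?c" using \<gamma> by (intro mult_nonneg_nonneg zero_le_power) auto
      have "k - ?r = Suc (k - Suc ?r)" using True by simp
      then have half: "?b (Suc ?r) = ?c / 2 + N * (3 / 4) ^ m" by simp
      \<comment> \<open>Acceptance halves the potential \<open>C\<close>, so averaging over
        acceptance with probability \<open>p\<close> yields the factor
        \<open>1 - p / 2\<close>.\<close>
      have split: "(C + n) * (1 - p) + (C / 2 + n) * p = C * (1 - p / 2) + n" for C n :: real
        by (simp add: field_simps)
      have "?c * (1 - p / 2) \<le> ?c * (1 - \<gamma> / 4)"
        using c p by (intro mult_left_mono) auto
      also have "\<dots> = 2 ^ (k - ?r) * (1 - \<gamma> / 4) ^ Suc N" by simp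
      finally have "?c * (1 - p / 2) \<le> 2 ^ (k - ?r) * (1 - \<gamma> / 4) ^ Suc N" .
      then show ?thesis
        unfolding half split by (simp add: distrib_right)
    qed
    finally show ?thesis .
  qed
qed

end

section \<open>Accuracy of accepted directions\<close>

lemma bisect_bounds:
  assumes "0 \<le> D"
  shows "lo \<le> bisect P l lo D \<and> bisect P l lo D + D / 2 ^ l \<le> lo + D"
  using assms
proof (induction l arbitrary: lo D)
  case (Suc l)
  have D: "0 \<le> D / 2" using Suc.prems by simp
  have e: "D / 2 / 2 ^ l = D / 2 ^ Suc l" by simp
  show ?case
  proof (cases "P (lo + D / 2)")
    case True
    have "lo \<le> bisect P l lo (D / 2)" "bisect P l lo (D / 2) + D / 2 ^ Suc l \<le> lo + D / 2"
      using Suc.IH[OF D, of lo] unfolding e by blast+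
    moreover have "bisect P (Suc l) lo D = bisect P l lo (D / 2)" using True by simp
    ultimately show ?thesis using D by (intro conjI) linarith+
  next
    case False
    have "lo + D / 2 \<le> bisect P l (lo + D / 2) (D / 2)"
      "bisect P l (lo + D / 2) (D / 2) + D / 2 ^ Suc l \<le> lo + D / 2 + D / 2"
      using Suc.IH[OF D, of "lo + D / 2"] unfolding e by blast+
    moreover have "bisect P (Suc l) lo D = bisect P l (lo + D / 2) (D / 2)" using False by simp
    ultimately show ?thesis using D by (intro conjI) linarith+
  qed
qed simp

lemma bisect_bracket:
  assumes "\<not> P lo" "P (lo + D)"
  shows "\<not> P (bisect P l lo D) \<and> P (bisect P l lo D + D / 2 ^ l)"
  using assms
proof (induction l arbitrary: lo D)
  case (Suc l)
  show ?case
  proof (cases "P (lo + D / 2)")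
    case True
    from Suc.IH[OF Suc.prems(1) this] True show ?thesis by (simp add: divide_divide_eq_left)
  next
    case False
    have "P (lo + D / 2 + D / 2)" using Suc.prems(2) by (simp add: add.assoc)
    from Suc.IH[OF False this] False show ?thesis by (simp add: divide_divide_eq_left)
  qed
qed simp

text \<open>The link between the Taylor bounds used throughout and the derivative in which
  hypothesis (4) is phrased; it also gives continuity along rays.\<close>

lemma derivative_from_quadratic_bound:
  fixes f :: "real \<Rightarrow> real"
  assumes "\<And>s. \<bar>f (x + s) - f x - d * s\<bar> \<le> C * s\<^sup>2"
  shows "(f has_real_derivative d) (at x)"
proof -
  have "\<bar>(f (x + s) - f x) / s - d\<bar> \<le> C * \<bar>s\<bar>" if "s \<noteq> 0" for s
  proof -
    have "(f (x + s) - f x) / s - d = (f (x + s) - f x - d * s) / s"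
      using that by (simp add: field_simps)
    then have "\<bar>(f (x + s) - f x) / s - d\<bar> = \<bar>f (x + s) - f x - d * s\<bar> / \<bar>s\<bar>" by simp
    also have "\<dots> \<le> C * s\<^sup>2 / \<bar>s\<bar>" using assms by (intro divide_right_mono) auto
    also have "\<dots> = C * \<bar>s\<bar>" using that by (simp add: power2_eq_square abs_if)
    finally show ?thesis .
  qed
  then have ev: "\<forall>\<^sub>F s in at 0. norm ((f (x + s) - f x) / s - d) \<le> C * \<bar>s\<bar>"
    by (intro eventually_mono[OF eventually_neq_at_within[of 0]]) simp
  have "((\<lambda>s::real. C * \<bar>s\<bar>) \<longlongrightarrow> C * \<bar>0\<bar>) (at 0)"
    by (intro tendsto_intros)
  then have "((\<lambda>s::real. C * \<bar>s\<bar>) \<longlongrightarrow> 0) (at 0)" by simp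
  with ev have "((\<lambda>s. (f (x + s) - f x) / s - d) \<longlongrightarrow> 0) (at 0)"
    by (rule Lim_null_comparison)
  then show ?thesis
    by (simp add: DERIV_def LIM_zero_iff)
qed

lemma normn_le_bound:
  assumes "\<And>i. i < n \<Longrightarrow> \<bar>f i\<bar> \<le> c"
  shows "normn n f \<le> n * c"
proof -
  have "normn n f \<le> (\<Sum>i<n. \<bar>f i\<bar>)" by (rule L2_set_le_sum_abs)
  also have "\<dots> \<le> (\<Sum>i<n. c)" using assms by (intro sum_mono) auto
  finally show ?thesis by simp
qed

lemma normn_unit: "i < n \<Longrightarrow> normn n (unit_fn i) = 1"
  by (simp add: L2_set_def unit_fn_def if_distrib[of "\<lambda>x. x\<^sup>2"] cong: if_cong)

lemma dotn_unit: "i < n \<Longrightarrow> dotn n a (unit_fn i) = a i"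
  by (simp add: dotn_def unit_fn_def if_distrib cong: if_cong)

text \<open>\<open>K\<close> dominates all parameters and \<open>h\<close> is a high negative power
  of \<open>K\<close>. With the gradient bounded by \<open>X\<close>, the slopes of a transversal
  level set are at most \<open>h * X / \<eta>\<close>, within \<open>T\<^sub>0\<close>. The
  tolerance \<open>\<theta>\<close> exceeds Taylor errors of order \<open>K ^ 10 * h\<^sup>2\<close>
  divided by a derivative of at least \<open>1 / K\<close>. The residual of a transversal candidate
  has norm at least \<open>h / (2 * K)\<close>, enough for \<open>thr\<close>. Bisection of the unit
  interval ends at resolution \<open>h\<^sup>2\<close>.\<close>

locale search_scale = search_oracle +
  fixes K :: real
  assumes K: "64 \<le> K" "4 * n \<le> K" and h: "0 < h" "h * K ^ 16 \<le> 1"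
    and T0: "T\<^sub>0 = K * h" and th: "\<theta> = K ^ 14 * h\<^sup>2" and thr: "thr = (h / K\<^sup>2)\<^sup>2"
    and b: "(1 / 2) ^ b = h\<^sup>2"
begin

lemma K_powers: "p \<le> q \<Longrightarrow> K ^ p \<le> K ^ q"
  using K by (intro power_increasing) auto

lemma h_powers: "p \<le> 16 \<Longrightarrow> h * K ^ p \<le> 1"
  using mult_left_mono[OF K_powers[of p 16], of h] h by linarith

lemma h_powers64: "p \<le> 15 \<Longrightarrow> 64 * (h * K ^ p) \<le> 1"
proof -
  assume "p \<le> 15"
  have "64 * (h * K ^ p) \<le> K * (h * K ^ p)"
    using K h by (intro mult_right_mono mult_nonneg_nonneg zero_le_power) auto
  also have "\<dots> = h * K ^ Suc p" by simp
  also have "\<dots> \<le> 1" using \<open>p \<le> 15\<close> by (intro h_powers) simp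
  finally show ?thesis .
qed

lemma theta_pos: "0 < \<theta>" and thr_pos: "0 < thr"
  using h K by (simp_all add: th thr)

lemma candidate_bound: "\<bar>candidate g i\<bar> \<le> T\<^sub>0"
proof -
  have T: "0 \<le> T\<^sub>0" using h K by (simp add: T0)
  then show ?thesis
  proof (cases "i < n")
    case True
    let ?P = "ask (base_point g) (unit_fn i) g"
    have "0 \<le> 2 * T\<^sub>0 / 2 ^ b" using T by simp
    moreover have "- T\<^sub>0 \<le> bisect ?P b (- T\<^sub>0) (2 * T\<^sub>0)"
      "bisect ?P b (- T\<^sub>0) (2 * T\<^sub>0) + 2 * T\<^sub>0 / 2 ^ b \<le> - T\<^sub>0 + 2 * T\<^sub>0"
      using bisect_bounds[of "2 * T\<^sub>0" "- T\<^sub>0" ?P b] T by auto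
    ultimately have "\<bar>bisect ?P b (- T\<^sub>0) (2 * T\<^sub>0)\<bar> \<le> T\<^sub>0" by linarith
    then show ?thesis using True by (simp add: candidate_def)
  qed (simp add: candidate_def)
qed

lemma normn_candidate: "normn n (candidate g) \<le> K\<^sup>2 * h"
proof -
  have "normn n (candidate g) \<le> n * T\<^sub>0" by (rule normn_le_bound) (rule candidate_bound)
  also have "\<dots> \<le> K * (K * h)" unfolding T0 using K h by (intro mult_right_mono) auto
  finally show ?thesis by (simp add: power2_eq_square mult.assoc)
qed

text \<open>The error is relative to the norm of the stored vector, which is not normalised. The
  exponent \<open>17\<close> comes from the test error
  \<open>K * \<theta> = K ^ 15 * h\<^sup>2\<close> over the least norm \<open>h / K\<^sup>2\<close>;
  the influence of the earlier vectors costs \<open>6\<close> more per position.\<close>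

definition accurate :: "(nat \<Rightarrow> real) list \<Rightarrow> bool" where
  "accurate us \<longleftrightarrow> orthogonal_list n us \<and>
     (\<forall>j<length us. nearly_normal (h * K ^ (17 + 6 * j) * normn n (us ! j)) (us ! j))"

text \<open>\<open>K ^ 4\<close> is the largest candidate norm \<open>K\<^sup>2 * h\<close> over the
  least residual norm \<open>h / K\<^sup>2\<close>, the factor with which the errors of earlier
  vectors enter a new one.\<close>

lemma geometric_bound: "1 + K ^ 4 * (\<Sum>j<r. K ^ (6 * j)) \<le> K ^ (6 * r)"
proof (induction r)
  case (Suc r)
  have "1 + K ^ 4 \<le> K ^ 6"
  proof -
    have "1 \<le> K ^ 4" using K by simp
    then have "1 + K ^ 4 \<le> 2 * K ^ 4" by simp
    also have "\<dots> \<le> K * K ^ 4" using K by (intro mult_right_mono) auto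
    also have "\<dots> = K ^ 5" by (simp add: eval_nat_numeral)
    also have "\<dots> \<le> K ^ 6" by (rule K_powers) simp
    finally show ?thesis .
  qed
  have "1 + K ^ 4 * (\<Sum>j<Suc r. K ^ (6 * j)) \<le> K ^ (6 * r) * (1 + K ^ 4)"
    using Suc by (simp add: algebra_simps)
  also have "\<dots> \<le> K ^ (6 * r) * K ^ 6"
    using \<open>1 + K ^ 4 \<le> K ^ 6\<close> K by (intro mult_left_mono) auto
  also have "\<dots> = K ^ (6 * Suc r)" by (simp add: power_add)
  finally show ?case .
qed simp

lemma accurate_dotn_bound:
  assumes acc: "accurate us" and w: "invariant_dir w"
    and c: "\<And>j. j < length us \<Longrightarrow> \<bar>c (us ! j)\<bar> * normn n (us ! j) \<le> C"
  shows "\<bar>\<Sum>u\<leftarrow>us. c u * dotn n u w\<bar> \<le> C * (\<Sum>j<length us. h * K ^ (17 + 6 * j)) * normn n w"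
proof -
  have "(\<Sum>u\<leftarrow>us. c u * dotn n u w) = (\<Sum>j<length us. c (us ! j) * dotn n (us ! j) w)"
    by (simp add: sum_list_sum_nth atLeast0LessThan)
  also have "\<bar>\<dots>\<bar> \<le> (\<Sum>j<length us. C * (h * K ^ (17 + 6 * j)) * normn n w)"
  proof (rule order_trans[OF sum_abs], rule sum_mono)
    fix j assume "j \<in> {..<length us}"
    then have j: "j < length us" by simp
    have "\<bar>dotn n (us ! j) w\<bar> \<le> h * K ^ (17 + 6 * j) * normn n (us ! j) * normn n w"
      using acc w j by (auto simp: accurate_def nearly_normal_def)
    then have "\<bar>c (us ! j) * dotn n (us ! j) w\<bar> \<le> \<bar>c (us ! j)\<bar> * (h * K ^ (17 + 6 * j) * normn n (us ! j) * normn n w)"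
      by (simp add: abs_mult mult_left_mono)
    also have "\<dots> = (\<bar>c (us ! j)\<bar> * normn n (us ! j)) * (h * K ^ (17 + 6 * j) * normn n w)"
      by (simp add: ac_simps)
    also have "\<dots> \<le> C * (h * K ^ (17 + 6 * j) * normn n w)"
      using c[OF j] h K by (intro mult_right_mono mult_nonneg_nonneg zero_le_power normn_nonneg) auto
    finally show "\<bar>c (us ! j) * dotn n (us ! j) w\<bar> \<le> C * (h * K ^ (17 + 6 * j)) * normn n w"
      by (simp add: ac_simps)
  qed
  also have "\<dots> = C * (\<Sum>j<length us. h * K ^ (17 + 6 * j)) * normn n w"
    by (simp add: sum_distrib_left sum_distrib_right)
  finally show ?thesis .
qed

text \<open>The residual inherits the test error of \<open>t\<close> and, through the components
  removed, the relative errors of the earlier vectors with weights of at most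
  \<open>normn n t\<close>. Division by its own norm, which \<open>thr\<close> keeps away from zero,
  gives the new relative error.\<close>

lemma accurate_snoc:
  assumes acc: "accurate us" and t: "nearly_normal (4 * n * \<theta>) t" "normn n t \<le> K\<^sup>2 * h"
    and u: "thr \<le> dotn n (resid n us t) (resid n us t)"
  shows "accurate (us @ [resid n us t])"
proof -
  let ?u = "resid n us t" and ?r = "length us"
  have o: "orthogonal_list n us" using acc by (simp add: accurate_def)
  have "(h / K\<^sup>2)\<^sup>2 \<le> (normn n ?u)\<^sup>2" using u by (simp add: thr dotn_self)
  then have nu: "h / K\<^sup>2 \<le> normn n ?u" using normn_nonneg by (rule power2_le_imp_le)
  have K0: "0 < K" using K by simp
  have "\<bar>dotn n ?u w\<bar> \<le> h * K ^ (17 + 6 * ?r) * normn n ?u * normn n w" if w: "invariant_dir w" for w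
  proof -
    have pos: "0 < dotn n v v" if "v \<in> set us" for v using o that by (auto simp: orthogonal_list_def)
    have c: "\<bar>dotn n t v / dotn n v v\<bar> * normn n v \<le> K\<^sup>2 * h" if "v \<in> set us" for v
    proof -
      have v: "0 < normn n v" using pos[OF that] normn_nonneg[of v n] by (auto simp: dotn_self less_le)
      have "\<bar>dotn n t v / dotn n v v\<bar> * normn n v = \<bar>dotn n t v\<bar> / normn n v"
        using v by (simp add: dotn_self power2_eq_square)
      also have "\<dots> \<le> normn n t * normn n v / normn n v"
        using v dotn_le_normn by (intro divide_right_mono) auto
      also have "\<dots> \<le> K\<^sup>2 * h" using v t(2) by simp
      finally show ?thesis .
    qed
    have "dotn n ?u w = dotn n t w - (\<Sum>v\<leftarrow>us. dotn n t v / dotn n v v * dotn n v w)"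
      by (simp add: resid_eq[OF o] dotn_diff_left dotn_sum_list_left del: times_divide_eq_left)
    also have "\<bar>\<dots>\<bar> \<le> \<bar>dotn n t w\<bar> + \<bar>\<Sum>v\<leftarrow>us. dotn n t v / dotn n v v * dotn n v w\<bar>" by simp
    also have "\<dots> \<le> 4 * n * \<theta> * normn n w + (K\<^sup>2 * h) * (\<Sum>j<?r. h * K ^ (17 + 6 * j)) * normn n w"
      using t(1) w accurate_dotn_bound[OF acc w, of "\<lambda>v. dotn n t v / dotn n v v" "K\<^sup>2 * h"] c
      by (intro add_mono) (auto simp: nearly_normal_def)
    also have "\<dots> \<le> (K * \<theta> + K\<^sup>2 * h * (\<Sum>j<?r. h * K ^ (17 + 6 * j))) * normn n w"
      using K theta_pos normn_nonneg[of w n]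
      by (simp add: distrib_right mult_right_mono)
    also have "\<dots> = (h / K\<^sup>2) * (h * K ^ 17 * (1 + K ^ 4 * (\<Sum>j<?r. K ^ (6 * j)))) * normn n w"
    proof -
      have S: "(\<Sum>j<?r. h * K ^ (17 + 6 * j)) = h * K ^ 17 * (\<Sum>j<?r. K ^ (6 * j))"
        by (simp add: power_add sum_distrib_left mult.assoc)
      have "K ^ 15 = K ^ 17 / K\<^sup>2" using power_diff[of K 2 17] K0 by simp
      then have "h / K\<^sup>2 * (h * K ^ 17 * (1 + K ^ 4 * y)) = h\<^sup>2 * K ^ 15 * (1 + K ^ 4 * y)" for y
        by (simp add: power2_eq_square)
      also have "h\<^sup>2 * K ^ 15 * (1 + K ^ 4 * y) = K * \<theta> + K\<^sup>2 * h * (h * K ^ 17 * y)" for y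
        by (simp add: th distrib_left) (simp add: power2_eq_square eval_nat_numeral)
      finally show ?thesis unfolding S by simp
    qed
    also have "\<dots> \<le> normn n ?u * (h * K ^ 17 * K ^ (6 * ?r)) * normn n w"
      using nu geometric_bound[of ?r] h K0
      by (intro mult_right_mono mult_mono mult_left_mono mult_nonneg_nonneg normn_nonneg add_nonneg_nonneg sum_nonneg) auto
    finally show ?thesis by (simp add: power_add ac_simps)
  qed
  then have "nearly_normal (h * K ^ (17 + 6 * ?r) * normn n ?u) ?u"
    by (simp add: nearly_normal_def)
  moreover have "orthogonal_list n (us @ [?u])"
    using orthogonal_list_snoc[OF o] u thr_pos by simp
  ultimately show ?thesis
    using acc by (auto simp: accurate_def nth_append less_Suc_eq)
qed

text \<open>By orthogonality no summand \<open>c u * u\<close> is longer than \<open>x\<close>, so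
  cancellation within \<open>x\<close> cannot magnify the errors of the summands.\<close>

lemma accurate_span:
  fixes c :: "(nat \<Rightarrow> real) \<Rightarrow> real"
  assumes acc: "accurate us" and w: "invariant_dir w" and len: "length us = k"
  defines "x \<equiv> ( \<lambda>i. \<Sum>u\<leftarrow>us. c u * u i) :: nat \<Rightarrow> real"
  shows "\<bar>dotn n x w\<bar> \<le> h * K ^ (17 + 6 * k) * normn n x * normn n w"
proof -
  have o: "orthogonal_list n us" using acc by (simp add: accurate_def)
  have c: "\<bar>c u\<bar> * normn n u \<le> normn n x" if "u \<in> set us" for u
  proof -
    have u: "0 < normn n u"
      using o that normn_nonneg[of u n] by (auto simp: orthogonal_list_def dotn_self less_le)
    have "dotn n x u = c u * dotn n u u"
      unfolding x_def using dotn_sum_list_orthogonal[OF o that] by (simp add: dotn_sum_list_left)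
    then have "\<bar>c u\<bar> * normn n u * normn n u \<le> normn n x * normn n u"
      using dotn_le_normn[of n x u] by (simp add: dotn_self power2_eq_square abs_mult mult.assoc)
    then show ?thesis using u by simp
  qed
  have K1: "1 \<le> K" using K by simp
  have "\<bar>dotn n x w\<bar> \<le> normn n x * (\<Sum>j<k. h * K ^ (17 + 6 * j)) * normn n w"
    using accurate_dotn_bound[OF acc w, of c "normn n x"] c[OF nth_mem] unfolding len
    by (simp add: x_def dotn_sum_list_left)
  also have "(\<Sum>j<k. h * K ^ (17 + 6 * j)) = h * K ^ 17 * (\<Sum>j<k. K ^ (6 * j))"
    by (simp add: power_add sum_distrib_left mult.assoc)
  also have "normn n x * (h * K ^ 17 * (\<Sum>j<k. K ^ (6 * j))) * normn n w
      \<le> normn n x * (h * K ^ 17 * K ^ (6 * k)) * normn n w"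
  proof (intro mult_left_mono mult_right_mono normn_nonneg)
    have "(\<Sum>j<k. K ^ (6 * j)) \<le> K ^ 4 * (\<Sum>j<k. K ^ (6 * j))"
      using K1 mult_right_mono[of 1 "K ^ 4" "\<Sum>j<k. K ^ (6 * j)"] by (simp add: sum_nonneg)
    then show "(\<Sum>j<k. K ^ (6 * j)) \<le> K ^ (6 * k)" using geometric_bound[of k] by simp
  qed (use h K1 in auto)
  finally show ?thesis by (simp add: power_add ac_simps)
qed

end

section \<open>Acceptance of transversal crossings\<close>

context search_scale begin

text \<open>A deterministic statement: on a tape of bounded norm whose direction crosses
  transversally, the bisections and the tests behave as they would for the linearisation of
  \<open>F\<close> at the crossing, since the Taylor errors are small against
  \<open>\<theta>\<close> times the derivative.\<close>

lemma extend_accepts: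
  fixes F :: "(nat \<Rightarrow> real) \<Rightarrow> real" and a :: "(nat \<Rightarrow> real) \<Rightarrow> nat \<Rightarrow> real"
  assumes M: "\<And>f. M f \<longleftrightarrow> 1 \<le> F f" and F0: "F (\<lambda>_. 0) < 1"
    and taylor: "\<And>x z. \<bar>F (\<lambda>i. x i + z i) - F x - dotn n (a x) z\<bar> \<le> K\<^sup>2 * (normn n z)\<^sup>2"
    and grad: "\<And>x z. \<bar>dotn n (a x) z\<bar> \<le> X * normn n z" and X: "0 \<le> X" "X \<le> K" "2 * X \<le> K * \<eta>"
    and \<eta>: "0 < \<eta>" "1 \<le> K * \<eta>" and us: "orthogonal_list n us"
    and \<omega>: "normn n \<omega> \<le> K" "\<And>j. j < m \<Longrightarrow> normn n (\<lambda>i. \<omega> (n + (j * n + i))) \<le> K"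
    and start: "1 \<le> F (resid n us \<omega>)"
    and steep: "\<And>c. 0 < c \<Longrightarrow> F (\<lambda>i. c * resid n us \<omega> i) = 1 \<Longrightarrow>
      \<eta> \<le> \<bar>dotn n (a (\<lambda>i. c * resid n us \<omega> i)) (resid n us \<omega>)\<bar>"
  shows "extend us \<omega> \<noteq> us"
proof -
  define g where "g = resid n us \<omega>"
  define c where "c = crossing g"
  define t where "t = candidate g"
  \<comment> \<open>The resolution \<open>(1 / 2) ^ b\<close> of the bisection along
    \<open>g\<close>; that of the candidate entries is no coarser.\<close>
  define \<tau> where "\<tau> = h\<^sup>2"
  have K0: "0 < K" "1 \<le> K" using K by auto
  have gK: "normn n g \<le> K" unfolding g_def using normn_resid_le[OF us] \<omega>(1) by (rule order_trans)
  have h1: "h \<le> 1" using h_powers[of 0] by simp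
  have \<tau>: "0 < \<tau>" "\<tau> \<le> h" using h h1 by (auto simp: \<tau>_def power2_eq_square mult_le_one intro: mult_left_le)
  have start': "1 \<le> F g" using start by (simp add: g_def)
  have bracket0: "\<not> M (\<lambda>i. c * g i) \<and> M (\<lambda>i. (c + \<tau>) * g i)" "0 \<le> c"
  proof -
    let ?P = "ask (\<lambda>_. 0) (\<lambda>_. 0) g"
    have P: "?P s = M (\<lambda>i. s * g i)" for s by (simp add: ask_def)
    have "\<not> ?P 0" "?P (0 + 1)" using F0 start' by (auto simp: P M)
    from bisect_bracket[of ?P, OF this, of b] show "\<not> M (\<lambda>i. c * g i) \<and> M (\<lambda>i. (c + \<tau>) * g i)"
      using b by (simp add: P c_def crossing_def \<tau>_def power_one_over)
    show "0 \<le> c" using bisect_bounds[of 1 0 ?P b] by (simp add: c_def crossing_def)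
  qed
  define f where "f = (\<lambda>c. F (\<lambda>i. c * g i))"
  have line: "\<bar>f (x + s) - f x - dotn n (a (\<lambda>i. x * g i)) g * s\<bar> \<le> (K\<^sup>2 * (normn n g)\<^sup>2) * s\<^sup>2" for x s
    using taylor[of "\<lambda>i. x * g i" "\<lambda>i. s * g i"]
    by (simp add: f_def dotn_scale_right normn_scale power_mult_distrib algebra_simps)
  have "continuous_on UNIV f"
    using derivative_from_quadratic_bound[OF line] DERIV_isCont
    by (intro continuous_at_imp_continuous_on) blast
  then have "continuous_on {c..c + \<tau>} f" by (rule continuous_on_subset) simp
  moreover have fc: "f c < 1" "1 \<le> f (c + \<tau>)" using bracket0 by (auto simp: M f_def)
  \<comment> \<open>Assumption \<open>steep\<close> speaks of exact level points, so an exact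
    crossing in the bracket takes the place of the computed \<open>c\<close>.\<close>
  ultimately obtain x where x: "c \<le> x" "x \<le> c + \<tau>" "f x = 1"
    using IVT'[of f c 1 "c + \<tau>"] \<tau> by auto
  have "f 0 < 1" using F0 by (simp add: f_def)
  with x bracket0(2) have x0: "0 < x" by (cases "x = 0") auto
  define A where "A = a (\<lambda>i. x * g i)"
  define D where "D = dotn n A g"
  have absD: "\<eta> \<le> \<bar>D\<bar>" using steep[of x] x0 x(3) by (simp add: f_def g_def A_def D_def)
  have DK: "\<bar>D\<bar> \<le> K\<^sup>2"
    using grad[of "\<lambda>i. x * g i" g] mult_mono[OF X(2) gK] K0 normn_nonneg[of g n]
    by (simp add: A_def D_def power2_eq_square)
  have line_x: "\<bar>f (x + s) - 1 - D * s\<bar> \<le> K ^ 4 * s\<^sup>2" for s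
  proof -
    have "K\<^sup>2 * (normn n g)\<^sup>2 \<le> K\<^sup>2 * K\<^sup>2"
      using gK normn_nonneg[of g n] by (intro mult_left_mono power_mono) auto
    then have "(K\<^sup>2 * (normn n g)\<^sup>2) * s\<^sup>2 \<le> K ^ 4 * s\<^sup>2"
      by (intro mult_right_mono) (auto simp: eval_nat_numeral)
    with line[of x s] show ?thesis by (simp add: A_def D_def x(3))
  qed
  \<comment> \<open>Within the resolution the linear term wins because
    \<open>h * K ^ 5 < 1 \<le> K * \<eta>\<close>.\<close>
  have small: "K ^ 4 * s\<^sup>2 < \<eta> * s" if "0 < s" "s \<le> \<tau>" for s
  proof -
    have "K ^ 4 * s * K \<le> K ^ 4 * h * K" using that \<tau> K0 by (intro mult_right_mono mult_left_mono) auto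
    also have "\<dots> = h * K ^ 5" by (simp add: eval_nat_numeral)
    also have "\<dots> < 1" using h_powers64[of 5] h K0 by (simp add: zero_less_mult_iff)
    also have "1 \<le> \<eta> * K" using \<eta> by (simp add: mult.commute)
    finally have "K ^ 4 * s < \<eta>" using K0 by simp
    then show ?thesis using that by (simp add: power2_eq_square flip: mult.assoc)
  qed
  \<comment> \<open>The bracket passes from false to true. A negative derivative at \<open>x\<close>
    would contradict the value at its right end or, if \<open>x\<close> is that end, the value at
    its left end.\<close>
  have D: "\<eta> \<le> D"
  proof (rule ccontr)
    assume "\<not> \<eta> \<le> D"
    then have neg: "D \<le> - \<eta>" using absD by linarith
    have "x = c + \<tau>"
    proof (rule ccontr)
      assume "x \<noteq> c + \<tau>"
      then have s: "0 < c + \<tau> - x" "c + \<tau> - x \<le> \<tau>" using x by auto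
      have "D * (c + \<tau> - x) \<le> - \<eta> * (c + \<tau> - x)" using neg s by (intro mult_right_mono) auto
      with line_x[of "c + \<tau> - x"] fc(2) small[OF s] show False by simp
    qed
    then have "f (x + - \<tau>) < 1" using fc(1) by simp
    moreover have "\<eta> * \<tau> \<le> D * - \<tau>" using neg \<tau> mult_right_mono[of \<eta> "- D" \<tau>] by simp
    ultimately show False using line_x[of "- \<tau>"] small[of \<tau>] \<tau> by simp
  qed
  \<comment> \<open>For the offset \<open>unit_fn i\<close> and \<open>s\<close> up to
    \<open>T\<^sub>0\<close> the displacement is at most \<open>3 * (h * K\<^sup>2)\<close>;
    \<open>E\<close> is \<open>K\<^sup>2\<close> times the square of this.\<close>
  define E where "E = 9 * K ^ 6 * h\<^sup>2"
  \<comment> \<open>Queries start from \<open>c * g\<close> but the expansion is taken at the exact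
    crossing, hence the shift \<open>c - x\<close>, of size at most \<open>\<tau>\<close>.\<close>
  have expansion: "\<bar>F (\<lambda>i. c * g i + h * z i + s * g i) - 1 - ((c - x + s) * D + h * dotn n A z)\<bar>
      \<le> K\<^sup>2 * ((\<tau> + \<bar>s\<bar>) * K + h * normn n z)\<^sup>2" for z s
  proof -
    let ?z = "\<lambda>i. (c - x + s) * g i + h * z i"
    have "(\<lambda>i. c * g i + h * z i + s * g i) = (\<lambda>i. x * g i + ?z i)" by (simp add: algebra_simps)
    moreover have "dotn n A ?z = (c - x + s) * D + h * dotn n A z" by (simp add: dotn_right D_def)
    moreover have "normn n ?z \<le> (\<tau> + \<bar>s\<bar>) * K + h * normn n z"
    proof -
      have "normn n ?z \<le> normn n (\<lambda>i. (c - x + s) * g i) + normn n (\<lambda>i. h * z i)"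
        by (rule L2_set_triangle_ineq)
      also have "\<dots> = \<bar>c - x + s\<bar> * normn n g + h * normn n z" using h by (simp add: normn_scale)
      also have "\<dots> \<le> (\<tau> + \<bar>s\<bar>) * K + h * normn n z"
        using x gK normn_nonneg[of g n] by (intro add_right_mono mult_mono) auto
      finally show ?thesis .
    qed
    then have "K\<^sup>2 * (normn n ?z)\<^sup>2 \<le> K\<^sup>2 * ((\<tau> + \<bar>s\<bar>) * K + h * normn n z)\<^sup>2"
      by (intro mult_left_mono power_mono normn_nonneg) auto
    ultimately show ?thesis
      using taylor[of "\<lambda>i. x * g i" ?z] x(3) by (simp add: f_def A_def)
  qed
  have ask: "ask (base_point g) z g s \<longleftrightarrow> 1 \<le> F (\<lambda>i. c * g i + h * z i + s * g i)" for z s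
    by (simp add: ask_def base_point_def M c_def)
  \<comment> \<open>Up to the resolution, a lower bound for the first-order term at the ends of the
    search interval. The offset contributes at most \<open>q / 2\<close>; the other half leaves room
    for the errors.\<close>
  define q where "q = K * h * \<eta>"
  have q: "h \<le> q" "2 * (h * X) \<le> q" "64 * (h * \<eta>) \<le> q" "T\<^sub>0 * \<eta> = q"
  proof -
    have "h * 1 \<le> h * (K * \<eta>)" using h \<eta> by (intro mult_left_mono) auto
    then show "h \<le> q" by (simp add: q_def ac_simps)
    have "h * (2 * X) \<le> h * (K * \<eta>)" using h X by (intro mult_left_mono) auto
    then show "2 * (h * X) \<le> q" by (simp add: q_def ac_simps)
    have "64 * (h * \<eta>) \<le> K * (h * \<eta>)" using K h \<eta> by (intro mult_right_mono) auto
    then show "64 * (h * \<eta>) \<le> q" by (simp add: q_def ac_simps)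
  qed (simp add: q_def T0)
  have T: "h \<le> T\<^sub>0" "0 < T\<^sub>0" "2 * T\<^sub>0 \<le> 1"
    using K0 h h_powers64[of 1] mult_right_mono[of 1 K h] by (auto simp: T0 ac_simps)
  have E: "4 * E \<le> h" "0 \<le> E"
  proof -
    have "4 * E = h * (36 * (h * K ^ 6))" by (simp add: E_def power2_eq_square)
    also have "\<dots> \<le> h * 1" using h_powers64[of 6] h K0 by (intro mult_left_mono) auto
    finally show "4 * E \<le> h" by simp
  qed (simp add: E_def)
  have \<tau>K: "\<tau> * K\<^sup>2 \<le> E"
  proof -
    have "\<tau> * K\<^sup>2 \<le> h\<^sup>2 * K ^ 6" unfolding \<tau>_def using K_powers[of 2 6] by (intro mult_left_mono) auto
    also have "\<dots> \<le> E" by (simp add: E_def)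
    finally show ?thesis .
  qed
  \<comment> \<open>Thus \<open>t\<close> is close to \<open>- h / D\<close> times the gradient. One
    \<open>E\<close> is the Taylor error, the other covers the resolutions of the two
    bisections.\<close>
  have t: "\<bar>t i * D + h * A i\<bar> \<le> 2 * E" if i: "i < n" for i
  proof -
    let ?P = "ask (base_point g) (unit_fn i) g"
    have ti: "t i = bisect ?P b (- T\<^sub>0) (2 * T\<^sub>0)" using i by (simp add: t_def candidate_def)
    have Ai: "\<bar>h * A i\<bar> \<le> h * X"
      using grad[of "\<lambda>i. x * g i" "unit_fn i"] h i by (simp add: A_def dotn_unit normn_unit abs_mult)
    then have Ai2: "h * A i \<le> h * X" "- (h * X) \<le> h * A i" by linarith+
    have err: "\<bar>F (\<lambda>j. c * g j + h * unit_fn i j + s * g j) - 1 - ((c - x + s) * D + h * A i)\<bar> \<le> E"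
      if s: "\<bar>s\<bar> \<le> T\<^sub>0" for s
    proof -
      have "(\<tau> + \<bar>s\<bar>) * K + h * 1 \<le> (h + K * h) * K + h * 1"
        using s \<tau> K0 by (intro add_right_mono mult_right_mono add_mono) (auto simp: T0)
      also have "\<dots> = h * K + h * K\<^sup>2 + h" by (simp add: power2_eq_square algebra_simps)
      also have "\<dots> \<le> 3 * (h * K\<^sup>2)"
      proof -
        have "h * K ^ 1 \<le> h * K\<^sup>2" "h * K ^ 0 \<le> h * K\<^sup>2"
          using h by (intro mult_left_mono K_powers; simp)+
        then show ?thesis by simp
      qed
      finally have "((\<tau> + \<bar>s\<bar>) * K + h * 1)\<^sup>2 \<le> (3 * (h * K\<^sup>2))\<^sup>2"
        using \<tau> K0 h by (intro power_mono add_nonneg_nonneg mult_nonneg_nonneg) auto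
      then have "K\<^sup>2 * ((\<tau> + \<bar>s\<bar>) * K + h * 1)\<^sup>2 \<le> K\<^sup>2 * (3 * (h * K\<^sup>2))\<^sup>2"
        by (intro mult_left_mono) auto
      also have "\<dots> = E" by (simp add: E_def power2_eq_square eval_nat_numeral)
      finally show ?thesis
        using expansion[of "unit_fn i" s] i by (simp add: dotn_unit normn_unit)
    qed
    have hi: "(T\<^sub>0 - \<tau>) * \<eta> \<le> (c - x + T\<^sub>0) * D"
      using x \<eta> D T \<tau> by (intro mult_mono) auto
    have lo: "(c - x - T\<^sub>0) * D \<le> - (T\<^sub>0 * \<eta>)"
      using mult_mono[of T\<^sub>0 "x - c + T\<^sub>0" \<eta> D] x \<eta> D T by (simp add: algebra_simps)
    have \<tau>\<eta>: "64 * (\<tau> * \<eta>) \<le> q"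
      using mult_right_mono[OF \<tau>(2) less_imp_le[OF \<eta>(1)]] q(3) by linarith
    have "?P (- T\<^sub>0 + 2 * T\<^sub>0)"
      using err[of T\<^sub>0] hi Ai2 q E T \<tau>\<eta> h by (simp add: ask left_diff_distrib abs_le_iff)
    moreover have "\<not> ?P (- T\<^sub>0)"
    proof -
      have a: "\<bar>- T\<^sub>0\<bar> \<le> T\<^sub>0" using T by simp
      have e: "c - x + - T\<^sub>0 = c - x - T\<^sub>0" by simp
      show ?thesis
        using err[OF a, unfolded e] lo Ai2 q E h unfolding ask by linarith
    qed
    ultimately have br: "\<not> ?P (t i)" "?P (t i + 2 * T\<^sub>0 / 2 ^ b)"
      using bisect_bracket[of ?P "- T\<^sub>0" "2 * T\<^sub>0" b] by (auto simp: ti)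
    have \<delta>: "0 \<le> 2 * T\<^sub>0 / 2 ^ b" "2 * T\<^sub>0 / 2 ^ b \<le> \<tau>"
      using T b mult_right_mono[OF T(3), of "h\<^sup>2"] by (auto simp: \<tau>_def power_one_over field_simps)
    have ti2: "- T\<^sub>0 \<le> t i" "t i + 2 * T\<^sub>0 / 2 ^ b \<le> T\<^sub>0"
      using bisect_bounds[of "2 * T\<^sub>0" "- T\<^sub>0" ?P b] T by (auto simp: ti)
    have abs1: "\<bar>t i\<bar> \<le> T\<^sub>0" "\<bar>t i + 2 * T\<^sub>0 / 2 ^ b\<bar> \<le> T\<^sub>0" using ti2 \<delta> by linarith+
    have "(c - x + t i) * D + h * A i < E"
      using err[OF abs1(1)] br(1) by (simp add: ask abs_le_iff)
    moreover have "- E \<le> (c - x + (t i + 2 * T\<^sub>0 / 2 ^ b)) * D + h * A i"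
      using err[OF abs1(2)] br(2) by (simp add: ask abs_le_iff)
    moreover have "0 \<le> (x - c) * D" "(x - c) * D \<le> E" "2 * T\<^sub>0 / 2 ^ b * D \<le> E"
    proof -
      have "(x - c) * D \<le> \<tau> * K\<^sup>2" using x \<tau> \<eta> D DK by (intro mult_mono) auto
      then show "(x - c) * D \<le> E" using \<tau>K by simp
      have "2 * T\<^sub>0 / 2 ^ b * D \<le> \<tau> * K\<^sup>2" using \<delta> \<tau> \<eta> D DK by (intro mult_mono) auto
      then show "2 * T\<^sub>0 / 2 ^ b * D \<le> E" using \<tau>K by simp
    qed (use x \<eta> D in auto)
    ultimately show ?thesis by (simp add: distrib_right left_diff_distrib abs_le_iff)
  qed
  have error_sum: "\<bar>(\<Sum>i<n. y i * (t i * D + h * A i))\<bar> \<le> 2 * K\<^sup>2 * E" if y: "normn n y \<le> K" for y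
  proof -
    have "\<bar>(\<Sum>i<n. y i * (t i * D + h * A i))\<bar> \<le> (\<Sum>i<n. K * (2 * E))"
    proof (rule order_trans[OF sum_abs], rule sum_mono)
      fix i assume "i \<in> {..<n}"
      then show "\<bar>y i * (t i * D + h * A i)\<bar> \<le> K * (2 * E)"
        unfolding abs_mult using t[of i] abs_le_normn[of i n y] y K0
        by (intro mult_mono) auto
    qed
    also have "\<dots> = n * (2 * K * E)" by simp
    also have "\<dots> \<le> K * (2 * K * E)" using K E K0 by (intro mult_right_mono) auto
    finally show ?thesis by (simp add: power2_eq_square ac_simps)
  qed
  have combine: "(\<Sum>i<n. y i * (t i * D + h * A i)) = dotn n y t * D + h * dotn n A y" for y
    by (simp add: dotn_def sum.distrib sum_distrib_left sum_distrib_right algebra_simps)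
  have tn: "normn n t \<le> K\<^sup>2 * h" unfolding t_def by (rule normn_candidate)
  have tests: "passes_test (base_point g) t g \<zeta>" if z: "normn n \<zeta> \<le> K" for \<zeta>
  proof -
    have th1: "\<theta> \<le> h" "0 < \<theta>"
      using mult_left_mono[OF h_powers[of 14], of h] h theta_pos by (auto simp: th power2_eq_square ac_simps)
    have dz: "\<bar>dotn n \<zeta> t\<bar> \<le> K ^ 3 * h"
    proof -
      have "\<bar>dotn n \<zeta> t\<bar> \<le> normn n \<zeta> * normn n t" by (rule dotn_le_normn)
      also have "\<dots> \<le> K * (K\<^sup>2 * h)" using z tn K0 normn_nonneg[of t n] by (intro mult_mono) auto
      finally show ?thesis by (simp add: eval_nat_numeral ac_simps)
    qed
    \<comment> \<open>At the tested points \<open>s\<close> can be of order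
      \<open>K ^ 3 * h\<close>, so the term \<open>s * g\<close> dominates the displacement, which
      is at most \<open>4 * (h * K ^ 4)\<close>.\<close>
    have err: "\<bar>F (\<lambda>i. c * g i + h * \<zeta> i + s * g i) - 1 - ((c - x + s) * D + h * dotn n A \<zeta>)\<bar>
        \<le> 16 * K ^ 10 * h\<^sup>2" if s: "\<bar>s\<bar> \<le> K ^ 3 * h + \<theta>" for s
    proof -
      have "(\<tau> + \<bar>s\<bar>) * K + h * normn n \<zeta> \<le> (h + (K ^ 3 * h + h)) * K + h * K"
        using s \<tau> th1 z h K0 by (intro add_mono mult_right_mono mult_left_mono) auto
      also have "\<dots> = 3 * (h * K ^ 1) + h * K ^ 4" by (simp add: eval_nat_numeral algebra_simps)
      also have "\<dots> \<le> 4 * (h * K ^ 4)"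
        using mult_left_mono[OF K_powers[of 1 4], of h] h by simp
      finally have "((\<tau> + \<bar>s\<bar>) * K + h * normn n \<zeta>)\<^sup>2 \<le> (4 * (h * K ^ 4))\<^sup>2"
        using \<tau> K0 h normn_nonneg[of \<zeta> n] by (intro power_mono add_nonneg_nonneg mult_nonneg_nonneg) auto
      then have "K\<^sup>2 * ((\<tau> + \<bar>s\<bar>) * K + h * normn n \<zeta>)\<^sup>2 \<le> K\<^sup>2 * (4 * (h * K ^ 4))\<^sup>2"
        by (intro mult_left_mono) auto
      also have "\<dots> = 16 * K ^ 10 * h\<^sup>2" by (simp add: power2_eq_square eval_nat_numeral)
      finally show ?thesis using expansion[of \<zeta> s] by simp
    qed
    have sum_bound: "\<bar>dotn n \<zeta> t * D + h * dotn n A \<zeta>\<bar> \<le> 2 * K\<^sup>2 * E"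
      using error_sum[OF z] by (simp add: combine)
    have xc: "0 \<le> (x - c) * D" "(x - c) * D \<le> E"
    proof -
      have "(x - c) * D \<le> \<tau> * K\<^sup>2" using x \<tau> \<eta> D DK by (intro mult_mono) auto
      then show "(x - c) * D \<le> E" using \<tau>K by simp
    qed (use x \<eta> D in auto)
    \<comment> \<open>Moving \<open>s\<close> by \<open>\<theta>\<close> changes the first-order
      term by at least \<open>64 * y\<close>, while the errors are at most \<open>9 * y\<close>,
      \<open>18 * y\<close> and \<open>16 * y\<close>.\<close>
    have margin: "E + 2 * K\<^sup>2 * E + 16 * K ^ 10 * h\<^sup>2 < \<theta> * D"
    proof -
      define y where "y = K ^ 10 * h\<^sup>2"
      have y: "0 < y" using K0 h by (simp add: y_def)
      have "E \<le> 9 * y" using K_powers[of 6 10] by (simp add: E_def y_def mult_right_mono)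
      moreover have "2 * K\<^sup>2 * E \<le> 18 * y"
      proof -
        have "2 * K\<^sup>2 * E = 18 * (K ^ 8 * h\<^sup>2)" by (simp add: E_def eval_nat_numeral)
        also have "\<dots> \<le> 18 * y" using K_powers[of 8 10] by (simp add: y_def mult_right_mono)
        finally show ?thesis .
      qed
      moreover have "64 * y \<le> \<theta> * D"
      proof -
        have "64 * y \<le> K ^ 3 * y" using K_powers[of 1 3] K y by (intro mult_right_mono) auto
        also have "\<dots> = K ^ 13 * h\<^sup>2 * 1" by (simp add: y_def eval_nat_numeral)
        also have "\<dots> \<le> K ^ 13 * h\<^sup>2 * (K * \<eta>)" using \<eta> K0 by (intro mult_left_mono) auto
        also have "\<dots> = \<theta> * \<eta>" by (simp add: th eval_nat_numeral)
        also have "\<dots> \<le> \<theta> * D" using D th1 by (intro mult_left_mono) auto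
        finally show ?thesis .
      qed
      moreover have "16 * K ^ 10 * h\<^sup>2 = 16 * y" by (simp add: y_def)
      ultimately show ?thesis using y by linarith
    qed
    have s1: "\<bar>dotn n \<zeta> t + \<theta>\<bar> \<le> K ^ 3 * h + \<theta>" "\<bar>dotn n \<zeta> t - \<theta>\<bar> \<le> K ^ 3 * h + \<theta>"
      using dz th1 by linarith+
    show ?thesis
      using err[OF s1(1)] err[OF s1(2)] sum_bound xc margin
      by (simp add: passes_test_def ask abs_le_iff distrib_right left_diff_distrib)
  qed
  \<comment> \<open>As \<open>g\<close> is orthogonal to the earlier vectors, \<open>u\<close> and
    \<open>t\<close> have the same inner product with it. This is about \<open>- h\<close>, because
    \<open>t\<close> is about \<open>- h / D\<close> times the gradient and \<open>D\<close> is the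
    gradient along \<open>g\<close>. Since \<open>g\<close> has norm at most \<open>K\<close>,
    \<open>u\<close> cannot be short.\<close>
  have size: "thr \<le> dotn n (resid n us t) (resid n us t)"
  proof -
    let ?u = "resid n us t"
    have ug: "dotn n ?u g = dotn n t g"
      unfolding g_def using resid_orthogonal'[OF us] by (intro resid_dotn[OF us]) auto
    have "\<bar>dotn n g t * D + h * D\<bar> \<le> 2 * K\<^sup>2 * E"
      using error_sum[OF gK] by (simp only: combine D_def[symmetric])
    then have "(h + dotn n g t) * D \<le> 2 * K\<^sup>2 * E" by (simp add: algebra_simps abs_le_iff)
    also have "\<dots> \<le> h / 2 * \<eta>"
    proof -
      have "2 * K\<^sup>2 * E * 1 \<le> 2 * K\<^sup>2 * E * (K * \<eta>)" using \<eta> E by (intro mult_left_mono) auto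
      also have "\<dots> = h * \<eta> * (18 * (h * K ^ 9))" by (simp add: E_def power2_eq_square eval_nat_numeral)
      also have "\<dots> \<le> h * \<eta> * (1 / 2)" using h_powers64[of 9] h \<eta> by (intro mult_left_mono) auto
      finally show ?thesis by simp
    qed
    also have "\<dots> \<le> h / 2 * D" using D h by (intro mult_left_mono) auto
    finally have "h / 2 \<le> - dotn n t g" using D \<eta> by (simp add: dotn_commute)
    then have "h / 2 \<le> normn n ?u * normn n g" using dotn_le_normn[of n ?u g] ug by simp
    also have "\<dots> \<le> normn n ?u * K" using gK normn_nonneg by (intro mult_left_mono) auto
    finally have "h \<le> normn n ?u * (2 * K)" by simp
    also have "\<dots> \<le> normn n ?u * K\<^sup>2"
      using K normn_nonneg[of ?u n] by (intro mult_left_mono) (auto simp: power2_eq_square)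
    finally have "h / K\<^sup>2 \<le> normn n ?u" using K0 by (simp add: divide_le_eq)
    then show ?thesis unfolding thr dotn_self using h by (intro power_mono) auto
  qed
  have "passes_tests (base_point g) t g m (\<lambda>i. \<omega> (n + i))"
    using tests \<omega>(2) by (auto simp: passes_tests_def)
  with size show ?thesis
    by (simp add: extend_def g_def t_def Let_def)
qed

end

text \<open>The first-order condition at a maximiser of a quadratic form. At
  \<open>t = - a / d\<close> with \<open>d > c\<close> the quadratic term cannot compensate a
  nonzero linear one.\<close>

lemma linear_coefficient_zero:
  fixes a c :: real
  assumes "\<And>t. 0 \<le> t * a + t\<^sup>2 * c"
  shows "a = 0"
proof (rule ccontr)
  assume "a \<noteq> 0"
  define d where "d = \<bar>c\<bar> + 1"
  have d: "0 < d" "c < d" by (auto simp: d_def)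
  have "0 \<le> (- a / d) * a + (- a / d)\<^sup>2 * c" by (rule assms)
  also have "\<dots> = (a / d)\<^sup>2 * (c - d)" using d by (simp add: power2_eq_square field_simps)
  also have "\<dots> < 0" using d \<open>a \<noteq> 0\<close> by (intro mult_pos_neg) auto
  finally show False by simp
qed

section \<open>Taylor estimates for networks\<close>

definition mat_app :: "nat \<Rightarrow> (nat \<Rightarrow> nat \<Rightarrow> real) \<Rightarrow> (nat \<Rightarrow> real) \<Rightarrow> nat \<Rightarrow> real" where
  "mat_app n G x i = dotn n (G i) x"

text \<open>Fixing the coordinates from \<open>n\<close> on to \<open>0\<close> makes the sphere of
  a dimension that is not a type a compact subset of the function space, by Tychonoff.\<close>

lemma compact_sphere:
  "compact {f::nat \<Rightarrow> real. f \<in> PiE UNIV (\<lambda>i. if i < n then {-1..1} else {0}) \<and> dotn n f f = 1}"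
proof -
  have "compactin (product_topology (\<lambda>_. euclidean) UNIV) (PiE UNIV (\<lambda>i::nat. if i < n then {-1..1::real} else {0}))"
    by (simp add: compactin_PiE)
  then have "compact (PiE UNIV (\<lambda>i::nat. if i < n then {-1..1::real} else {0}))"
    by (simp add: euclidean_product_topology)
  moreover have "closed {f::nat \<Rightarrow> real. dotn n f f = 1}"
    unfolding dotn_def
    by (intro closed_Collect_eq continuous_intros continuous_on_product_coordinates)
  ultimately have "compact (PiE UNIV (\<lambda>i::nat. if i < n then {-1..1::real} else {0}) \<inter> {f. dotn n f f = 1})"
    by (rule compact_Int_closed)
  then show ?thesis by (simp add: Int_def)
qed

text \<open>A maximiser of the quadratic form on the sphere is an eigenvector: perturbing it along
  each basis vector, the linear term has to vanish.\<close>

lemma symmetric_max_eigenvector: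
  assumes n: "0 < n" and sym: "\<And>i j. i < n \<Longrightarrow> j < n \<Longrightarrow> G i j = G j i"
  obtains e x where "dotn n x x = 1" "\<And>i. i < n \<Longrightarrow> mat_app n G x i = e * x i"
    "\<And>f. dotn n f (mat_app n G f) \<le> e * dotn n f f"
proof -
  let ?S = "{f::nat \<Rightarrow> real. f \<in> PiE UNIV (\<lambda>i. if i < n then {-1..1} else {0}) \<and> dotn n f f = 1}"
  let ?q = "\<lambda>f. dotn n f (mat_app n G f)"
  have "dotn n (unit_fn 0) (unit_fn 0) = 1"
    using n by (simp add: dotn_def unit_fn_def if_distrib cong: if_cong)
  then have "unit_fn 0 \<in> ?S"
    using n by (auto simp: unit_fn_def)
  then have "?S \<noteq> {}" by blast
  moreover have "continuous_on ?S ?q"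
    unfolding dotn_def mat_app_def
    by (intro continuous_intros continuous_on_subset[OF continuous_on_product_coordinates subset_UNIV])
  ultimately obtain x where x: "x \<in> ?S" "\<And>y. y \<in> ?S \<Longrightarrow> ?q y \<le> ?q x"
    using continuous_attains_sup[OF compact_sphere, of n ?q] by blast
  define e where "e = ?q x"
  have app_scale: "mat_app n G (\<lambda>i. c * f i) = (\<lambda>i. c * mat_app n G f i)" for c f
    by (simp add: mat_app_def fun_eq_iff dotn_right)
  have app_add: "mat_app n G (\<lambda>i. f i + g i) = (\<lambda>i. mat_app n G f i + mat_app n G g i)" for f g
    by (simp add: mat_app_def fun_eq_iff dotn_right)
  have app_cong: "mat_app n G f = mat_app n G g" if "\<And>i. i < n \<Longrightarrow> f i = g i" for f g
    using that by (auto simp: mat_app_def fun_eq_iff intro!: dotn_cong)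
  have le: "?q f \<le> e * dotn n f f" for f
  proof (cases "dotn n f f = 0")
    case True
    then have "\<forall>i<n. f i = 0" by (simp add: dotn_def sum_nonneg_eq_0_iff)
    then show ?thesis by (simp add: dotn_def)
  next
    case False
    define c where "c = normn n f"
    have c: "0 < c" "dotn n f f = c\<^sup>2"
      using False normn_nonneg[of f n] by (auto simp: c_def dotn_self less_le)
    define y where "y = (\<lambda>i. if i < n then f i / c else 0)"
    have yf: "f i = c * y i" if "i < n" for i using that c by (simp add: y_def)
    have "dotn n f f = dotn n (\<lambda>i. c * y i) (\<lambda>i. c * y i)" by (intro dotn_cong yf)
    then have "dotn n y y = 1" using c by (simp add: dotn_left dotn_right power2_eq_square)
    moreover have "\<bar>f i\<bar> \<le> c" if "i < n" for i using abs_le_normn[OF that] by (simp add: c_def)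
    then have "- c \<le> f i \<and> f i \<le> c" if "i < n" for i using that by (simp add: abs_le_iff minus_le_iff)
    ultimately have "y \<in> ?S"
      using c by (auto simp: y_def abs_le_iff divide_le_eq le_divide_eq)
    then have "?q y \<le> e" unfolding e_def by (rule x(2))
    moreover have "?q f = c\<^sup>2 * ?q y"
    proof -
      have "mat_app n G f = mat_app n G (\<lambda>i. c * y i)" by (intro app_cong yf)
      then have "?q f = dotn n (\<lambda>i. c * y i) (\<lambda>i. c * mat_app n G y i)"
        unfolding app_scale by (intro dotn_cong) (auto simp: yf)
      then show ?thesis by (simp add: dotn_left dotn_right power2_eq_square)
    qed
    ultimately show ?thesis using c by (simp add: mult.commute mult_left_mono)
  qed
  have "mat_app n G x i = e * x i" if i: "i < n" for i
  proof -
    let ?u = "unit_fn i"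
    have ux: "dotn n ?u f = f i" for f
      using i by (simp add: dotn_def unit_fn_def if_distrib[of "\<lambda>y. y * _"] cong: if_cong)
    have xGu: "dotn n x (mat_app n G ?u) = mat_app n G x i"
    proof -
      have "mat_app n G ?u j = G j i" for j
        using ux[of "G j"] by (simp add: mat_app_def dotn_commute)
      then show ?thesis
        using sym i by (auto simp: mat_app_def dotn_def mult.commute intro!: sum.cong)
    qed
    have "0 \<le> t * (2 * (e * x i - mat_app n G x i)) + t\<^sup>2 * (e * dotn n ?u ?u - ?q ?u)" for t
    proof -
      have "0 \<le> e * dotn n (\<lambda>j. x j + t * ?u j) (\<lambda>j. x j + t * ?u j) - ?q (\<lambda>j. x j + t * ?u j)"
        using le by simp
      also have "\<dots> = t * (2 * (e * x i - mat_app n G x i)) + t\<^sup>2 * (e * dotn n ?u ?u - ?q ?u)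
          + (e * dotn n x x - ?q x)"
        by (simp add: app_add app_scale dotn_left dotn_right ux xGu dotn_commute[of n x ?u]
            power2_eq_square algebra_simps)
      also have "e * dotn n x x - ?q x = 0" using x(1) by (simp add: e_def)
      finally show ?thesis by simp
    qed
    from linear_coefficient_zero[OF this] show ?thesis by simp
  qed
  with x(1) le show ?thesis by (intro that[of x e]) auto
qed

text \<open>The largest eigenvalue of the smaller Gram matrix bounds its quadratic form, and the
  root of this eigenvalue is a singular value. If \<open>nr \<le> nc\<close> the form belongs to
  \<open>W * W\<^sup>T\<close>, so the transpose is bounded first and \<open>W\<close> by
  duality.\<close>

lemma operator_norm_bound:
  assumes W: "W \<in> carrier_mat nr nc" and sv: "\<And>s. s \<in> singular_values W \<Longrightarrow> s \<le> S" and S: "0 \<le> S"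
  shows "normn nr (\<lambda>i. dotn nc (\<lambda>j. W $$ (i, j)) v) \<le> S * normn nc v"
proof (cases "nr = 0 \<or> nc = 0")
  case True
  then have "normn nr (\<lambda>i. dotn nc (\<lambda>j. W $$ (i, j)) v) = 0" by (auto simp: L2_set_def dotn_def)
  then show ?thesis using S normn_nonneg[of v nc] by simp
next
  case False
  have bound: "dotn r f (mat_app r G f) \<le> S\<^sup>2 * dotn r f f"
    if r: "0 < r" "gram W = mat r r (\<lambda>(i, j). G i j)" and sym: "\<And>i j. G i j = G j i"
      and pos: "\<And>f. 0 \<le> dotn r f (mat_app r G f)" for r G f
  proof -
    obtain e x where x: "dotn r x x = 1" "\<And>i. i < r \<Longrightarrow> mat_app r G x i = e * x i"
      "\<And>f. dotn r f (mat_app r G f) \<le> e * dotn r f f"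
      by (rule symmetric_max_eigenvector[OF r(1), of G]) (rule sym, rule that)
    have "gram W *\<^sub>v vec r x = e \<cdot>\<^sub>v vec r x"
      unfolding r(2)
    proof (rule eq_vecI)
      fix i assume "i < dim_vec (e \<cdot>\<^sub>v vec r x)"
      then have i: "i < r" by simp
      have "(mat r r (\<lambda>(i, j). G i j) *\<^sub>v vec r x) $ i = mat_app r G x i"
        using i by (simp add: mat_app_def dotn_def scalar_prod_def atLeast0LessThan)
      then show "(mat r r (\<lambda>(i, j). G i j) *\<^sub>v vec r x) $ i = (e \<cdot>\<^sub>v vec r x) $ i"
        using x(2)[OF i] i by simp
    qed simp
    moreover have "vec r x \<noteq> 0\<^sub>v r"
    proof
      assume z: "vec r x = 0\<^sub>v r"
      have "x i = 0" if "i < r" for i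
        using arg_cong[OF z, of "\<lambda>v. v $ i"] that by simp
      then have "dotn r x x = 0" by (simp add: dotn_def)
      with x(1) show False by simp
    qed
    ultimately have "eigenvalue (gram W) e"
      by (auto simp: eigenvalue_def eigenvector_def r(2) intro!: exI[of _ "vec r x"])
    then have "sqrt e \<le> S" by (intro sv) (auto simp: singular_values_def)
    moreover have "0 \<le> e" using pos[of x] x(3)[of x] x(1) by simp
    ultimately have "e \<le> S\<^sup>2" using sqrt_le_D by blast
    with x(3)[of f] dotn_self_nonneg[of r f] show ?thesis
      by (meson mult_right_mono order_trans)
  qed
  define w where "w = (\<lambda>i j. W $$ (i, j))"
  show ?thesis
  proof (cases "nr \<le> nc")
    case True
    let ?G = "\<lambda>i i'. dotn nc (w i) (w i')"
    let ?T = "\<lambda>f j. dotn nr f (\<lambda>i. w i j)"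
    have g: "gram W = mat nr nr (\<lambda>(i, j). ?G i j)"
      using True W by (auto simp: gram_def dotn_def w_def scalar_prod_def atLeast0LessThan intro!: eq_matI sum.cong)
    have q: "dotn nr f (mat_app nr ?G f) = (normn nc (?T f))\<^sup>2" for f
    proof -
      have "dotn nr f (mat_app nr ?G f) = (\<Sum>i<nr. \<Sum>i'<nr. \<Sum>j<nc. f i * w i j * (f i' * w i' j))"
        by (simp add: mat_app_def dotn_def sum_distrib_left sum_distrib_right ac_simps)
      also have "\<dots> = (\<Sum>j<nc. \<Sum>i<nr. \<Sum>i'<nr. f i * w i j * (f i' * w i' j))"
        by (subst (2) sum.swap, subst sum.swap) simp
      also have "\<dots> = dotn nc (?T f) (?T f)"
        by (simp add: dotn_def sum_product)
      finally show ?thesis by (simp add: dotn_self)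
    qed
    have T: "normn nc (?T f) \<le> S * normn nr f" for f
    proof -
      have "(normn nc (?T f))\<^sup>2 \<le> S\<^sup>2 * dotn nr f f"
        unfolding q[symmetric] using False g by (intro bound) (auto simp: q dotn_commute)
      then show ?thesis
        using S normn_nonneg[of f nr] by (simp add: dotn_self flip: power_mult_distrib)
    qed
    let ?y = "\<lambda>i. dotn nc (w i) v"
    \<comment> \<open>Duality: the squared norm of \<open>W v\<close> is the inner product of
      \<open>v\<close> with the transpose applied to \<open>W v\<close>.\<close>
    have "(normn nr ?y)\<^sup>2 = dotn nc (?T ?y) v"
    proof -
      have "dotn nr ?y ?y = (\<Sum>i<nr. \<Sum>j<nc. ?y i * (w i j * v j))"
        by (simp add: dotn_def sum_distrib_left)
      also have "\<dots> = (\<Sum>j<nc. \<Sum>i<nr. ?y i * (w i j * v j))" by (rule sum.swap)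
      also have "\<dots> = dotn nc (?T ?y) v" by (simp add: dotn_def sum_distrib_right mult.assoc)
      finally show ?thesis by (simp add: dotn_self)
    qed
    also have "\<dots> \<le> normn nc (?T ?y) * normn nc v" using dotn_le_normn[of nc "?T ?y" v] by simp
    also have "\<dots> \<le> (S * normn nr ?y) * normn nc v" by (intro mult_right_mono T normn_nonneg)
    finally have "normn nr ?y * normn nr ?y \<le> (S * normn nc v) * normn nr ?y"
      by (simp add: power2_eq_square ac_simps)
    then have "normn nr ?y \<le> S * normn nc v"
    proof (cases "normn nr ?y = 0")
      case False
      then have "0 < normn nr ?y" using normn_nonneg[of ?y nr] by linarith
      then show ?thesis
        using \<open>normn nr ?y * normn nr ?y \<le> _\<close> by (rule mult_right_le_imp_le[rotated])
    qed (use S normn_nonneg[of v nc] in simp)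
    then show ?thesis unfolding w_def .
  next
    case nle: False
    let ?G = "\<lambda>j j'. dotn nr (\<lambda>i. w i j) (\<lambda>i. w i j')"
    have g: "gram W = mat nc nc (\<lambda>(i, j). ?G i j)"
      using nle W by (auto simp: gram_def dotn_def w_def scalar_prod_def atLeast0LessThan intro!: eq_matI sum.cong)
    have q: "dotn nc f (mat_app nc ?G f) = (normn nr (\<lambda>i. dotn nc (w i) f))\<^sup>2" for f
    proof -
      have "dotn nc f (mat_app nc ?G f) = (\<Sum>j<nc. \<Sum>j'<nc. \<Sum>i<nr. w i j * f j * (w i j' * f j'))"
        by (simp add: mat_app_def dotn_def sum_distrib_left sum_distrib_right ac_simps)
      also have "\<dots> = (\<Sum>i<nr. \<Sum>j<nc. \<Sum>j'<nc. w i j * f j * (w i j' * f j'))"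
        by (subst (2) sum.swap, subst sum.swap) simp
      also have "\<dots> = dotn nr (\<lambda>i. dotn nc (w i) f) (\<lambda>i. dotn nc (w i) f)"
        by (simp add: dotn_def sum_product)
      finally show ?thesis by (simp add: dotn_self)
    qed
    have "(normn nr (\<lambda>i. dotn nc (w i) v))\<^sup>2 \<le> S\<^sup>2 * dotn nc v v"
      unfolding q[symmetric] using False g by (intro bound) (auto simp: q dotn_commute)
    then have "(normn nr (\<lambda>i. dotn nc (w i) v))\<^sup>2 \<le> (S * normn nc v)\<^sup>2"
      by (simp add: dotn_self power_mult_distrib)
    then have "normn nr (\<lambda>i. dotn nc (w i) v) \<le> S * normn nc v"
      using S normn_nonneg[of v nc] by (rule power2_le_imp_le[OF _ mult_nonneg_nonneg])
    then show ?thesis unfolding w_def .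
  qed
qed

text \<open>A Taylor estimate with an arbitrary linear part \<open>J\<close> composes through the layers without reference to
  second derivatives in several variables.\<close>

definition smooth_map :: "nat \<Rightarrow> nat \<Rightarrow> real \<Rightarrow> real \<Rightarrow> ((nat \<Rightarrow> real) \<Rightarrow> nat \<Rightarrow> real) \<Rightarrow> bool" where
  "smooth_map n m l q y \<longleftrightarrow> (\<forall>x. \<exists>J. \<forall>z.
     normn m (\<lambda>i. dotn n (J i) z) \<le> l * normn n z \<and>
     normn m (\<lambda>i. y (\<lambda>j. x j + z j) i - y x i) \<le> l * normn n z \<and>
     normn m (\<lambda>i. y (\<lambda>j. x j + z j) i - y x i - dotn n (J i) z) \<le> q * (normn n z)\<^sup>2)"

lemma smooth_mapE:
  assumes "smooth_map n m l q y"
  obtains J where "\<And>z. normn m (\<lambda>i. dotn n (J i) z) \<le> l * normn n z"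
    "\<And>z. normn m (\<lambda>i. y (\<lambda>j. x j + z j) i - y x i) \<le> l * normn n z"
    "\<And>z. normn m (\<lambda>i. y (\<lambda>j. x j + z j) i - y x i - dotn n (J i) z) \<le> q * (normn n z)\<^sup>2"
proof -
  from assms[unfolded smooth_map_def, THEN spec, of x] obtain J where
    J: "\<forall>z. normn m (\<lambda>i. dotn n (J i) z) \<le> l * normn n z \<and>
     normn m (\<lambda>i. y (\<lambda>j. x j + z j) i - y x i) \<le> l * normn n z \<and>
     normn m (\<lambda>i. y (\<lambda>j. x j + z j) i - y x i - dotn n (J i) z) \<le> q * (normn n z)\<^sup>2"
    by (rule exE)
  show ?thesis
    by (rule that[of J]) (simp_all only: J[THEN spec, THEN conjunct1]
        J[THEN spec, THEN conjunct2, THEN conjunct1] J[THEN spec, THEN conjunct2, THEN conjunct2])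
qed

lemma smooth_map_linear:
  assumes y: "smooth_map n m l q y" and W: "\<And>v. normn m' (\<lambda>i. dotn m (w i) v) \<le> S * normn m v"
    and S: "0 \<le> S"
  shows "smooth_map n m' (S * l) (S * q) (\<lambda>x i. dotn m (w i) (y x))"
  unfolding smooth_map_def
proof
  fix x
  obtain J where J: "\<And>z. normn m (\<lambda>i. dotn n (J i) z) \<le> l * normn n z"
    "\<And>z. normn m (\<lambda>i. y (\<lambda>j. x j + z j) i - y x i) \<le> l * normn n z"
    "\<And>z. normn m (\<lambda>i. y (\<lambda>j. x j + z j) i - y x i - dotn n (J i) z) \<le> q * (normn n z)\<^sup>2"
    by (rule smooth_mapE[OF y, of x]) (rule that)
  let ?J = "\<lambda>i k. \<Sum>j<m. w i j * J j k"
  have D: "dotn n (?J i) z = dotn m (w i) (\<lambda>j. dotn n (J j) z)" for i z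
    by (simp add: dotn_sum_left dotn_scale_left) (simp add: dotn_def)
  have step: "normn m' (\<lambda>i. dotn m (w i) v) \<le> S * c" if "normn m v \<le> c" for v c
    using W[of v] mult_left_mono[OF that S] by linarith
  show "\<exists>J. \<forall>z. normn m' (\<lambda>i. dotn n (J i) z) \<le> S * l * normn n z \<and>
     normn m' (\<lambda>i. dotn m (w i) (y (\<lambda>j. x j + z j)) - dotn m (w i) (y x)) \<le> S * l * normn n z \<and>
     normn m' (\<lambda>i. dotn m (w i) (y (\<lambda>j. x j + z j)) - dotn m (w i) (y x) - dotn n (J i) z)
       \<le> S * q * (normn n z)\<^sup>2"
    using step[OF J(1)] step[OF J(2)] step[OF J(3)]
    by (intro exI[of _ ?J]) (simp add: D dotn_right mult.assoc)
qed

text \<open>The quadratic remainder comes from the mean value bound for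
  \<open>\<phi> t - deriv \<phi> a * t\<close>, whose derivative on the segment is at most
  \<open>L * |u|\<close> by the Lipschitz property of \<open>deriv \<phi>\<close>.\<close>

lemma activation_bounds:
  assumes "smooth_activation \<phi> L"
  shows "0 \<le> L" "\<bar>\<phi> (a + u) - \<phi> a\<bar> \<le> L * \<bar>u\<bar>"
    "\<bar>\<phi> (a + u) - \<phi> a - deriv \<phi> a * u\<bar> \<le> L * u\<^sup>2" "\<bar>deriv \<phi> a\<bar> \<le> L"
proof -
  have d1: "(\<phi> has_real_derivative deriv \<phi> t) (at t)" for t
    using assms by (simp add: smooth_activation_def DERIV_deriv_iff_field_differentiable)
  have d2: "(deriv \<phi> has_real_derivative deriv (deriv \<phi>) t) (at t)" for t
    using assms by (simp add: smooth_activation_def DERIV_deriv_iff_field_differentiable)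
  have b: "\<bar>deriv \<phi> t\<bar> \<le> L" "\<bar>deriv (deriv \<phi>) t\<bar> \<le> L" for t
    using assms by (auto simp: smooth_activation_def)
  show "0 \<le> L" using b(1)[of 0] by linarith
  show "\<bar>deriv \<phi> a\<bar> \<le> L" by (rule b)
  have lip: "\<bar>f y - f x\<bar> \<le> L * \<bar>y - x\<bar>"
    if "\<And>t. (f has_real_derivative f' t) (at t)" "\<And>t. \<bar>f' t\<bar> \<le> L" for f f' :: "real \<Rightarrow> real" and x y
    using field_differentiable_bound[of UNIV f f' L y x] that by simp
  show "\<bar>\<phi> (a + u) - \<phi> a\<bar> \<le> L * \<bar>u\<bar>" using lip[OF d1 b(1), of "a + u" a] by simp
  have "\<bar>(\<phi> (a + u) - deriv \<phi> a * (a + u)) - (\<phi> a - deriv \<phi> a * a)\<bar> \<le> (L * \<bar>u\<bar>) * \<bar>(a + u) - a\<bar>"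
  proof -
    have "norm ((\<phi> (a + u) - deriv \<phi> a * (a + u)) - (\<phi> a - deriv \<phi> a * a)) \<le> (L * \<bar>u\<bar>) * norm ((a + u) - a)"
    proof (rule field_differentiable_bound[of "closed_segment a (a + u)"
          "\<lambda>t. \<phi> t - deriv \<phi> a * t" "\<lambda>t. deriv \<phi> t - deriv \<phi> a"])
      fix t assume t: "t \<in> closed_segment a (a + u)"
      show "((\<lambda>t. \<phi> t - deriv \<phi> a * t) has_real_derivative deriv \<phi> t - deriv \<phi> a) (at t within closed_segment a (a + u))"
        by (rule derivative_eq_intros d1[THEN DERIV_subset] | simp)+
      have "\<bar>t - a\<bar> \<le> \<bar>u\<bar>" using t by (auto simp: closed_segment_eq_real_ivl split: if_splits)
      then have "L * \<bar>t - a\<bar> \<le> L * \<bar>u\<bar>" using \<open>0 \<le> L\<close> by (rule mult_left_mono)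
      then show "norm (deriv \<phi> t - deriv \<phi> a) \<le> L * \<bar>u\<bar>"
        using lip[OF d2 b(2), of t a] by simp
    qed auto
    then show ?thesis by simp
  qed
  then show "\<bar>\<phi> (a + u) - \<phi> a - deriv \<phi> a * u\<bar> \<le> L * u\<^sup>2"
    by (simp add: algebra_simps power2_eq_square abs_mult_self_eq)
qed

lemma normn_mono:
  assumes "\<And>i. i < m \<Longrightarrow> \<bar>f i\<bar> \<le> \<bar>g i\<bar>"
  shows "normn m f \<le> normn m g"
  unfolding L2_set_def using assms by (intro real_sqrt_le_mono sum_mono) (simp add: abs_le_square_iff)

lemma normn_square_le: "normn m (\<lambda>i. (u i)\<^sup>2) \<le> (normn m u)\<^sup>2"
proof -
  have "normn m (\<lambda>i. (u i)\<^sup>2) \<le> (\<Sum>i<m. \<bar>(u i)\<^sup>2\<bar>)" by (rule L2_set_le_sum_abs)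
  also have "\<dots> = (normn m u)\<^sup>2" by (simp add: L2_set_def sum_nonneg)
  finally show ?thesis .
qed

text \<open>The remainder splits into that of \<open>\<phi>\<close> at the increment of
  \<open>y\<close>, which contributes \<open>L * l\<^sup>2\<close>, and \<open>deriv \<phi>\<close>
  times the remainder of \<open>y\<close>, which contributes \<open>L * q\<close>.\<close>

lemma smooth_map_activation:
  assumes y: "smooth_map n m l q y" and \<phi>: "smooth_activation \<phi> L"
  shows "smooth_map n m (L * l) (L * (q + l\<^sup>2)) (\<lambda>x i. \<phi> (y x i))"
  unfolding smooth_map_def
proof
  fix x
  obtain J where J: "\<And>z. normn m (\<lambda>i. dotn n (J i) z) \<le> l * normn n z"
    "\<And>z. normn m (\<lambda>i. y (\<lambda>j. x j + z j) i - y x i) \<le> l * normn n z"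
    "\<And>z. normn m (\<lambda>i. y (\<lambda>j. x j + z j) i - y x i - dotn n (J i) z) \<le> q * (normn n z)\<^sup>2"
    by (rule smooth_mapE[OF y, of x]) (rule that)
  note L = activation_bounds[OF \<phi>]
  let ?J = "\<lambda>i k. deriv \<phi> (y x i) * J i k"
  have scaled: "normn m (\<lambda>i. c i * v i) \<le> L * r" if "\<And>i. \<bar>c i\<bar> \<le> L" "normn m v \<le> r" for c v r
  proof -
    have "normn m (\<lambda>i. c i * v i) \<le> normn m (\<lambda>i. L * v i)"
      using that(1) L(1) by (intro normn_mono) (simp add: abs_mult mult_right_mono)
    also have "\<dots> = L * normn m v" using L(1) by (simp add: normn_scale)
    also have "\<dots> \<le> L * r" using that(2) L(1) by (rule mult_left_mono)
    finally show ?thesis .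
  qed
  have b: "normn m (\<lambda>i. dotn n (?J i) z) \<le> L * l * normn n z \<and>
     normn m (\<lambda>i. \<phi> (y (\<lambda>j. x j + z j) i) - \<phi> (y x i)) \<le> L * l * normn n z \<and>
     normn m (\<lambda>i. \<phi> (y (\<lambda>j. x j + z j) i) - \<phi> (y x i) - dotn n (?J i) z) \<le> L * (q + l\<^sup>2) * (normn n z)\<^sup>2" for z
  proof (intro conjI)
    define u where "u = (\<lambda>i. y (\<lambda>j. x j + z j) i - y x i)"
    have yu: "y (\<lambda>j. x j + z j) i = y x i + u i" for i by (simp add: u_def)
    have u: "normn m u \<le> l * normn n z" using J(2)[of z] by (simp add: u_def)
    show "normn m (\<lambda>i. dotn n (?J i) z) \<le> L * l * normn n z"
      using scaled[OF L(4) J(1), of "y x" z] by (simp add: dotn_scale_left mult.assoc)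
    have "normn m (\<lambda>i. \<phi> (y (\<lambda>j. x j + z j) i) - \<phi> (y x i)) \<le> normn m (\<lambda>i. L * u i)"
      using L(1,2) by (intro normn_mono) (simp add: yu abs_mult)
    also have "\<dots> \<le> L * (l * normn n z)" using u L(1) by (simp add: normn_scale mult_left_mono)
    finally show "normn m (\<lambda>i. \<phi> (y (\<lambda>j. x j + z j) i) - \<phi> (y x i)) \<le> L * l * normn n z"
      by (simp add: mult.assoc)
    let ?r = "\<lambda>i. \<phi> (y x i + u i) - \<phi> (y x i) - deriv \<phi> (y x i) * u i"
    let ?d = "\<lambda>i. deriv \<phi> (y x i) * (u i - dotn n (J i) z)"
    have "normn m (\<lambda>i. ?r i + ?d i) \<le> normn m ?r + normn m ?d" by (rule L2_set_triangle_ineq)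
    also have "normn m ?d \<le> L * (q * (normn n z)\<^sup>2)"
      using J(3)[of z] by (intro scaled L(4)) (simp add: u_def)
    also have "normn m ?r \<le> normn m (\<lambda>i. L * (u i)\<^sup>2)"
      using L(1,3) by (intro normn_mono) (simp add: abs_mult)
    also have "\<dots> = L * normn m (\<lambda>i. (u i)\<^sup>2)" using L(1) by (simp add: normn_scale)
    also have "\<dots> \<le> L * (l * normn n z)\<^sup>2"
    proof (rule mult_left_mono[OF _ L(1)])
      have "(normn m u)\<^sup>2 \<le> (l * normn n z)\<^sup>2" using u normn_nonneg by (rule power_mono)
      with normn_square_le[of u m] show "normn m (\<lambda>i. (u i)\<^sup>2) \<le> (l * normn n z)\<^sup>2" by linarith
    qed
    finally have "normn m (\<lambda>i. ?r i + ?d i) \<le> L * (q + l\<^sup>2) * (normn n z)\<^sup>2"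
      by (simp add: power_mult_distrib algebra_simps)
    moreover have "(\<lambda>i. ?r i + ?d i) = (\<lambda>i. \<phi> (y (\<lambda>j. x j + z j) i) - \<phi> (y x i) - dotn n (?J i) z)"
      unfolding yu dotn_scale_left by (rule ext) (simp add: right_diff_distrib)
    ultimately show "normn m (\<lambda>i. \<phi> (y (\<lambda>j. x j + z j) i) - \<phi> (y x i) - dotn n (?J i) z) \<le> L * (q + l\<^sup>2) * (normn n z)\<^sup>2"
      by simp
  qed
  show "\<exists>J. \<forall>z. normn m (\<lambda>i. dotn n (J i) z) \<le> L * l * normn n z \<and>
     normn m (\<lambda>i. \<phi> (y (\<lambda>j. x j + z j) i) - \<phi> (y x i)) \<le> L * l * normn n z \<and>
     normn m (\<lambda>i. \<phi> (y (\<lambda>j. x j + z j) i) - \<phi> (y x i) - dotn n (J i) z) \<le> L * (q + l\<^sup>2) * (normn n z)\<^sup>2"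
    by (intro exI[of _ ?J] allI) (rule b)
qed

lemma smooth_map_mono:
  assumes "smooth_map n m l q y" "l \<le> l'" "q \<le> q'"
  shows "smooth_map n m l' q' y"
proof -
  have "l * normn n z \<le> l' * normn n z" "q * (normn n z)\<^sup>2 \<le> q' * (normn n z)\<^sup>2" for z
    using assms by (auto intro!: mult_right_mono normn_nonneg)
  note le = this
  show ?thesis
    unfolding smooth_map_def
  proof
    fix x
    obtain J where J: "\<And>z. normn m (\<lambda>i. dotn n (J i) z) \<le> l * normn n z"
      "\<And>z. normn m (\<lambda>i. y (\<lambda>j. x j + z j) i - y x i) \<le> l * normn n z"
      "\<And>z. normn m (\<lambda>i. y (\<lambda>j. x j + z j) i - y x i - dotn n (J i) z) \<le> q * (normn n z)\<^sup>2"
      by (rule smooth_mapE[OF assms(1), of x]) (rule that)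
    show "\<exists>J. \<forall>z. normn m (\<lambda>i. dotn n (J i) z) \<le> l' * normn n z \<and>
     normn m (\<lambda>i. y (\<lambda>j. x j + z j) i - y x i) \<le> l' * normn n z \<and>
     normn m (\<lambda>i. y (\<lambda>j. x j + z j) i - y x i - dotn n (J i) z) \<le> q' * (normn n z)\<^sup>2"
      by (intro exI[of _ J] allI conjI order_trans[OF J(1) le(1)] order_trans[OF J(2) le(1)]
          order_trans[OF J(3) le(2)])
  qed
qed

lemma smooth_map_id: "smooth_map n n 1 0 (\<lambda>x. x)"
proof -
  have "normn n (\<lambda>i. dotn n (unit_fn i) z) = normn n z" for z
    by (rule L2_set_cong) (auto simp: dotn_def unit_fn_def if_distrib[of "\<lambda>y. y * _"] cong: if_cong)
  moreover have "normn n (\<lambda>i. z i - dotn n (unit_fn i) z) = 0" for z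
    by (rule L2_set_eq_0_iff[THEN iffD2])
       (auto simp: dotn_def unit_fn_def if_distrib[of "\<lambda>y. y * _"] cong: if_cong)
  ultimately show ?thesis
    unfolding smooth_map_def by (intro allI exI[of _ unit_fn]) simp
qed

lemma dim_apply_layers: "layers_dims m ls (dim_vec y) \<Longrightarrow> dim_vec (apply_layers ls y) = m"
  by (induction m ls "dim_vec y" rule: layers_dims.induct) auto

lemma smooth_map_cong:
  assumes "smooth_map n m l q y" "\<And>x i. i < m \<Longrightarrow> y x i = y' x i"
  shows "smooth_map n m l q y'"
proof -
  have "normn m (\<lambda>i. y (\<lambda>j. x j + z j) i - y x i) = normn m (\<lambda>i. y' (\<lambda>j. x j + z j) i - y' x i)" for x z
    using assms(2) by (intro L2_set_cong) auto
  moreover have "normn m (\<lambda>i. y (\<lambda>j. x j + z j) i - y x i - dotn n (J i) z)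
      = normn m (\<lambda>i. y' (\<lambda>j. x j + z j) i - y' x i - dotn n (J i) z)" for x z J
    using assms(2) by (intro L2_set_cong) auto
  ultimately show ?thesis using assms(1) by (simp add: smooth_map_def)
qed

text \<open>The induction keeps the quadratic constant equal to the square of the Lipschitz
  constant. The factor \<open>2\<close> per layer pays for the sum
  \<open>Y\<^sup>2 + Y\<^sup>2\<close> that an activation produces; passing from \<open>L i\<close>
  to \<open>lam i \<ge> 1\<close> keeps every factor at least \<open>1\<close>.\<close>

lemma smooth_map_layers:
  fixes L lam :: "nat \<Rightarrow> real"
  assumes A: "A \<in> carrier_mat k n" "\<And>s. s \<in> singular_values A \<Longrightarrow> s \<le> S" and S: "1 \<le> S"
    and ls: "layers_dims m ls k"
    and act: "\<And>i. i < length ls \<Longrightarrow> smooth_activation (snd (ls ! i)) (L i)"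
    and W: "\<And>i s. i < length ls \<Longrightarrow> s \<in> singular_values (fst (ls ! i)) \<Longrightarrow> s \<le> S"
    and lam: "\<And>i. i < length ls \<Longrightarrow> L i \<le> lam i \<and> 1 \<le> lam i"
    and X: "X = S * (\<Prod>i<length ls. 2 * S * lam i)"
  shows "smooth_map n m X (X\<^sup>2) (\<lambda>x i. apply_layers ls (A *\<^sub>v vec n x) $ i) \<and> 1 \<le> X"
  using ls act W lam X
proof (induction ls arbitrary: m L lam X)
  case Nil
  have "smooth_map n k (S * 1) (S * 0) (\<lambda>x i. dotn n (\<lambda>j. A $$ (i, j)) x)"
    using operator_norm_bound[OF A] S by (intro smooth_map_linear[OF smooth_map_id]) auto
  then have "smooth_map n k X (X\<^sup>2) (\<lambda>x i. dotn n (\<lambda>j. A $$ (i, j)) x)"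
    by (rule smooth_map_mono) (use Nil.prems in auto)
  then have "smooth_map n k X (X\<^sup>2) (\<lambda>x i. (A *\<^sub>v vec n x) $ i)"
    by (rule smooth_map_cong) (use A(1) in \<open>simp add: scalar_prod_def dotn_def atLeast0LessThan\<close>)
  then show ?case using Nil.prems S by simp
next
  case (Cons l ls)
  obtain W \<phi> where l: "l = (W, \<phi>)" by (cases l)
  let ?r = "dim_col W"
  have dims: "dim_row W = m" "layers_dims ?r ls k" using Cons.prems(1) by (auto simp: l)
  define Y where "Y = S * (\<Prod>i<length ls. 2 * S * lam (Suc i))"
  let ?y = "\<lambda>x i. apply_layers ls (A *\<^sub>v vec n x) $ i"
  have IH: "smooth_map n ?r Y (Y\<^sup>2) ?y \<and> 1 \<le> Y"
  proof (rule Cons.IH[OF dims(2)])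
    show "smooth_activation (snd (ls ! i)) (L (Suc i))" if "i < length ls" for i
      using Cons.prems(2)[of "Suc i"] that by simp
    show "s \<le> S" if "i < length ls" "s \<in> singular_values (fst (ls ! i))" for i s
      using Cons.prems(3)[of "Suc i" s] that by simp
    show "L (Suc i) \<le> lam (Suc i) \<and> 1 \<le> lam (Suc i)" if "i < length ls" for i
      using Cons.prems(4)[of "Suc i"] that by simp
  qed (simp add: Y_def)
  have \<phi>: "smooth_activation \<phi> (L 0)" using Cons.prems(2)[of 0] by (simp add: l)
  have L0: "0 \<le> L 0" by (rule activation_bounds(1)[OF \<phi>])
  have lam0: "L 0 \<le> lam 0" "1 \<le> lam 0" using Cons.prems(4)[of 0] by auto
  have sv: "s \<le> S" if "s \<in> singular_values W" for s using Cons.prems(3)[of 0 s] that by (simp add: l)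
  have Wc: "W \<in> carrier_mat m ?r" using dims(1) by auto
  have "smooth_map n ?r (L 0 * Y) (L 0 * (Y\<^sup>2 + Y\<^sup>2)) (\<lambda>x i. \<phi> (?y x i))"
    using IH by (intro smooth_map_activation[OF _ \<phi>]) simp
  then have "smooth_map n m (S * (L 0 * Y)) (S * (L 0 * (Y\<^sup>2 + Y\<^sup>2)))
      (\<lambda>x i. dotn ?r (\<lambda>j. W $$ (i, j)) (\<lambda>i. \<phi> (?y x i)))"
    using S operator_norm_bound[OF Wc sv] by (intro smooth_map_linear) auto
  then have "smooth_map n m (S * (L 0 * Y)) (S * (L 0 * (Y\<^sup>2 + Y\<^sup>2)))
      (\<lambda>x i. apply_layers (l # ls) (A *\<^sub>v vec n x) $ i)"
  proof (rule smooth_map_cong)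
    fix x i assume i: "i < m"
    have "dim_vec (apply_layers ls (A *\<^sub>v vec n x)) = ?r"
      using dims(2) A(1) by (intro dim_apply_layers) auto
    then show "dotn ?r (\<lambda>j. W $$ (i, j)) (\<lambda>i. \<phi> (?y x i)) = apply_layers (l # ls) (A *\<^sub>v vec n x) $ i"
      using i dims(1) by (simp add: l scalar_prod_def dotn_def atLeast0LessThan)
  qed
  moreover have X: "X = 2 * (S * lam 0) * Y"
  proof -
    have "(\<Prod>i<length (l # ls). 2 * S * lam i) = (2 * S * lam 0) * (\<Prod>i<length ls. 2 * S * lam (Suc i))"
      unfolding list.size(4) add_Suc_right add_0_right by (rule prod.lessThan_Suc_shift)
    then show ?thesis unfolding Cons.prems(5) Y_def by (simp only: ac_simps)
  qed
  moreover have SL: "S * L 0 \<le> S * lam 0" "1 \<le> S * lam 0"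
    using S lam0 mult_mono[of 1 S 1 "lam 0"] by auto
  moreover have "S * (L 0 * Y) \<le> X"
  proof -
    have "S * L 0 * Y \<le> S * lam 0 * Y" using SL IH by (intro mult_right_mono) auto
    moreover have "0 \<le> S * lam 0 * Y" using S lam0 IH by (intro mult_nonneg_nonneg) auto
    ultimately show ?thesis unfolding X by (simp add: mult.assoc)
  qed
  moreover have "S * (L 0 * (Y\<^sup>2 + Y\<^sup>2)) \<le> X\<^sup>2"
  proof -
    define a where "a = S * lam 0"
    have a: "S * L 0 \<le> a" "1 \<le> a" using SL by (auto simp: a_def)
    then have aa: "a \<le> a * a" by simp
    have "S * (L 0 * (Y\<^sup>2 + Y\<^sup>2)) = S * L 0 * (2 * Y\<^sup>2)" by simp
    also have "\<dots> \<le> a * (2 * Y\<^sup>2)" using a by (intro mult_right_mono) auto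
    also have "\<dots> \<le> (a * a) * (4 * Y\<^sup>2)" using a aa by (intro mult_mono) auto
    also have "\<dots> = X\<^sup>2" unfolding X by (simp add: power2_eq_square a_def)
    finally show ?thesis .
  qed
  moreover have "1 \<le> X"
    unfolding X using SL IH mult_mono[of 1 "2 * (S * lam 0)" 1 Y] by auto
  ultimately show ?case by (blast intro: smooth_map_mono)
qed

section \<open>Projections onto spans of orthogonal lists\<close>

lemma scalar_prod_vec: "vec n f \<bullet> vec n g = dotn n f g"
  by (simp add: scalar_prod_def dotn_def atLeast0LessThan)

lemma scalar_prod_index: "dim_vec y = n \<Longrightarrow> x \<bullet> y = dotn n (\<lambda>i. x $ i) (\<lambda>i. y $ i)"
  by (simp add: scalar_prod_def dotn_def atLeast0LessThan)

lemma euclid_norm_vec: "euclid_norm (vec n f) = normn n f"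
  by (simp add: euclid_norm_def scalar_prod_vec L2_set_def dotn_def power2_eq_square)

text \<open>For uniqueness in the definite description: the difference of two solutions lies in
  \<open>V\<close> and is orthogonal to itself.\<close>

lemma orth_proj_eqI:
  assumes V: "V \<subseteq> carrier_vec n" "\<And>u v. u \<in> V \<Longrightarrow> v \<in> V \<Longrightarrow> u - v \<in> V"
    and x: "x \<in> carrier_vec n" and v: "v \<in> V" "\<And>w. w \<in> V \<Longrightarrow> (x - v) \<bullet> w = 0"
  shows "orth_proj V x = v"
  unfolding orth_proj_def
proof (rule the_equality)
  fix u assume u: "u \<in> V \<and> (\<forall>w\<in>V. (x - u) \<bullet> w = 0)"
  have uv: "u - v \<in> V" using u v(1) V(2) by blast
  have c: "u \<in> carrier_vec n" "v \<in> carrier_vec n" "u - v \<in> carrier_vec n"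
    using u v(1) V(1) uv by auto
  have "(x - v) \<bullet> (u - v) - (x - u) \<bullet> (u - v) = (u - v) \<bullet> (u - v)"
    using c x by (simp add: minus_scalar_prod_distrib[of _ n])
  then have "(u - v) \<bullet> (u - v) = 0" using u v(2) uv by simp
  then have "dotn n (\<lambda>i. (u - v) $ i) (\<lambda>i. (u - v) $ i) = 0"
    using c by (simp add: scalar_prod_index[of _ n])
  then have "\<forall>i<n. (u - v) $ i = 0" by (simp add: dotn_def sum_nonneg_eq_0_iff)
  then show "u = v" using c by (intro eq_vecI) auto
qed (use v in auto)

lemma span_of_diff:
  assumes "S \<subseteq> carrier_vec n" "u \<in> span_of n S" "v \<in> span_of n S"
  shows "u - v \<in> span_of n S"
proof -
  interpret vec_space "TYPE(real)" n .
  have c: "u \<in> carrier_vec n" "v \<in> carrier_vec n"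
    using assms span_closed[of S] by (auto simp: span_of_def)
  have "(- 1) \<cdot>\<^sub>v v \<in> span S" using assms by (intro smult_in_span) (auto simp: span_of_def)
  then have "u + (- 1) \<cdot>\<^sub>v v \<in> span S"
    using span_add1[of S u "(- 1) \<cdot>\<^sub>v v"] assms by (auto simp: span_of_def)
  moreover have "u + (- 1) \<cdot>\<^sub>v v = u - v" using c by auto
  ultimately show ?thesis by (simp add: span_of_def)
qed

lemma span_of_carrier: "S \<subseteq> carrier_vec n \<Longrightarrow> span_of n S \<subseteq> carrier_vec n"
proof -
  interpret vec_space "TYPE(real)" n .
  show "S \<subseteq> carrier_vec n \<Longrightarrow> ?thesis" using span_closed[of S] by (auto simp: span_of_def)
qed

lemma orthogonal_list_dotn:
  assumes "orthogonal_list n us" "u \<in> set us" "v \<in> set us" "u \<noteq> v"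
  shows "dotn n u v = 0"
  using assms
proof (induction us)
  case (Cons w us)
  have o: "orthogonal_list n us" and w: "\<And>v. v \<in> set us \<Longrightarrow> dotn n w v = 0"
    using Cons.prems(1) by (auto simp: orthogonal_list_def)
  consider "u \<in> set us" "v \<in> set us" | "u = w" "v \<in> set us" | "v = w" "u \<in> set us"
    using Cons.prems by auto
  then show ?case
  proof cases
    case 3
    then show ?thesis using w[of u] by (simp add: dotn_commute)
  qed (use Cons.IH[OF o] Cons.prems(4) w in auto)
qed simp

context
  fixes n :: nat and us :: "(nat \<Rightarrow> real) list"
  assumes us: "orthogonal_list n us"
begin

text \<open>List entries are functions on all naturals of which only the first \<open>n\<close>
  values matter. Orthogonality with positive norms keeps the truncations distinct, so lists and sets
  of vectors can be exchanged.\<close>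

lemma vec_inj_on: "inj_on (vec n) (set us)" and distinct_us: "distinct us"
proof -
  have 0: "dotn n u v = 0" if "i < j" "j < length us" "u = us ! i" "v = us ! j" for i j u v
    using us that by (auto simp: orthogonal_list_def sorted_wrt_iff_nth_less)
  have pos: "0 < dotn n u u" if "u \<in> set us" for u using us that by (auto simp: orthogonal_list_def)
  have eq: "i = j" if "i < length us" "j < length us" "vec n (us ! i) = vec n (us ! j)" for i j
  proof (rule ccontr)
    assume "i \<noteq> j"
    then have "dotn n (us ! i) (us ! j) = 0"
      using that 0[of i j] 0[of j i] by (cases i j rule: linorder_cases) (auto simp: dotn_commute)
    moreover have "dotn n (us ! i) (us ! j) = dotn n (us ! i) (us ! i)"
      using that(3) by (metis scalar_prod_vec)
    ultimately show False using pos[of "us ! i"] that by simp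
  qed
  show "inj_on (vec n) (set us)"
    by (rule inj_onI) (metis eq in_set_conv_nth)
  show "distinct us"
    unfolding distinct_conv_nth using eq by metis
qed

lemma span_of_listE:
  assumes "x \<in> span_of n (vec n ` set us)"
  obtains c where "x = vec n (\<lambda>i. \<Sum>u\<leftarrow>us. c u * u i)"
proof -
  interpret vec_space "TYPE(real)" n .
  obtain a A where A: "x = lincomb a A" "finite A" "A \<subseteq> vec n ` set us"
    using in_spanE assms unfolding span_of_def by blast
  let ?c = "\<lambda>u. if vec n u \<in> A then a (vec n u) else 0"
  have car: "A \<subseteq> carrier_vec n" using A(3) by auto
  have "x = vec n (\<lambda>i. \<Sum>u\<leftarrow>us. ?c u * u i)"
  proof (rule eq_vecI)
    fix i assume "i < dim_vec (vec n (\<lambda>i. \<Sum>u\<leftarrow>us. ?c u * u i))"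
    then have i: "i < n" by simp
    have "x $ i = (\<Sum>v\<in>A. a v * v $ i)" unfolding A(1) by (rule lincomb_index[OF i car])
    also have "\<dots> = (\<Sum>v\<in>vec n ` set us. if v \<in> A then a v * v $ i else 0)"
      using A(3) by (simp add: sum.If_cases Int_absorb1)
    also have "\<dots> = (\<Sum>u\<in>set us. ?c u * u i)"
      using i by (subst sum.reindex[OF vec_inj_on]) (auto intro!: sum.cong)
    also have "\<dots> = (\<Sum>u\<leftarrow>us. ?c u * u i)"
      by (rule sum_list_distinct_conv_sum_set[symmetric]) (rule distinct_us)
    finally show "x $ i = vec n (\<lambda>i. \<Sum>u\<leftarrow>us. ?c u * u i) $ i" using i by simp
  qed (use A(1) lincomb_dim[OF A(2) car] in simp)
  then show ?thesis by (rule that)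
qed

lemma span_of_listI: "vec n (\<lambda>i. \<Sum>u\<leftarrow>us. c u * u i) \<in> span_of n (vec n ` set us)"
proof -
  interpret vec_space "TYPE(real)" n .
  let ?a = "\<lambda>v. c (the_inv_into (set us) (vec n) v)"
  have car: "vec n ` set us \<subseteq> carrier_vec n" by auto
  have "vec n (\<lambda>i. \<Sum>u\<leftarrow>us. c u * u i) = lincomb ?a (vec n ` set us)"
  proof (rule eq_vecI)
    fix i assume "i < dim_vec (lincomb ?a (vec n ` set us))"
    then have i: "i < n" using lincomb_dim[OF _ car] by simp
    have "lincomb ?a (vec n ` set us) $ i = (\<Sum>v\<in>vec n ` set us. ?a v * v $ i)"
      by (rule lincomb_index[OF i car])
    also have "\<dots> = (\<Sum>u\<in>set us. c u * u i)"
      using i vec_inj_on by (subst sum.reindex[OF vec_inj_on]) (auto intro!: sum.cong simp: the_inv_into_f_f)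
    also have "\<dots> = (\<Sum>u\<leftarrow>us. c u * u i)"
      by (rule sum_list_distinct_conv_sum_set[symmetric]) (rule distinct_us)
    finally show "vec n (\<lambda>i. \<Sum>u\<leftarrow>us. c u * u i) $ i = lincomb ?a (vec n ` set us) $ i" using i by simp
  qed (use lincomb_dim[OF _ car] in simp)
  then show ?thesis by (auto simp: span_of_def intro: in_spanI)
qed

lemma subspace_span_of: "subspace_of n (span_of n (vec n ` set us))"
proof -
  interpret vec_space "TYPE(real)" n .
  show ?thesis unfolding subspace_of_def span_of_def by (rule span_is_subspace) auto
qed

lemma dim_span_of: "subspace_dim n (span_of n (vec n ` set us)) = length us"
proof -
  interpret vec_space "TYPE(real)" n .
  let ?S = "vec n ` set us"
  have car: "?S \<subseteq> carrier_vec n" by auto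
  have "lin_indpt ?S"
  proof
    assume "lin_dep ?S"
    then obtain A a v where A: "finite A" "A \<subseteq> ?S" "lincomb a A = 0\<^sub>v n" "v \<in> A" "a v \<noteq> 0"
      unfolding lin_dep_def by auto
    have carA: "A \<subseteq> carrier_vec n" using A(2) by auto
    obtain u where u: "u \<in> set us" "v = vec n u" using A(2,4) by blast
    have other: "dotn n u' u = 0" if "u' \<in> set us" "u' \<noteq> u" for u'
      using us that(1) u(1) that(2) by (rule orthogonal_list_dotn)
    \<comment> \<open>Pairing the linear dependency with \<open>u\<close> isolates the coefficient
      of \<open>v\<close>.\<close>
    have "0 = dotn n (\<lambda>i. lincomb a A $ i) u" by (simp add: A(3) dotn_def)
    also have "\<dots> = dotn n (\<lambda>i. \<Sum>w\<in>A. a w * w $ i) u"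
      by (rule dotn_cong) (simp_all add: lincomb_index[OF _ carA])
    also have "\<dots> = (\<Sum>w\<in>A. a w * dotn n (\<lambda>i. w $ i) u)"
      by (simp add: dotn_sum_left dotn_scale_left)
    also have "\<dots> = (\<Sum>w\<in>A. if w = v then a v * dotn n u u else 0)"
    proof (rule sum.cong)
      fix w assume "w \<in> A"
      then obtain u' where u': "u' \<in> set us" "w = vec n u'" using A(2) by blast
      have "dotn n (\<lambda>i. w $ i) u = dotn n u' u" using u' by (intro dotn_cong) auto
      then show "a w * dotn n (\<lambda>i. w $ i) u = (if w = v then a v * dotn n u u else 0)"
        using other[OF u'(1)] u' u vec_inj_on by (cases "u' = u") (auto dest: inj_onD)
    qed simp
    also have "\<dots> = a v * dotn n u u" using A by simp
    finally show False using A(5) us u(1) by (auto simp: orthogonal_list_def)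
  qed
  then have "maximal ?S (\<lambda>T. T \<subseteq> ?S \<and> lin_indpt T)"
    by (auto simp: maximal_def)
  from dim_span[OF car _ this] have "vectorspace.dim class_ring (span_vs ?S) = card ?S" by simp
  also have "\<dots> = length us"
    using vec_inj_on distinct_us by (simp add: card_image distinct_card)
  finally show ?thesis by (simp add: subspace_dim_def span_of_def)
qed

text \<open>Identifies the vector that the algorithm computes with the projected argument in terms
  of which \<open>net_off\<close> and the hypotheses are stated.\<close>

lemma orth_proj_span_of:
  "vec n g - orth_proj (span_of n (vec n ` set us)) (vec n g) = vec n (resid n us g)"
proof -
  let ?S = "vec n ` set us"
  let ?p = "\<lambda>i. \<Sum>u\<leftarrow>us. dotn n g u / dotn n u u * u i"
  have "orth_proj (span_of n ?S) (vec n g) = vec n ?p"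
  proof (rule orth_proj_eqI)
    show "span_of n ?S \<subseteq> carrier_vec n" by (rule span_of_carrier) auto
    show "u - v \<in> span_of n ?S" if "u \<in> span_of n ?S" "v \<in> span_of n ?S" for u v
      by (rule span_of_diff[OF _ that]) auto
    show "vec n ?p \<in> span_of n ?S" by (rule span_of_listI)
    fix w assume "w \<in> span_of n ?S"
    then obtain c where w: "w = vec n (\<lambda>i. \<Sum>u\<leftarrow>us. c u * u i)" by (rule span_of_listE)
    have "vec n g - vec n ?p = vec n (resid n us g)" by (auto simp: resid_eq[OF us])
    then have "(vec n g - vec n ?p) \<bullet> w = dotn n (\<lambda>i. \<Sum>u\<leftarrow>us. c u * u i) (resid n us g)"
      by (simp add: w scalar_prod_vec dotn_commute)
    also have "\<dots> = (\<Sum>u\<leftarrow>us. c u * dotn n u (resid n us g))" by (rule dotn_sum_list_left)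
    also have "\<dots> = (\<Sum>u\<leftarrow>us. 0)"
      using resid_orthogonal'[OF us] by (intro arg_cong[of _ _ sum_list] map_cong) auto
    finally show "(vec n g - vec n ?p) \<bullet> w = 0" by simp
  qed simp
  then show ?thesis by (auto simp: resid_eq[OF us])
qed

end

section \<open>Least squares and projection onto the row space\<close>

lemma least_squares_exists:
  "\<exists>c. \<forall>v\<in>set vs. dotn n (\<lambda>i. x i - (\<Sum>j<length vs. c j * (vs ! j) i)) v = 0"
proof (induction vs arbitrary: x)
  case (Cons v vs)
  obtain c where c: "\<forall>w\<in>set vs. dotn n (\<lambda>i. v i - (\<Sum>j<length vs. c j * (vs ! j) i)) w = 0"
    using Cons.IH by blast
  obtain d where d: "\<forall>w\<in>set vs. dotn n (\<lambda>i. x i - (\<Sum>j<length vs. d j * (vs ! j) i)) w = 0"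
    using Cons.IH by blast
  define q where "q = (\<lambda>i. \<Sum>j<length vs. c j * (vs ! j) i)"
  define p where "p = (\<lambda>i. \<Sum>j<length vs. d j * (vs ! j) i)"
  define r where "r = (\<lambda>i. v i - q i)"
  \<comment> \<open>A Gram-Schmidt step: \<open>r\<close> is the part of \<open>v\<close> orthogonal
    to \<open>vs\<close>. If \<open>r\<close> vanishes, division by zero makes \<open>s = 0\<close>
    and orthogonality to \<open>r\<close> is trivial.\<close>
  define s where "s = dotn n (\<lambda>i. x i - p i) r / dotn n r r"
  let ?c = "case_nat s (\<lambda>j. d j - s * c j)"
  have r: "dotn n r w = 0" if "w \<in> set vs" for w using c that by (simp add: r_def q_def)
  have xp: "dotn n (\<lambda>i. x i - p i) w = 0" if "w \<in> set vs" for w using d that by (simp add: p_def)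
  have e: "(\<lambda>i. x i - (\<Sum>j<length (v # vs). ?c j * ((v # vs) ! j) i)) = (\<lambda>i. (x i - p i) - s * r i)"
  proof
    fix i
    have "(\<Sum>j<length (v # vs). ?c j * ((v # vs) ! j) i) = s * v i + (\<Sum>j<length vs. (d j - s * c j) * (vs ! j) i)"
      unfolding list.size(4) add_Suc_right add_0_right by (subst sum.lessThan_Suc_shift) simp
    also have "(\<Sum>j<length vs. (d j - s * c j) * (vs ! j) i) = p i - s * q i"
      by (simp add: p_def q_def left_diff_distrib sum_subtractf sum_distrib_left mult.assoc)
    finally show "x i - (\<Sum>j<length (v # vs). ?c j * ((v # vs) ! j) i) = (x i - p i) - s * r i"
      by (simp add: r_def right_diff_distrib)
  qed
  have rq: "dotn n f q = 0" if "\<And>w. w \<in> set vs \<Longrightarrow> dotn n f w = 0" for f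
    using that unfolding q_def by (simp add: dotn_right)
  have "dotn n (\<lambda>i. (x i - p i) - s * r i) v = 0"
  proof -
    have v: "v = (\<lambda>i. r i + q i)" by (simp add: r_def)
    have "dotn n (\<lambda>i. (x i - p i) - s * r i) r = 0"
    proof (cases "dotn n r r = 0")
      case True
      then have "\<forall>i<n. r i = 0" by (simp add: dotn_def sum_nonneg_eq_0_iff)
      then show ?thesis by (simp add: dotn_def)
    next
      case False
      have "dotn n (\<lambda>i. (x i - p i) - s * r i) r = dotn n (\<lambda>i. x i - p i) r - s * dotn n r r"
        unfolding dotn_diff_left[of n "\<lambda>i. x i - p i"] dotn_scale_left ..
      then show ?thesis using False by (simp add: s_def)
    qed
    moreover have "dotn n (\<lambda>i. (x i - p i) - s * r i) q = 0"
      unfolding dotn_diff_left[of n "\<lambda>i. x i - p i"] dotn_scale_left using rq[OF xp] rq[OF r] by simp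
    ultimately show ?thesis by (subst v) (simp add: dotn_add_right)
  qed
  moreover have "dotn n (\<lambda>i. (x i - p i) - s * r i) w = 0" if "w \<in> set vs" for w
    unfolding dotn_diff_left[of n "\<lambda>i. x i - p i"] dotn_scale_left using xp[OF that] r[OF that] by simp
  ultimately show ?case
    by (intro exI[of _ ?c], unfold e) auto
qed simp

text \<open>The remainder \<open>x - p\<close> has to be recognised as a kernel vector of
  \<open>A\<close>, hence as an invariant direction; solving least squares for the rows provides
  this without inverting a matrix.\<close>

lemma row_space_projection:
  assumes A: "A \<in> carrier_mat k n"
  obtains p where "orth_proj (vec_space.row_space n A) (vec n x) = vec n p"
    "\<And>i. i < k \<Longrightarrow> dotn n (\<lambda>j. A $$ (i, j)) (\<lambda>i. x i - p i) = 0"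
    "dotn n p (\<lambda>i. x i - p i) = 0"
proof -
  interpret vec_space "TYPE(real)" n .
  let ?vs = "map (\<lambda>i j. A $$ (i, j)) [0..<k]"
  obtain c where c: "\<forall>v\<in>set ?vs. dotn n (\<lambda>i. x i - (\<Sum>j<length ?vs. c j * (?vs ! j) i)) v = 0"
    using least_squares_exists by blast
  define p where "p = (\<lambda>i. \<Sum>j<k. c j * A $$ (j, i))"
  have ps: "(\<lambda>i. \<Sum>j<length ?vs. c j * (?vs ! j) i) = p" by (simp add: p_def)
  have orth: "dotn n (\<lambda>j. A $$ (i, j)) (\<lambda>i. x i - p i) = 0" if "i < k" for i
    using c that unfolding ps[symmetric] by (auto simp: dotn_commute)
  have rs: "row_space A = {w. \<exists>y\<in>carrier_vec k. A\<^sup>T *\<^sub>v y = w}"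
    using row_space_eq[OF A] A by auto
  have orth_w: "dotn n (\<lambda>i. \<Sum>j<k. y j * A $$ (j, i)) (\<lambda>i. x i - p i) = 0" for y
    using orth by (simp add: dotn_left)
  have comb: "A\<^sup>T *\<^sub>v y = vec n (\<lambda>i. \<Sum>j<k. y $ j * A $$ (j, i))" if "y \<in> carrier_vec k" for y
    using that A by (auto simp: scalar_prod_def atLeast0LessThan mult.commute intro!: sum.cong)
  have "orth_proj (row_space A) (vec n x) = vec n p"
  proof (rule orth_proj_eqI)
    show "row_space A \<subseteq> carrier_vec n" using A by (auto simp: rs)
    show "u - v \<in> row_space A" if "u \<in> row_space A" "v \<in> row_space A" for u v
    proof -
      obtain y z where yz: "y \<in> carrier_vec k" "z \<in> carrier_vec k" "u = A\<^sup>T *\<^sub>v y" "v = A\<^sup>T *\<^sub>v z"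
        using \<open>u \<in> row_space A\<close> \<open>v \<in> row_space A\<close> unfolding rs by blast
      have "A\<^sup>T *\<^sub>v (y - z) = u - v"
        unfolding yz(3,4) using A yz(1,2) by (intro mult_minus_distrib_mat_vec) auto
      then show ?thesis unfolding rs using yz by (auto intro!: bexI[of _ "y - z"])
    qed
    show "vec n p \<in> row_space A"
      unfolding rs using comb[of "vec k c"] by (auto simp: p_def intro!: bexI[of _ "vec k c"])
    fix w assume "w \<in> row_space A"
    then obtain y where y: "y \<in> carrier_vec k" "w = A\<^sup>T *\<^sub>v y" unfolding rs by blast
    have "vec n x - vec n p = vec n (\<lambda>i. x i - p i)" by auto
    then show "(vec n x - vec n p) \<bullet> w = 0"
      using orth_w[of "\<lambda>j. y $ j"] unfolding y(2) comb[OF y(1)] by (simp add: scalar_prod_vec dotn_commute)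
  qed simp
  moreover have "dotn n p (\<lambda>i. x i - p i) = 0" using orth_w[of c] by (simp add: p_def)
  ultimately show ?thesis using orth by (intro that) auto
qed

section \<open>Timed correctness rules for the machine\<close>

text \<open>The counters for steps and queries never influence execution, so correctness is stated
  on the other components; steps reappear as the time bound in \<open>runs\<close>.\<close>

type_synonym conf = "(nat \<Rightarrow> nat) \<times> (nat \<Rightarrow> real) \<times> nat"

fun ieff :: "oracle_fn \<Rightarrow> tape \<Rightarrow> instr \<Rightarrow> conf \<Rightarrow> conf" where
  "ieff Q \<omega> (Const a c) (I, m, d) = (I(a := c), m, d)"
| "ieff Q \<omega> (NatOp f a b c) (I, m, d) = (I(a := apply_nat_op f (I b) (I c)), m, d)"
| "ieff Q \<omega> (Of_Nat a b) (I, m, d) = (I, m(I a := real (I b)), d)"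
| "ieff Q \<omega> (Copy a b) (I, m, d) = (I, m(I a := m (I b)), d)"
| "ieff Q \<omega> (RealOp f a b c) (I, m, d) = (I, m(I a := apply_real_op f (m (I b)) (m (I c))), d)"
| "ieff Q \<omega> (Gauss a) (I, m, d) = (I, m(I a := \<omega> d), Suc d)"
| "ieff Q \<omega> (Query a b) (I, m, d) = (I(a := Q (\<lambda>j. m (I b + j))), m, d)"

fun tholds :: "test \<Rightarrow> conf \<Rightarrow> bool" where
  "tholds (NLess a b) (I, m, d) \<longleftrightarrow> I a < I b"
| "tholds (RLess a b) (I, m, d) \<longleftrightarrow> m (I a) < m (I b)"

definition conf_of :: "state \<Rightarrow> conf" where
  "conf_of s = (idx s, mem s, drawn s)"

lemma conf_of_tick [simp]: "conf_of (tick s) = conf_of s"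
  by (simp add: conf_of_def tick_def)

lemma conf_of_effect: "conf_of (effect Q \<omega> i s) = ieff Q \<omega> i (conf_of s)"
  by (cases i) (simp_all add: conf_of_def set_idx_def set_mem_def cell_def)

lemma holds_conf: "holds b s \<longleftrightarrow> tholds b (conf_of s)"
  by (cases b) (simp_all add: conf_of_def cell_def)

lemma steps_effect [simp]: "steps (effect Q \<omega> i s) = steps s"
  by (cases i) (simp_all add: set_idx_def set_mem_def)

lemma steps_tick [simp]: "steps (tick s) = steps s + 1" "queries (tick s) = queries s"
  by (simp_all add: tick_def)

lemma queries_effect: "queries (effect Q \<omega> i s) \<le> queries s + 1"
  by (cases i) (simp_all add: set_idx_def set_mem_def)

text \<open>A query is an instruction and every instruction costs a step, so time bounds
  suffice.\<close>

lemma exec_queries_le_steps: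
  "exec Q \<omega> c s s' \<Longrightarrow> queries s' + steps s \<le> queries s + steps s'"
proof (induction rule: exec.induct)
  case (Instr i s)
  then show ?case using queries_effect[of Q \<omega> i s] by simp
qed simp_all

inductive_cases exec_InstrE: "exec Q \<omega> (Instr i) s s'"
inductive_cases exec_SeqE: "exec Q \<omega> (Seq c1 c2) s s'"
inductive_cases exec_CondE: "exec Q \<omega> (Cond b c1 c2) s s'"
inductive_cases exec_WhileE: "exec Q \<omega> (While b c) s s'"

text \<open>Turns an existential statement about runs into one about the run that is constructed, so
  that success becomes a predicate of the tape.\<close>

lemma exec_deterministic:
  "exec Q \<omega> c s s' \<Longrightarrow> exec Q \<omega> c s s'' \<Longrightarrow> s' = s''"
proof (induction arbitrary: s'' rule: exec.induct)
  case (Instr i s)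
  then show ?case by (auto elim: exec_InstrE)
next
  case (Seq c1 s s1 c2 s2)
  from Seq.prems obtain r where r: "exec Q \<omega> c1 s r" "exec Q \<omega> c2 r s''" by (rule exec_SeqE)
  show ?case using Seq.IH(1)[OF r(1)] Seq.IH(2) r(2) by simp
next
  case (CondT b s c1 s' c2)
  from CondT.prems CondT.hyps(1) have "exec Q \<omega> c1 (tick s) s''" by (auto elim: exec_CondE)
  then show ?case by (rule CondT.IH)
next
  case (CondF b s c2 s' c1)
  from CondF.prems CondF.hyps(1) have "exec Q \<omega> c2 (tick s) s''" by (auto elim: exec_CondE)
  then show ?case by (rule CondF.IH)
next
  case (WhileT b s c s1 s2)
  from WhileT.prems WhileT.hyps(1) obtain r where
    r: "exec Q \<omega> c (tick s) r" "exec Q \<omega> (While b c) r s''" by (auto elim: exec_WhileE)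
  show ?case using WhileT.IH(1)[OF r(1)] WhileT.IH(2) r(2) by simp
next
  case (WhileF b s c)
  from WhileF.prems WhileF.hyps show ?case by (auto elim: exec_WhileE)
qed

text \<open>A total-correctness triple with a time bound; termination is part of it.\<close>

definition runs :: "oracle_fn \<Rightarrow> tape \<Rightarrow> (conf \<Rightarrow> bool) \<Rightarrow> com \<Rightarrow> nat \<Rightarrow> (conf \<Rightarrow> bool) \<Rightarrow> bool" where
  "runs Q \<omega> P c t R \<longleftrightarrow> (\<forall>s. P (conf_of s) \<longrightarrow>
     (\<exists>s'. exec Q \<omega> c s s' \<and> steps s' \<le> steps s + t \<and> R (conf_of s')))"

lemma runs_conseq:
  assumes "runs Q \<omega> P c t R" "\<And>\<sigma>. P' \<sigma> \<Longrightarrow> P \<sigma>" "\<And>\<sigma>. R \<sigma> \<Longrightarrow> R' \<sigma>" "t \<le> t'"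
  shows "runs Q \<omega> P' c t' R'"
  unfolding runs_def
proof (intro allI impI)
  fix s assume "P' (conf_of s)"
  with assms(1,2) obtain s' where "exec Q \<omega> c s s'" "steps s' \<le> steps s + t" "R (conf_of s')"
    unfolding runs_def by blast
  with assms(3,4) show "\<exists>s'. exec Q \<omega> c s s' \<and> steps s' \<le> steps s + t' \<and> R' (conf_of s')"
    by (intro exI[of _ s']) auto
qed

lemma runs_Instr:
  assumes "\<And>\<sigma>. P \<sigma> \<Longrightarrow> R (ieff Q \<omega> i \<sigma>)"
  shows "runs Q \<omega> P (Instr i) 1 R"
  unfolding runs_def
  by (intro allI impI exI[of _ "tick (effect Q \<omega> i _)"]) (auto simp: conf_of_effect intro: exec.Instr assms)

lemma runs_Seq:
  assumes 1: "runs Q \<omega> P c1 t1 R" and 2: "runs Q \<omega> R c2 t2 S"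
  shows "runs Q \<omega> P (Seq c1 c2) (t1 + t2) S"
  unfolding runs_def
proof (intro allI impI)
  fix s assume "P (conf_of s)"
  with 1 obtain s1 where s1: "exec Q \<omega> c1 s s1" "steps s1 \<le> steps s + t1" "R (conf_of s1)"
    unfolding runs_def by blast
  with 2 obtain s2 where s2: "exec Q \<omega> c2 s1 s2" "steps s2 \<le> steps s1 + t2" "S (conf_of s2)"
    unfolding runs_def by blast
  from s1 s2 show "\<exists>s'. exec Q \<omega> (Seq c1 c2) s s' \<and> steps s' \<le> steps s + (t1 + t2) \<and> S (conf_of s')"
    by (intro exI[of _ s2]) (auto intro: exec.Seq)
qed

lemma runs_Cond:
  assumes 1: "runs Q \<omega> (\<lambda>\<sigma>. P \<sigma> \<and> tholds b \<sigma>) c1 t R"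
    and 2: "runs Q \<omega> (\<lambda>\<sigma>. P \<sigma> \<and> \<not> tholds b \<sigma>) c2 t R"
  shows "runs Q \<omega> P (Cond b c1 c2) (t + 1) R"
  unfolding runs_def
proof (intro allI impI)
  fix s assume P: "P (conf_of s)"
  show "\<exists>s'. exec Q \<omega> (Cond b c1 c2) s s' \<and> steps s' \<le> steps s + (t + 1) \<and> R (conf_of s')"
  proof (cases "holds b s")
    case True
    with 1 P obtain s' where "exec Q \<omega> c1 (tick s) s'" "steps s' \<le> steps (tick s) + t" "R (conf_of s')"
      unfolding runs_def holds_conf by (metis conf_of_tick)
    then show ?thesis using True by (intro exI[of _ s']) (auto intro: exec.CondT)
  next
    case False
    with 2 P obtain s' where "exec Q \<omega> c2 (tick s) s'" "steps s' \<le> steps (tick s) + t" "R (conf_of s')"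
      unfolding runs_def holds_conf by (metis conf_of_tick)
    then show ?thesis using False by (intro exI[of _ s']) (auto intro: exec.CondF)
  qed
qed

text \<open>The invariant is indexed by the iteration number and decides the test, so the number of
  iterations, and with it the time, is exact.\<close>

lemma runs_While:
  assumes test: "\<And>j \<sigma>. j \<le> N \<Longrightarrow> Inv j \<sigma> \<Longrightarrow> tholds b \<sigma> \<longleftrightarrow> j < N"
    and body: "\<And>j. j < N \<Longrightarrow> runs Q \<omega> (Inv j) c t (Inv (Suc j))"
  shows "runs Q \<omega> (Inv 0) (While b c) (N * (t + 1) + 1) (Inv N)"
proof -
  have "\<exists>s'. exec Q \<omega> (While b c) s s' \<and> steps s' \<le> steps s + ((N - j) * (t + 1) + 1) \<and> Inv N (conf_of s')"
    if "j \<le> N" "Inv j (conf_of s)" for j s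
    using that
  proof (induction "N - j" arbitrary: j s)
    case 0
    then have "\<not> holds b s" "j = N" using test[of j "conf_of s"] by (auto simp: holds_conf)
    then show ?case using 0 by (intro exI[of _ "tick s"]) (auto intro: exec.WhileF)
  next
    case (Suc x)
    then have j: "j < N" by simp
    then have h: "holds b s" using test[of j "conf_of s"] Suc.prems by (auto simp: holds_conf)
    have "Inv j (conf_of (tick s))" using Suc.prems by simp
    then obtain s1 where s1: "exec Q \<omega> c (tick s) s1" "steps s1 \<le> steps (tick s) + t" "Inv (Suc j) (conf_of s1)"
      using body[OF j] unfolding runs_def by blast
    have x: "x = N - Suc j" "Suc j \<le> N" using Suc.hyps j by auto
    obtain s2 where s2: "exec Q \<omega> (While b c) s1 s2" "steps s2 \<le> steps s1 + (x * (t + 1) + 1)" "Inv N (conf_of s2)"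
      using Suc.hyps(1)[OF x s1(3)] x by auto
    have "exec Q \<omega> (While b c) s s2" using h s1(1) s2(1) by (rule exec.WhileT)
    moreover have "steps s2 \<le> steps s + ((N - j) * (t + 1) + 1)"
      using s1(2) s2(2) unfolding Suc.hyps(2)[symmetric] by simp
    ultimately show ?case using s2(3) by blast
  qed
  from this[of 0] show ?thesis unfolding runs_def by simp
qed

section \<open>Straight-line code and counted loops\<close>

fun block :: "instr list \<Rightarrow> com" where
  "block [] = Instr (Const 30 0)"
| "block [i] = Instr i"
| "block (i # is) = Seq (Instr i) (block is)"

fun ieffs :: "oracle_fn \<Rightarrow> tape \<Rightarrow> instr list \<Rightarrow> conf \<Rightarrow> conf" where
  "ieffs Q \<omega> [] \<sigma> = \<sigma>"
| "ieffs Q \<omega> (i # is) \<sigma> = ieffs Q \<omega> is (ieff Q \<omega> i \<sigma>)"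

lemma runs_block:
  assumes "is \<noteq> []" "\<And>\<sigma>. P \<sigma> \<Longrightarrow> R (ieffs Q \<omega> is \<sigma>)"
  shows "runs Q \<omega> P (block is) (length is) R"
  using assms
proof (induction "is" arbitrary: P rule: block.induct)
  case (2 i)
  have "runs Q \<omega> P (Instr i) 1 R" by (rule runs_Instr) (use 2 in simp)
  then show ?case by simp
next
  case (3 i i' "is")
  have "runs Q \<omega> P (Instr i) 1 (\<lambda>\<sigma>. R (ieffs Q \<omega> (i' # is) \<sigma>))"
    by (rule runs_Instr) (use 3 in simp)
  from runs_Seq[OF this 3(1)] show ?case by simp
qed simp

text \<open>The increment is read from register \<open>3\<close>, which must hold \<open>1\<close>;
  loop bodies have to preserve this.\<close>

definition for_loop :: "nat \<Rightarrow> nat \<Rightarrow> com \<Rightarrow> com" where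
  "for_loop i cnt body =
     Seq (Instr (Const i 0)) (While (NLess i cnt) (Seq body (Instr (NatOp NAdd i i 3))))"

lemma runs_for:
  assumes init: "\<And>I m d. P (I, m, d) \<Longrightarrow> Inv 0 (I(i := 0), m, d)"
    and regs: "\<And>j I m d. j \<le> N \<Longrightarrow> Inv j (I, m, d) \<Longrightarrow> I i = j \<and> I cnt = N"
    and body: "\<And>j. j < N \<Longrightarrow> runs Q \<omega> (Inv j) body t (\<lambda>(I, m, d). I 3 = 1 \<and> Inv (Suc j) (I(i := Suc (I i)), m, d))"
  shows "runs Q \<omega> P (for_loop i cnt body) (N * (t + 2) + 2) (Inv N)"
proof -
  have "runs Q \<omega> (Inv j) (Seq body (Instr (NatOp NAdd i i 3))) (t + 1) (Inv (Suc j))" if "j < N" for j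
    by (rule runs_Seq[OF body[OF that]], rule runs_Instr) auto
  moreover have "tholds (NLess i cnt) \<sigma> \<longleftrightarrow> j < N" if "j \<le> N" "Inv j \<sigma>" for j \<sigma>
    using regs[OF that(1)] that(2) by (cases \<sigma>) auto
  ultimately have "runs Q \<omega> (Inv 0) (While (NLess i cnt) (Seq body (Instr (NatOp NAdd i i 3)))) (N * (t + 1 + 1) + 1) (Inv N)"
    by (intro runs_While)
  moreover have "runs Q \<omega> P (Instr (Const i 0)) 1 (Inv 0)"
    by (rule runs_Instr) (use init in auto)
  ultimately have "runs Q \<omega> P (for_loop i cnt body) (1 + (N * (t + 1 + 1) + 1)) (Inv N)"
    unfolding for_loop_def by (intro runs_Seq)
  then show ?thesis by (rule runs_conseq) auto
qed

lemma runs_for_block: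
  assumes init: "\<And>I m d. P (I, m, d) \<Longrightarrow> Inv 0 (I(i := 0), m, d)"
    and regs: "\<And>j I m d. j \<le> N \<Longrightarrow> Inv j (I, m, d) \<Longrightarrow> I i = j \<and> I cnt = N"
    and "is \<noteq> []"
    and body: "\<And>j I m d. j < N \<Longrightarrow> Inv j (I, m, d) \<Longrightarrow>
      (\<lambda>(I, m, d). I 3 = 1 \<and> Inv (Suc j) (I(i := Suc (I i)), m, d)) (ieffs Q \<omega> is (I, m, d))"
  shows "runs Q \<omega> P (for_loop i cnt (block is)) (N * (length is + 2) + 2) (Inv N)"
proof (rule runs_for)
  show "Inv 0 (I(i := 0), m, d)" if "P (I, m, d)" for I m d using that by (rule init)
  show "I i = j \<and> I cnt = N" if "j \<le> N" "Inv j (I, m, d)" for j I m d using that by (rule regs)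
  fix j assume "j < N"
  then have "(\<lambda>(I, m, d). I 3 = 1 \<and> Inv (Suc j) (I(i := Suc (I i)), m, d)) (ieffs Q \<omega> is \<sigma>)"
    if "Inv j \<sigma>" for \<sigma>
    using body[of j "fst \<sigma>" "fst (snd \<sigma>)" "snd (snd \<sigma>)"] that by simp
  with \<open>is \<noteq> []\<close> show "runs Q \<omega> (Inv j) (block is) (length is)
      (\<lambda>(I, m, d). I 3 = 1 \<and> Inv (Suc j) (I(i := Suc (I i)), m, d))"
    by (rule runs_block)
qed

lemma runs_pointwise:
  assumes "\<And>I m d. P (I, m, d) \<Longrightarrow> runs Q \<omega> (\<lambda>\<sigma>. \<sigma> = (I, m, d)) c t R"
  shows "runs Q \<omega> P c t R"
  unfolding runs_def
proof (intro allI impI)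
  fix s assume "P (conf_of s)"
  with assms show "\<exists>s'. exec Q \<omega> c s s' \<and> steps s' \<le> steps s + t \<and> R (conf_of s')"
    unfolding runs_def conf_of_def by blast
qed

text \<open>The cells from \<open>B\<close> on hold \<open>h\<close>, \<open>T\<^sub>0\<close>, \<open>\<theta>\<close>, \<open>thr\<close>, the scalar and the two bisection variables of the round, two
  scratch cells and \<open>1 / 2\<close>. They are followed by arrays of length \<open>n\<close> for the direction, the slopes, the
  base point, the offset and the query point, and by the rows found so far. Registers 30 to 34 are
  scratch, 35 to 39 are loop counters.\<close>

definition lay :: "nat \<Rightarrow> nat \<Rightarrow> (nat \<Rightarrow> nat) \<Rightarrow> bool" where
  "lay n B I \<longleftrightarrow> I 0 = n \<and> I 3 = 1 \<and> I 4 = 0 \<and> I 10 = B \<and> I 11 = B + 1 \<and> I 12 = B + 2 \<and>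
     I 13 = B + 3 \<and> I 14 = B + 4 \<and> I 15 = B + 5 \<and> I 16 = B + 6 \<and> I 17 = B + 7 \<and> I 18 = B + 8 \<and>
     I 19 = B + 9 \<and> I 20 = B + 10 \<and> I 21 = B + 10 + n \<and> I 22 = B + 10 + 2 * n \<and>
     I 23 = B + 10 + 3 * n \<and> I 24 = B + 10 + 4 * n \<and> I 25 = B + 10 + 5 * n"

text \<open>With scalar \<open>1\<close> this copies an array and with scalar \<open>0\<close> it
  clears one.\<close>

definition scale_com :: "nat \<Rightarrow> nat \<Rightarrow> com" where
  "scale_com p q = for_loop 30 0
     (block [NatOp NAdd 31 p 30, NatOp NAdd 32 q 30, RealOp RMul 32 14 31])"

lemma scale_runs:
  assumes lay: "lay n B I\<^sub>0" and p: "p \<notin> {30, 31, 32}" "q \<notin> {30, 31, 32}"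
    and a: "I\<^sub>0 p = a" "I\<^sub>0 q = a'" "B + 10 \<le> a'" "a + n \<le> a' \<or> a' + n \<le> a"
  shows "runs Q \<omega> (\<lambda>\<sigma>. \<sigma> = (I\<^sub>0, m\<^sub>0, d\<^sub>0)) (scale_com p q) (n * 5 + 2) (\<lambda>(I, m, d).
     (\<forall>r. r \<notin> {30, 31, 32} \<longrightarrow> I r = I\<^sub>0 r) \<and> d = d\<^sub>0 \<and>
     m = (\<lambda>x. if a' \<le> x \<and> x < a' + n then m\<^sub>0 (B + 4) * m\<^sub>0 (a + (x - a')) else m\<^sub>0 x))"
proof -
  let ?Inv = "\<lambda>j (I, m, d). I 30 = j \<and> (\<forall>r. r \<notin> {30, 31, 32} \<longrightarrow> I r = I\<^sub>0 r) \<and> d = d\<^sub>0 \<and>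
     m = (\<lambda>x. if a' \<le> x \<and> x < a' + j then m\<^sub>0 (B + 4) * m\<^sub>0 (a + (x - a')) else m\<^sub>0 x)"
  have L: "I\<^sub>0 0 = n" "I\<^sub>0 3 = 1" "I\<^sub>0 14 = B + 4" using lay by (auto simp: lay_def)
  have "runs Q \<omega> (\<lambda>\<sigma>. \<sigma> = (I\<^sub>0, m\<^sub>0, d\<^sub>0)) (scale_com p q) (n * (length [NatOp NAdd 31 p 30, NatOp NAdd 32 q 30, RealOp RMul 32 14 31] + 2) + 2) (?Inv n)"
    unfolding scale_com_def
  proof (rule runs_for_block[where Inv = ?Inv])
      fix j I m d assume j: "j < n" and i: "?Inv j (I, m, d)"
      from i have i: "I 30 = j" "\<And>r. r \<notin> {30, 31, 32} \<Longrightarrow> I r = I\<^sub>0 r" "d = d\<^sub>0"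
        "m = (\<lambda>x. if a' \<le> x \<and> x < a' + j then m\<^sub>0 (B + 4) * m\<^sub>0 (a + (x - a')) else m\<^sub>0 x)"
        by auto
      have pq: "I p = a" "I q = a'" "I 14 = B + 4" "I 3 = 1"
        using i(2)[of p] i(2)[of q] i(2)[of 14] i(2)[of 3] p a L by auto
      have mm: "m (B + 4) = m\<^sub>0 (B + 4)" "m (a + j) = m\<^sub>0 (a + j)"
        using a j by (auto simp: i(4))
      show "(\<lambda>(I, m, d). I 3 = 1 \<and> ?Inv (Suc j) (I(30 := Suc (I 30)), m, d))
          (ieffs Q \<omega> [NatOp NAdd 31 p 30, NatOp NAdd 32 q 30, RealOp RMul 32 14 31] (I, m, d))"
        using p pq mm i(1,2,3) by (auto simp: fun_eq_iff) (auto simp: i(4))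
  qed (use L in auto)
  then show ?thesis by (rule runs_conseq) auto
qed

definition gauss_com :: com where
  "gauss_com = for_loop 30 0 (block [NatOp NAdd 31 23 30, Gauss 31])"

lemma gauss_runs:
  assumes lay: "lay n B I\<^sub>0"
  shows "runs Q \<omega> (\<lambda>\<sigma>. \<sigma> = (I\<^sub>0, m\<^sub>0, d\<^sub>0)) gauss_com (n * 4 + 2) (\<lambda>(I, m, d).
     (\<forall>r. r \<notin> {30, 31, 32} \<longrightarrow> I r = I\<^sub>0 r) \<and> d = d\<^sub>0 + n \<and>
     m = (\<lambda>x. if B + 10 + 3 * n \<le> x \<and> x < B + 10 + 3 * n + n then \<omega> (d\<^sub>0 + (x - (B + 10 + 3 * n))) else m\<^sub>0 x))"
proof -
  let ?a = "B + 10 + 3 * n"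
  let ?Inv = "\<lambda>j (I, m, d). I 30 = j \<and> (\<forall>r. r \<notin> {30, 31, 32} \<longrightarrow> I r = I\<^sub>0 r) \<and> d = d\<^sub>0 + j \<and>
     m = (\<lambda>x. if ?a \<le> x \<and> x < ?a + j then \<omega> (d\<^sub>0 + (x - ?a)) else m\<^sub>0 x)"
  have L: "I\<^sub>0 0 = n" "I\<^sub>0 3 = 1" "I\<^sub>0 23 = ?a" using lay by (auto simp: lay_def)
  have "runs Q \<omega> (\<lambda>\<sigma>. \<sigma> = (I\<^sub>0, m\<^sub>0, d\<^sub>0)) gauss_com (n * (length [NatOp NAdd 31 23 30, Gauss 31] + 2) + 2) (?Inv n)"
    unfolding gauss_com_def
  proof (rule runs_for_block[where Inv = ?Inv])
      fix j I m d assume j: "j < n" and i: "?Inv j (I, m, d)"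
      from i have i: "I 30 = j" "\<And>r. r \<notin> {30, 31, 32} \<Longrightarrow> I r = I\<^sub>0 r" "d = d\<^sub>0 + j"
        "m = (\<lambda>x. if ?a \<le> x \<and> x < ?a + j then \<omega> (d\<^sub>0 + (x - ?a)) else m\<^sub>0 x)"
        by auto
      have pq: "I 23 = ?a" "I 3 = 1" using i(2)[of 23] i(2)[of 3] L by auto
      show "(\<lambda>(I, m, d). I 3 = 1 \<and> ?Inv (Suc j) (I(30 := Suc (I 30)), m, d))
          (ieffs Q \<omega> [NatOp NAdd 31 23 30, Gauss 31] (I, m, d))"
        using pq i(1,2,3) by (auto simp: fun_eq_iff) (auto simp: i(4))
  qed (use L in auto)
  then show ?thesis by (rule runs_conseq) auto
qed

definition axpy_com :: com where
  "axpy_com = for_loop 30 0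
     (block [NatOp NAdd 31 20 30, NatOp NAdd 32 26 30, RealOp RMul 17 14 32, RealOp RSub 31 31 17])"

lemma axpy_runs:
  assumes lay: "lay n B I\<^sub>0" and a: "I\<^sub>0 26 = a" "B + 10 + n \<le> a"
  shows "runs Q \<omega> (\<lambda>\<sigma>. \<sigma> = (I\<^sub>0, m\<^sub>0, d\<^sub>0)) axpy_com (n * 6 + 2) (\<lambda>(I, m, d).
     (\<forall>r. r \<notin> {30, 31, 32} \<longrightarrow> I r = I\<^sub>0 r) \<and> d = d\<^sub>0 \<and>
     (\<forall>x. x \<noteq> B + 7 \<longrightarrow> m x = (if B + 10 \<le> x \<and> x < B + 10 + n
        then m\<^sub>0 x - m\<^sub>0 (B + 4) * m\<^sub>0 (a + (x - (B + 10))) else m\<^sub>0 x)))"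
proof -
  let ?is = "[NatOp NAdd 31 20 30, NatOp NAdd 32 26 30, RealOp RMul 17 14 32, RealOp RSub 31 31 17]"
  let ?Inv = "\<lambda>j (I, m, d). I 30 = j \<and> (\<forall>r. r \<notin> {30, 31, 32} \<longrightarrow> I r = I\<^sub>0 r) \<and> d = d\<^sub>0 \<and>
     (\<forall>x. x \<noteq> B + 7 \<longrightarrow> m x = (if B + 10 \<le> x \<and> x < B + 10 + j
        then m\<^sub>0 x - m\<^sub>0 (B + 4) * m\<^sub>0 (a + (x - (B + 10))) else m\<^sub>0 x))"
  have L: "I\<^sub>0 0 = n" "I\<^sub>0 3 = 1" "I\<^sub>0 14 = B + 4" "I\<^sub>0 17 = B + 7" "I\<^sub>0 20 = B + 10"
    using lay by (auto simp: lay_def)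
  have "runs Q \<omega> (\<lambda>\<sigma>. \<sigma> = (I\<^sub>0, m\<^sub>0, d\<^sub>0)) axpy_com (n * (length ?is + 2) + 2) (?Inv n)"
    unfolding axpy_com_def
  proof (rule runs_for_block[where Inv = ?Inv])
      fix j I m d assume j: "j < n" and i: "?Inv j (I, m, d)"
      from i have i: "I 30 = j" "\<And>r. r \<notin> {30, 31, 32} \<Longrightarrow> I r = I\<^sub>0 r" "d = d\<^sub>0"
        "\<And>x. x \<noteq> B + 7 \<Longrightarrow> m x = (if B + 10 \<le> x \<and> x < B + 10 + j
        then m\<^sub>0 x - m\<^sub>0 (B + 4) * m\<^sub>0 (a + (x - (B + 10))) else m\<^sub>0 x)"
        by auto
      have pq: "I 26 = a" "I 20 = B + 10" "I 14 = B + 4" "I 17 = B + 7" "I 3 = 1"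
        using i(2)[of 26] i(2)[of 20] i(2)[of 14] i(2)[of 17] i(2)[of 3] a L by auto
      have mm: "m (B + 4) = m\<^sub>0 (B + 4)" "m (a + j) = m\<^sub>0 (a + j)" "m (B + 10 + j) = m\<^sub>0 (B + 10 + j)"
        using a j by (auto simp: i(4))
      show "(\<lambda>(I, m, d). I 3 = 1 \<and> ?Inv (Suc j) (I(30 := Suc (I 30)), m, d)) (ieffs Q \<omega> ?is (I, m, d))"
        using pq mm i(1,2,3) a by auto (auto simp: i(4))
  qed (use L in auto)
  then show ?thesis by (rule runs_conseq) auto
qed

text \<open>The accumulator is cleared by subtracting it from itself, as programs contain no real
  constants.\<close>

definition dot_com :: "nat \<Rightarrow> nat \<Rightarrow> nat \<Rightarrow> com" where
  "dot_com p q t = Seq (Instr (RealOp RSub t t t)) (for_loop 30 0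
     (block [NatOp NAdd 31 p 30, NatOp NAdd 32 q 30, RealOp RMul 17 31 32, RealOp RAdd t t 17]))"

lemma dot_runs:
  assumes lay: "lay n B I\<^sub>0" and p: "p \<notin> {30, 31, 32}" "q \<notin> {30, 31, 32}" "t \<in> {14, 15}"
    and a: "I\<^sub>0 p = a" "I\<^sub>0 q = a'" "B + 10 \<le> a" "B + 10 \<le> a'"
  shows "runs Q \<omega> (\<lambda>\<sigma>. \<sigma> = (I\<^sub>0, m\<^sub>0, d\<^sub>0)) (dot_com p q t) (n * 6 + 3) (\<lambda>(I, m, d).
     (\<forall>r. r \<notin> {30, 31, 32} \<longrightarrow> I r = I\<^sub>0 r) \<and> d = d\<^sub>0 \<and>
     (\<forall>x. x \<noteq> B + 7 \<longrightarrow> m x = (if x = I\<^sub>0 t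
        then dotn n (\<lambda>i. m\<^sub>0 (a + i)) (\<lambda>i. m\<^sub>0 (a' + i)) else m\<^sub>0 x)))"
proof -
  let ?is = "[NatOp NAdd 31 p 30, NatOp NAdd 32 q 30, RealOp RMul 17 31 32, RealOp RAdd t t 17]"
  let ?Inv = "\<lambda>j (I, m, d). I 30 = j \<and> (\<forall>r. r \<notin> {30, 31, 32} \<longrightarrow> I r = I\<^sub>0 r) \<and> d = d\<^sub>0 \<and>
     (\<forall>x. x \<noteq> B + 7 \<longrightarrow> m x = (if x = I\<^sub>0 t
        then dotn j (\<lambda>i. m\<^sub>0 (a + i)) (\<lambda>i. m\<^sub>0 (a' + i)) else m\<^sub>0 x))"
  have L: "I\<^sub>0 0 = n" "I\<^sub>0 3 = 1" "I\<^sub>0 17 = B + 7" "I\<^sub>0 t \<in> {B + 4, B + 5}"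
    using lay p by (auto simp: lay_def)
  have "runs Q \<omega> (\<lambda>\<sigma>. \<sigma> = (I\<^sub>0, m\<^sub>0(I\<^sub>0 t := 0), d\<^sub>0)) (for_loop 30 0 (block ?is)) (n * (length ?is + 2) + 2) (?Inv n)"
  proof (rule runs_for_block[where Inv = ?Inv])
      fix j I m d assume j: "j < n" and i: "?Inv j (I, m, d)"
      from i have i: "I 30 = j" "\<And>r. r \<notin> {30, 31, 32} \<Longrightarrow> I r = I\<^sub>0 r" "d = d\<^sub>0"
        "\<And>x. x \<noteq> B + 7 \<Longrightarrow> m x = (if x = I\<^sub>0 t
        then dotn j (\<lambda>i. m\<^sub>0 (a + i)) (\<lambda>i. m\<^sub>0 (a' + i)) else m\<^sub>0 x)"
        by auto
      have t: "t \<notin> {30, 31, 32}" using p by auto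
      have pq: "I p = a" "I q = a'" "I t = I\<^sub>0 t" "I 17 = B + 7" "I 3 = 1"
        using i(2)[of p] i(2)[of q] i(2)[of t] i(2)[of 17] i(2)[of 3] a L p t by auto
      have ne: "I\<^sub>0 t \<noteq> B + 7" using L(4) by auto
      have mm: "m (a + j) = m\<^sub>0 (a + j)" "m (a' + j) = m\<^sub>0 (a' + j)"
        "m (I\<^sub>0 t) = dotn j (\<lambda>i. m\<^sub>0 (a + i)) (\<lambda>i. m\<^sub>0 (a' + i))"
        using a j L(4) ne by (auto simp: i(4))
      have dS: "dotn (Suc j) f g = dotn j f g + f j * g j" for f g by (simp add: dotn_def)
      show "(\<lambda>(I, m, d). I 3 = 1 \<and> ?Inv (Suc j) (I(30 := Suc (I 30)), m, d)) (ieffs Q \<omega> ?is (I, m, d))"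
        using pq mm i(1,2,3) a p t ne by (auto simp: dS) (auto simp: i(4))
  qed (use L in \<open>auto simp: dotn_def\<close>)
  moreover have "runs Q \<omega> (\<lambda>\<sigma>. \<sigma> = (I\<^sub>0, m\<^sub>0, d\<^sub>0)) (Instr (RealOp RSub t t t)) 1 (\<lambda>\<sigma>. \<sigma> = (I\<^sub>0, m\<^sub>0(I\<^sub>0 t := 0), d\<^sub>0))"
    by (rule runs_Instr) auto
  ultimately have "runs Q \<omega> (\<lambda>\<sigma>. \<sigma> = (I\<^sub>0, m\<^sub>0, d\<^sub>0)) (dot_com p q t) (1 + (n * (length ?is + 2) + 2)) (?Inv n)"
    unfolding dot_com_def by (rule runs_Seq[rotated])
  then show ?thesis by (rule runs_conseq) auto
qed

definition ask_com :: com where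
  "ask_com = Seq (for_loop 30 0 (block
     [NatOp NAdd 31 22 30, NatOp NAdd 32 23 30, NatOp NAdd 33 20 30, NatOp NAdd 34 24 30,
      RealOp RMul 17 10 32, RealOp RAdd 17 31 17, RealOp RMul 18 14 33, RealOp RAdd 34 17 18]))
     (Instr (Query 27 24))"

lemma ask_runs:
  assumes lay: "lay n B I\<^sub>0"
  shows "runs Q \<omega> (\<lambda>\<sigma>. \<sigma> = (I\<^sub>0, m\<^sub>0, d\<^sub>0)) ask_com (n * 10 + 3) (\<lambda>(I, m, d).
     (\<forall>r. r \<notin> {27, 30, 31, 32, 33, 34} \<longrightarrow> I r = I\<^sub>0 r) \<and> d = d\<^sub>0 \<and>
     I 27 = Q (\<lambda>j. m (B + 10 + 4 * n + j)) \<and>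
     (\<forall>x. x \<notin> {B + 7, B + 8} \<and> \<not> (B + 10 + 4 * n \<le> x \<and> x < B + 10 + 4 * n + n) \<longrightarrow> m x = m\<^sub>0 x) \<and>
     (\<forall>i<n. m (B + 10 + 4 * n + i) = m\<^sub>0 (B + 10 + 2 * n + i) + m\<^sub>0 B * m\<^sub>0 (B + 10 + 3 * n + i)
        + m\<^sub>0 (B + 4) * m\<^sub>0 (B + 10 + i)))"
proof -
  let ?is = "[NatOp NAdd 31 22 30, NatOp NAdd 32 23 30, NatOp NAdd 33 20 30, NatOp NAdd 34 24 30,
      RealOp RMul 17 10 32, RealOp RAdd 17 31 17, RealOp RMul 18 14 33, RealOp RAdd 34 17 18]"
  let ?v = "\<lambda>i. m\<^sub>0 (B + 10 + 2 * n + i) + m\<^sub>0 B * m\<^sub>0 (B + 10 + 3 * n + i) + m\<^sub>0 (B + 4) * m\<^sub>0 (B + 10 + i)"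
  let ?Inv = "\<lambda>j (I, m, d). I 30 = j \<and> (\<forall>r. r \<notin> {30, 31, 32, 33, 34} \<longrightarrow> I r = I\<^sub>0 r) \<and> d = d\<^sub>0 \<and>
     (\<forall>x. x \<notin> {B + 7, B + 8} \<and> \<not> (B + 10 + 4 * n \<le> x \<and> x < B + 10 + 4 * n + n) \<longrightarrow> m x = m\<^sub>0 x) \<and>
     (\<forall>i<j. m (B + 10 + 4 * n + i) = ?v i)"
  have L: "I\<^sub>0 0 = n" "I\<^sub>0 3 = 1" "I\<^sub>0 17 = B + 7" "I\<^sub>0 18 = B + 8" "I\<^sub>0 10 = B" "I\<^sub>0 14 = B + 4"
    "I\<^sub>0 20 = B + 10" "I\<^sub>0 22 = B + 10 + 2 * n" "I\<^sub>0 23 = B + 10 + 3 * n" "I\<^sub>0 24 = B + 10 + 4 * n"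
    using lay by (auto simp: lay_def)
  have loop: "runs Q \<omega> (\<lambda>\<sigma>. \<sigma> = (I\<^sub>0, m\<^sub>0, d\<^sub>0)) (for_loop 30 0 (block ?is)) (n * (length ?is + 2) + 2) (?Inv n)"
  proof (rule runs_for_block[where Inv = ?Inv])
      fix j I m d assume j: "j < n" and i: "?Inv j (I, m, d)"
      from i have i: "I 30 = j" "\<And>r. r \<notin> {30, 31, 32, 33, 34} \<Longrightarrow> I r = I\<^sub>0 r" "d = d\<^sub>0"
        "\<And>x. x \<notin> {B + 7, B + 8} \<and> \<not> (B + 10 + 4 * n \<le> x \<and> x < B + 10 + 4 * n + n) \<Longrightarrow> m x = m\<^sub>0 x"
        "\<And>i. i < j \<Longrightarrow> m (B + 10 + 4 * n + i) = ?v i"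
        by auto
      have pq: "I 10 = B" "I 14 = B + 4" "I 17 = B + 7" "I 18 = B + 8" "I 3 = 1" "I 20 = B + 10"
        "I 22 = B + 10 + 2 * n" "I 23 = B + 10 + 3 * n" "I 24 = B + 10 + 4 * n"
        using i(2)[of 10] i(2)[of 14] i(2)[of 17] i(2)[of 18] i(2)[of 3] i(2)[of 20] i(2)[of 22]
          i(2)[of 23] i(2)[of 24] L by auto
      have mm: "m (B + 4) = m\<^sub>0 (B + 4)" "m B = m\<^sub>0 B" "m (B + 10 + j) = m\<^sub>0 (B + 10 + j)"
        "m (B + 10 + 2 * n + j) = m\<^sub>0 (B + 10 + 2 * n + j)" "m (B + 10 + 3 * n + j) = m\<^sub>0 (B + 10 + 3 * n + j)"
        using j by (auto simp: i(4))
      show "(\<lambda>(I, m, d). I 3 = 1 \<and> ?Inv (Suc j) (I(30 := Suc (I 30)), m, d)) (ieffs Q \<omega> ?is (I, m, d))"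
        using pq mm i(1,2,3) j by (auto simp: less_Suc_eq i(4) i(5))
  qed (use L in auto)
  have query: "runs Q \<omega> (?Inv n) (Instr (Query 27 24)) 1 (\<lambda>(I, m, d).
     (\<forall>r. r \<notin> {27, 30, 31, 32, 33, 34} \<longrightarrow> I r = I\<^sub>0 r) \<and> d = d\<^sub>0 \<and>
     I 27 = Q (\<lambda>j. m (B + 10 + 4 * n + j)) \<and>
     (\<forall>x. x \<notin> {B + 7, B + 8} \<and> \<not> (B + 10 + 4 * n \<le> x \<and> x < B + 10 + 4 * n + n) \<longrightarrow> m x = m\<^sub>0 x) \<and>
     (\<forall>i<n. m (B + 10 + 4 * n + i) = ?v i))"
    by (rule runs_Instr) (use L in \<open>auto split: prod.splits\<close>)
  from runs_Seq[OF loop query] show ?thesis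
    unfolding ask_com_def by (rule runs_conseq) auto
qed

section \<open>Implementation of a round\<close>

text \<open>In this order: direction, slopes, base point, offset, stored rows, the scalar, the two
  bisection variables, the number of rows, the number of wrong answers, the tape position and the
  loop registers. Program steps become record updates.\<close>

record cfg =
  cG :: "nat \<Rightarrow> real"
  cT :: "nat \<Rightarrow> real"
  cX :: "nat \<Rightarrow> real"
  cZ :: "nat \<Rightarrow> real"
  cU :: "nat \<Rightarrow> real"
  cS :: real
  cLO :: real
  cD :: real
  cnum :: nat
  cerr :: nat
  cdrawn :: nat
  cloop :: "nat \<Rightarrow> nat"

text \<open>Zero beyond the last row, like the untouched memory there, so that one function on all
  addresses describes the region of stored rows.\<close>

definition flat :: "nat \<Rightarrow> (nat \<Rightarrow> real) list \<Rightarrow> nat \<Rightarrow> real" where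
  "flat n us x = (if x < length us * n then (us ! (x div n)) (x mod n) else 0)"

lemma flat_row: "j < length us \<Longrightarrow> i < n \<Longrightarrow> flat n us (j * n + i) = (us ! j) i"
proof -
  assume "j < length us" "i < n"
  moreover from this have "j * n + i < length us * n"
    using mult_le_mono1[of "Suc j" "length us" n] by simp
  ultimately show ?thesis by (simp add: flat_def)
qed

lemma flat_snoc:
  assumes "0 < n"
  shows "flat n (us @ [u]) x = (if length us * n \<le> x \<and> x < length us * n + n
    then u (x - length us * n) else flat n us x)"
proof -
  consider "x < length us * n" | "length us * n \<le> x" "x < length us * n + n" | "length us * n + n \<le> x"
    by linarith
  then show ?thesis
  proof cases
    case 1
    then have "x div n < length us" using assms by (simp add: less_mult_imp_div_less)
    with 1 show ?thesis by (simp add: flat_def nth_append)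
  next
    case 2
    define y where "y = x - length us * n"
    have x: "x = y + length us * n" "y < n" using 2 by (auto simp: y_def)
    then have "x div n = length us" "x mod n = y" using assms by auto
    with 2 show ?thesis by (simp add: flat_def y_def)
  qed (simp add: flat_def)
qed

text \<open>The recursion of \<open>resid\<close> takes rows from the front, whereas the loop
  invariant about \<open>take j us\<close> grows at the back.\<close>

lemma resid_snoc:
  "resid n (us @ [u]) g = (\<lambda>i. resid n us g i - dotn n (resid n us g) u / dotn n u u * u i)"
  by (induction us arbitrary: g) simp_all

locale machine = search n b m h T\<^sub>0 \<theta> thr M
  for n b m h T\<^sub>0 \<theta> thr M +
  fixes B k N :: nat and Q :: oracle_fn and \<omega> :: tape
  assumes Q: "Q f = (if M f then 1 else 0)"
    and M_cong: "(\<And>i. i < n \<Longrightarrow> f i = g i) \<Longrightarrow> M f = M g"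
    and n_pos: "0 < n"
begin

definition rregs :: "cfg \<Rightarrow> (nat \<Rightarrow> nat) \<Rightarrow> bool" where
  "rregs c I \<longleftrightarrow> lay n B I \<and> I 1 = k \<and> I 5 = cnum c \<and> I 6 = N \<and> I 7 = m \<and> I 8 = b \<and> I 9 = cerr c \<and>
     I 26 = cloop c 26 \<and> I 35 = cloop c 35 \<and> I 36 = cloop c 36 \<and> I 37 = cloop c 37 \<and>
     I 38 = cloop c 38 \<and> I 39 = cloop c 39"

text \<open>Arrays are compared on their first \<open>n\<close> entries, so record updates may
  prescribe anything beyond; the region of rows is compared on all its addresses.\<close>

definition rmem :: "cfg \<Rightarrow> (nat \<Rightarrow> real) \<Rightarrow> bool" where
  "rmem c mm \<longleftrightarrow>
     mm B = h \<and> mm (B + 1) = T\<^sub>0 \<and> mm (B + 2) = \<theta> \<and> mm (B + 3) = thr \<and> mm (B + 9) = 1 / 2 \<and>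
     mm (B + 4) = cS c \<and> mm (B + 5) = cLO c \<and> mm (B + 6) = cD c \<and>
     (\<forall>i<n. mm (B + 10 + i) = cG c i) \<and> (\<forall>i<n. mm (B + 10 + n + i) = cT c i) \<and>
     (\<forall>i<n. mm (B + 10 + 2 * n + i) = cX c i) \<and> (\<forall>i<n. mm (B + 10 + 3 * n + i) = cZ c i) \<and>
     (\<forall>i. mm (B + 10 + 5 * n + i) = cU c i)"

definition rep :: "cfg \<Rightarrow> conf \<Rightarrow> bool" where
  "rep c = (\<lambda>(I, mm, d). rregs c I \<and> rmem c mm \<and> d = cdrawn c)"

lemma rregs_frame:
  assumes "rregs c I\<^sub>0" "\<And>r. r \<notin> {27, 30, 31, 32, 33, 34} \<Longrightarrow> I r = I\<^sub>0 r"
  shows "rregs c I"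
  using assms by (simp add: rregs_def lay_def)

lemma rregs_update [simp]:
  "rregs (c\<lparr>cG := f\<rparr>) = rregs c" "rregs (c\<lparr>cT := f\<rparr>) = rregs c" "rregs (c\<lparr>cX := f\<rparr>) = rregs c"
  "rregs (c\<lparr>cZ := f\<rparr>) = rregs c" "rregs (c\<lparr>cU := f\<rparr>) = rregs c" "rregs (c\<lparr>cS := x\<rparr>) = rregs c"
  "rregs (c\<lparr>cLO := x\<rparr>) = rregs c" "rregs (c\<lparr>cD := x\<rparr>) = rregs c" "rregs (c\<lparr>cdrawn := y\<rparr>) = rregs c"
  by (simp_all add: rregs_def fun_eq_iff)

abbreviation Runs where "Runs \<equiv> runs Q \<omega>"

lemma rep_pointwise:
  assumes "\<And>I mm d. rep c (I, mm, d) \<Longrightarrow> lay n B I \<Longrightarrow> Runs (\<lambda>\<sigma>. \<sigma> = (I, mm, d)) com t R"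
  shows "Runs (rep c) com t R"
  by (rule runs_pointwise, rule assms) (auto simp: rep_def rregs_def)

lemma lay_simps:
  assumes "lay n B I"
  shows "I 0 = n" "I 14 = B + 4" "I 15 = B + 5" "I 20 = B + 10" "I 21 = B + 10 + n" "I 22 = B + 10 + 2 * n" "I 23 = B + 10 + 3 * n"
  using assms by (simp_all add: lay_def)

text \<open>The registers are framed in the same way for every vector operation; doing it here
  reduces each operation to its effect on memory.\<close>

lemma rep_macro:
  assumes run: "\<And>I\<^sub>0 m\<^sub>0 d\<^sub>0. lay n B I\<^sub>0 \<Longrightarrow> I\<^sub>0 26 = cloop c 26 \<Longrightarrow> I\<^sub>0 14 = B + 4 \<Longrightarrow> I\<^sub>0 15 = B + 5 \<Longrightarrow> I\<^sub>0 20 = B + 10 \<Longrightarrow> I\<^sub>0 21 = B + 10 + n \<Longrightarrow>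
      I\<^sub>0 22 = B + 10 + 2 * n \<Longrightarrow> I\<^sub>0 23 = B + 10 + 3 * n \<Longrightarrow> Runs (\<lambda>\<sigma>. \<sigma> = (I\<^sub>0, m\<^sub>0, d\<^sub>0)) com t (R I\<^sub>0 m\<^sub>0 d\<^sub>0)"
    and post: "\<And>I\<^sub>0 m\<^sub>0 I mm d. rmem c m\<^sub>0 \<Longrightarrow> I\<^sub>0 14 = B + 4 \<Longrightarrow> I\<^sub>0 15 = B + 5 \<Longrightarrow> R I\<^sub>0 m\<^sub>0 (cdrawn c) (I, mm, d) \<Longrightarrow>
      (\<forall>r. r \<notin> {30, 31, 32} \<longrightarrow> I r = I\<^sub>0 r) \<and> rmem c' mm \<and> d = cdrawn c'"
    and c': "rregs c' = rregs c"
  shows "Runs (rep c) com t (rep c')"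
proof (rule runs_pointwise)
  fix I\<^sub>0 m\<^sub>0 d\<^sub>0 assume r: "rep c (I\<^sub>0, m\<^sub>0, d\<^sub>0)"
  then have lay: "lay n B I\<^sub>0" "I\<^sub>0 26 = cloop c 26" by (auto simp: rep_def rregs_def)
  show "Runs (\<lambda>\<sigma>. \<sigma> = (I\<^sub>0, m\<^sub>0, d\<^sub>0)) com t (rep c')"
  proof (rule runs_conseq[OF run[OF lay lay_simps(2-)[OF lay(1)]]])
    fix \<sigma> assume R: "R I\<^sub>0 m\<^sub>0 d\<^sub>0 \<sigma>"
    obtain I mm d where \<sigma>: "\<sigma> = (I, mm, d)" by (cases \<sigma>)
    have p: "(\<forall>r. r \<notin> {30, 31, 32} \<longrightarrow> I r = I\<^sub>0 r) \<and> rmem c' mm \<and> d = cdrawn c'"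
      using r R lay_simps[OF lay(1)] by (intro post) (auto simp: rep_def \<sigma>)
    have "rregs c I"
    proof (rule rregs_frame)
      show "rregs c I\<^sub>0" using r by (simp add: rep_def)
      show "I r = I\<^sub>0 r" if "r \<notin> {27, 30, 31, 32, 33, 34}" for r
        using p that by blast
    qed
    then show "rep c' \<sigma>" using p by (simp add: rep_def \<sigma> c')
  qed auto
qed

lemma rep_scale:
  "Runs (rep c) (scale_com 20 22) (n * 5 + 2) (rep (c\<lparr>cX := \<lambda>i. cS c * cG c i\<rparr>))"
  "Runs (rep c) (scale_com 20 23) (n * 5 + 2) (rep (c\<lparr>cZ := \<lambda>i. cS c * cG c i\<rparr>))"
  "Runs (rep c) (scale_com 23 20) (n * 5 + 2) (rep (c\<lparr>cG := \<lambda>i. cS c * cZ c i\<rparr>))"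
  "Runs (rep c) (scale_com 21 20) (n * 5 + 2) (rep (c\<lparr>cG := \<lambda>i. cS c * cT c i\<rparr>))"
proof -
  show "Runs (rep c) (scale_com 20 22) (n * 5 + 2) (rep (c\<lparr>cX := \<lambda>i. cS c * cG c i\<rparr>))"
    by (rule rep_macro, rule scale_runs[where n = n and B = B and a = "B + 10" and a' = "B + 10 + 2 * n"])
       (unfold rmem_def, simp_all)
  show "Runs (rep c) (scale_com 20 23) (n * 5 + 2) (rep (c\<lparr>cZ := \<lambda>i. cS c * cG c i\<rparr>))"
    by (rule rep_macro, rule scale_runs[where n = n and B = B and a = "B + 10" and a' = "B + 10 + 3 * n"])
       (unfold rmem_def, simp_all)
  show "Runs (rep c) (scale_com 23 20) (n * 5 + 2) (rep (c\<lparr>cG := \<lambda>i. cS c * cZ c i\<rparr>))"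
    by (rule rep_macro, rule scale_runs[where n = n and B = B and a = "B + 10 + 3 * n" and a' = "B + 10"])
       (unfold rmem_def, simp_all)
  show "Runs (rep c) (scale_com 21 20) (n * 5 + 2) (rep (c\<lparr>cG := \<lambda>i. cS c * cT c i\<rparr>))"
    by (rule rep_macro, rule scale_runs[where n = n and B = B and a = "B + 10 + n" and a' = "B + 10"])
       (unfold rmem_def, simp_all)
qed

lemma rmem_row:
  assumes "rmem c m\<^sub>0"
  shows "rmem (c\<lparr>cU := \<lambda>x. if r \<le> x \<and> x < r + n then cS c * cG c (x - r) else cU c x\<rparr>)
    (\<lambda>x. if B + 10 + 5 * n + r \<le> x \<and> x < B + 10 + 5 * n + r + n
      then m\<^sub>0 (B + 4) * m\<^sub>0 (B + 10 + (x - (B + 10 + 5 * n + r))) else m\<^sub>0 x)" (is "rmem ?c ?m")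
proof -
  have "?m (B + 10 + 5 * n + i) = cU ?c i" for i
  proof (cases "r \<le> i \<and> i < r + n")
    case True
    then have "B + 10 + 5 * n + i - (B + 10 + 5 * n + r) = i - r" "i - r < n" by auto
    moreover have "m\<^sub>0 (B + 10 + (i - r)) = cG c (i - r)" "m\<^sub>0 (B + 4) = cS c"
      using assms \<open>i - r < n\<close> by (auto simp: rmem_def)
    ultimately show ?thesis using True by simp
  next
    case False
    then have "\<not> (B + 10 + 5 * n + r \<le> B + 10 + 5 * n + i \<and> B + 10 + 5 * n + i < B + 10 + 5 * n + r + n)"
      by arith
    then have "?m (B + 10 + 5 * n + i) = m\<^sub>0 (B + 10 + 5 * n + i)" by (simp only: if_False)
    also have "\<dots> = cU c i" using assms by (simp only: rmem_def)
    also have "\<dots> = cU ?c i" using False by auto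
    finally show ?thesis .
  qed
  moreover have "?m x = m\<^sub>0 x" if "x < B + 10 + 5 * n" for x using that by simp
  ultimately show ?thesis using assms unfolding rmem_def by (simp del: One_nat_def)
qed

lemma rep_scale_row:
  assumes "cloop c 26 = B + 10 + 5 * n + r"
  shows "Runs (rep c) (scale_com 20 26) (n * 5 + 2)
    (rep (c\<lparr>cU := \<lambda>x. if r \<le> x \<and> x < r + n then cS c * cG c (x - r) else cU c x\<rparr>))"
proof (rule rep_macro)
  fix I\<^sub>0 m\<^sub>0 d\<^sub>0
  assume "lay n B I\<^sub>0" "I\<^sub>0 26 = cloop c 26" "I\<^sub>0 20 = B + 10"
  then show "Runs (\<lambda>\<sigma>. \<sigma> = (I\<^sub>0, m\<^sub>0, d\<^sub>0)) (scale_com 20 26) (n * 5 + 2) (\<lambda>(I, m, d).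
     (\<forall>r. r \<notin> {30, 31, 32} \<longrightarrow> I r = I\<^sub>0 r) \<and> d = d\<^sub>0 \<and>
     m = (\<lambda>x. if B + 10 + 5 * n + r \<le> x \<and> x < B + 10 + 5 * n + r + n
      then m\<^sub>0 (B + 4) * m\<^sub>0 (B + 10 + (x - (B + 10 + 5 * n + r))) else m\<^sub>0 x))"
    using assms by (intro scale_runs) simp_all
qed (use rmem_row[of c] in simp_all)

lemma rep_gauss:
  "Runs (rep c) gauss_com (n * 4 + 2) (rep (c\<lparr>cZ := \<lambda>i. \<omega> (cdrawn c + i), cdrawn := cdrawn c + n\<rparr>))"
  by (rule rep_macro, rule gauss_runs[where n = n and B = B]) (unfold rmem_def, simp_all)

lemma rep_axpy:
  assumes "cloop c 26 = B + 10 + 5 * n + r"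
  shows "Runs (rep c) axpy_com (n * 6 + 2) (rep (c\<lparr>cG := \<lambda>i. cG c i - cS c * cU c (r + i)\<rparr>))"
  by (rule rep_macro, rule axpy_runs[where n = n and B = B and a = "B + 10 + 5 * n + r"])
     (use assms in \<open>(unfold rmem_def, simp_all add: add.assoc)\<close>)

lemma rep_dot:
  "cloop c 26 = B + 10 + 5 * n + r \<Longrightarrow>
   Runs (rep c) (dot_com 20 26 14) (n * 6 + 3) (rep (c\<lparr>cS := dotn n (cG c) (\<lambda>i. cU c (r + i))\<rparr>))"
  "cloop c 26 = B + 10 + 5 * n + r \<Longrightarrow>
   Runs (rep c) (dot_com 26 26 15) (n * 6 + 3) (rep (c\<lparr>cLO := dotn n (\<lambda>i. cU c (r + i)) (\<lambda>i. cU c (r + i))\<rparr>))"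
  "Runs (rep c) (dot_com 20 20 14) (n * 6 + 3) (rep (c\<lparr>cS := dotn n (cG c) (cG c)\<rparr>))"
  "Runs (rep c) (dot_com 23 21 15) (n * 6 + 3) (rep (c\<lparr>cLO := dotn n (cZ c) (cT c)\<rparr>))"
proof -
  assume r: "cloop c 26 = B + 10 + 5 * n + r"
  show "Runs (rep c) (dot_com 20 26 14) (n * 6 + 3) (rep (c\<lparr>cS := dotn n (cG c) (\<lambda>i. cU c (r + i))\<rparr>))"
    by (rule rep_macro, rule dot_runs[where n = n and B = B and a = "B + 10" and a' = "B + 10 + 5 * n + r"])
       (use r in \<open>unfold rmem_def, simp_all, intro dotn_cong, simp_all add: add.assoc\<close>)
  show "Runs (rep c) (dot_com 26 26 15) (n * 6 + 3) (rep (c\<lparr>cLO := dotn n (\<lambda>i. cU c (r + i)) (\<lambda>i. cU c (r + i))\<rparr>))"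
    by (rule rep_macro, rule dot_runs[where n = n and B = B and a = "B + 10 + 5 * n + r" and a' = "B + 10 + 5 * n + r"])
       (use r in \<open>unfold rmem_def, simp_all, intro dotn_cong, simp_all add: add.assoc\<close>)
next
  show "Runs (rep c) (dot_com 20 20 14) (n * 6 + 3) (rep (c\<lparr>cS := dotn n (cG c) (cG c)\<rparr>))"
    by (rule rep_macro, rule dot_runs[where n = n and B = B and a = "B + 10" and a' = "B + 10"])
       (unfold rmem_def, simp_all, intro dotn_cong, simp_all)
  show "Runs (rep c) (dot_com 23 21 15) (n * 6 + 3) (rep (c\<lparr>cLO := dotn n (cZ c) (cT c)\<rparr>))"
    by (rule rep_macro, rule dot_runs[where n = n and B = B and a = "B + 10 + 3 * n" and a' = "B + 10 + n"])
       (unfold rmem_def, simp_all, intro dotn_cong, simp_all)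
qed

lemma rep_ask:
  "Runs (rep c) ask_com (n * 10 + 3) (\<lambda>\<sigma>. rep c \<sigma> \<and>
     fst \<sigma> 27 = (if ask (cX c) (cZ c) (cG c) (cS c) then 1 else 0))"
proof (rule rep_pointwise)
  fix I\<^sub>0 m\<^sub>0 d\<^sub>0 assume r: "rep c (I\<^sub>0, m\<^sub>0, d\<^sub>0)" and lay: "lay n B I\<^sub>0"
  show "Runs (\<lambda>\<sigma>. \<sigma> = (I\<^sub>0, m\<^sub>0, d\<^sub>0)) ask_com (n * 10 + 3) (\<lambda>\<sigma>. rep c \<sigma> \<and>
     fst \<sigma> 27 = (if ask (cX c) (cZ c) (cG c) (cS c) then 1 else 0))"
  proof (rule runs_conseq[OF ask_runs[OF lay]])
    fix \<sigma>
    assume "case \<sigma> of (I, mm, d) \<Rightarrow> (\<forall>r. r \<notin> {27, 30, 31, 32, 33, 34} \<longrightarrow> I r = I\<^sub>0 r) \<and> d = d\<^sub>0 \<and>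
     I 27 = Q (\<lambda>j. mm (B + 10 + 4 * n + j)) \<and>
     (\<forall>x. x \<notin> {B + 7, B + 8} \<and> \<not> (B + 10 + 4 * n \<le> x \<and> x < B + 10 + 4 * n + n) \<longrightarrow> mm x = m\<^sub>0 x) \<and>
     (\<forall>i<n. mm (B + 10 + 4 * n + i) = m\<^sub>0 (B + 10 + 2 * n + i) + m\<^sub>0 B * m\<^sub>0 (B + 10 + 3 * n + i)
        + m\<^sub>0 (B + 4) * m\<^sub>0 (B + 10 + i))"
    then obtain I mm d where \<sigma>: "\<sigma> = (I, mm, d)" "\<And>r. r \<notin> {27, 30, 31, 32, 33, 34} \<Longrightarrow> I r = I\<^sub>0 r" "d = d\<^sub>0"
      "I 27 = Q (\<lambda>j. mm (B + 10 + 4 * n + j))"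
      "\<And>x. x \<notin> {B + 7, B + 8} \<and> \<not> (B + 10 + 4 * n \<le> x \<and> x < B + 10 + 4 * n + n) \<Longrightarrow> mm x = m\<^sub>0 x"
      "\<And>i. i < n \<Longrightarrow> mm (B + 10 + 4 * n + i) = m\<^sub>0 (B + 10 + 2 * n + i) + m\<^sub>0 B * m\<^sub>0 (B + 10 + 3 * n + i)
        + m\<^sub>0 (B + 4) * m\<^sub>0 (B + 10 + i)"
      by (cases \<sigma>) auto
    have "rregs c I"
    proof (rule rregs_frame)
      show "rregs c I\<^sub>0" using r by (simp add: rep_def)
    qed (rule \<sigma>(2))
    then have "rep c \<sigma>" using r unfolding \<sigma>(1) by (simp add: rep_def rmem_def \<sigma>(3,5))
    moreover have "M (\<lambda>j. mm (B + 10 + 4 * n + j)) = ask (cX c) (cZ c) (cG c) (cS c)"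
      unfolding ask_def using r by (intro M_cong) (simp add: \<sigma>(6) rep_def rmem_def)
    ultimately show "rep c \<sigma> \<and> fst \<sigma> 27 = (if ask (cX c) (cZ c) (cG c) (cS c) then 1 else 0)"
      by (simp add: \<sigma>(1,4) Q)
  qed auto
qed

lemma rep_block:
  assumes "is \<noteq> []" "\<And>I mm d. rep c (I, mm, d) \<Longrightarrow> R (ieffs Q \<omega> is (I, mm, d))"
  shows "Runs (rep c) (block is) (length is) R"
  using assms by (intro runs_block) (auto simp: split_paired_all)

lemma Runs_rep_eq: "Runs (rep c) com t (rep c') \<Longrightarrow> c' = c'' \<Longrightarrow> Runs (rep c) com t (rep c'')"
  by simp

lemma rep_one: "rep c (I, mm, d) \<Longrightarrow> I 3 = 1"
  by (simp add: rep_def rregs_def lay_def)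

lemma rep_block_step:
  assumes "is \<noteq> []" "t = length is"
    "\<And>I mm. rregs c I \<Longrightarrow> rmem c mm \<Longrightarrow> rep c' (ieffs Q \<omega> is (I, mm, cdrawn c))"
  shows "Runs (rep c) (block is) t (rep c')"
  unfolding assms(2) using assms(1,3) by (intro rep_block) (auto simp: rep_def)

text \<open>Each pass first halves the length and then queries at the left end plus the new length,
  so the left end moves precisely on a negative answer.\<close>

definition bisect_com :: com where
  "bisect_com = for_loop 35 8 (Seq (block [RealOp RMul 16 16 19, RealOp RAdd 14 15 16])
     (Seq ask_com (Cond (NLess 27 3) (block [Copy 15 14]) (block [Const 30 0]))))"

lemma rep_bisect:
  "Runs (rep c) bisect_com (b * (n * 10 + 9) + 2) (\<lambda>\<sigma>. \<exists>S D. rep (c\<lparr>cS := S, cD := D,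
     cLO := bisect (ask (cX c) (cZ c) (cG c)) b (cLO c) (cD c), cloop := (cloop c)(35 := b)\<rparr>) \<sigma>)"
proof -
  let ?P = "ask (cX c) (cZ c) (cG c)"
  let ?c = "\<lambda>j S lo D. c\<lparr>cS := S, cD := D, cLO := lo, cloop := (cloop c)(35 := j)\<rparr>"
  let ?body = "Seq (block [RealOp RMul 16 16 19, RealOp RAdd 14 15 16])
     (Seq ask_com (Cond (NLess 27 3) (block [Copy 15 14]) (block [Const 30 0])))"
  let ?Inv = "\<lambda>j \<sigma>. \<exists>S lo D. rep (?c j S lo D) \<sigma> \<and>
     bisect ?P (b - j) lo D = bisect ?P b (cLO c) (cD c)"
  have "Runs (rep c) (for_loop 35 8 ?body) (b * ((2 + ((n * 10 + 3) + (1 + 1))) + 2) + 2) (?Inv b)"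
  proof (rule runs_for[where Inv = ?Inv])
    fix I mm d assume "rep c (I, mm, d)"
    then have "rep (?c 0 (cS c) (cLO c) (cD c)) (I(35 := 0), mm, d)"
      by (simp_all add: rep_def rregs_def rmem_def lay_def)
    then show "?Inv 0 (I(35 := 0), mm, d)"
      by (intro exI[of _ "cS c"] exI[of _ "cLO c"] exI[of _ "cD c"]) simp
  next
    fix j I mm d assume "?Inv j (I, mm, d)"
    then show "I 35 = j \<and> I 8 = b" by (auto simp: rep_def rregs_def)
  next
    fix j assume j: "j < b"
    show "Runs (?Inv j) ?body (2 + ((n * 10 + 3) + (1 + 1)))
      (\<lambda>(I, m, d). I 3 = 1 \<and> ?Inv (Suc j) (I(35 := Suc (I 35)), m, d))"
    proof (rule runs_pointwise)
      fix I m d assume "?Inv j (I, m, d)"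
      then obtain S lo D where r: "rep (?c j S lo D) (I, m, d)"
        and eq: "bisect ?P (b - j) lo D = bisect ?P b (cLO c) (cD c)" by blast
      have 1: "Runs (rep (?c j S lo D)) (block [RealOp RMul 16 16 19, RealOp RAdd 14 15 16])
          2 (rep (?c j (lo + D / 2) lo (D / 2)))"
        by (rule rep_block_step) (simp_all add: rep_def rregs_def rmem_def lay_def)
      have 2: "Runs (rep (?c j (lo + D / 2) lo (D / 2))) ask_com (n * 10 + 3)
          (\<lambda>\<sigma>. rep (?c j (lo + D / 2) lo (D / 2)) \<sigma> \<and> fst \<sigma> 27 = (if ?P (lo + D / 2) then 1 else 0))"
        using rep_ask[of "?c j (lo + D / 2) lo (D / 2)"] by simp
      let ?lo = "if ?P (lo + D / 2) then lo else lo + D / 2"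
      have 3: "Runs (\<lambda>\<sigma>. rep (?c j (lo + D / 2) lo (D / 2)) \<sigma> \<and> fst \<sigma> 27 = (if ?P (lo + D / 2) then 1 else 0))
          (Cond (NLess 27 3) (block [Copy 15 14]) (block [Const 30 0])) (1 + 1) (rep (?c j (lo + D / 2) ?lo (D / 2)))"
      proof (rule runs_Cond)
        show "Runs (\<lambda>\<sigma>. (rep (?c j (lo + D / 2) lo (D / 2)) \<sigma> \<and> fst \<sigma> 27 = (if ?P (lo + D / 2) then 1 else 0))
            \<and> tholds (NLess 27 3) \<sigma>) (block [Copy 15 14]) 1 (rep (?c j (lo + D / 2) ?lo (D / 2)))"
          unfolding block.simps
        proof (rule runs_Instr)
          fix \<sigma> assume a: "(rep (?c j (lo + D / 2) lo (D / 2)) \<sigma> \<and> fst \<sigma> 27 = (if ?P (lo + D / 2) then 1 else 0))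
            \<and> tholds (NLess 27 3) \<sigma>"
          obtain I m d where \<sigma>: "\<sigma> = (I, m, d)" by (cases \<sigma>)
          have "\<not> ?P (lo + D / 2)"
            using a rep_one[of "?c j (lo + D / 2) lo (D / 2)" I m d] unfolding \<sigma> by (cases "?P (lo + D / 2)") simp_all
          then show "rep (?c j (lo + D / 2) ?lo (D / 2)) (ieff Q \<omega> (Copy 15 14) \<sigma>)"
            using a unfolding \<sigma> by (simp add: rep_def rregs_def rmem_def lay_def)
        qed
        show "Runs (\<lambda>\<sigma>. (rep (?c j (lo + D / 2) lo (D / 2)) \<sigma> \<and> fst \<sigma> 27 = (if ?P (lo + D / 2) then 1 else 0))
            \<and> \<not> tholds (NLess 27 3) \<sigma>) (block [Const 30 0]) 1 (rep (?c j (lo + D / 2) ?lo (D / 2)))"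
          unfolding block.simps
        proof (rule runs_Instr)
          fix \<sigma> assume a: "(rep (?c j (lo + D / 2) lo (D / 2)) \<sigma> \<and> fst \<sigma> 27 = (if ?P (lo + D / 2) then 1 else 0))
            \<and> \<not> tholds (NLess 27 3) \<sigma>"
          obtain I m d where \<sigma>: "\<sigma> = (I, m, d)" by (cases \<sigma>)
          have "?P (lo + D / 2)"
            using a rep_one[of "?c j (lo + D / 2) lo (D / 2)" I m d] unfolding \<sigma> by (cases "?P (lo + D / 2)") simp_all
          then show "rep (?c j (lo + D / 2) ?lo (D / 2)) (ieff Q \<omega> (Const 30 0) \<sigma>)"
            using a unfolding \<sigma> by (simp add: rep_def rregs_def rmem_def lay_def)
        qed
      qed
      have step: "bisect ?P (b - Suc j) ?lo (D / 2) = bisect ?P b (cLO c) (cD c)"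
      proof -
        have "b - j = Suc (b - Suc j)" using j by simp
        then show ?thesis using eq by (cases "?P (lo + D / 2)") simp_all
      qed
      show "Runs (\<lambda>\<sigma>. \<sigma> = (I, m, d)) ?body (2 + ((n * 10 + 3) + (1 + 1)))
         (\<lambda>(I, m, d). I 3 = 1 \<and> ?Inv (Suc j) (I(35 := Suc (I 35)), m, d))"
      proof (rule runs_conseq[OF runs_Seq[OF 1 runs_Seq[OF 2 3]]])
        fix \<sigma> assume r: "rep (?c j (lo + D / 2) ?lo (D / 2)) \<sigma>"
        obtain I m d where \<sigma>: "\<sigma> = (I, m, d)" by (cases \<sigma>)
        have "rep (?c (Suc j) (lo + D / 2) ?lo (D / 2)) (I(35 := Suc (I 35)), m, d)"
          using r unfolding \<sigma> by (simp add: rep_def rregs_def rmem_def lay_def)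
        moreover have "I 3 = 1" using r unfolding \<sigma> by (simp add: rep_def rregs_def rmem_def lay_def)
        ultimately show "(\<lambda>(I, m, d). I 3 = 1 \<and> ?Inv (Suc j) (I(35 := Suc (I 35)), m, d)) \<sigma>"
          unfolding \<sigma> using step by blast
      qed (use r in auto)
    qed
  qed
  then show ?thesis
    unfolding bisect_com_def by (rule runs_conseq) auto
qed

definition resid_com :: com where
  "resid_com = for_loop 39 5 (Seq (block [NatOp NMul 26 39 0, NatOp NAdd 26 25 26])
     (Seq (dot_com 20 26 14) (Seq (dot_com 26 26 15) (Seq (block [RealOp RDiv 14 14 15]) axpy_com))))"

lemma rep_resid:
  assumes us: "cnum c = length us" "cU c = flat n us"
  shows "Runs (rep c) resid_com (length us * (n * 18 + 13) + 2) (\<lambda>\<sigma>. \<exists>S L v w. rep (c\<lparr>cS := S, cLO := L,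
     cG := resid n us (cG c), cloop := (cloop c)(39 := v, 26 := w)\<rparr>) \<sigma>)"
proof -
  let ?c = "\<lambda>j S L w g. c\<lparr>cS := S, cLO := L, cG := g, cloop := (cloop c)(39 := j, 26 := w)\<rparr>"
  let ?body = "Seq (block [NatOp NMul 26 39 0, NatOp NAdd 26 25 26])
     (Seq (dot_com 20 26 14) (Seq (dot_com 26 26 15) (Seq (block [RealOp RDiv 14 14 15]) axpy_com)))"
  let ?g = "\<lambda>j. resid n (take j us) (cG c)"
  let ?Inv = "\<lambda>j \<sigma>. \<exists>S L w. rep (?c j S L w (?g j)) \<sigma>"
  have "Runs (rep c) (for_loop 39 5 ?body) (length us * ((2 + ((n * 6 + 3) + ((n * 6 + 3) + (1 + (n * 6 + 2))))) + 2) + 2) (?Inv (length us))"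
  proof (rule runs_for[where Inv = ?Inv])
    fix I mm d assume "rep c (I, mm, d)"
    then have "rep (?c 0 (cS c) (cLO c) (cloop c 26) (?g 0)) (I(39 := 0), mm, d)"
      by (simp_all add: rep_def rregs_def rmem_def lay_def)
    then show "?Inv 0 (I(39 := 0), mm, d)" by blast
  next
    fix j I mm d assume "?Inv j (I, mm, d)"
    then show "I 39 = j \<and> I 5 = length us" by (auto simp: rep_def rregs_def us)
  next
    fix j assume j: "j < length us"
    show "Runs (?Inv j) ?body (2 + ((n * 6 + 3) + ((n * 6 + 3) + (1 + (n * 6 + 2)))))
      (\<lambda>(I, m, d). I 3 = 1 \<and> ?Inv (Suc j) (I(39 := Suc (I 39)), m, d))"
    proof (rule runs_pointwise)
      fix I m d assume "?Inv j (I, m, d)"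
      then obtain S L w where r: "rep (?c j S L w (?g j)) (I, m, d)" by blast
      let ?w = "B + 10 + 5 * n + j * n" and ?u = "\<lambda>i. flat n us (j * n + i)"
      let ?S = "dotn n (?g j) ?u" and ?L = "dotn n ?u ?u"
      have 1: "Runs (rep (?c j S L w (?g j))) (block [NatOp NMul 26 39 0, NatOp NAdd 26 25 26]) 2
          (rep (?c j S L ?w (?g j)))"
        by (rule rep_block_step) (simp_all add: rep_def rregs_def rmem_def lay_def)
      have 2: "Runs (rep (?c j S L ?w (?g j))) (dot_com 20 26 14) (n * 6 + 3) (rep (?c j ?S L ?w (?g j)))"
        by (rule Runs_rep_eq[OF rep_dot(1)[of "?c j S L ?w (?g j)" "j * n"]], simp, rule cfg.equality) (simp_all add: us)
      have 3: "Runs (rep (?c j ?S L ?w (?g j))) (dot_com 26 26 15) (n * 6 + 3) (rep (?c j ?S ?L ?w (?g j)))"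
        by (rule Runs_rep_eq[OF rep_dot(2)[of "?c j ?S L ?w (?g j)" "j * n"]], simp, rule cfg.equality) (simp_all add: us)
      have 4: "Runs (rep (?c j ?S ?L ?w (?g j))) (block [RealOp RDiv 14 14 15]) 1 (rep (?c j (?S / ?L) ?L ?w (?g j)))"
        by (rule rep_block_step) (simp_all add: rep_def rregs_def rmem_def lay_def)
      have 5: "Runs (rep (?c j (?S / ?L) ?L ?w (?g j))) axpy_com (n * 6 + 2)
          (rep (?c j (?S / ?L) ?L ?w (\<lambda>i. ?g j i - ?S / ?L * ?u i)))"
        by (rule Runs_rep_eq[OF rep_axpy[of "?c j (?S / ?L) ?L ?w (?g j)" "j * n"]], simp, rule cfg.equality) (simp_all add: us)
      \<comment> \<open>The loop subtracts a multiple of the row found in memory; on the first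
        \<open>n\<close> coordinates this is the recursion step of \<open>resid\<close>.\<close>
      have eq: "?g j i - ?S / ?L * ?u i = ?g (Suc j) i" if "i < n" for i
      proof -
        have "?S = dotn n (?g j) (us ! j)" "?L = dotn n (us ! j) (us ! j)"
          using j by (auto simp: flat_row intro!: dotn_cong)
        then show ?thesis
          using j that by (simp add: take_Suc_conv_app_nth resid_snoc flat_row)
      qed
      show "Runs (\<lambda>\<sigma>. \<sigma> = (I, m, d)) ?body (2 + ((n * 6 + 3) + ((n * 6 + 3) + (1 + (n * 6 + 2)))))
         (\<lambda>(I, m, d). I 3 = 1 \<and> ?Inv (Suc j) (I(39 := Suc (I 39)), m, d))"
      proof (rule runs_conseq[OF runs_Seq[OF 1 runs_Seq[OF 2 runs_Seq[OF 3 runs_Seq[OF 4 5]]]]])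
        fix \<sigma> assume r: "rep (?c j (?S / ?L) ?L ?w (\<lambda>i. ?g j i - ?S / ?L * ?u i)) \<sigma>"
        obtain I m d where \<sigma>: "\<sigma> = (I, m, d)" by (cases \<sigma>)
        have "rep (?c (Suc j) (?S / ?L) ?L ?w (?g (Suc j))) (I(39 := Suc (I 39)), m, d)"
          using r eq unfolding \<sigma> by (simp add: rep_def rregs_def rmem_def lay_def)
        moreover have "I 3 = 1" using r unfolding \<sigma> by (simp add: rep_def rregs_def rmem_def lay_def)
        ultimately show "(\<lambda>(I, m, d). I 3 = 1 \<and> ?Inv (Suc j) (I(39 := Suc (I 39)), m, d)) \<sigma>"
          unfolding \<sigma> by blast
      qed (use r in auto)
    qed
  qed
  then show ?thesis
    unfolding resid_com_def by (rule runs_conseq) (auto simp: algebra_simps)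
qed

end

section \<open>Verification of a round and of the search loop\<close>

context machine begin

text \<open>Hides scratch contents behind an existential and keeps the stored list, the round
  counter \<open>l\<close>, the tape position \<open>d\<close> and a predicate on the rest.\<close>

definition holding :: "(nat \<Rightarrow> real) list \<Rightarrow> nat \<Rightarrow> nat \<Rightarrow> (cfg \<Rightarrow> bool) \<Rightarrow> conf \<Rightarrow> bool" where
  "holding us l d P \<sigma> \<longleftrightarrow> (\<exists>c. rep c \<sigma> \<and> cnum c = length us \<and> cU c = flat n us \<and> cloop c 38 = l \<and>
     cdrawn c = d \<and> P c)"

lemma holding_step:
  assumes "\<And>c. cnum c = length us \<Longrightarrow> cU c = flat n us \<Longrightarrow> cloop c 38 = l \<Longrightarrow> cdrawn c = d \<Longrightarrow> P c \<Longrightarrow>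
    Runs (rep c) com t (holding us' l d' P')"
  shows "Runs (holding us l d P) com t (holding us' l d' P')"
  unfolding runs_def
proof (intro allI impI)
  fix s assume "holding us l d P (conf_of s)"
  then obtain c where "rep c (conf_of s)" "cnum c = length us" "cU c = flat n us" "cloop c 38 = l" "cdrawn c = d" "P c"
    unfolding holding_def by blast
  with assms[of c] show "\<exists>s'. exec Q \<omega> com s s' \<and> steps s' \<le> steps s + t \<and> holding us' l d' P' (conf_of s')"
    unfolding runs_def by blast
qed

lemma holding_simple:
  assumes "\<And>c. Runs (rep c) com t (rep (f c))"
    and "\<And>c. cnum c = length us \<Longrightarrow> cU c = flat n us \<Longrightarrow> cloop c 38 = l \<Longrightarrow> cdrawn c = d \<Longrightarrow> P c \<Longrightarrow>
      cnum (f c) = length us' \<and> cU (f c) = flat n us' \<and> cloop (f c) 38 = l \<and> cdrawn (f c) = d' \<and> P' (f c)"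
  shows "Runs (holding us l d P) com t (holding us' l d' P')"
proof (rule holding_step)
  fix c :: cfg assume "cnum c = length us" "cU c = flat n us" "cloop c 38 = l" "cdrawn c = d" "P c"
  from assms(2)[OF this] show "Runs (rep c) com t (holding us' l d' P')"
    by (intro runs_conseq[OF assms(1)]) (auto simp: holding_def)
qed

lemma rep_scalars:
  "Runs (rep c) (block [Of_Nat 14 3]) 1 (rep (c\<lparr>cS := 1\<rparr>))"
  "Runs (rep c) (block [Of_Nat 14 4]) 1 (rep (c\<lparr>cS := 0\<rparr>))"
  "Runs (rep c) (block [Of_Nat 15 4, Of_Nat 16 3]) 2 (rep (c\<lparr>cLO := 0, cD := 1\<rparr>))"
  "Runs (rep c) (block [Copy 14 15]) 1 (rep (c\<lparr>cS := cLO c\<rparr>))"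
  "Runs (rep c) (block [Const 9 0]) 1 (rep (c\<lparr>cerr := 0\<rparr>))"
  "Runs (rep c) (block [RealOp RAdd 14 15 12]) 1 (rep (c\<lparr>cS := cLO c + \<theta>\<rparr>))"
  by (rule rep_block_step; simp add: rep_def rregs_def rmem_def lay_def)+

lemma rep_unit:
  assumes i: "cloop c 36 = i" "i < n"
  shows "Runs (rep c) (block [NatOp NAdd 31 23 36, Of_Nat 31 3, Of_Nat 15 4, RealOp RSub 15 15 11, RealOp RAdd 16 11 11]) 5
    (rep (c\<lparr>cZ := (cZ c)(i := 1), cLO := - T\<^sub>0, cD := 2 * T\<^sub>0\<rparr>))"
  using i by (intro rep_block_step) (simp_all add: rep_def rregs_def rmem_def lay_def)

lemma rep_store:
  assumes i: "cloop c 36 = i" "i < n"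
  shows "Runs (rep c) (block [NatOp NAdd 31 21 36, Copy 31 15]) 2 (rep (c\<lparr>cT := (cT c)(i := cLO c)\<rparr>))"
  using i by (intro rep_block_step) (simp_all add: rep_def rregs_def rmem_def lay_def)

definition coord_body :: com where
  "coord_body = Seq (block [Of_Nat 14 4]) (Seq (scale_com 20 23)
     (Seq (block [NatOp NAdd 31 23 36, Of_Nat 31 3, Of_Nat 15 4, RealOp RSub 15 15 11, RealOp RAdd 16 11 11])
     (Seq bisect_com (block [NatOp NAdd 31 21 36, Copy 31 15]))))"

definition coord_time :: nat where
  "coord_time = 1 + ((n * 5 + 2) + (5 + ((b * (n * 10 + 9) + 2) + 2)))"

lemma holding_coord_body:
  assumes j: "j < n"
  shows "Runs (holding us l d (\<lambda>c. cG c = g \<and> cX c = base_point g \<and> cloop c 36 = j \<and> (\<forall>i<j. cT c i = candidate g i)))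
    coord_body coord_time
    (holding us l d (\<lambda>c. cG c = g \<and> cX c = base_point g \<and> cloop c 36 = j \<and> (\<forall>i<Suc j. cT c i = candidate g i)))"
proof -
  let ?P = "\<lambda>c. cG c = g \<and> cX c = base_point g \<and> cloop c 36 = j \<and> (\<forall>i<j. cT c i = candidate g i)"
  have 1: "Runs (holding us l d ?P) (block [Of_Nat 14 4]) 1 (holding us l d (\<lambda>c. ?P c \<and> cS c = 0))"
    by (rule holding_simple, rule rep_scalars(2)) simp
  have 2: "Runs (holding us l d (\<lambda>c. ?P c \<and> cS c = 0)) (scale_com 20 23) (n * 5 + 2)
      (holding us l d (\<lambda>c. ?P c \<and> cZ c = (\<lambda>_. 0)))"
    by (rule holding_simple, rule rep_scale(2)) simp
  have 3: "Runs (holding us l d (\<lambda>c. ?P c \<and> cZ c = (\<lambda>_. 0)))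
      (block [NatOp NAdd 31 23 36, Of_Nat 31 3, Of_Nat 15 4, RealOp RSub 15 15 11, RealOp RAdd 16 11 11]) 5
      (holding us l d (\<lambda>c. ?P c \<and> cZ c = unit_fn j \<and> cLO c = - T\<^sub>0 \<and> cD c = 2 * T\<^sub>0))"
  proof (rule holding_step)
    fix c :: cfg assume c: "cnum c = length us" "cU c = flat n us" "cloop c 38 = l" "cdrawn c = d" "?P c \<and> cZ c = (\<lambda>_. 0)"
    have "(\<lambda>_. 0)(j := 1) = unit_fn j" by (auto simp: unit_fn_def)
    then show "Runs (rep c) (block [NatOp NAdd 31 23 36, Of_Nat 31 3, Of_Nat 15 4, RealOp RSub 15 15 11, RealOp RAdd 16 11 11]) 5
      (holding us l d (\<lambda>c. ?P c \<and> cZ c = unit_fn j \<and> cLO c = - T\<^sub>0 \<and> cD c = 2 * T\<^sub>0))"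
      using c j by (intro runs_conseq[OF rep_unit[of c j]]) (auto simp: holding_def intro!: exI[of _ "c\<lparr>cZ := unit_fn j, cLO := - T\<^sub>0, cD := 2 * T\<^sub>0\<rparr>"])
  qed
  have 4: "Runs (holding us l d (\<lambda>c. ?P c \<and> cZ c = unit_fn j \<and> cLO c = - T\<^sub>0 \<and> cD c = 2 * T\<^sub>0)) bisect_com
      (b * (n * 10 + 9) + 2) (holding us l d (\<lambda>c. ?P c \<and> cLO c = candidate g j))"
  proof (rule holding_step)
    fix c :: cfg assume c: "cnum c = length us" "cU c = flat n us" "cloop c 38 = l" "cdrawn c = d"
      "?P c \<and> cZ c = unit_fn j \<and> cLO c = - T\<^sub>0 \<and> cD c = 2 * T\<^sub>0"
    show "Runs (rep c) bisect_com (b * (n * 10 + 9) + 2) (holding us l d (\<lambda>c. ?P c \<and> cLO c = candidate g j))"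
    proof (rule runs_conseq[OF rep_bisect])
      fix \<sigma> assume "\<exists>S D. rep (c\<lparr>cS := S, cD := D,
        cLO := bisect (ask (cX c) (cZ c) (cG c)) b (cLO c) (cD c), cloop := (cloop c)(35 := b)\<rparr>) \<sigma>"
      then obtain S D where "rep (c\<lparr>cS := S, cD := D,
        cLO := bisect (ask (cX c) (cZ c) (cG c)) b (cLO c) (cD c), cloop := (cloop c)(35 := b)\<rparr>) \<sigma>" by blast
      then show "holding us l d (\<lambda>c. ?P c \<and> cLO c = candidate g j) \<sigma>"
        unfolding holding_def by (intro exI conjI, assumption) (use c j in \<open>simp_all add: candidate_def\<close>)
    qed auto
  qed
  have 5: "Runs (holding us l d (\<lambda>c. ?P c \<and> cLO c = candidate g j)) (block [NatOp NAdd 31 21 36, Copy 31 15]) 2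
      (holding us l d (\<lambda>c. cG c = g \<and> cX c = base_point g \<and> cloop c 36 = j \<and> (\<forall>i<Suc j. cT c i = candidate g i)))"
  proof (rule holding_step)
    fix c :: cfg assume c: "cnum c = length us" "cU c = flat n us" "cloop c 38 = l" "cdrawn c = d" "?P c \<and> cLO c = candidate g j"
    show "Runs (rep c) (block [NatOp NAdd 31 21 36, Copy 31 15]) 2
      (holding us l d (\<lambda>c. cG c = g \<and> cX c = base_point g \<and> cloop c 36 = j \<and> (\<forall>i<Suc j. cT c i = candidate g i)))"
    proof (rule runs_conseq[OF rep_store[of c j]])
      fix \<sigma> assume "rep (c\<lparr>cT := (cT c)(j := cLO c)\<rparr>) \<sigma>"
      then show "holding us l d (\<lambda>c. cG c = g \<and> cX c = base_point g \<and> cloop c 36 = j \<and> (\<forall>i<Suc j. cT c i = candidate g i)) \<sigma>"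
        unfolding holding_def by (intro exI conjI, assumption) (use c in \<open>simp_all add: less_Suc_eq\<close>)
    qed (use c j in auto)
  qed
  show ?thesis
    unfolding coord_body_def coord_time_def
    by (rule runs_Seq[OF 1 runs_Seq[OF 2 runs_Seq[OF 3 runs_Seq[OF 4 5]]]])
qed

lemma holding_for:
  assumes reg: "(i = 36 \<and> cnt = 0 \<and> L = n) \<or> (i = 37 \<and> cnt = 7 \<and> L = m)"
    and P: "\<And>j c x. P j (c\<lparr>cloop := (cloop c)(i := x)\<rparr>) = P j c"
    and body: "\<And>j. j < L \<Longrightarrow> Runs (holding us l (d j) (\<lambda>c. cloop c i = j \<and> P j c)) body t
      (holding us l (d (Suc j)) (\<lambda>c. cloop c i = j \<and> P (Suc j) c))"
  shows "Runs (holding us l (d 0) (P 0)) (for_loop i cnt body) (L * (t + 2) + 2) (holding us l (d L) (P L))"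
proof -
  let ?Inv = "\<lambda>j. holding us l (d j) (\<lambda>c. cloop c i = j \<and> P j c)"
  have set: "rep (c\<lparr>cloop := (cloop c)(i := x)\<rparr>) (I(i := x), mm, e)" if "rep c (I, mm, e)" for c x I mm e
    using reg that by (elim disjE) (simp_all add: rep_def rregs_def rmem_def lay_def)
  have move: "?Inv j' (I(i := x), mm, e)"
    if r: "rep c (I, mm, e)" "cnum c = length us" "cU c = flat n us" "cloop c 38 = l" "cdrawn c = d j'"
      "P j' c" "x = j'" for c x I mm e j'
    unfolding holding_def
    by (intro exI[of _ "c\<lparr>cloop := (cloop c)(i := x)\<rparr>"] conjI set[OF r(1)])
       (use r reg P in auto)
  have "Runs (holding us l (d 0) (P 0)) (for_loop i cnt body) (L * (t + 2) + 2) (?Inv L)"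
  proof (rule runs_for[where Inv = ?Inv])
    fix I mm e assume "holding us l (d 0) (P 0) (I, mm, e)"
    then obtain c where "rep c (I, mm, e)" "cnum c = length us" "cU c = flat n us" "cloop c 38 = l"
      "cdrawn c = d 0" "P 0 c" unfolding holding_def by blast
    from move[OF this refl] show "?Inv 0 (I(i := 0), mm, e)" .
  next
    fix j I mm e assume "?Inv j (I, mm, e)"
    then obtain c where "rep c (I, mm, e)" "cloop c i = j" unfolding holding_def by blast
    then show "I i = j \<and> I cnt = L" using reg by (auto simp: rep_def rregs_def lay_def)
  next
    fix j assume j: "j < L"
    show "Runs (?Inv j) body t (\<lambda>(I, m, d). I 3 = 1 \<and> ?Inv (Suc j) (I(i := Suc (I i)), m, d))"
    proof (rule runs_conseq[OF body[OF j]])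
      fix \<sigma> assume h: "holding us l (d (Suc j)) (\<lambda>c. cloop c i = j \<and> P (Suc j) c) \<sigma>"
      obtain I mm e where \<sigma>: "\<sigma> = (I, mm, e)" by (cases \<sigma>)
      from h obtain c where c: "rep c (I, mm, e)" "cnum c = length us" "cU c = flat n us" "cloop c 38 = l"
        "cdrawn c = d (Suc j)" "P (Suc j) c" "cloop c i = j" unfolding holding_def \<sigma> by blast
      have "I 3 = 1" "I i = j" using c(1,7) reg by (auto simp: rep_def rregs_def lay_def)
      moreover have "?Inv (Suc j) (I(i := Suc (I i)), mm, e)"
        by (rule move[OF c(1-6)]) (simp add: \<open>I i = j\<close>)
      ultimately show "(\<lambda>(I, m, d). I 3 = 1 \<and> ?Inv (Suc j) (I(i := Suc (I i)), m, d)) \<sigma>"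
        unfolding \<sigma> by simp
    qed auto
  qed
  then show ?thesis by (rule runs_conseq) (auto simp: holding_def)
qed

text \<open>The upper query adds one minus its answer and the lower query its answer, so all tests
  pass precisely if the counter stays zero. Counting instead of leaving the loop keeps the tape
  consumption of a round constant.\<close>

lemma rep_count:
  "Runs (rep c) (Seq ask_com (block [NatOp NSub 31 3 27, NatOp NAdd 9 9 31, RealOp RSub 14 15 12])) (n * 10 + 6)
    (rep (c\<lparr>cerr := cerr c + (if ask (cX c) (cZ c) (cG c) (cS c) then 0 else 1), cS := cLO c - \<theta>\<rparr>))"
  "Runs (rep c) (Seq ask_com (block [NatOp NAdd 9 9 27])) (n * 10 + 4)
    (rep (c\<lparr>cerr := cerr c + (if ask (cX c) (cZ c) (cG c) (cS c) then 1 else 0)\<rparr>))"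
proof -
  let ?A = "\<lambda>\<sigma>. rep c \<sigma> \<and> fst \<sigma> 27 = (if ask (cX c) (cZ c) (cG c) (cS c) then 1 else 0)"
  let ?c = "c\<lparr>cerr := cerr c + (if ask (cX c) (cZ c) (cG c) (cS c) then 0 else 1), cS := cLO c - \<theta>\<rparr>"
  let ?d = "c\<lparr>cerr := cerr c + (if ask (cX c) (cZ c) (cG c) (cS c) then 1 else 0)\<rparr>"
  have 1: "Runs ?A (block [NatOp NSub 31 3 27, NatOp NAdd 9 9 31, RealOp RSub 14 15 12])
      (length [NatOp NSub 31 3 27, NatOp NAdd 9 9 31, RealOp RSub 14 15 12]) (rep ?c)"
  proof (rule runs_block)
    fix \<sigma> assume "?A \<sigma>"
    then show "rep ?c (ieffs Q \<omega> [NatOp NSub 31 3 27, NatOp NAdd 9 9 31, RealOp RSub 14 15 12] \<sigma>)"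
      by (cases \<sigma>) (simp add: rep_def rregs_def rmem_def lay_def)
  qed simp
  have 2: "Runs ?A (block [NatOp NAdd 9 9 27]) (length [NatOp NAdd 9 9 27]) (rep ?d)"
  proof (rule runs_block)
    fix \<sigma> assume "?A \<sigma>"
    then show "rep ?d (ieffs Q \<omega> [NatOp NAdd 9 9 27] \<sigma>)"
      by (cases \<sigma>) (simp add: rep_def rregs_def rmem_def lay_def)
  qed simp
  show "Runs (rep c) (Seq ask_com (block [NatOp NSub 31 3 27, NatOp NAdd 9 9 31, RealOp RSub 14 15 12])) (n * 10 + 6) (rep ?c)"
    by (rule runs_conseq[OF runs_Seq[OF rep_ask 1]]) auto
  show "Runs (rep c) (Seq ask_com (block [NatOp NAdd 9 9 27])) (n * 10 + 4) (rep ?d)"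
    by (rule runs_conseq[OF runs_Seq[OF rep_ask 2]]) auto
qed

definition test_body :: com where
  "test_body = Seq gauss_com (Seq (dot_com 23 21 15) (Seq (block [RealOp RAdd 14 15 12])
     (Seq (Seq ask_com (block [NatOp NSub 31 3 27, NatOp NAdd 9 9 31, RealOp RSub 14 15 12]))
          (Seq ask_com (block [NatOp NAdd 9 9 27])))))"

definition test_time :: nat where
  "test_time = (n * 4 + 2) + ((n * 6 + 3) + (1 + ((n * 10 + 6) + (n * 10 + 4))))"

lemma holding_test_body:
  shows "Runs (holding us l e (\<lambda>c. cloop c 37 = j \<and> cG c = g \<and> cX c = x \<and> (\<forall>i<n. cT c i = t i) \<and> (cerr c = 0) = p))
    test_body test_time
    (holding us l (e + n) (\<lambda>c. cloop c 37 = j \<and> cG c = g \<and> cX c = x \<and> (\<forall>i<n. cT c i = t i) \<and>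
       (cerr c = 0) = (p \<and> passes_test x t g (\<lambda>i. \<omega> (e + i)))))"
proof -
  let ?P = "\<lambda>c. cloop c 37 = j \<and> cG c = g \<and> cX c = x \<and> (\<forall>i<n. cT c i = t i)"
  let ?z = "\<lambda>i. \<omega> (e + i)"
  let ?a = "ask x ?z g (dotn n ?z t + \<theta>)" and ?b = "ask x ?z g (dotn n ?z t - \<theta>)"
  have 1: "Runs (holding us l e (\<lambda>c. ?P c \<and> (cerr c = 0) = p)) gauss_com (n * 4 + 2)
      (holding us l (e + n) (\<lambda>c. ?P c \<and> (cerr c = 0) = p \<and> cZ c = ?z))"
    by (rule holding_simple, rule rep_gauss) simp
  have 2: "Runs (holding us l (e + n) (\<lambda>c. ?P c \<and> (cerr c = 0) = p \<and> cZ c = ?z)) (dot_com 23 21 15) (n * 6 + 3)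
      (holding us l (e + n) (\<lambda>c. ?P c \<and> (cerr c = 0) = p \<and> cZ c = ?z \<and> cLO c = dotn n ?z t))"
    by (rule holding_simple, rule rep_dot(4)) (simp cong: dotn_cong)
  have 3: "Runs (holding us l (e + n) (\<lambda>c. ?P c \<and> (cerr c = 0) = p \<and> cZ c = ?z \<and> cLO c = dotn n ?z t)) (block [RealOp RAdd 14 15 12]) 1
      (holding us l (e + n) (\<lambda>c. ?P c \<and> (cerr c = 0) = p \<and> cZ c = ?z \<and> cLO c = dotn n ?z t \<and> cS c = dotn n ?z t + \<theta>))"
    by (rule holding_simple, rule rep_scalars(6)) simp
  have 4: "Runs (holding us l (e + n) (\<lambda>c. ?P c \<and> (cerr c = 0) = p \<and> cZ c = ?z \<and> cLO c = dotn n ?z t \<and> cS c = dotn n ?z t + \<theta>))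
      (Seq ask_com (block [NatOp NSub 31 3 27, NatOp NAdd 9 9 31, RealOp RSub 14 15 12])) (n * 10 + 6)
      (holding us l (e + n) (\<lambda>c. ?P c \<and> (cerr c = 0) = (p \<and> ?a) \<and> cZ c = ?z \<and> cS c = dotn n ?z t - \<theta>))"
    by (rule holding_simple, rule rep_count(1)) simp
  have 5: "Runs (holding us l (e + n) (\<lambda>c. ?P c \<and> (cerr c = 0) = (p \<and> ?a) \<and> cZ c = ?z \<and> cS c = dotn n ?z t - \<theta>))
      (Seq ask_com (block [NatOp NAdd 9 9 27])) (n * 10 + 4)
      (holding us l (e + n) (\<lambda>c. ?P c \<and> (cerr c = 0) = (p \<and> passes_test x t g ?z)))"
    by (rule holding_simple, rule rep_count(2)) (auto simp: passes_test_def)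
  have "Runs (holding us l e (\<lambda>c. ?P c \<and> (cerr c = 0) = p)) test_body test_time
    (holding us l (e + n) (\<lambda>c. ?P c \<and> (cerr c = 0) = (p \<and> passes_test x t g ?z)))"
    unfolding test_body_def test_time_def
    by (rule runs_Seq[OF 1 runs_Seq[OF 2 runs_Seq[OF 3 runs_Seq[OF 4 5]]]])
  then show ?thesis by (simp only: conj_assoc)
qed

text \<open>There is no idle statement; writing the scratch register \<open>30\<close> serves as
  one.\<close>

definition skip :: com where "skip = block [Const 30 0]"

definition add_com :: com where
  "add_com = Seq (block [NatOp NMul 26 5 0, NatOp NAdd 26 25 26, Of_Nat 14 3])
     (Seq (scale_com 20 26) (block [NatOp NAdd 5 5 3]))"

lemma rep_skip: "Runs (rep c) skip 1 (rep c)"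
  unfolding skip_def by (rule rep_block_step) (simp_all add: rep_def rregs_def rmem_def lay_def)

lemma holding_add:
  assumes u: "\<And>i. i < n \<Longrightarrow> g i = u i"
  shows "Runs (holding us l e (\<lambda>c. cG c = g)) add_com (n * 5 + 6) (holding (us @ [u]) l e (\<lambda>_. True))"
proof (rule holding_step)
  fix c :: cfg assume c: "cnum c = length us" "cU c = flat n us" "cloop c 38 = l" "cdrawn c = e" "cG c = g"
  let ?r = "length us * n"
  let ?c1 = "c\<lparr>cS := 1, cloop := (cloop c)(26 := B + 10 + 5 * n + ?r)\<rparr>"
  let ?U = "\<lambda>x. if ?r \<le> x \<and> x < ?r + n then 1 * g (x - ?r) else flat n us x"
  have 1: "Runs (rep c) (block [NatOp NMul 26 5 0, NatOp NAdd 26 25 26, Of_Nat 14 3]) 3 (rep ?c1)"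
    by (rule rep_block_step) (simp_all add: rep_def rregs_def rmem_def lay_def c)
  have 2: "Runs (rep ?c1) (scale_com 20 26) (n * 5 + 2) (rep (?c1\<lparr>cU := ?U\<rparr>))"
    by (rule Runs_rep_eq[OF rep_scale_row[of ?c1 ?r]], simp, rule cfg.equality) (simp_all add: c fun_eq_iff)
  have 3: "Runs (rep (?c1\<lparr>cU := ?U\<rparr>)) (block [NatOp NAdd 5 5 3]) 1 (rep (?c1\<lparr>cU := ?U, cnum := Suc (cnum c)\<rparr>))"
    by (rule rep_block_step) (simp_all add: rep_def rregs_def rmem_def lay_def)
  have U: "?U = flat n (us @ [u])"
  proof
    fix x show "?U x = flat n (us @ [u]) x"
      unfolding flat_snoc[OF n_pos] using u[of "x - ?r"] by auto
  qed
  show "Runs (rep c) add_com (n * 5 + 6) (holding (us @ [u]) l e (\<lambda>_. True))"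
    unfolding add_com_def
  proof (rule runs_conseq[OF runs_Seq[OF 1 runs_Seq[OF 2 3]]])
    fix \<sigma> assume "rep (?c1\<lparr>cU := ?U, cnum := Suc (cnum c)\<rparr>) \<sigma>"
    then show "holding (us @ [u]) l e (\<lambda>_. True) \<sigma>"
      unfolding holding_def by (intro exI conjI, assumption) (use c U in simp_all)
  qed auto
qed

definition round_com :: com where
  "round_com = Seq gauss_com (Seq (block [Of_Nat 14 3]) (Seq (scale_com 23 20) (Seq resid_com
    (Seq (block [Of_Nat 14 4]) (Seq (scale_com 20 22) (Seq (scale_com 20 23)
    (Seq (block [Of_Nat 15 4, Of_Nat 16 3]) (Seq bisect_com (Seq (block [Copy 14 15]) (Seq (scale_com 20 22)
    (Seq (for_loop 36 0 coord_body) (Seq (block [Const 9 0]) (Seq (for_loop 37 7 test_body)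
    (Seq (block [Of_Nat 14 3]) (Seq (scale_com 21 20) (Seq resid_com (Seq (dot_com 20 20 14)
    (Cond (NLess 9 3) (Cond (RLess 14 13) skip add_com) skip))))))))))))))))))"

definition round_time :: nat where
  "round_time = (n * 4 + 2) + (1 + ((n * 5 + 2) + ((k * (n * 18 + 13) + 2)
    + (1 + ((n * 5 + 2) + ((n * 5 + 2)
    + (2 + ((b * (n * 10 + 9) + 2) + (1 + ((n * 5 + 2)
    + ((n * (coord_time + 2) + 2) + (1 + ((m * (test_time + 2) + 2)
    + (1 + ((n * 5 + 2) + ((k * (n * 18 + 13) + 2) + ((n * 6 + 3)
    + (((n * 5 + 6) + 1) + 1))))))))))))))))))"

lemma holding_resid:
  assumes len: "length us < k"
    and P: "\<And>c S L v w f. P c \<Longrightarrow> P (c\<lparr>cS := S, cLO := L, cG := f, cloop := (cloop c)(39 := v, 26 := w)\<rparr>)"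
  shows "Runs (holding us l e (\<lambda>c. cG c = g \<and> P c)) resid_com (k * (n * 18 + 13) + 2)
    (holding us l e (\<lambda>c. cG c = resid n us g \<and> P c))"
proof (rule holding_step)
  fix c :: cfg assume c: "cnum c = length us" "cU c = flat n us" "cloop c 38 = l" "cdrawn c = e" "cG c = g \<and> P c"
  show "Runs (rep c) resid_com (k * (n * 18 + 13) + 2) (holding us l e (\<lambda>c. cG c = resid n us g \<and> P c))"
  proof (rule runs_conseq[OF rep_resid[OF c(1,2)]])
    fix \<sigma> assume "\<exists>S L v w. rep (c\<lparr>cS := S, cLO := L, cG := resid n us (cG c), cloop := (cloop c)(39 := v, 26 := w)\<rparr>) \<sigma>"
    then obtain S L v w where "rep (c\<lparr>cS := S, cLO := L, cG := resid n us (cG c), cloop := (cloop c)(39 := v, 26 := w)\<rparr>) \<sigma>"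
      by blast
    then show "holding us l e (\<lambda>c. cG c = resid n us g \<and> P c) \<sigma>"
      unfolding holding_def by (intro exI conjI, assumption) (use c P in simp_all)
  next
    show "length us * (n * 18 + 13) + 2 \<le> k * (n * 18 + 13) + 2" using len by simp
  qed
qed

lemma holding_round:
  assumes len: "length us < k"
  shows "Runs (holding us l e (\<lambda>_. True)) round_com round_time
    (holding (extend us (\<lambda>i. \<omega> (e + i))) l (e + (m + 1) * n) (\<lambda>_. True))"
proof -
  let ?w = "\<lambda>i. \<omega> (e + i)"
  define g where "g = resid n us ?w"
  define t where "t = candidate g"
  define x where "x = base_point g"
  define p where "p = passes_tests x t g m (\<lambda>i. \<omega> (e + n + i))"
  define u where "u = resid n us t"
  let ?e = "e + n" and ?e' = "e + (m + 1) * n"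
  have ext: "extend us ?w = (if p \<and> thr \<le> dotn n u u then us @ [u] else us)"
    by (simp add: extend_def g_def t_def x_def p_def u_def Let_def add.assoc)
  have 1: "Runs (holding us l e (\<lambda>_. True)) gauss_com (n * 4 + 2) (holding us l ?e (\<lambda>c. cZ c = ?w))"
    by (rule holding_simple, rule rep_gauss) simp
  have 2: "Runs (holding us l ?e (\<lambda>c. cZ c = ?w)) (block [Of_Nat 14 3]) 1 (holding us l ?e (\<lambda>c. cZ c = ?w \<and> cS c = 1))"
    by (rule holding_simple, rule rep_scalars(1)) simp
  have 3: "Runs (holding us l ?e (\<lambda>c. cZ c = ?w \<and> cS c = 1)) (scale_com 23 20) (n * 5 + 2)
      (holding us l ?e (\<lambda>c. cG c = ?w \<and> True))"
    by (rule holding_simple, rule rep_scale(3)) simp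
  have 4: "Runs (holding us l ?e (\<lambda>c. cG c = ?w \<and> True)) resid_com (k * (n * 18 + 13) + 2)
      (holding us l ?e (\<lambda>c. cG c = resid n us ?w \<and> True))"
    by (rule holding_resid[OF len, where P = "\<lambda>_. True"]) simp
  have 5: "Runs (holding us l ?e (\<lambda>c. cG c = resid n us ?w \<and> True)) (block [Of_Nat 14 4]) 1
      (holding us l ?e (\<lambda>c. cG c = g \<and> cS c = 0))"
    by (rule holding_simple, rule rep_scalars(2)) (simp add: g_def)
  have 6: "Runs (holding us l ?e (\<lambda>c. cG c = g \<and> cS c = 0)) (scale_com 20 22) (n * 5 + 2)
      (holding us l ?e (\<lambda>c. cG c = g \<and> cS c = 0 \<and> cX c = (\<lambda>_. 0)))"
    by (rule holding_simple, rule rep_scale(1)) simp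
  have 7: "Runs (holding us l ?e (\<lambda>c. cG c = g \<and> cS c = 0 \<and> cX c = (\<lambda>_. 0))) (scale_com 20 23) (n * 5 + 2)
      (holding us l ?e (\<lambda>c. cG c = g \<and> cX c = (\<lambda>_. 0) \<and> cZ c = (\<lambda>_. 0)))"
    by (rule holding_simple, rule rep_scale(2)) simp
  have 8: "Runs (holding us l ?e (\<lambda>c. cG c = g \<and> cX c = (\<lambda>_. 0) \<and> cZ c = (\<lambda>_. 0))) (block [Of_Nat 15 4, Of_Nat 16 3]) 2
      (holding us l ?e (\<lambda>c. cG c = g \<and> cX c = (\<lambda>_. 0) \<and> cZ c = (\<lambda>_. 0) \<and> cLO c = 0 \<and> cD c = 1))"
    by (rule holding_simple, rule rep_scalars(3)) simp
  have 9: "Runs (holding us l ?e (\<lambda>c. cG c = g \<and> cX c = (\<lambda>_. 0) \<and> cZ c = (\<lambda>_. 0) \<and> cLO c = 0 \<and> cD c = 1)) bisect_com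
      (b * (n * 10 + 9) + 2) (holding us l ?e (\<lambda>c. cG c = g \<and> cLO c = crossing g))"
  proof (rule holding_step)
    fix c :: cfg assume c: "cnum c = length us" "cU c = flat n us" "cloop c 38 = l" "cdrawn c = ?e"
      "cG c = g \<and> cX c = (\<lambda>_. 0) \<and> cZ c = (\<lambda>_. 0) \<and> cLO c = 0 \<and> cD c = 1"
    show "Runs (rep c) bisect_com (b * (n * 10 + 9) + 2) (holding us l ?e (\<lambda>c. cG c = g \<and> cLO c = crossing g))"
    proof (rule runs_conseq[OF rep_bisect])
      fix \<sigma> assume "\<exists>S D. rep (c\<lparr>cS := S, cD := D,
        cLO := bisect (ask (cX c) (cZ c) (cG c)) b (cLO c) (cD c), cloop := (cloop c)(35 := b)\<rparr>) \<sigma>"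
      then obtain S D where "rep (c\<lparr>cS := S, cD := D,
        cLO := bisect (ask (cX c) (cZ c) (cG c)) b (cLO c) (cD c), cloop := (cloop c)(35 := b)\<rparr>) \<sigma>" by blast
      then show "holding us l ?e (\<lambda>c. cG c = g \<and> cLO c = crossing g) \<sigma>"
        unfolding holding_def by (intro exI conjI, assumption) (use c in \<open>simp_all add: crossing_def\<close>)
    qed auto
  qed
  have 10: "Runs (holding us l ?e (\<lambda>c. cG c = g \<and> cLO c = crossing g)) (block [Copy 14 15]) 1
      (holding us l ?e (\<lambda>c. cG c = g \<and> cS c = crossing g))"
    by (rule holding_simple, rule rep_scalars(4)) simp
  have 11: "Runs (holding us l ?e (\<lambda>c. cG c = g \<and> cS c = crossing g)) (scale_com 20 22) (n * 5 + 2)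
      (holding us l ?e (\<lambda>c. cG c = g \<and> cX c = base_point g \<and> (\<forall>i<0. cT c i = candidate g i)))"
    by (rule holding_simple, rule rep_scale(1)) (simp add: base_point_def)
  have 12: "Runs (holding us l ?e (\<lambda>c. cG c = g \<and> cX c = base_point g \<and> (\<forall>i<0. cT c i = candidate g i)))
      (for_loop 36 0 coord_body) (n * (coord_time + 2) + 2)
      (holding us l ?e (\<lambda>c. cG c = g \<and> cX c = base_point g \<and> (\<forall>i<n. cT c i = candidate g i)))"
  proof (rule holding_for[where d = "\<lambda>_. ?e" and P = "\<lambda>j c. cG c = g \<and> cX c = base_point g \<and> (\<forall>i<j. cT c i = candidate g i)"])
    fix j assume "j < n"
    from holding_coord_body[OF this, of us l ?e g]
    show "Runs (holding us l ?e (\<lambda>c. cloop c 36 = j \<and> cG c = g \<and> cX c = base_point g \<and> (\<forall>i<j. cT c i = candidate g i)))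
        coord_body coord_time
        (holding us l ?e (\<lambda>c. cloop c 36 = j \<and> cG c = g \<and> cX c = base_point g \<and> (\<forall>i<Suc j. cT c i = candidate g i)))"
      by (rule runs_conseq) (auto simp: holding_def)
  qed auto
  have 13: "Runs (holding us l ?e (\<lambda>c. cG c = g \<and> cX c = base_point g \<and> (\<forall>i<n. cT c i = candidate g i)))
      (block [Const 9 0]) 1
      (holding us l (?e + 0 * n) (\<lambda>c. cG c = g \<and> cX c = x \<and> (\<forall>i<n. cT c i = t i) \<and>
        (cerr c = 0) = passes_tests x t g 0 (\<lambda>i. \<omega> (e + n + i))))"
    by (rule holding_simple, rule rep_scalars(5)) (simp add: x_def t_def passes_tests_def)
  have 14: "Runs (holding us l (?e + 0 * n) (\<lambda>c. cG c = g \<and> cX c = x \<and> (\<forall>i<n. cT c i = t i) \<and>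
        (cerr c = 0) = passes_tests x t g 0 (\<lambda>i. \<omega> (e + n + i)))) (for_loop 37 7 test_body) (m * (test_time + 2) + 2)
      (holding us l (?e + m * n) (\<lambda>c. cG c = g \<and> cX c = x \<and> (\<forall>i<n. cT c i = t i) \<and>
        (cerr c = 0) = passes_tests x t g m (\<lambda>i. \<omega> (e + n + i))))"
  proof (rule holding_for[where d = "\<lambda>j. ?e + j * n" and P = "\<lambda>j c. cG c = g \<and> cX c = x \<and> (\<forall>i<n. cT c i = t i) \<and>
        (cerr c = 0) = passes_tests x t g j (\<lambda>i. \<omega> (e + n + i))"])
    fix j
    have s: "passes_tests x t g (Suc j) (\<lambda>i. \<omega> (e + n + i)) =
        (passes_tests x t g j (\<lambda>i. \<omega> (e + n + i)) \<and> passes_test x t g (\<lambda>i. \<omega> (?e + j * n + i)))"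
      by (auto simp: passes_tests_def less_Suc_eq add.assoc)
    have d: "?e + Suc j * n = ?e + j * n + n" by simp
    show "Runs (holding us l (?e + j * n) (\<lambda>c. cloop c 37 = j \<and> cG c = g \<and> cX c = x \<and> (\<forall>i<n. cT c i = t i) \<and>
        (cerr c = 0) = passes_tests x t g j (\<lambda>i. \<omega> (e + n + i)))) test_body test_time
      (holding us l (?e + Suc j * n) (\<lambda>c. cloop c 37 = j \<and> cG c = g \<and> cX c = x \<and> (\<forall>i<n. cT c i = t i) \<and>
        (cerr c = 0) = passes_tests x t g (Suc j) (\<lambda>i. \<omega> (e + n + i))))"
      unfolding d s by (rule holding_test_body)
  qed auto
  have 15: "Runs (holding us l (?e + m * n) (\<lambda>c. cG c = g \<and> cX c = x \<and> (\<forall>i<n. cT c i = t i) \<and>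
        (cerr c = 0) = passes_tests x t g m (\<lambda>i. \<omega> (e + n + i)))) (block [Of_Nat 14 3]) 1
      (holding us l ?e' (\<lambda>c. (\<forall>i<n. cT c i = t i) \<and> (cerr c = 0) = p \<and> cS c = 1))"
    by (rule holding_simple, rule rep_scalars(1)) (simp add: p_def)
  have 16: "Runs (holding us l ?e' (\<lambda>c. (\<forall>i<n. cT c i = t i) \<and> (cerr c = 0) = p \<and> cS c = 1)) (scale_com 21 20) (n * 5 + 2)
      (holding us l ?e' (\<lambda>c. (\<forall>i<n. cG c i = t i) \<and> (cerr c = 0) = p))"
    by (rule holding_simple, rule rep_scale(4)) simp
  have 17: "Runs (holding us l ?e' (\<lambda>c. (\<forall>i<n. cG c i = t i) \<and> (cerr c = 0) = p)) resid_com (k * (n * 18 + 13) + 2)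
      (holding us l ?e' (\<lambda>c. (\<forall>i<n. cG c i = u i) \<and> (cerr c = 0) = p))"
  proof (rule holding_step)
    fix c :: cfg assume c: "cnum c = length us" "cU c = flat n us" "cloop c 38 = l" "cdrawn c = ?e'"
      "(\<forall>i<n. cG c i = t i) \<and> (cerr c = 0) = p"
    have u: "resid n us (cG c) i = u i" if "i < n" for i
      unfolding u_def using that c by (intro resid_cong) auto
    show "Runs (rep c) resid_com (k * (n * 18 + 13) + 2)
      (holding us l ?e' (\<lambda>c. (\<forall>i<n. cG c i = u i) \<and> (cerr c = 0) = p))"
    proof (rule runs_conseq[OF rep_resid[OF c(1,2)]])
      fix \<sigma> assume "\<exists>S L v w. rep (c\<lparr>cS := S, cLO := L, cG := resid n us (cG c), cloop := (cloop c)(39 := v, 26 := w)\<rparr>) \<sigma>"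
      then obtain S L v w where "rep (c\<lparr>cS := S, cLO := L, cG := resid n us (cG c), cloop := (cloop c)(39 := v, 26 := w)\<rparr>) \<sigma>"
        by blast
      then show "holding us l ?e' (\<lambda>c. (\<forall>i<n. cG c i = u i) \<and> (cerr c = 0) = p) \<sigma>"
        unfolding holding_def by (intro exI conjI, assumption) (use c u in simp_all)
    next
      show "length us * (n * 18 + 13) + 2 \<le> k * (n * 18 + 13) + 2" using len by simp
    qed
  qed
  let ?F = "\<lambda>c. (\<forall>i<n. cG c i = u i) \<and> (cerr c = 0) = p \<and> cS c = dotn n u u"
  have 18: "Runs (holding us l ?e' (\<lambda>c. (\<forall>i<n. cG c i = u i) \<and> (cerr c = 0) = p)) (dot_com 20 20 14) (n * 6 + 3)
      (holding us l ?e' ?F)"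
    by (rule holding_simple, rule rep_dot(3)) (simp cong: dotn_cong)
  have 19: "Runs (holding us l ?e' ?F) (Cond (NLess 9 3) (Cond (RLess 14 13) skip add_com) skip) (((n * 5 + 6) + 1) + 1)
      (holding (extend us ?w) l ?e' (\<lambda>_. True))"
  proof (rule holding_step)
    fix c :: cfg assume c: "cnum c = length us" "cU c = flat n us" "cloop c 38 = l" "cdrawn c = ?e'" "?F c"
    have skip: "Runs (\<lambda>\<sigma>. rep c \<sigma> \<and> R \<sigma>) skip t (holding us l ?e' (\<lambda>_. True))" if "1 \<le> t" for R t
      by (rule runs_conseq[OF rep_skip[of c]]) (use c that in \<open>auto simp: holding_def\<close>)
    have add: "Runs (\<lambda>\<sigma>. rep c \<sigma> \<and> R \<sigma>) add_com (n * 5 + 6) (holding (us @ [u]) l ?e' (\<lambda>_. True))" for R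
      by (rule runs_conseq[OF holding_add[of "cG c" u us l ?e']]) (use c in \<open>auto simp: holding_def\<close>)
    have test: "tholds (NLess 9 3) \<sigma> \<longleftrightarrow> p" "tholds (RLess 14 13) \<sigma> \<longleftrightarrow> dotn n u u < thr" if "rep c \<sigma>" for \<sigma>
      using that c by (cases \<sigma>; auto simp: rep_def rregs_def rmem_def lay_def)+
    show "Runs (rep c) (Cond (NLess 9 3) (Cond (RLess 14 13) skip add_com) skip) (((n * 5 + 6) + 1) + 1)
      (holding (extend us ?w) l ?e' (\<lambda>_. True))"
    proof (cases "p \<and> thr \<le> dotn n u u")
      case True
      then have p: p and le: "\<not> dotn n u u < thr" by auto
      have "Runs (\<lambda>\<sigma>. rep c \<sigma> \<and> tholds (NLess 9 3) \<sigma>) (Cond (RLess 14 13) skip add_com) ((n * 5 + 6) + 1)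
          (holding (us @ [u]) l ?e' (\<lambda>_. True))"
      proof (rule runs_Cond)
        show "Runs (\<lambda>\<sigma>. (rep c \<sigma> \<and> tholds (NLess 9 3) \<sigma>) \<and> tholds (RLess 14 13) \<sigma>) skip (n * 5 + 6)
            (holding (us @ [u]) l ?e' (\<lambda>_. True))"
          unfolding runs_def using le test(2) by blast
        show "Runs (\<lambda>\<sigma>. (rep c \<sigma> \<and> tholds (NLess 9 3) \<sigma>) \<and> \<not> tholds (RLess 14 13) \<sigma>) add_com (n * 5 + 6)
            (holding (us @ [u]) l ?e' (\<lambda>_. True))"
          by (rule runs_conseq[OF add[of "tholds (NLess 9 3)"]]) auto
      qed
      moreover have "Runs (\<lambda>\<sigma>. rep c \<sigma> \<and> \<not> tholds (NLess 9 3) \<sigma>) skip ((n * 5 + 6) + 1)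
          (holding (us @ [u]) l ?e' (\<lambda>_. True))"
        unfolding runs_def using p test(1) by blast
      ultimately show ?thesis
        unfolding ext if_P[OF True] by (rule runs_Cond)
    next
      case False
      have "Runs (\<lambda>\<sigma>. rep c \<sigma> \<and> tholds (NLess 9 3) \<sigma>) (Cond (RLess 14 13) skip add_com) ((n * 5 + 6) + 1)
          (holding us l ?e' (\<lambda>_. True))"
      proof (rule runs_Cond)
        show "Runs (\<lambda>\<sigma>. (rep c \<sigma> \<and> tholds (NLess 9 3) \<sigma>) \<and> tholds (RLess 14 13) \<sigma>) skip (n * 5 + 6) (holding us l ?e' (\<lambda>_. True))"
          by (rule runs_conseq[OF skip[of "n * 5 + 6" "\<lambda>_. True"]]) auto
        show "Runs (\<lambda>\<sigma>. (rep c \<sigma> \<and> tholds (NLess 9 3) \<sigma>) \<and> \<not> tholds (RLess 14 13) \<sigma>) add_com (n * 5 + 6) (holding us l ?e' (\<lambda>_. True))"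
          unfolding runs_def using False test not_le by blast
      qed
      moreover have "Runs (\<lambda>\<sigma>. rep c \<sigma> \<and> \<not> tholds (NLess 9 3) \<sigma>) skip ((n * 5 + 6) + 1) (holding us l ?e' (\<lambda>_. True))"
        by (rule skip) simp
      ultimately show ?thesis
        unfolding ext if_not_P[OF False] by (rule runs_Cond)
    qed
  qed
  show ?thesis
    unfolding round_com_def round_time_def
    by (rule runs_Seq[OF 1 runs_Seq[OF 2 runs_Seq[OF 3 runs_Seq[OF 4 runs_Seq[OF 5 runs_Seq[OF 6
      runs_Seq[OF 7 runs_Seq[OF 8 runs_Seq[OF 9 runs_Seq[OF 10 runs_Seq[OF 11 runs_Seq[OF 12
      runs_Seq[OF 13 runs_Seq[OF 14 runs_Seq[OF 15 runs_Seq[OF 16 runs_Seq[OF 17 runs_Seq[OF 18 19]]]]]]]]]]]]]]]]]])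
qed

text \<open>The loop always makes \<open>N\<close> passes and idles once \<open>k\<close> vectors
  are stored, with the same resulting list as the early exit of \<open>rounds\<close>.\<close>

definition search_com :: com where
  "search_com = for_loop 38 6 (Cond (NLess 5 1) round_com skip)"

lemma holding_search:
  "Runs (holding us\<^sub>0 l d\<^sub>0 (\<lambda>_. True)) search_com (N * (round_time + 1 + 2) + 2)
    (\<lambda>\<sigma>. \<exists>e. holding (rounds k N us\<^sub>0 (\<lambda>i. \<omega> (d\<^sub>0 + i))) N e (\<lambda>_. True) \<sigma>)"
proof -
  let ?r = "rounds k N us\<^sub>0 (\<lambda>i. \<omega> (d\<^sub>0 + i))"
  let ?Inv = "\<lambda>j \<sigma>. \<exists>us e. holding us j e (\<lambda>_. True) \<sigma> \<and> rounds k (N - j) us (\<lambda>i. \<omega> (e + i)) = ?r"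
  have set: "holding us x e (\<lambda>_. True) (I(38 := x), mm, d)" if "holding us l e (\<lambda>_. True) (I, mm, d)" for us l e I mm d x
  proof -
    from that obtain c where c: "rep c (I, mm, d)" "cnum c = length us" "cU c = flat n us" "cdrawn c = e"
      unfolding holding_def by blast
    have "rep (c\<lparr>cloop := (cloop c)(38 := x)\<rparr>) (I(38 := x), mm, d)"
      using c(1) by (simp add: rep_def rregs_def rmem_def lay_def)
    then show ?thesis unfolding holding_def by (intro exI conjI, assumption) (use c in simp_all)
  qed
  have regs: "I 3 = 1 \<and> I 38 = l \<and> I 6 = N \<and> I 1 = k \<and> I 5 = length us"
    if "holding us l e P (I, mm, d)" for us l e P I mm d
    using that unfolding holding_def rep_def rregs_def lay_def by auto
  have "Runs (holding us\<^sub>0 l d\<^sub>0 (\<lambda>_. True)) search_com (N * (round_time + 1 + 2) + 2) (?Inv N)"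
    unfolding search_com_def
  proof (rule runs_for[where Inv = ?Inv])
    fix I mm d assume "holding us\<^sub>0 l d\<^sub>0 (\<lambda>_. True) (I, mm, d)"
    from set[OF this, of 0] show "?Inv 0 (I(38 := 0), mm, d)" by auto
  next
    fix j I mm d assume "?Inv j (I, mm, d)"
    then show "I 38 = j \<and> I 6 = N" using regs by blast
  next
    fix j assume j: "j < N"
    then have Nj: "N - j = Suc (N - Suc j)" by simp
    show "Runs (?Inv j) (Cond (NLess 5 1) round_com skip) (round_time + 1)
        (\<lambda>(I, m, d). I 3 = 1 \<and> ?Inv (Suc j) (I(38 := Suc (I 38)), m, d))"
    proof (rule runs_pointwise)
      fix I mm d assume "?Inv j (I, mm, d)"
      then obtain us e where h: "holding us j e (\<lambda>_. True) (I, mm, d)"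
        and eq: "rounds k (N - j) us (\<lambda>i. \<omega> (e + i)) = ?r" by blast
      have post: "(\<lambda>(I, m, d). I 3 = 1 \<and> ?Inv (Suc j) (I(38 := Suc (I 38)), m, d)) \<sigma>"
        if "holding vs j e' (\<lambda>_. True) \<sigma>" "rounds k (N - Suc j) vs (\<lambda>i. \<omega> (e' + i)) = ?r" for vs e' \<sigma>
      proof -
        obtain I m d where \<sigma>: "\<sigma> = (I, m, d)" by (cases \<sigma>)
        have "I 3 = 1" "I 38 = j" using regs[OF that(1)[unfolded \<sigma>]] by auto
        then show ?thesis using set[OF that(1)[unfolded \<sigma>], of "Suc j"] that(2) unfolding \<sigma> by auto
      qed
      show "Runs (\<lambda>\<sigma>. \<sigma> = (I, mm, d)) (Cond (NLess 5 1) round_com skip) (round_time + 1)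
          (\<lambda>(I, m, d). I 3 = 1 \<and> ?Inv (Suc j) (I(38 := Suc (I 38)), m, d))"
      proof (rule runs_Cond)
        show "Runs (\<lambda>\<sigma>. \<sigma> = (I, mm, d) \<and> tholds (NLess 5 1) \<sigma>) round_com round_time
            (\<lambda>(I, m, d). I 3 = 1 \<and> ?Inv (Suc j) (I(38 := Suc (I 38)), m, d))"
        proof (cases "length us < k")
          case True
          show ?thesis
          proof (rule runs_conseq[OF holding_round[OF True, of j e]])
            fix \<sigma> assume "holding (extend us (\<lambda>i. \<omega> (e + i))) j (e + (m + 1) * n) (\<lambda>_. True) \<sigma>"
            moreover have "rounds k (N - Suc j) (extend us (\<lambda>i. \<omega> (e + i))) (\<lambda>i. \<omega> (e + (m + 1) * n + i)) = ?r"
              using eq True unfolding Nj by (simp add: add.assoc)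
            ultimately show "(\<lambda>(I, m, d). I 3 = 1 \<and> ?Inv (Suc j) (I(38 := Suc (I 38)), m, d)) \<sigma>" by (rule post)
          qed (use h in auto)
        next
          case False
          then have "\<not> tholds (NLess 5 1) (I, mm, d)" using regs[OF h] by simp
          then show ?thesis by (auto simp: runs_def)
        qed
        show "Runs (\<lambda>\<sigma>. \<sigma> = (I, mm, d) \<and> \<not> tholds (NLess 5 1) \<sigma>) skip round_time
            (\<lambda>(I, m, d). I 3 = 1 \<and> ?Inv (Suc j) (I(38 := Suc (I 38)), m, d))"
        proof (cases "length us < k")
          case True
          then have "tholds (NLess 5 1) (I, mm, d)" using regs[OF h] by simp
          then show ?thesis by (auto simp: runs_def)
        next
          case False
          from h obtain c where c: "rep c (I, mm, d)" "cnum c = length us" "cU c = flat n us" "cloop c 38 = j" "cdrawn c = e"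
            unfolding holding_def by blast
          have r: "rounds k (N - Suc j) us (\<lambda>i. \<omega> (e + i)) = ?r"
            using eq False unfolding Nj by (cases "N - Suc j") auto
          show ?thesis
          proof (rule runs_conseq[OF rep_skip[of c]])
            fix \<sigma> assume "rep c \<sigma>"
            then have "holding us j e (\<lambda>_. True) \<sigma>" using c unfolding holding_def by blast
            then show "(\<lambda>(I, m, d). I 3 = 1 \<and> ?Inv (Suc j) (I(38 := Suc (I 38)), m, d)) \<sigma>"
              using r by (rule post)
          qed (use c in \<open>auto simp: round_time_def\<close>)
        qed
      qed
    qed
  qed
  then show ?thesis
    by (rule runs_conseq) auto
qed

end

section \<open>Initialisation\<close>

text \<open>A rounded-up logarithm to base \<open>2\<close> that the machine finds by repeated
  doubling. It is \<open>0\<close> for \<open>v \<le> 1\<close>, matching the truncation in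
  \<open>log1\<close>.\<close>

definition lg :: "real \<Rightarrow> nat" where "lg v = (LEAST e. v \<le> 2 ^ e)"

text \<open>The rounded-up reciprocal, found by adding \<open>\<gamma>\<close> repeatedly; time
  linear in \<open>1 / \<gamma>\<close> is within the allowed size.\<close>

definition gcount :: "real \<Rightarrow> nat" where "gcount \<gamma> = (LEAST j. 1 \<le> real j * \<gamma>)"

lemma lg_exists: "\<exists>e. (v::real) \<le> 2 ^ e"
  using real_arch_pow[of 2 v] by (auto intro: less_imp_le)

lemma lg_bound: "v \<le> 2 ^ lg v"
  unfolding lg_def using lg_exists by (rule LeastI_ex)

lemma gcount_exists: "0 < \<gamma> \<Longrightarrow> \<exists>j. 1 \<le> real j * \<gamma>"
  using reals_Archimedean3[of \<gamma>] by (metis less_imp_le)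

lemma gcount_bound: "0 < \<gamma> \<Longrightarrow> 1 \<le> real (gcount \<gamma>) * \<gamma>"
  unfolding gcount_def using gcount_exists by (rule LeastI_ex)

text \<open>One loop for both counts. With \<open>c = 17\<close> the cell is added to itself and
  doubles; with \<open>c = 4\<close> the address is \<open>0\<close>, where the input stores
  \<open>\<gamma>\<close>. Register \<open>i\<close> supplies the start value.\<close>

definition count_com :: "nat \<Rightarrow> nat \<Rightarrow> nat \<Rightarrow> nat \<Rightarrow> com" where
  "count_com i c a r = Seq (block [Of_Nat 17 i])
     (While (RLess 17 a) (block [RealOp RAdd 17 17 c, NatOp NAdd r r 3]))"

lemma count_runs:
  fixes f m\<^sub>0 :: "nat \<Rightarrow> real" and I\<^sub>0 :: "nat \<Rightarrow> nat" and a :: nat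
  defines "N \<equiv> LEAST j. m\<^sub>0 (I\<^sub>0 a) \<le> f j"
  assumes r: "r \<notin> {3, 17, a, c, i}" and I: "I\<^sub>0 3 = 1" "I\<^sub>0 a \<noteq> I\<^sub>0 17"
    and f: "f 0 = I\<^sub>0 i" "\<And>j. f (Suc j) = f j + (if I\<^sub>0 c = I\<^sub>0 17 then f j else m\<^sub>0 (I\<^sub>0 c))"
    and ex: "\<exists>j. m\<^sub>0 (I\<^sub>0 a) \<le> f j"
  shows "runs Q \<omega> (\<lambda>\<sigma>. \<sigma> = (I\<^sub>0, m\<^sub>0, d)) (count_com i c a r) (3 * N + 2)
    (\<lambda>\<sigma>. \<sigma> = (I\<^sub>0(r := I\<^sub>0 r + N), m\<^sub>0(I\<^sub>0 17 := f N), d))"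
proof -
  let ?Inv = "\<lambda>j \<sigma>. \<sigma> = (I\<^sub>0(r := I\<^sub>0 r + j), m\<^sub>0(I\<^sub>0 17 := f j), d)"
  have N: "m\<^sub>0 (I\<^sub>0 a) \<le> f N" unfolding N_def using ex by (rule LeastI_ex)
  have less: "f j < m\<^sub>0 (I\<^sub>0 a)" if "j < N" for j
    using not_less_Least[of j "\<lambda>j. m\<^sub>0 (I\<^sub>0 a) \<le> f j"] that unfolding N_def by simp
  have 1: "runs Q \<omega> (\<lambda>\<sigma>. \<sigma> = (I\<^sub>0, m\<^sub>0, d)) (block [Of_Nat 17 i]) (length [Of_Nat 17 i]) (?Inv 0)"
    by (rule runs_block) (simp_all add: f(1))
  have 2: "runs Q \<omega> (?Inv 0) (While (RLess 17 a) (block [RealOp RAdd 17 17 c, NatOp NAdd r r 3]))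
      (N * (length [RealOp RAdd 17 17 c, NatOp NAdd r r 3] + 1) + 1) (?Inv N)"
  proof (rule runs_While)
    fix j \<sigma> assume j: "j \<le> N" and \<sigma>: "?Inv j \<sigma>"
    then show "tholds (RLess 17 a) \<sigma> \<longleftrightarrow> j < N"
      using r I less[of j] N by (cases "j = N") auto
  next
    fix j assume "j < N"
    show "runs Q \<omega> (?Inv j) (block [RealOp RAdd 17 17 c, NatOp NAdd r r 3])
        (length [RealOp RAdd 17 17 c, NatOp NAdd r r 3]) (?Inv (Suc j))"
      by (rule runs_block) (use r I f(2)[of j] in \<open>simp_all add: fun_eq_iff\<close>)
  qed
  show ?thesis
    unfolding count_com_def using runs_Seq[OF 1 2] by (rule runs_conseq) auto
qed

lemma lg_runs:
  assumes "r \<notin> {3, 17, a}" "I\<^sub>0 3 = 1" "I\<^sub>0 a \<noteq> I\<^sub>0 17"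
  shows "runs Q \<omega> (\<lambda>\<sigma>. \<sigma> = (I\<^sub>0, m\<^sub>0, d)) (count_com 3 17 a r) (3 * lg (m\<^sub>0 (I\<^sub>0 a)) + 2)
    (\<lambda>\<sigma>. \<sigma> = (I\<^sub>0(r := I\<^sub>0 r + lg (m\<^sub>0 (I\<^sub>0 a))), m\<^sub>0(I\<^sub>0 17 := 2 ^ lg (m\<^sub>0 (I\<^sub>0 a))), d))"
  unfolding lg_def by (rule count_runs) (use assms lg_exists in auto)

definition half_power_com :: "nat \<Rightarrow> nat \<Rightarrow> com" where
  "half_power_com c e = Seq (block [Of_Nat c 3]) (for_loop 35 e (block [RealOp RMul c c 19]))"

lemma half_power_runs:
  assumes "c \<notin> {35}" "e \<noteq> 35" "I\<^sub>0 3 = 1" "I\<^sub>0 c \<noteq> I\<^sub>0 19" "m\<^sub>0 (I\<^sub>0 19) = 1 / 2"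
  shows "runs Q \<omega> (\<lambda>\<sigma>. \<sigma> = (I\<^sub>0, m\<^sub>0, d)) (half_power_com c e) (3 * I\<^sub>0 e + 3)
    (\<lambda>\<sigma>. \<sigma> = (I\<^sub>0(35 := I\<^sub>0 e), m\<^sub>0(I\<^sub>0 c := (1 / 2) ^ I\<^sub>0 e), d))"
proof -
  let ?Inv = "\<lambda>j \<sigma>. \<sigma> = (I\<^sub>0(35 := j), m\<^sub>0(I\<^sub>0 c := (1 / 2) ^ j), d)"
  have 1: "runs Q \<omega> (\<lambda>\<sigma>. \<sigma> = (I\<^sub>0, m\<^sub>0, d)) (block [Of_Nat c 3]) (length [Of_Nat c 3])
      (\<lambda>\<sigma>. \<sigma> = (I\<^sub>0, m\<^sub>0(I\<^sub>0 c := 1), d))"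
    by (rule runs_block) (use assms in simp_all)
  have 2: "runs Q \<omega> (\<lambda>\<sigma>. \<sigma> = (I\<^sub>0, m\<^sub>0(I\<^sub>0 c := 1), d)) (for_loop 35 e (block [RealOp RMul c c 19]))
      (I\<^sub>0 e * (length [RealOp RMul c c 19] + 2) + 2) (?Inv (I\<^sub>0 e))"
    by (rule runs_for_block[where Inv = ?Inv]) (use assms in auto)
  show ?thesis
    unfolding half_power_com_def using runs_Seq[OF 1 2] by (rule runs_conseq) auto
qed

text \<open>With \<open>h = (1 / K) ^ rate p\<close> the final error
  \<open>h * K ^ (17 + 6 * k)\<close> is \<open>(1 / K) ^ 3\<close>, which is below
  \<open>\<epsilon>\<close> since \<open>K * \<epsilon> \<ge> 1\<close>.\<close>

definition rate :: "params \<Rightarrow> nat" where "rate p = 20 + 6 * par_k p"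

text \<open>By \<open>1 - \<gamma> / 4 \<le> exp (- \<gamma> / 4)\<close>, every \<open>4 * gcount \<gamma>\<close> rounds halve \<open>(1 - \<gamma> / 4) ^ N\<close>.\<close>

definition round_count :: "params \<Rightarrow> nat" where
  "round_count p = (par_k p + 1 + lg (1 / par_delta p)) * gcount (par_gamma p) * 4"

text \<open>Three tests halve the probability of a false acceptance, since
  \<open>(3 / 4) ^ 3 < 1 / 2\<close>. The summand \<open>round_count p\<close> absorbs the union
  bound over the rounds by \<open>N \<le> 2 ^ N\<close>.\<close>

definition test_count :: "params \<Rightarrow> nat" where
  "test_count p = (lg (1 / par_delta p) + 1 + round_count p) * 3"

text \<open>The exponent of \<open>2\<close> in \<open>S * (\<Prod>i<d. 2 * S * lam i)\<close> when
  the scale and all \<open>L i\<close> are rounded up to powers of two.\<close>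

definition lip_exp :: "params \<Rightarrow> nat" where
  "lip_exp p = lg (par_scale p) * (par_d p + 1) + par_d p + (\<Sum>i<par_d p. lg (par_L p i))"

text \<open>The summands make \<open>2 ^ E\<close> dominate, in this order, \<open>64\<close>, the Lipschitz constant, \<open>1 / \<eta>\<close>, \<open>1 / \<epsilon>\<close>, \<open>1 / \<gamma>\<close>,
  the number of test vectors, and \<open>n\<close>.\<close>

definition scale_exp :: "params \<Rightarrow> nat" where
  "scale_exp p = 6 + lip_exp p + lg (1 / par_eta p) + lg (1 / par_eps p) + gcount (par_gamma p)
     + test_count p + par_n p"

text \<open>The first cell after the input, which consists of five scalars and two lists of length
  \<open>d\<close>.\<close>

definition base :: "params \<Rightarrow> nat" where "base p = 5 + 2 * par_d p"

definition ready :: "params \<Rightarrow> (nat \<Rightarrow> nat) \<Rightarrow> (nat \<Rightarrow> real) \<Rightarrow> bool" where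
  "ready p I m \<longleftrightarrow> lay (par_n p) (base p) I \<and> I 1 = par_k p \<and> I 2 = par_d p \<and> I 5 = 0 \<and>
     I 41 = 1 \<and> I 42 = 2 \<and> I 43 = 3 \<and> I 44 = 4 \<and> I 52 = 5 \<and> I 53 = 5 + par_d p \<and>
     m 0 = par_gamma p \<and> m 1 = par_eta p \<and> m 2 = par_eps p \<and> m 3 = par_delta p \<and> m 4 = par_scale p \<and>
     (\<forall>i<par_d p. m (5 + i) = par_L p i) \<and> (\<forall>x. base p + 10 \<le> x \<longrightarrow> m x = 0)"

text \<open>Registers from \<open>46\<close> on collect the computed integers in the order of
  \<open>vs\<close>. The remaining ones up to \<open>51\<close> are required to be zero because
  \<open>count_com\<close> increments its target.\<close>

definition counted :: "params \<Rightarrow> nat list \<Rightarrow> conf \<Rightarrow> bool" where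
  "counted p vs = (\<lambda>(I, m, d). ready p I m \<and> d = 0 \<and> (\<forall>i<length vs. I (46 + i) = vs ! i) \<and>
     (\<forall>r. 46 + length vs \<le> r \<and> r < 52 \<longrightarrow> I r = 0))"

definition layout :: "instr list" where
  "layout = [Const 3 1, Const 40 5, NatOp NAdd 10 2 2, NatOp NAdd 10 10 40,
     NatOp NAdd 11 10 3, NatOp NAdd 12 11 3, NatOp NAdd 13 12 3, NatOp NAdd 14 13 3, NatOp NAdd 15 14 3,
     NatOp NAdd 16 15 3, NatOp NAdd 17 16 3, NatOp NAdd 18 17 3, NatOp NAdd 19 18 3, NatOp NAdd 20 19 3,
     NatOp NAdd 21 20 0, NatOp NAdd 22 21 0, NatOp NAdd 23 22 0, NatOp NAdd 24 23 0, NatOp NAdd 25 24 0,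
     Const 41 1, Const 42 2, Const 43 3, Const 44 4, Const 52 5, NatOp NAdd 53 40 2]"

lemma layout_runs:
  "runs Q \<omega> (\<lambda>\<sigma>. \<sigma> = conf_of (input_state p)) (block layout) 25 (counted p [])"
proof -
  define I where "I = idx (input_state p)"
  define m where "m = mem (input_state p)"
  have I: "I 0 = par_n p" "I 1 = par_k p" "I 2 = par_d p" "\<And>r. 3 \<le> r \<Longrightarrow> I r = 0"
    by (auto simp: I_def input_state_def Let_def)
  have m: "m 0 = par_gamma p" "m 1 = par_eta p" "m 2 = par_eps p" "m 3 = par_delta p" "m 4 = par_scale p"
    "\<And>i. i < par_d p \<Longrightarrow> m (5 + i) = par_L p i" "\<And>x. base p + 10 \<le> x \<Longrightarrow> m x = 0"
    by (auto simp: m_def input_state_def Let_def nth_append base_def eval_nat_numeral)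
  have c: "conf_of (input_state p) = (I, m, 0)"
    by (simp add: conf_of_def I_def m_def input_state_def Let_def)
  let ?E = "ieffs Q \<omega> layout (I, m, 0)"
  let ?J = "fst ?E"
  have J: "?J 0 = par_n p" "?J 1 = par_k p" "?J 2 = par_d p" "?J 3 = 1"
    "?J 4 = 0" "?J 5 = 0" "?J 10 = base p" "?J 11 = base p + 1"
    "?J 12 = base p + 2" "?J 13 = base p + 3" "?J 14 = base p + 4" "?J 15 = base p + 5"
    "?J 16 = base p + 6" "?J 17 = base p + 7" "?J 18 = base p + 8" "?J 19 = base p + 9"
    "?J 20 = base p + 10" "?J 21 = base p + 10 + par_n p" "?J 22 = base p + 10 + 2 * par_n p" "?J 23 = base p + 10 + 3 * par_n p"
    "?J 24 = base p + 10 + 4 * par_n p" "?J 25 = base p + 10 + 5 * par_n p" "?J 41 = 1" "?J 42 = 2"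
    "?J 43 = 3" "?J 44 = 4" "?J 52 = 5" "?J 53 = 5 + par_d p"
    "?J 46 = 0" "?J 47 = 0" "?J 48 = 0" "?J 49 = 0"
    "?J 50 = 0" "?J 51 = 0"
    by (simp_all add: layout_def I I(2)[unfolded One_nat_def] base_def)
  have E: "?E = (?J, m, 0)" by (simp add: layout_def)
  have "?J r = 0" if "46 \<le> r" "r < 52" for r
  proof -
    have "r \<in> {46, 47, 48, 49, 50, 51}" using that by auto
    with J show ?thesis by (elim insertE emptyE) (simp_all only:)
  qed
  moreover have "ready p ?J m"
    unfolding ready_def lay_def by (intro conjI allI impI J m)
  ultimately have "counted p [] (?J, m, 0)"
    unfolding counted_def by simp
  then have "counted p [] ?E" by (simp only: E [symmetric])
  then have "runs Q \<omega> (\<lambda>\<sigma>. \<sigma> = (I, m, 0)) (block layout) (length layout) (counted p [])"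
    by (intro runs_block) (simp_all add: layout_def)
  then show ?thesis unfolding c by (rule runs_conseq) (simp_all add: layout_def)
qed

lemma counted_regs:
  assumes "counted p vs (I, m, d)"
  shows "I 3 = 1" "I 4 = 0" "I 10 = base p" "I 17 = base p + 7" "I 19 = base p + 9" "I 41 = 1" "I 42 = 2" "I 43 = 3" "I 44 = 4"
    "I 52 = 5" "I 53 = 5 + par_d p" "length vs \<le> 5 \<Longrightarrow> I (46 + length vs) = 0" "d = 0"
    "m 0 = par_gamma p" "m 1 = par_eta p" "m 2 = par_eps p" "m 3 = par_delta p" "m 4 = par_scale p"
    "\<And>i. i < par_d p \<Longrightarrow> m (5 + i) = par_L p i"
  using assms by (simp_all add: counted_def ready_def lay_def)

lemma counted_snoc:
  assumes c: "counted p vs (I, m, d)" and l: "length vs \<le> 5"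
    and m': "\<And>x. x \<notin> {base p, base p + 7, base p + 9} \<Longrightarrow> m' x = m x"
  shows "counted p (vs @ [v]) (I(46 + length vs := v), m', d)"
proof -
  have m'': "m' x = m x" if "x < base p \<or> base p + 10 \<le> x" for x
    using that by (intro m') auto
  have "ready p (I(46 + length vs := v)) m'"
    using c l unfolding counted_def ready_def lay_def by (simp add: m'' base_def)
  then show ?thesis
    using c by (auto simp: counted_def nth_append less_Suc_eq)
qed

lemma counted_lg:
  assumes l: "length vs = l" "l \<le> 5"
    and a: "\<And>I m d. counted p vs (I, m, d) \<Longrightarrow> I a < base p \<and> m (I a) = v" and "a \<notin> {3, 17, 46 + l}"
  shows "runs Q \<omega> (counted p vs) (count_com 3 17 a (46 + l)) (3 * lg v + 2) (counted p (vs @ [lg v]))"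
proof (rule runs_pointwise)
  fix I m d assume c: "counted p vs (I, m, d)"
  note regs = counted_regs[OF c]
  show "runs Q \<omega> (\<lambda>\<sigma>. \<sigma> = (I, m, d)) (count_com 3 17 a (46 + l)) (3 * lg v + 2) (counted p (vs @ [lg v]))"
  proof (rule runs_conseq[OF lg_runs[of "46 + l" a I]])
    fix \<sigma> assume "\<sigma> = (I(46 + l := I (46 + l) + lg (m (I a))), m(I 17 := 2 ^ lg (m (I a))), d)"
    then show "counted p (vs @ [lg v]) \<sigma>"
      using counted_snoc[OF c, of "m(I 17 := 2 ^ lg v)" "lg v"] a[OF c] l regs by simp
  qed (use a[OF c] regs assms in auto)
qed

text \<open>The reciprocal is parked in the cell that later receives \<open>h\<close>.\<close>

lemma counted_inverse_lg:
  assumes l: "length vs = l" "l \<le> 5"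
    and a: "\<And>I m d. counted p vs (I, m, d) \<Longrightarrow> m (I a) = v \<and> I a < base p"
  shows "runs Q \<omega> (counted p vs) (Seq (block [Of_Nat 17 3, RealOp RDiv 10 17 a]) (count_com 3 17 10 (46 + l)))
    (2 + (3 * lg (1 / v) + 2)) (counted p (vs @ [lg (1 / v)]))"
proof (rule runs_pointwise)
  fix I m d assume c: "counted p vs (I, m, d)"
  note regs = counted_regs[OF c]
  let ?m = "m(base p + 7 := 1, base p := 1 / v)"
  have 1: "runs Q \<omega> (\<lambda>\<sigma>. \<sigma> = (I, m, d)) (block [Of_Nat 17 3, RealOp RDiv 10 17 a]) (length [Of_Nat 17 3, RealOp RDiv 10 17 a])
      (\<lambda>\<sigma>. \<sigma> = (I, ?m, d))"
    by (rule runs_block) (use regs a[OF c] in auto)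
  have 2: "runs Q \<omega> (\<lambda>\<sigma>. \<sigma> = (I, ?m, d)) (count_com 3 17 10 (46 + l)) (3 * lg (1 / v) + 2) (counted p (vs @ [lg (1 / v)]))"
  proof (rule runs_conseq[OF lg_runs[of "46 + l" 10 I]])
    fix \<sigma> assume "\<sigma> = (I(46 + l := I (46 + l) + lg (?m (I 10))), ?m(I 17 := 2 ^ lg (?m (I 10))), d)"
    then show "counted p (vs @ [lg (1 / v)]) \<sigma>"
      using counted_snoc[OF c, of "?m(I 17 := 2 ^ lg (1 / v))" "lg (1 / v)"] l regs by simp
  qed (use regs l in auto)
  show "runs Q \<omega> (\<lambda>\<sigma>. \<sigma> = (I, m, d)) (Seq (block [Of_Nat 17 3, RealOp RDiv 10 17 a]) (count_com 3 17 10 (46 + l)))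
      (2 + (3 * lg (1 / v) + 2)) (counted p (vs @ [lg (1 / v)]))"
    using runs_Seq[OF 1 2] by (rule runs_conseq) auto
qed

lemma counted_gcount:
  assumes l: "length vs = l" "l \<le> 5" and \<gamma>: "0 < par_gamma p"
  shows "runs Q \<omega> (counted p vs) (Seq (block [Of_Nat 19 3]) (count_com 4 4 19 (46 + l)))
    (1 + (3 * gcount (par_gamma p) + 2)) (counted p (vs @ [gcount (par_gamma p)]))"
proof (rule runs_pointwise)
  fix I m d assume c: "counted p vs (I, m, d)"
  note regs = counted_regs[OF c]
  let ?m = "m(base p + 9 := 1)" and ?G = "gcount (par_gamma p)"
  have b: "0 < base p" by (simp add: base_def)
  have 1: "runs Q \<omega> (\<lambda>\<sigma>. \<sigma> = (I, m, d)) (block [Of_Nat 19 3]) (length [Of_Nat 19 3]) (\<lambda>\<sigma>. \<sigma> = (I, ?m, d))"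
    by (rule runs_block) (use regs in auto)
  have G: "(LEAST j. ?m (I 19) \<le> real j * par_gamma p) = ?G"
    unfolding gcount_def using regs by simp
  have 2: "runs Q \<omega> (\<lambda>\<sigma>. \<sigma> = (I, ?m, d)) (count_com 4 4 19 (46 + l)) (3 * ?G + 2)
      (\<lambda>\<sigma>. \<sigma> = (I(46 + l := I (46 + l) + ?G), ?m(I 17 := real ?G * par_gamma p), d))"
    unfolding G[symmetric]
    by (rule count_runs) (use regs b l gcount_exists[OF \<gamma>] in \<open>auto simp: algebra_simps\<close>)
  have 3: "runs Q \<omega> (\<lambda>\<sigma>. \<sigma> = (I, ?m, d)) (count_com 4 4 19 (46 + l)) (3 * ?G + 2) (counted p (vs @ [?G]))"
  proof (rule runs_conseq[OF 2])
    fix \<sigma> assume "\<sigma> = (I(46 + l := I (46 + l) + ?G), ?m(I 17 := real ?G * par_gamma p), d)"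
    then show "counted p (vs @ [?G]) \<sigma>"
      using counted_snoc[OF c, of "?m(I 17 := real ?G * par_gamma p)" ?G] l regs by simp
  qed auto
  show "runs Q \<omega> (\<lambda>\<sigma>. \<sigma> = (I, m, d)) (Seq (block [Of_Nat 19 3]) (count_com 4 4 19 (46 + l)))
      (1 + (3 * ?G + 2)) (counted p (vs @ [?G]))"
    using runs_Seq[OF 1 3] by (rule runs_conseq) auto
qed

text \<open>Register \<open>52\<close> walks through the cells of the \<open>L i\<close> while
  \<open>count_com\<close> keeps adding to register \<open>51\<close>. The final reset restores the
  value that \<open>ready\<close> prescribes for register \<open>52\<close>.\<close>

definition sum_com :: com where
  "sum_com = Seq (While (NLess 52 53) (Seq (count_com 3 17 52 51) (block [NatOp NAdd 52 52 3]))) (block [Const 52 5])"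

lemma counted_sum:
  assumes l: "length vs = 5" and t: "\<And>i. i < par_d p \<Longrightarrow> lg (par_L p i) \<le> t"
  shows "runs Q \<omega> (counted p vs) sum_com (par_d p * (3 * t + 4) + 2)
    (counted p (vs @ [\<Sum>i<par_d p. lg (par_L p i)]))"
proof (rule runs_pointwise)
  fix I m d assume c: "counted p vs (I, m, d)"
  note regs = counted_regs[OF c]
  let ?s = "\<lambda>j. \<Sum>i<j. lg (par_L p i)"
  let ?Inv = "\<lambda>j \<sigma>. \<exists>y. \<sigma> = (I(51 := ?s j, 52 := 5 + j), m(base p + 7 := y), d)"
  have I51: "I 51 = 0" using regs(12) l by simp
  have 1: "runs Q \<omega> (?Inv 0) (While (NLess 52 53) (Seq (count_com 3 17 52 51) (block [NatOp NAdd 52 52 3])))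
      (par_d p * (((3 * t + 2) + 1) + 1) + 1) (?Inv (par_d p))"
  proof (rule runs_While)
    fix j \<sigma> assume "j \<le> par_d p" "?Inv j \<sigma>"
    then show "tholds (NLess 52 53) \<sigma> \<longleftrightarrow> j < par_d p" using regs by auto
  next
    fix j assume j: "j < par_d p"
    show "runs Q \<omega> (?Inv j) (Seq (count_com 3 17 52 51) (block [NatOp NAdd 52 52 3])) ((3 * t + 2) + 1) (?Inv (Suc j))"
    proof (rule runs_pointwise)
      fix I' m' d' assume "?Inv j (I', m', d')"
      then obtain y where s: "I' = I(51 := ?s j, 52 := 5 + j)" "m' = m(base p + 7 := y)" "d' = d" by auto
      have v: "m' (I' 52) = par_L p j" using regs(19)[OF j] j by (simp add: s base_def)
      have 1: "runs Q \<omega> (\<lambda>\<sigma>. \<sigma> = (I', m', d')) (count_com 3 17 52 51) (3 * t + 2)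
          (\<lambda>\<sigma>. \<exists>y. \<sigma> = (I(51 := ?s (Suc j), 52 := 5 + j), m(base p + 7 := y), d))"
      proof (rule runs_conseq[OF lg_runs[of 51 52 I']])
        fix \<sigma> assume "\<sigma> = (I'(51 := I' 51 + lg (m' (I' 52))), m'(I' 17 := 2 ^ lg (m' (I' 52))), d')"
        then show "\<exists>y. \<sigma> = (I(51 := ?s (Suc j), 52 := 5 + j), m(base p + 7 := y), d)"
          unfolding v by (auto simp: s regs fun_eq_iff)
      next
        show "3 * lg (m' (I' 52)) + 2 \<le> 3 * t + 2" using t[OF j] by (simp add: v)
      qed (use regs j in \<open>auto simp: s base_def\<close>)
      have 2: "runs Q \<omega> (\<lambda>\<sigma>. \<exists>y. \<sigma> = (I(51 := ?s (Suc j), 52 := 5 + j), m(base p + 7 := y), d))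
          (block [NatOp NAdd 52 52 3]) (length [NatOp NAdd 52 52 3]) (?Inv (Suc j))"
        by (rule runs_block) (use regs in \<open>auto simp: fun_eq_iff\<close>)
      show "runs Q \<omega> (\<lambda>\<sigma>. \<sigma> = (I', m', d')) (Seq (count_com 3 17 52 51) (block [NatOp NAdd 52 52 3])) ((3 * t + 2) + 1) (?Inv (Suc j))"
        using runs_Seq[OF 1 2] by (rule runs_conseq) auto
    qed
  qed
  have I0: "I(51 := 0, 52 := 5) = I" using I51 regs by (auto simp: fun_eq_iff)
  have 2: "runs Q \<omega> (?Inv (par_d p)) (block [Const 52 5]) (length [Const 52 5]) (counted p (vs @ [?s (par_d p)]))"
  proof (rule runs_block)
    fix \<sigma> assume "?Inv (par_d p) \<sigma>"
    then obtain y where \<sigma>: "\<sigma> = (I(51 := ?s (par_d p), 52 := 5 + par_d p), m(base p + 7 := y), d)" by blast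
    have "I(51 := ?s (par_d p), 52 := 5) = I(51 := ?s (par_d p))" using regs by (auto simp: fun_eq_iff)
    then show "counted p (vs @ [?s (par_d p)]) (ieffs Q \<omega> [Const 52 5] \<sigma>)"
      using counted_snoc[OF c, of "m(base p + 7 := y)" "?s (par_d p)"] l by (simp add: \<sigma>)
  qed simp
  show "runs Q \<omega> (\<lambda>\<sigma>. \<sigma> = (I, m, d)) sum_com (par_d p * (3 * t + 4) + 2) (counted p (vs @ [?s (par_d p)]))"
    unfolding sum_com_def
  proof (rule runs_conseq[OF runs_Seq[OF 1 2]])
    fix \<sigma> assume "\<sigma> = (I, m, d)"
    then show "?Inv 0 \<sigma>" using I0 by (intro exI[of _ "m (base p + 7)"]) simp
  qed (auto simp: algebra_simps)
qed

text \<open>Registers \<open>6\<close>, \<open>7\<close> and \<open>8\<close> receive the numbers of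
  rounds, tests and halvings; \<open>62\<close> to \<open>65\<close> receive the exponents of
  \<open>h\<close>, \<open>T\<^sub>0\<close>, \<open>\<theta>\<close> and \<open>thr\<close> as
  powers of \<open>1 / 2\<close>.\<close>

definition arithmetic :: "instr list" where
  "arithmetic = [NatOp NAdd 54 1 3, NatOp NAdd 54 54 49, NatOp NMul 54 54 50, Const 55 4, NatOp NMul 6 54 55,
     NatOp NAdd 56 49 3, NatOp NAdd 56 56 6, Const 57 3, NatOp NMul 7 56 57,
     NatOp NAdd 58 2 3, NatOp NMul 58 46 58, NatOp NAdd 58 58 2, NatOp NAdd 58 58 51,
     Const 59 6, NatOp NAdd 59 59 58, NatOp NAdd 59 59 47, NatOp NAdd 59 59 48, NatOp NAdd 59 59 50,
     NatOp NAdd 59 59 7, NatOp NAdd 59 59 0,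
     Const 60 20, Const 61 6, NatOp NMul 61 61 1, NatOp NAdd 60 60 61, NatOp NMul 62 59 60, NatOp NAdd 8 62 62,
     NatOp NSub 63 62 59, Const 64 14, NatOp NMul 64 64 59, NatOp NSub 64 8 64,
     Const 65 4, NatOp NMul 65 65 59, NatOp NAdd 65 8 65]"

definition prepared :: "params \<Rightarrow> conf \<Rightarrow> bool" where
  "prepared p = (\<lambda>(I, m, d). ready p I m \<and> d = 0 \<and> I 6 = round_count p \<and> I 7 = test_count p \<and>
     I 8 = 2 * (scale_exp p * rate p) \<and> I 62 = scale_exp p * rate p \<and>
     I 63 = scale_exp p * rate p - scale_exp p \<and> I 64 = 2 * (scale_exp p * rate p) - 14 * scale_exp p \<and>
     I 65 = 2 * (scale_exp p * rate p) + 4 * scale_exp p)"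

lemma arithmetic_runs:
  "runs Q \<omega> (counted p [lg (par_scale p), lg (1 / par_eta p), lg (1 / par_eps p), lg (1 / par_delta p),
     gcount (par_gamma p), \<Sum>i<par_d p. lg (par_L p i)]) (block arithmetic) 33 (prepared p)"
  (is "runs Q \<omega> (counted p ?vs) _ _ _")
proof (rule runs_pointwise)
  fix I m d assume c: "counted p ?vs (I, m, d)"
  have r: "ready p I m" "d = 0" using c by (simp_all add: counted_def)
  have "I (46 + i) = ?vs ! i" if "i < 6" for i
    using c that by (simp add: counted_def)
  from this[of 0] this[of 1] this[of 2] this[of 3] this[of 4] this[of 5]
  have v: "I 46 = lg (par_scale p)" "I 47 = lg (1 / par_eta p)" "I 48 = lg (1 / par_eps p)"
    "I 49 = lg (1 / par_delta p)" "I 50 = gcount (par_gamma p)" "I 51 = (\<Sum>i<par_d p. lg (par_L p i))"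
    by simp_all
  have l: "I 0 = par_n p" "I (Suc 0) = par_k p" "I 2 = par_d p" "I 3 = 1"
    using r(1) by (simp_all add: ready_def lay_def)
  let ?E = "ieffs Q \<omega> arithmetic (I, m, d)"
  let ?J = "fst ?E"
  have E: "?E = (?J, m, d)" by (simp add: arithmetic_def)
  have same: "?J 0 = I 0" "?J 1 = I 1" "?J 2 = I 2" "?J 3 = I 3" "?J 4 = I 4" "?J 5 = I 5" "?J 10 = I 10"
    "?J 11 = I 11" "?J 12 = I 12" "?J 13 = I 13" "?J 14 = I 14" "?J 15 = I 15" "?J 16 = I 16" "?J 17 = I 17"
    "?J 18 = I 18" "?J 19 = I 19" "?J 20 = I 20" "?J 21 = I 21" "?J 22 = I 22" "?J 23 = I 23" "?J 24 = I 24"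
    "?J 25 = I 25" "?J 41 = I 41" "?J 42 = I 42" "?J 43 = I 43" "?J 44 = I 44" "?J 52 = I 52" "?J 53 = I 53"
    by (simp_all add: arithmetic_def)
  have ready: "ready p ?J m" using r(1) unfolding ready_def lay_def same by simp
  have J: "?J 6 = round_count p" "?J 7 = test_count p" "?J 59 = scale_exp p" "?J 60 = rate p"
    by (simp_all add: arithmetic_def v l round_count_def test_count_def scale_exp_def lip_exp_def rate_def algebra_simps)
  have K: "?J 62 = ?J 59 * ?J 60" "?J 8 = 2 * (?J 59 * ?J 60)" "?J 63 = ?J 59 * ?J 60 - ?J 59"
    "?J 64 = 2 * (?J 59 * ?J 60) - 14 * ?J 59" "?J 65 = 2 * (?J 59 * ?J 60) + 4 * ?J 59"
    by (simp_all add: arithmetic_def)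
  have "prepared p (?J, m, d)"
    unfolding prepared_def using ready r(2) J K by simp
  then have "prepared p ?E" by (simp only: E [symmetric])
  then have "runs Q \<omega> (\<lambda>\<sigma>. \<sigma> = (I, m, d)) (block arithmetic) (length arithmetic) (prepared p)"
    by (intro runs_block) (simp_all add: arithmetic_def)
  then show "runs Q \<omega> (\<lambda>\<sigma>. \<sigma> = (I, m, d)) (block arithmetic) 33 (prepared p)"
    by (rule runs_conseq) (simp_all add: arithmetic_def)
qed

text \<open>\<open>1 / 2\<close> is obtained as \<open>1 / (1 + 1)\<close>, and all four scales are
  powers of it, hence exact.\<close>

definition powers_com :: com where
  "powers_com = Seq (block [Of_Nat 19 3, RealOp RAdd 17 19 19, RealOp RDiv 19 19 17])
     (Seq (half_power_com 10 62) (Seq (half_power_com 11 63) (Seq (half_power_com 12 64) (half_power_com 13 65))))"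

definition powers_time :: "params \<Rightarrow> nat" where
  "powers_time p = (let e = scale_exp p; x = e * rate p in
     3 + ((3 * x + 3) + ((3 * (x - e) + 3) + ((3 * (2 * x - 14 * e) + 3) + (3 * (2 * x + 4 * e) + 3)))))"

definition start :: "params \<Rightarrow> conf \<Rightarrow> bool" where
  "start p = (\<lambda>(I, m, d). lay (par_n p) (base p) I \<and> I 1 = par_k p \<and> I 5 = 0 \<and> d = 0 \<and>
     I 6 = round_count p \<and> I 7 = test_count p \<and> I 8 = 2 * (scale_exp p * rate p) \<and>
     m (base p) = (1 / 2) ^ (scale_exp p * rate p) \<and> m (base p + 1) = (1 / 2) ^ (scale_exp p * rate p - scale_exp p) \<and>
     m (base p + 2) = (1 / 2) ^ (2 * (scale_exp p * rate p) - 14 * scale_exp p) \<and>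
     m (base p + 3) = (1 / 2) ^ (2 * (scale_exp p * rate p) + 4 * scale_exp p) \<and>
     m (base p + 9) = 1 / 2 \<and> (\<forall>x. base p + 10 \<le> x \<longrightarrow> m x = 0))"

lemma powers_runs: "runs Q \<omega> (prepared p) powers_com (powers_time p) (start p)"
proof (rule runs_pointwise)
  fix I m d assume c: "prepared p (I, m, d)"
  let ?B = "base p" and ?e = "scale_exp p" and ?x = "scale_exp p * rate p"
  have l: "I 3 = 1" "I 10 = ?B" "I 11 = ?B + 1" "I 12 = ?B + 2" "I 13 = ?B + 3" "I 17 = ?B + 7" "I 19 = ?B + 9"
    "I 62 = ?x" "I 63 = ?x - ?e" "I 64 = 2 * ?x - 14 * ?e" "I 65 = 2 * ?x + 4 * ?e" "d = 0"
    using c by (simp_all add: prepared_def ready_def lay_def)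
  let ?J = "\<lambda>x. I(35 := x)"
  let ?m1 = "m(?B + 7 := 2, ?B + 9 := 1 / 2)"
  let ?m2 = "?m1(?B := (1 / 2) ^ ?x)"
  let ?m3 = "?m2(?B + 1 := (1 / 2) ^ (?x - ?e))"
  let ?m4 = "?m3(?B + 2 := (1 / 2) ^ (2 * ?x - 14 * ?e))"
  let ?m5 = "?m4(?B + 3 := (1 / 2) ^ (2 * ?x + 4 * ?e))"
  have 1: "runs Q \<omega> (\<lambda>\<sigma>. \<sigma> = (I, m, d)) (block [Of_Nat 19 3, RealOp RAdd 17 19 19, RealOp RDiv 19 19 17])
      (length [Of_Nat 19 3, RealOp RAdd 17 19 19, RealOp RDiv 19 19 17]) (\<lambda>\<sigma>. \<sigma> = (I, ?m1, d))"
    by (rule runs_block) (simp_all add: l fun_eq_iff)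
  have power: "runs Q \<omega> (\<lambda>\<sigma>. \<sigma> = (I', m', d)) (half_power_com c e) (3 * v + 3)
      (\<lambda>\<sigma>. \<sigma> = (?J v, m'(a := (1 / 2) ^ v), d))"
    if "I' = I \<or> I' = ?J u" "c \<in> {10, 11, 12, 13}" "e \<in> {62, 63, 64, 65}" "I e = v" "I c = a" "m' (?B + 9) = 1 / 2" for I' m' c e v a u
  proof -
    have J: "I' 3 = 1" "I' c = a" "I' 19 = ?B + 9" "I' e = v" "I'(35 := v) = ?J v" "a \<noteq> ?B + 9"
      using that l by auto
    show ?thesis
      using half_power_runs[of c e I' m' Q \<omega> d] that(2,3,6) J by auto
  qed
  have 2: "runs Q \<omega> (\<lambda>\<sigma>. \<sigma> = (I, ?m1, d)) (half_power_com 10 62) (3 * ?x + 3) (\<lambda>\<sigma>. \<sigma> = (?J ?x, ?m2, d))"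
    by (rule power) (simp_all add: l)
  have 3: "runs Q \<omega> (\<lambda>\<sigma>. \<sigma> = (?J ?x, ?m2, d)) (half_power_com 11 63) (3 * (?x - ?e) + 3)
      (\<lambda>\<sigma>. \<sigma> = (?J (?x - ?e), ?m3, d))"
    by (rule power[OF disjI2[OF refl]]) (simp_all add: l)
  have 4: "runs Q \<omega> (\<lambda>\<sigma>. \<sigma> = (?J (?x - ?e), ?m3, d)) (half_power_com 12 64) (3 * (2 * ?x - 14 * ?e) + 3)
      (\<lambda>\<sigma>. \<sigma> = (?J (2 * ?x - 14 * ?e), ?m4, d))"
    by (rule power[OF disjI2[OF refl]]) (simp_all add: l)
  have 5: "runs Q \<omega> (\<lambda>\<sigma>. \<sigma> = (?J (2 * ?x - 14 * ?e), ?m4, d)) (half_power_com 13 65) (3 * (2 * ?x + 4 * ?e) + 3)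
      (\<lambda>\<sigma>. \<sigma> = (?J (2 * ?x + 4 * ?e), ?m5, d))"
    by (rule power[OF disjI2[OF refl]]) (simp_all add: l)
  have m5: "?m5 x = 0" if "?B + 10 \<le> x" for x
    using that c by (simp add: prepared_def ready_def)
  have "start p (?J (2 * ?x + 4 * ?e), ?m5, d)"
    using c m5 unfolding start_def prepared_def ready_def lay_def by simp
  with runs_Seq[OF 1 runs_Seq[OF 2 runs_Seq[OF 3 runs_Seq[OF 4 5]]]]
  show "runs Q \<omega> (\<lambda>\<sigma>. \<sigma> = (I, m, d)) powers_com (powers_time p) (start p)"
    unfolding powers_com_def powers_time_def Let_def by (elim runs_conseq) auto
qed

text \<open>The definition of \<open>search_com\<close> mentions no locale parameter, so outside the
  locale it is one fixed program; the parameters reach it through registers and cells. The last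
  instruction moves the address of the rows to register \<open>0\<close>, where the output is
  expected.\<close>

definition recovery_com :: com where
  "recovery_com = Seq (block layout)
     (Seq (count_com 3 17 44 46)
     (Seq (Seq (block [Of_Nat 17 3, RealOp RDiv 10 17 41]) (count_com 3 17 10 47))
     (Seq (Seq (block [Of_Nat 17 3, RealOp RDiv 10 17 42]) (count_com 3 17 10 48))
     (Seq (Seq (block [Of_Nat 17 3, RealOp RDiv 10 17 43]) (count_com 3 17 10 49))
     (Seq (Seq (block [Of_Nat 19 3]) (count_com 4 4 19 50))
     (Seq sum_com (Seq (block arithmetic) (Seq powers_com (Seq machine.search_com (block [NatOp NAdd 0 25 4]))))))))))"

definition recovery_time :: "params \<Rightarrow> nat" where
  "recovery_time p = 25 + ((3 * lg (par_scale p) + 2) + ((2 + (3 * lg (1 / par_eta p) + 2)) +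
     ((2 + (3 * lg (1 / par_eps p) + 2)) + ((2 + (3 * lg (1 / par_delta p) + 2)) +
     ((1 + (3 * gcount (par_gamma p) + 2)) +
     ((par_d p * (3 * (\<Sum>i<par_d p. lg (par_L p i)) + 4) + 2) + (33 + (powers_time p +
     ((round_count p * (machine.round_time (par_n p) (2 * (scale_exp p * rate p)) (test_count p) (par_k p) + 1 + 2) + 2) + 1)))))))))"

lemma recovery_runs:
  fixes p :: params
  defines "x \<equiv> scale_exp p * rate p" and "e \<equiv> scale_exp p"
  assumes \<gamma>: "0 < par_gamma p" and n: "0 < par_n p"
    and M: "\<And>f g. (\<And>i. i < par_n p \<Longrightarrow> f i = g i) \<Longrightarrow> M f = M g"
  shows "runs (\<lambda>f. if M f then 1 else 0) \<omega> (\<lambda>\<sigma>. \<sigma> = conf_of (input_state p)) recovery_com (recovery_time p)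
    (\<lambda>(I, m, d). \<forall>j. m (I 0 + j) = flat (par_n p) (search.rounds (par_n p) (2 * x) (test_count p)
      ((1 / 2) ^ x) ((1 / 2) ^ (x - e)) ((1 / 2) ^ (2 * x - 14 * e)) ((1 / 2) ^ (2 * x + 4 * e)) M
      (par_k p) (round_count p) [] \<omega>) j)"
proof -
  let ?Q = "\<lambda>f. if M f then 1 else 0 :: nat"
  interpret machine "par_n p" "2 * x" "test_count p" "(1 / 2) ^ x" "(1 / 2) ^ (x - e)"
    "(1 / 2) ^ (2 * x - 14 * e)" "(1 / 2) ^ (2 * x + 4 * e)" M "base p" "par_k p" "round_count p" ?Q \<omega>
  proof unfold_locales
    show "M f = M g" if "\<And>i. i < par_n p \<Longrightarrow> f i = g i" for f g by (rule M[OF that])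
  qed (rule refl n)+
  let ?s = "\<Sum>i<par_d p. lg (par_L p i)"
  have cell: "I 44 < base p \<and> m (I 44) = par_scale p" "m (I 41) = par_eta p \<and> I 41 < base p"
    "m (I 42) = par_eps p \<and> I 42 < base p" "m (I 43) = par_delta p \<and> I 43 < base p"
    if "counted p vs (I, m, d)" for vs I m d
    using counted_regs[OF that] by (simp_all add: base_def)
  let ?v1 = "[lg (par_scale p)]"
  have 1: "Runs (counted p []) (count_com 3 17 44 46) (3 * lg (par_scale p) + 2) (counted p ?v1)"
  proof -
    have "Runs (counted p []) (count_com 3 17 44 (46 + 0)) (3 * lg (par_scale p) + 2) (counted p ([] @ ?v1))"
      by (rule counted_lg) (simp, simp, rule cell(1), assumption, simp)
    then show ?thesis by simp
  qed
  let ?v2 = "?v1 @ [lg (1 / par_eta p)]"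
  have 2: "Runs (counted p ?v1) (Seq (block [Of_Nat 17 3, RealOp RDiv 10 17 41]) (count_com 3 17 10 47))
      (2 + (3 * lg (1 / par_eta p) + 2)) (counted p ?v2)"
  proof -
    have "Runs (counted p (?v1)) (Seq (block [Of_Nat 17 3, RealOp RDiv 10 17 41]) (count_com 3 17 10 (46 + 1)))
        (2 + (3 * lg (1 / par_eta p) + 2)) (counted p ?v2)"
      by (rule counted_inverse_lg) (simp, simp, rule cell(2), assumption)
    then show ?thesis by simp
  qed
  let ?v3 = "?v2 @ [lg (1 / par_eps p)]"
  have 3: "Runs (counted p ?v2) (Seq (block [Of_Nat 17 3, RealOp RDiv 10 17 42]) (count_com 3 17 10 48))
      (2 + (3 * lg (1 / par_eps p) + 2)) (counted p ?v3)"
  proof -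
    have "Runs (counted p (?v2)) (Seq (block [Of_Nat 17 3, RealOp RDiv 10 17 42]) (count_com 3 17 10 (46 + 2)))
        (2 + (3 * lg (1 / par_eps p) + 2)) (counted p ?v3)"
      by (rule counted_inverse_lg) (simp, simp, rule cell(3), assumption)
    then show ?thesis by simp
  qed
  let ?v4 = "?v3 @ [lg (1 / par_delta p)]"
  have 4: "Runs (counted p ?v3) (Seq (block [Of_Nat 17 3, RealOp RDiv 10 17 43]) (count_com 3 17 10 49))
      (2 + (3 * lg (1 / par_delta p) + 2)) (counted p ?v4)"
  proof -
    have "Runs (counted p (?v3)) (Seq (block [Of_Nat 17 3, RealOp RDiv 10 17 43]) (count_com 3 17 10 (46 + 3)))
        (2 + (3 * lg (1 / par_delta p) + 2)) (counted p ?v4)"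
      by (rule counted_inverse_lg) (simp, simp, rule cell(4), assumption)
    then show ?thesis by simp
  qed
  have 5: "Runs (counted p ?v4) (Seq (block [Of_Nat 19 3]) (count_com 4 4 19 50)) (1 + (3 * gcount (par_gamma p) + 2))
      (counted p (?v4 @ [gcount (par_gamma p)]))"
    using counted_gcount[of ?v4 4 p ?Q \<omega>] \<gamma> by simp
  have 6: "Runs (counted p (?v4 @ [gcount (par_gamma p)])) sum_com (par_d p * (3 * ?s + 4) + 2)
      (counted p (?v4 @ [gcount (par_gamma p), ?s]))"
    using counted_sum[of "?v4 @ [gcount (par_gamma p)]" p ?s ?Q \<omega>]
      member_le_sum[of _ "{..<par_d p}" "\<lambda>i. lg (par_L p i)"] by simp
  have 7: "Runs (counted p (?v4 @ [gcount (par_gamma p), ?s])) (block arithmetic) 33 (prepared p)"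
    using arithmetic_runs by simp
  have 8: "Runs (start p) search_com (round_count p * (round_time + 1 + 2) + 2)
      (\<lambda>\<sigma>. \<exists>e. holding (rounds (par_k p) (round_count p) [] \<omega>) (round_count p) e (\<lambda>_. True) \<sigma>)"
  proof (rule runs_pointwise)
    fix I m d assume s: "start p (I, m, d)"
    let ?c = "\<lparr>cG = \<lambda>i. m (base p + 10 + i), cT = \<lambda>i. m (base p + 10 + par_n p + i),
      cX = \<lambda>i. m (base p + 10 + 2 * par_n p + i), cZ = \<lambda>i. m (base p + 10 + 3 * par_n p + i), cU = flat (par_n p) [],
      cS = m (base p + 4), cLO = m (base p + 5), cD = m (base p + 6), cnum = 0, cerr = I 9, cdrawn = 0, cloop = I\<rparr>"
    have "rregs ?c I" "rmem ?c m" "d = 0"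
      unfolding rregs_def rmem_def using s by (simp_all add: start_def flat_def x_def e_def)
    then have "rep ?c (I, m, d)" by (simp add: rep_def)
    then have "holding [] (I 38) 0 (\<lambda>_. True) (I, m, d)"
      unfolding holding_def by (intro exI conjI, assumption) simp_all
    then show "Runs (\<lambda>\<sigma>. \<sigma> = (I, m, d)) search_com (round_count p * (round_time + 1 + 2) + 2)
      (\<lambda>\<sigma>. \<exists>e. holding (rounds (par_k p) (round_count p) [] \<omega>) (round_count p) e (\<lambda>_. True) \<sigma>)"
      by (intro runs_conseq[OF holding_search[of "[]" "I 38" 0]]) simp_all
  qed
  have 9: "Runs (\<lambda>\<sigma>. \<exists>e. holding (rounds (par_k p) (round_count p) [] \<omega>) (round_count p) e (\<lambda>_. True) \<sigma>)
      (block [NatOp NAdd 0 25 4]) (length [NatOp NAdd 0 25 4])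
      (\<lambda>(I, m, d). \<forall>j. m (I 0 + j) = flat (par_n p) (rounds (par_k p) (round_count p) [] \<omega>) j)"
  proof (rule runs_block)
    fix \<sigma> assume "\<exists>e. holding (rounds (par_k p) (round_count p) [] \<omega>) (round_count p) e (\<lambda>_. True) \<sigma>"
    moreover obtain I m d where "\<sigma> = (I, m, d)" by (cases \<sigma>)
    ultimately show "(\<lambda>(I, m, d). \<forall>j. m (I 0 + j) = flat (par_n p) (rounds (par_k p) (round_count p) [] \<omega>) j)
        (ieffs ?Q \<omega> [NatOp NAdd 0 25 4] \<sigma>)"
      by (auto simp: holding_def rep_def rregs_def rmem_def lay_def)
  qed simp
  show ?thesis
    unfolding recovery_com_def
  proof (rule runs_conseq[OF runs_Seq[OF layout_runs runs_Seq[OF 1 runs_Seq[OF 2 runs_Seq[OF 3 runs_Seq[OF 4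
      runs_Seq[OF 5 runs_Seq[OF 6 runs_Seq[OF 7 runs_Seq[OF powers_runs runs_Seq[OF 8 9]]]]]]]]]]])
  qed (simp_all add: recovery_time_def x_def)
qed

section \<open>Correctness\<close>

text \<open>A non-measurable set has \<open>measure\<close> zero, so a positive
  \<open>gauss_prob\<close> forces measurability. This is how the event in hypothesis (4), which
  quantifies over all crossings, becomes usable.\<close>

lemma gauss_prob_iid:
  assumes pos: "0 < gauss_prob n R"
  shows "{\<omega>. R (vec n \<omega>)} \<in> sets iid_gauss" "measure iid_gauss {\<omega>. R (vec n \<omega>)} = gauss_prob n R"
proof -
  let ?N = "PiM {..<n} (\<lambda>_. std_gauss)" and ?r = "\<lambda>\<omega>. restrict \<omega> {..<n}"
  define E where "E = {g \<in> space ?N. R (vec n g)}"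
  have p: "gauss_prob n R = measure ?N E" by (simp add: gauss_prob_def gauss_seq_def E_def)
  have E: "E \<in> sets ?N" using pos measure_notin_sets[of E ?N] unfolding p by (cases "E \<in> sets ?N") simp_all
  have r: "?r \<in> iid_gauss \<rightarrow>\<^sub>M ?N" by (rule measurable_restrict_subset) simp
  have vec: "vec n (?r \<omega>) = vec n \<omega>" for \<omega> :: "nat \<Rightarrow> real" by auto
  have eq: "?r -` E \<inter> space iid_gauss = {\<omega>. R (vec n \<omega>)}"
    by (auto simp: E_def vec space_PiM)
  show "{\<omega>. R (vec n \<omega>)} \<in> sets iid_gauss" using measurable_sets[OF r E] by (simp only: eq)
  have "measure ?N E = measure (distr iid_gauss ?N ?r) E"
    by (subst gseq.distr_PiM_restrict_finite) auto
  also have "\<dots> = measure iid_gauss {\<omega>. R (vec n \<omega>)}"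
    by (subst measure_distr[OF r E]) (simp only: eq)
  finally show "measure iid_gauss {\<omega>. R (vec n \<omega>)} = gauss_prob n R" by (simp add: p)
qed

lemma gauss_second_moment: "has_bochner_integral std_gauss (\<lambda>x. x\<^sup>2) 1"
proof -
  have "has_bochner_integral lborel (\<lambda>x. std_normal_density x *\<^sub>R x\<^sup>2) (1::real)"
    using std_normal_moment_even[of 1] by (simp add: fact_numeral)
  then show ?thesis by (intro has_bochner_integral_density) (auto intro!: AE_I2)
qed

lemma iid_gauss_second_moment: "integrable iid_gauss (\<lambda>\<omega>. (\<omega> i)\<^sup>2)" "(\<integral>\<omega>. (\<omega> i)\<^sup>2 \<partial>iid_gauss) = 1"
proof -
  have d: "distr iid_gauss std_gauss (\<lambda>\<omega>. \<omega> i) = std_gauss"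
    using gseq.PiM_component[of i] by simp
  have m: "(\<lambda>\<omega>. \<omega> i) \<in> iid_gauss \<rightarrow>\<^sub>M std_gauss" by simp
  have sq: "(\<lambda>x. x\<^sup>2) \<in> borel_measurable std_gauss" by simp
  have "integrable (distr iid_gauss std_gauss (\<lambda>\<omega>. \<omega> i)) (\<lambda>x. x\<^sup>2)"
    unfolding d using gauss_second_moment by (rule integrable.intros)
  then show "integrable iid_gauss (\<lambda>\<omega>. (\<omega> i)\<^sup>2)" using integrable_distr_eq[OF m sq] by simp
  have "(\<integral>\<omega>. (\<omega> i)\<^sup>2 \<partial>iid_gauss) = (\<integral>x. x\<^sup>2 \<partial>distr iid_gauss std_gauss (\<lambda>\<omega>. \<omega> i))"
    using integral_distr[OF m sq] by simp
  also have "\<dots> = 1" unfolding d using gauss_second_moment by (rule has_bochner_integral_integral_eq)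
  finally show "(\<integral>\<omega>. (\<omega> i)\<^sup>2 \<partial>iid_gauss) = 1" .
qed

text \<open>Markov's inequality for the squared norm, whose mean is \<open>r\<close>.\<close>

lemma iid_gauss_norm_tail:
  assumes "0 < c"
  shows "measure iid_gauss {\<omega>. c < normn r \<omega>} \<le> r / c\<^sup>2"
proof -
  let ?u = "\<lambda>\<omega>. \<Sum>i<r. (\<omega> i)\<^sup>2"
  have u: "integrable iid_gauss ?u" "(\<integral>\<omega>. ?u \<omega> \<partial>iid_gauss) = r"
    using iid_gauss_second_moment by (simp_all add: integrable_sum)
  have m: "{\<omega> \<in> space iid_gauss. c\<^sup>2 \<le> ?u \<omega>} \<in> sets iid_gauss"
    using borel_measurable_integrable[OF u(1)] by simp
  have "{\<omega>. c < normn r \<omega>} \<subseteq> {\<omega> \<in> space iid_gauss. c\<^sup>2 \<le> ?u \<omega>}"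
  proof
    fix \<omega> assume "\<omega> \<in> {\<omega>. c < normn r \<omega>}"
    then have "c\<^sup>2 \<le> (normn r \<omega>)\<^sup>2" using assms by (intro power_mono) auto
    then show "\<omega> \<in> {\<omega> \<in> space iid_gauss. c\<^sup>2 \<le> ?u \<omega>}"
      by (simp add: space_iid_gauss L2_set_def sum_nonneg)
  qed
  then have "measure iid_gauss {\<omega>. c < normn r \<omega>} \<le> measure iid_gauss {\<omega> \<in> space iid_gauss. c\<^sup>2 \<le> ?u \<omega>}"
    using m by (rule gseq.finite_measure_mono)
  also have "\<dots> \<le> (\<integral>\<omega>. ?u \<omega> \<partial>iid_gauss) / c\<^sup>2"
    by (rule integral_Markov_inequality_measure[OF u(1), where A = "{}"]) (use assms in \<open>auto simp: sum_nonneg\<close>)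
  finally show ?thesis by (simp add: u(2))
qed

lemma normn_block_le:
  assumes "l + n \<le> r"
  shows "normn n (\<lambda>i. \<omega> (l + i)) \<le> normn r \<omega>"
proof -
  have "(\<Sum>i<n. (\<omega> (l + i))\<^sup>2) = (\<Sum>i\<in>(+) l ` {..<n}. (\<omega> i)\<^sup>2)"
    by (subst sum.reindex) auto
  also have "\<dots> \<le> (\<Sum>i<r. (\<omega> i)\<^sup>2)"
    using assms by (intro sum_mono2) auto
  finally show ?thesis unfolding L2_set_def by (rule real_sqrt_le_mono)
qed

lemma layers_zero:
  assumes "\<And>i. i < length ls \<Longrightarrow> snd (ls ! i) 0 = 0" "layers_dims m ls k"
  shows "apply_layers ls (0\<^sub>v k) = 0\<^sub>v m"
  using assms
proof (induction ls arbitrary: m)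
  case (Cons a ls)
  obtain W \<phi> where a: "a = (W, \<phi>)" by (cases a)
  have "\<phi> 0 = 0" using Cons.prems(1)[of 0] by (simp add: a)
  have "apply_layers ls (0\<^sub>v k) = 0\<^sub>v (dim_col W)"
    using Cons.prems(1)[of "Suc i" for i] Cons.prems(2) by (intro Cons.IH) (auto simp: a)
  moreover have "map_vec \<phi> (0\<^sub>v (dim_col W)) = 0\<^sub>v (dim_col W)" using \<open>\<phi> 0 = 0\<close> by auto
  ultimately show ?case using Cons.prems(2) by (auto simp: a)
qed simp

text \<open>Lipschitz in the first \<open>n\<close> coordinates, hence continuous for the product
  topology, whose Borel sets form the product sigma-algebra.\<close>

lemma smooth_map_continuous:
  assumes "smooth_map n m l q y" "i < m"
  shows "(\<lambda>x. y x i) \<in> borel_measurable (PiM UNIV (\<lambda>_. borel))"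
proof -
  have "continuous (at x) (\<lambda>x. y x i)" for x
  proof -
    obtain J :: "nat \<Rightarrow> nat \<Rightarrow> real" where J: "\<And>z. normn m (\<lambda>i. y (\<lambda>j. x j + z j) i - y x i) \<le> l * normn n z"
      by (rule smooth_mapE[OF assms(1), of x]) (rule that)
    have c: "continuous (at x) (\<lambda>z. normn n (\<lambda>j. z j - x j))"
      unfolding L2_set_def
      by (intro continuous_intros continuous_on_interior[of UNIV "\<lambda>z. z _"] continuous_on_product_coordinates) auto
    have "((\<lambda>z. normn n (\<lambda>j. z j - x j)) \<longlongrightarrow> normn n (\<lambda>j. x j - x j)) (at x)"
      using c by (simp add: continuous_within)
    then have "((\<lambda>z. l * normn n (\<lambda>j. z j - x j)) \<longlongrightarrow> l * 0) (at x)"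
      by (intro tendsto_mult tendsto_const) (simp add: L2_set_def)
    then have lim: "((\<lambda>z. l * normn n (\<lambda>j. z j - x j)) \<longlongrightarrow> 0) (at x)" by simp
    have le: "norm (y z i - y x i) \<le> l * normn n (\<lambda>j. z j - x j)" for z
    proof -
      have "\<bar>y z i - y x i\<bar> \<le> normn m (\<lambda>i. y z i - y x i)"
        using member_le_L2_set[of "{..<m}" i "\<lambda>i. \<bar>y z i - y x i\<bar>"] assms(2) by (simp add: L2_set_def)
      also have "\<dots> \<le> l * normn n (\<lambda>j. z j - x j)" using J[of "\<lambda>j. z j - x j"] by simp
      finally show ?thesis by simp
    qed
    have "((\<lambda>z. y z i - y x i) \<longlongrightarrow> 0) (at x)"
      by (rule Lim_null_comparison[OF always_eventually[OF allI[OF le]] lim])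
    then show ?thesis by (simp add: continuous_within LIM_zero_iff)
  qed
  then have "continuous_on UNIV (\<lambda>x. y x i)" by (intro continuous_at_imp_continuous_on) simp
  then have "(\<lambda>x. y x i) \<in> borel_measurable borel" by (rule borel_measurable_continuous_onI)
  then show ?thesis by (simp only: measurable_cong_sets[OF sets_PiM_equal_borel refl])
qed

lemma lg_half: "0 < v \<Longrightarrow> (1 / 2) ^ lg (1 / v) \<le> v"
  using lg_bound[of "1 / v"] by (simp add: field_simps power_one_over)

text \<open>Each of the two summands from \<open>failure_probability\<close> is given half of
  \<open>\<delta>\<close>.\<close>

lemma failure_constants:
  assumes \<gamma>: "0 < par_gamma p" "par_gamma p \<le> 1" and \<delta>: "0 < par_delta p"
  shows "2 ^ par_k p * (1 - par_gamma p / 4) ^ round_count p + round_count p * (3 / 4) ^ test_count p \<le> par_delta p"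
proof -
  let ?k = "par_k p" and ?\<gamma> = "par_gamma p" and ?N = "round_count p" and ?l = "lg (1 / par_delta p)"
  let ?G = "gcount (par_gamma p)"
  have "(1 - ?\<gamma> / 4) ^ (?G * 4) \<le> exp (- ?\<gamma> / 4) ^ (?G * 4)"
    using \<gamma> exp_ge_add_one_self[of "- ?\<gamma> / 4"] by (intro power_mono) auto
  also have "\<dots> = exp (- (?G * ?\<gamma>))" by (simp add: exp_of_nat_mult[symmetric] field_simps)
  also have "\<dots> \<le> exp (- 1)" using gcount_bound[OF \<gamma>(1)] by simp
  also have "\<dots> \<le> 1 / 2" using exp_ge_add_one_self[of 1] by (simp add: exp_minus field_simps)
  finally have "((1 - ?\<gamma> / 4) ^ (?G * 4)) ^ (?k + 1 + ?l) \<le> (1 / 2) ^ (?k + 1 + ?l)"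
    using \<gamma> by (intro power_mono zero_le_power) auto
  moreover have "?N = (?G * 4) * (?k + 1 + ?l)" by (simp add: round_count_def)
  ultimately have "(1 - ?\<gamma> / 4) ^ ?N \<le> (1 / 2) ^ (?k + 1 + ?l)" by (simp only: power_mult)
  then have "(1 - ?\<gamma> / 4) ^ ?N \<le> (1 / 2) ^ ?k * (1 / 2) * (1 / 2) ^ ?l"
    by (simp only: power_add power_one_right)
  then have "2 ^ ?k * (1 - ?\<gamma> / 4) ^ ?N \<le> 2 ^ ?k * ((1 / 2) ^ ?k * (1 / 2) * (1 / 2) ^ ?l)"
    by (intro mult_left_mono) auto
  also have "\<dots> = (1 / 2) * (1 / 2) ^ ?l" by (simp add: power_mult_distrib[symmetric] mult.assoc[symmetric])
  also have "\<dots> \<le> par_delta p / 2" using lg_half[OF \<delta>] by simp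
  finally have 1: "2 ^ ?k * (1 - ?\<gamma> / 4) ^ ?N \<le> par_delta p / 2" .
  have "((3 / 4) ^ 3 :: real) ^ (?l + 1 + ?N) \<le> (1 / 2) ^ (?l + 1 + ?N)"
    by (intro power_mono) (simp_all add: power3_eq_cube)
  moreover have "test_count p = 3 * (?l + 1 + ?N)" by (simp add: test_count_def)
  ultimately have "(3 / 4 :: real) ^ test_count p \<le> (1 / 2) ^ (?l + 1 + ?N)" by (simp only: power_mult)
  then have "(3 / 4 :: real) ^ test_count p \<le> (1 / 2) ^ ?l * (1 / 2) * (1 / 2) ^ ?N"
    by (simp only: power_add power_one_right)
  then have "?N * (3 / 4 :: real) ^ test_count p \<le> ?N * ((1 / 2) ^ ?l * (1 / 2) * (1 / 2) ^ ?N)"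
    by (intro mult_left_mono) auto
  also have "\<dots> = (?N * (1 / 2) ^ ?N) * ((1 / 2) ^ ?l / 2)" by simp
  also have "\<dots> \<le> 1 * ((1 / 2) ^ ?l / 2)"
  proof (rule mult_right_mono)
    have "real ?N \<le> 2 ^ ?N" by (rule less_imp_le[OF of_nat_less_two_power])
    then show "real ?N * (1 / 2) ^ ?N \<le> 1" by (simp add: power_one_over field_simps)
  qed simp
  also have "\<dots> \<le> par_delta p / 2" using lg_half[OF \<delta>] by simp
  finally show ?thesis using 1 by simp
qed

text \<open>The last inequality makes the tail bound for the \<open>(test_count p + 1) * n\<close>
  Gaussian entries of a round, at norm \<open>K\<close>, at most
  \<open>\<gamma> / 2\<close>.\<close>

lemma scale_constants:
  fixes p :: params and K :: real
  defines "K \<equiv> 2 ^ scale_exp p"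
  shows "64 \<le> K" "4 * par_n p \<le> K" "2 ^ lip_exp p \<le> K"
    "0 < par_eta p \<Longrightarrow> 2 * 2 ^ lip_exp p \<le> K * par_eta p" "0 < par_eta p \<Longrightarrow> 1 \<le> K * par_eta p"
    "0 < par_eps p \<Longrightarrow> 1 \<le> K * par_eps p"
    "0 < par_gamma p \<Longrightarrow> 2 * ((test_count p + 1) * par_n p) \<le> K\<^sup>2 * par_gamma p"
proof -
  let ?G = "gcount (par_gamma p)" and ?l = "\<lambda>v. lg (1 / v)"
  have K: "K = 64 * 2 ^ lip_exp p * 2 ^ ?l (par_eta p) * 2 ^ ?l (par_eps p) * 2 ^ ?G * 2 ^ test_count p * 2 ^ par_n p"
    by (simp add: K_def scale_exp_def power_add)
  have ge: "x \<le> y * x" if "1 \<le> y" "0 \<le> x" for x y :: real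
    using mult_right_mono[OF that] by simp
  have le: "2 ^ a \<le> K" if "a \<le> scale_exp p" for a
    unfolding K_def using that by (intro power_increasing) auto
  show "64 \<le> K" using le[of 6] by (simp add: scale_exp_def)
  have n: "real (par_n p) \<le> 2 ^ par_n p" by (rule less_imp_le[OF of_nat_less_two_power])
  have "4 * real (par_n p) \<le> 2 ^ (2 + par_n p)" using n by (simp add: power_add)
  also have "\<dots> \<le> K" by (rule le) (simp add: scale_exp_def)
  finally show "4 * par_n p \<le> K" by simp
  show "2 ^ lip_exp p \<le> K" by (rule le) (simp add: scale_exp_def)
  {
    assume \<eta>: "0 < par_eta p"
    have e: "1 \<le> 2 ^ ?l (par_eta p) * par_eta p" using lg_bound[of "1 / par_eta p"] \<eta> by (simp add: field_simps)
    have "2 * 2 ^ lip_exp p * 1 \<le> 2 * 2 ^ lip_exp p * (2 ^ ?l (par_eta p) * par_eta p)"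
      using e by (intro mult_left_mono) auto
    also have "\<dots> = 2 ^ (1 + lip_exp p + ?l (par_eta p)) * par_eta p" by (simp add: power_add)
    also have "\<dots> \<le> K * par_eta p" using \<eta> by (intro mult_right_mono le) (auto simp: scale_exp_def)
    finally show *: "2 * 2 ^ lip_exp p \<le> K * par_eta p" by simp
    have "(1::real) \<le> 2 ^ lip_exp p" by simp
    with * show "1 \<le> K * par_eta p" by linarith
  }
  {
    assume \<epsilon>: "0 < par_eps p"
    have "1 \<le> 2 ^ ?l (par_eps p) * par_eps p" using lg_bound[of "1 / par_eps p"] \<epsilon> by (simp add: field_simps)
    also have "\<dots> \<le> K * par_eps p" using \<epsilon> by (intro mult_right_mono le) (auto simp: scale_exp_def)
    finally show "1 \<le> K * par_eps p" .
  }
  {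
    assume \<gamma>: "0 < par_gamma p"
    have "1 \<le> real ?G * par_gamma p" by (rule gcount_bound[OF \<gamma>])
    also have "\<dots> \<le> 2 ^ ?G * par_gamma p"
      using \<gamma> less_imp_le[OF of_nat_less_two_power] by (intro mult_right_mono) auto
    finally have G: "1 \<le> 2 ^ ?G * par_gamma p" .
    have "test_count p + 1 \<le> 2 ^ test_count p" using Suc_leI[OF less_exp[of "test_count p"]] by simp
    then have m: "real (test_count p + 1) \<le> 2 ^ test_count p" by (metis of_nat_le_iff of_nat_numeral of_nat_power)
    have "2 * real ((test_count p + 1) * par_n p) \<le> 2 * (2 ^ test_count p * 2 ^ par_n p)"
      unfolding of_nat_mult using m n by (intro mult_left_mono mult_mono) auto
    also have "\<dots> \<le> 2 * (2 ^ test_count p * 2 ^ par_n p) * (2 ^ ?G * par_gamma p)"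
      using mult_left_mono[OF G, of "2 * (2 ^ test_count p * 2 ^ par_n p)"] by simp
    also have "\<dots> = 2 ^ (1 + test_count p + par_n p + ?G) * par_gamma p" by (simp add: power_add)
    also have "\<dots> \<le> K * par_gamma p" using \<gamma> by (intro mult_right_mono le) (auto simp: scale_exp_def)
    also have "\<dots> \<le> K\<^sup>2 * par_gamma p"
      using \<gamma> ge[of K K] \<open>64 \<le> K\<close> by (intro mult_right_mono) (auto simp: power2_eq_square)
    finally show "2 * ((test_count p + 1) * par_n p) \<le> K\<^sup>2 * par_gamma p" by simp
  }
qed

lemma half_power_scale: "i \<le> j \<Longrightarrow> (1 / 2 :: real) ^ (e * j) * (2 ^ e) ^ i = (1 / 2) ^ (e * (j - i))"
proof -
  assume "i \<le> j"
  then have "e * j = e * (j - i) + e * i" by (simp add: diff_mult_distrib2)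
  then have "(1 / 2 :: real) ^ (e * j) = (1 / 2) ^ (e * (j - i)) * (1 / 2) ^ (e * i)"
    by (metis power_add)
  then show ?thesis by (simp add: power_mult[symmetric] power_one_over)
qed

section \<open>The network as an instance of the search\<close>

locale recovery_problem =
  fixes A :: "real mat" and ls :: layers and p :: params
  assumes A: "A \<in> carrier_mat (par_k p) (par_n p)" and kn: "par_k p < par_n p"
    and net: "network (par_k p) ls" "length ls = par_d p"
    and pos: "0 < par_gamma p" "0 < par_eta p" "0 < par_eps p" "0 < par_delta p"
    and act: "\<And>i. i < par_d p \<Longrightarrow> smooth_activation (snd (ls ! i)) (par_L p i)"
    and steep: "\<And>V. subspace_of (par_n p) V \<Longrightarrow> subspace_dim (par_n p) V < par_k p \<Longrightarrow>
      par_gamma p \<le> gauss_prob (par_n p) (\<lambda>g.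
        (\<forall>c>0. net_off A ls V (c \<cdot>\<^sub>v g) = 1 \<longrightarrow>
          \<bar>dir_deriv (net_off A ls V) g (c \<cdot>\<^sub>v g)\<bar> \<ge> par_eta p) \<and>
        net_off A ls V g \<ge> 1)"
    and scale_A: "\<And>s. s \<in> singular_values A \<Longrightarrow> s \<le> par_scale p"
    and scale_W: "\<And>i s. i < par_d p \<Longrightarrow> s \<in> singular_values (fst (ls ! i)) \<Longrightarrow> s \<le> par_scale p"
begin

abbreviation n :: nat where "n \<equiv> par_n p"
abbreviation k :: nat where "k \<equiv> par_k p"
abbreviation E :: nat where "E \<equiv> scale_exp p"
abbreviation x :: nat where "x \<equiv> scale_exp p * rate p"
abbreviation X :: real where "X \<equiv> 2 ^ lip_exp p"

definition F :: "(nat \<Rightarrow> real) \<Rightarrow> real" where "F f = net ls (A *\<^sub>v vec n f)"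

lemma n_pos: "0 < n" using kn by simp

lemma lip_exp_eq: "2 ^ lg (par_scale p) * (\<Prod>i<length ls. 2 * 2 ^ lg (par_scale p) * 2 ^ lg (par_L p i)) = X"
proof -
  let ?l = "lg (par_scale p)"
  have "(\<Prod>i<length ls. 2 * 2 ^ ?l * 2 ^ lg (par_L p i)) = (2::real) ^ (\<Sum>i<par_d p. 1 + ?l + lg (par_L p i))"
    by (simp add: power_sum net(2) power_add)
  also have "(\<Sum>i<par_d p. 1 + ?l + lg (par_L p i)) = par_d p + par_d p * ?l + (\<Sum>i<par_d p. lg (par_L p i))"
    by (simp only: sum.distrib) simp
  finally show ?thesis by (simp add: lip_exp_def power_add[symmetric] mult.commute)
qed

lemma smooth_F: "smooth_map n 1 X (X\<^sup>2) (\<lambda>x i. apply_layers ls (A *\<^sub>v vec n x) $ i)"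
proof -
  have le: "s \<le> 2 ^ lg (par_scale p)" if "s \<le> par_scale p" for s
    using that lg_bound[of "par_scale p"] by linarith
  have "smooth_map n 1 X (X\<^sup>2) (\<lambda>x i. apply_layers ls (A *\<^sub>v vec n x) $ i) \<and> 1 \<le> X"
  proof (rule smooth_map_layers[OF A, where L = "par_L p" and lam = "\<lambda>i. 2 ^ lg (par_L p i)"])
    show "s \<le> 2 ^ lg (par_scale p)" if "s \<in> singular_values A" for s
      using scale_A[OF that] by (rule le)
    show "s \<le> 2 ^ lg (par_scale p)" if "i < length ls" "s \<in> singular_values (fst (ls ! i))" for i s
      using scale_W[of i s] that net(2) by (intro le) simp
    show "layers_dims 1 ls k" using net(1) by (simp add: network_def)
    show "smooth_activation (snd (ls ! i)) (par_L p i)" if "i < length ls" for i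
      using act[of i] that net(2) by simp
    show "X = 2 ^ lg (par_scale p) * (\<Prod>i<length ls. 2 * 2 ^ lg (par_scale p) * 2 ^ lg (par_L p i))"
      by (rule lip_exp_eq[symmetric])
  qed (simp_all add: lg_bound)
  then show ?thesis ..
qed

text \<open>The linear parts in \<open>smooth_F\<close> exist point by point; choice combines their
  single rows into a gradient function.\<close>

lemma F_gradient:
  obtains a where "\<And>x z. \<bar>F (\<lambda>i. x i + z i) - F x - dotn n (a x) z\<bar> \<le> X\<^sup>2 * (normn n z)\<^sup>2"
    "\<And>x z. \<bar>dotn n (a x) z\<bar> \<le> X * normn n z"
proof -
  define a where "a = (\<lambda>x. SOME v. \<forall>z. \<bar>F (\<lambda>i. x i + z i) - F x - dotn n v z\<bar> \<le> X\<^sup>2 * (normn n z)\<^sup>2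
      \<and> \<bar>dotn n v z\<bar> \<le> X * normn n z)"
  have "\<forall>z. \<bar>F (\<lambda>i. x i + z i) - F x - dotn n (a x) z\<bar> \<le> X\<^sup>2 * (normn n z)\<^sup>2
      \<and> \<bar>dotn n (a x) z\<bar> \<le> X * normn n z" for x
  proof -
    let ?y = "\<lambda>x i. apply_layers ls (A *\<^sub>v vec n x) $ i"
    obtain J :: "nat \<Rightarrow> nat \<Rightarrow> real" where J: "\<And>z. normn 1 (\<lambda>i. dotn n (J i) z) \<le> X * normn n z"
      "\<And>z. normn 1 (\<lambda>i. ?y (\<lambda>j. x j + z j) i - ?y x i - dotn n (J i) z) \<le> X\<^sup>2 * (normn n z)\<^sup>2"
      by (rule smooth_mapE[OF smooth_F, of x]) (rule that)
    have 1: "normn 1 f = \<bar>f 0\<bar>" for f :: "nat \<Rightarrow> real" by (simp add: L2_set_def)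
    have "\<exists>v. \<forall>z. \<bar>F (\<lambda>i. x i + z i) - F x - dotn n v z\<bar> \<le> X\<^sup>2 * (normn n z)\<^sup>2
      \<and> \<bar>dotn n v z\<bar> \<le> X * normn n z"
      using J unfolding 1 by (intro exI[of _ "J 0"]) (simp add: F_def net_def)
    then show ?thesis unfolding a_def by (rule someI_ex)
  qed
  then show ?thesis by (intro that[of a]) blast+
qed

lemma F_zero: "F (\<lambda>_. 0) = 0"
proof -
  have "A *\<^sub>v vec n (\<lambda>_. 0) = 0\<^sub>v k" using A by (auto simp: scalar_prod_def)
  moreover have "apply_layers ls (0\<^sub>v k) = 0\<^sub>v 1"
    using act net by (intro layers_zero) (auto simp: network_def smooth_activation_def)
  ultimately show ?thesis by (simp add: F_def net_def)
qed

lemma rate_ge: "20 \<le> rate p" by (simp add: rate_def)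

text \<open>The relations among the scales become identities between powers of two; subtraction of
  naturals in the exponents is harmless because \<open>rate p \<ge> 20\<close>.\<close>

sublocale search_scale n "2 * x" "test_count p" "(1 / 2) ^ x" "(1 / 2) ^ (x - E)" "(1 / 2) ^ (2 * x - 14 * E)"
  "(1 / 2) ^ (2 * x + 4 * E)" "\<lambda>f. 1 \<le> F f" "2 ^ E"
proof unfold_locales
  show "(1 \<le> F f) = (1 \<le> F g)" if "\<And>i. i < n \<Longrightarrow> f i = g i" for f g
  proof -
    have "vec n f = vec n g" using that by auto
    then show ?thesis by (simp add: F_def)
  qed
  have "F \<in> borel_measurable (PiM UNIV (\<lambda>_. borel))"
    using smooth_map_continuous[OF smooth_F, of 0] by (simp add: F_def[abs_def] net_def)
  then show "Measurable.pred (PiM UNIV (\<lambda>_. borel)) (\<lambda>f. 1 \<le> F f)" by measurable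
  show "64 \<le> (2::real) ^ E" by (rule scale_constants)
  show "real (4 * n) \<le> 2 ^ E" by (rule scale_constants)
  show "0 < (1 / 2 :: real) ^ x" by simp
  have "(1 / 2 :: real) ^ x * (2 ^ E) ^ 16 = (1 / 2) ^ (E * (rate p - 16))"
    using rate_ge by (intro half_power_scale) simp
  then show "(1 / 2 :: real) ^ x * (2 ^ E) ^ 16 \<le> 1" by (simp add: power_le_one)
  show "(1 / 2 :: real) ^ (x - E) = 2 ^ E * (1 / 2) ^ x"
    using half_power_scale[of 1 "rate p" E] rate_ge by (simp add: diff_mult_distrib2 mult.commute)
  have sq: "(1 / 2 :: real) ^ (2 * x) = ((1 / 2) ^ x)\<^sup>2" by (simp add: power_even_eq)
  then show "(1 / 2 :: real) ^ (2 * x) = ((1 / 2) ^ x)\<^sup>2" .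
  have "(1 / 2 :: real) ^ (E * (2 * rate p)) * (2 ^ E) ^ 14 = (1 / 2) ^ (E * (2 * rate p - 14))"
    using rate_ge by (intro half_power_scale) simp
  moreover have "E * (2 * rate p) = 2 * x" "E * (2 * rate p - 14) = 2 * x - 14 * E"
    by (simp_all add: diff_mult_distrib2)
  ultimately have "((1 / 2 :: real) ^ x)\<^sup>2 * (2 ^ E) ^ 14 = (1 / 2) ^ (2 * x - 14 * E)" by (simp only: sq)
  then show "(1 / 2 :: real) ^ (2 * x - 14 * E) = (2 ^ E) ^ 14 * ((1 / 2) ^ x)\<^sup>2"
    by (subst mult.commute) (rule sym)
  have "(1 / 2 :: real) ^ (2 * x + 4 * E) = ((1 / 2) ^ x)\<^sup>2 * ((1 / 2) ^ E) ^ 4"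
    by (simp add: power_add sq power_mult[symmetric] mult.commute)
  also have "\<dots> = ((1 / 2) ^ x / (2 ^ E)\<^sup>2)\<^sup>2"
    by (simp add: power_divide power_one_over power_mult_distrib power_mult[symmetric])
  finally show "(1 / 2 :: real) ^ (2 * x + 4 * E) = ((1 / 2) ^ x / (2 ^ E)\<^sup>2)\<^sup>2" .
qed

lemma net_off_span:
  assumes "orthogonal_list n us"
  shows "net_off A ls (span_of n (vec n ` set us)) (vec n g) = F (resid n us g)"
  by (simp add: net_off_def F_def orth_proj_span_of[OF assms])

text \<open>Projecting commutes with scaling, so along the ray the derivative is the gradient at the
  projected point paired with the projected direction.\<close>

lemma steep_direction:
  assumes us: "orthogonal_list n us"
    and a: "\<And>x z. \<bar>F (\<lambda>i. x i + z i) - F x - dotn n (a x) z\<bar> \<le> X\<^sup>2 * (normn n z)\<^sup>2"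
  shows "dir_deriv (net_off A ls (span_of n (vec n ` set us))) (vec n g) (c \<cdot>\<^sub>v vec n g) =
    dotn n (a (\<lambda>i. c * resid n us g i)) (resid n us g)"
proof -
  let ?r = "resid n us g"
  let ?f = "\<lambda>t. F (\<lambda>i. t * ?r i)"
  have "net_off A ls (span_of n (vec n ` set us)) (c \<cdot>\<^sub>v vec n g + t \<cdot>\<^sub>v vec n g) = ?f (c + t)" for t
  proof -
    have "c \<cdot>\<^sub>v vec n g + t \<cdot>\<^sub>v vec n g = vec n (\<lambda>i. (c + t) * g i)" by (auto simp: algebra_simps)
    then show ?thesis by (simp add: net_off_span[OF us] resid_scale)
  qed
  then have "dir_deriv (net_off A ls (span_of n (vec n ` set us))) (vec n g) (c \<cdot>\<^sub>v vec n g) = deriv (\<lambda>t. ?f (c + t)) 0"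
    by (simp add: dir_deriv_def)
  also have "\<dots> = dotn n (a (\<lambda>i. c * ?r i)) ?r"
  proof (rule DERIV_imp_deriv, rule derivative_from_quadratic_bound)
    fix s
    show "\<bar>?f (c + (0 + s)) - ?f (c + 0) - dotn n (a (\<lambda>i. c * ?r i)) ?r * s\<bar> \<le> (X\<^sup>2 * (normn n ?r)\<^sup>2) * s\<^sup>2"
      using a[of "\<lambda>i. c * ?r i" "\<lambda>i. s * ?r i"]
      by (simp add: dotn_scale_right normn_scale power_mult_distrib algebra_simps)
  qed
  finally show ?thesis .
qed

text \<open>Hypothesis (4) for the span of the stored vectors gives an event of probability at least
  \<open>\<gamma>\<close>. Discarding the tapes whose first \<open>(m + 1) * n\<close> entries have
  norm above \<open>2 ^ E\<close> loses at most half of it, and on the rest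
  \<open>extend_accepts\<close> applies.\<close>

lemma progress:
  assumes us: "orthogonal_list n us" "length us < k"
  shows "par_gamma p / 2 \<le> measure iid_gauss {\<omega>. extend us \<omega> \<noteq> us}"
proof -
  let ?V = "span_of n (vec n ` set us)" and ?m = "test_count p"
  obtain a where a: "\<And>x z. \<bar>F (\<lambda>i. x i + z i) - F x - dotn n (a x) z\<bar> \<le> X\<^sup>2 * (normn n z)\<^sup>2"
    "\<And>x z. \<bar>dotn n (a x) z\<bar> \<le> X * normn n z" by (rule F_gradient) blast
  let ?R = "\<lambda>g. (\<forall>c>0. net_off A ls ?V (c \<cdot>\<^sub>v g) = 1 \<longrightarrow>
          \<bar>dir_deriv (net_off A ls ?V) g (c \<cdot>\<^sub>v g)\<bar> \<ge> par_eta p) \<and> net_off A ls ?V g \<ge> 1"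
  let ?S = "{\<omega>. ?R (vec n \<omega>)}" and ?T = "{\<omega>. 2 ^ E < normn ((?m + 1) * n) \<omega>}"
  have \<gamma>: "par_gamma p \<le> gauss_prob n ?R"
    using us(2) by (intro steep subspace_span_of us(1)) (simp add: dim_span_of[OF us(1)])
  then have "0 < gauss_prob n ?R" using pos(1) by linarith
  from gauss_prob_iid[OF this] \<gamma> have S: "?S \<in> sets iid_gauss" "par_gamma p \<le> measure iid_gauss ?S" by simp_all
  have T: "?T \<in> sets iid_gauss"
  proof -
    have "(\<lambda>\<omega>. normn ((?m + 1) * n) \<omega>) \<in> borel_measurable iid_gauss"
      unfolding L2_set_def using measurable_coordinate by measurable
    then have "{\<omega> \<in> space iid_gauss. 2 ^ E < normn ((?m + 1) * n) \<omega>} \<in> sets iid_gauss" by measurable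
    then show ?thesis by (simp add: space_iid_gauss)
  qed
  have "measure iid_gauss ?T \<le> real ((?m + 1) * n) / (2 ^ E)\<^sup>2" by (rule iid_gauss_norm_tail) simp
  also have "\<dots> \<le> par_gamma p / 2" using scale_constants(7)[OF pos(1)] by (simp add: field_simps)
  finally have "measure iid_gauss ?T \<le> par_gamma p / 2" .
  moreover have "measure iid_gauss ?S \<le> measure iid_gauss (?S - ?T) + measure iid_gauss ?T"
    using measure_Un_le[of "?S - ?T" iid_gauss ?T] S(1) T gseq.finite_measure_mono[of ?S "(?S - ?T) \<union> ?T"] by auto
  moreover have "measure iid_gauss (?S - ?T) \<le> measure iid_gauss {\<omega>. extend us \<omega> \<noteq> us}"
  proof (rule gseq.finite_measure_mono)
    show "{\<omega>. extend us \<omega> \<noteq> us} \<in> sets iid_gauss"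
      using simple_functionD(2)[OF simple_function_extend, of us "- {us}"]
      by (simp add: vimage_def space_iid_gauss)
    show "?S - ?T \<subseteq> {\<omega>. extend us \<omega> \<noteq> us}"
    proof
      fix \<omega> assume \<omega>: "\<omega> \<in> ?S - ?T"
      let ?r = "resid n us \<omega>"
      have scaled: "c \<cdot>\<^sub>v vec n \<omega> = vec n (\<lambda>i. c * \<omega> i)" for c by auto
      have norm: "normn ((?m + 1) * n) \<omega> \<le> 2 ^ E" using \<omega> by simp
      have "extend us \<omega> \<noteq> us"
      proof (rule extend_accepts[where a = a and X = X and \<eta> = "par_eta p"])
        show "F (\<lambda>_. 0) < 1" by (simp add: F_zero)
        show "\<bar>F (\<lambda>i. x i + z i) - F x - dotn n (a x) z\<bar> \<le> (2 ^ E)\<^sup>2 * (normn n z)\<^sup>2" for x z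
        proof -
          have "X\<^sup>2 \<le> (2 ^ E)\<^sup>2" using scale_constants(3) by (intro power_mono) auto
          then show ?thesis using a(1)[of x z] mult_right_mono[of "X\<^sup>2" "(2 ^ E)\<^sup>2" "(normn n z)\<^sup>2"] by simp
        qed
        show "normn n \<omega> \<le> 2 ^ E"
          using normn_block_le[of 0 n "(?m + 1) * n" \<omega>] norm by simp
        show "normn n (\<lambda>i. \<omega> (n + (j * n + i))) \<le> 2 ^ E" if "j < ?m" for j
        proof -
          have "Suc j * n \<le> ?m * n" using that by (intro mult_le_mono1) simp
          then show ?thesis
            using normn_block_le[of "n + j * n" n "(?m + 1) * n" \<omega>] norm by (simp add: add.assoc)
        qed
        show "1 \<le> F ?r" using \<omega> by (simp add: net_off_span[OF us(1)])
        show "par_eta p \<le> \<bar>dotn n (a (\<lambda>i. c * ?r i)) ?r\<bar>" if "0 < c" "F (\<lambda>i. c * ?r i) = 1" for c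
        proof -
          have "net_off A ls ?V (c \<cdot>\<^sub>v vec n \<omega>) = 1"
            using that(2) by (simp add: scaled net_off_span[OF us(1)] resid_scale)
          moreover have "\<forall>c>0. net_off A ls ?V (c \<cdot>\<^sub>v vec n \<omega>) = 1 \<longrightarrow>
              \<bar>dir_deriv (net_off A ls ?V) (vec n \<omega>) (c \<cdot>\<^sub>v vec n \<omega>)\<bar> \<ge> par_eta p"
            using \<omega> by blast
          ultimately have "\<bar>dir_deriv (net_off A ls ?V) (vec n \<omega>) (c \<cdot>\<^sub>v vec n \<omega>)\<bar> \<ge> par_eta p"
            using that(1) by blast
          then show ?thesis unfolding steep_direction[OF us(1) a(1)] .
        qed
      qed (use a(2) us(1) pos scale_constants(3-5) in auto)
      then show "\<omega> \<in> {\<omega>. extend us \<omega> \<noteq> us}" by simp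
    qed
  qed
  ultimately show ?thesis using S(2) by linarith
qed

lemma accurate_probability:
  "1 - par_delta p \<le> measure iid_gauss {\<omega>. accurate (rounds k (round_count p) [] \<omega>) \<and>
     length (rounds k (round_count p) [] \<omega>) = k}" (is "_ \<le> measure _ ?G")
proof (cases "k = 0")
  case True
  then have "rounds k (round_count p) [] \<omega> = []" for \<omega> by (cases "round_count p") simp_all
  then have "?G = space iid_gauss"
    using True by (simp add: accurate_def orthogonal_list_def space_iid_gauss)
  then have "measure iid_gauss ?G = 1" by (simp only: prob_space.prob_space[OF prob_space_PiM[OF gauss.prob_space_axioms]])
  then show ?thesis using pos by simp
next
  case False
  have o: "orthogonal_list n []" by (simp add: orthogonal_list_def)
  have "par_gamma p / 2 \<le> measure iid_gauss {\<omega>. extend us \<omega> \<noteq> us}" if "accurate us" "length us < k" for us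
    using that by (intro progress) (simp_all add: accurate_def)
  note prog = this
  \<comment> \<open>Follows because \<open>\<gamma>\<close> is a lower bound for a probability. The
    instance is the zero subspace, whose dimension is below \<open>k\<close> only for
    \<open>0 < k\<close>; hence the case distinction.\<close>
  have \<gamma>: "par_gamma p \<le> 1"
  proof -
    obtain V where V: "subspace_of n V" "subspace_dim n V < k"
      using subspace_span_of[OF o] dim_span_of[OF o] False by auto
    note le = steep[OF V]
    with pos(1) have "0 < gauss_prob n (\<lambda>g. (\<forall>c>0. net_off A ls V (c \<cdot>\<^sub>v g) = 1 \<longrightarrow>
        \<bar>dir_deriv (net_off A ls V) g (c \<cdot>\<^sub>v g)\<bar> \<ge> par_eta p) \<and> net_off A ls V g \<ge> 1)"
      by linarith
    from ord_eq_le_trans[OF gauss_prob_iid(2)[OF this, symmetric] gseq.prob_le_1] le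
    show ?thesis by linarith
  qed
  have G: "?G \<in> sets iid_gauss"
    using simple_functionD(2)[OF simple_function_rounds, of k "round_count p" "[]" "{vs. accurate vs \<and> length vs = k}"]
    by (simp add: vimage_def space_iid_gauss)
  have "measure iid_gauss {\<omega>. \<not> (accurate (rounds k (round_count p) [] \<omega>) \<and> length (rounds k (round_count p) [] \<omega>) = k)}
      \<le> 2 ^ (k - length ([] :: (nat \<Rightarrow> real) list)) * (1 - par_gamma p / 4) ^ round_count p + round_count p * (3 / 4) ^ test_count p"
  proof (rule failure_probability[where good = accurate])
    show "accurate (extend us \<omega>)" if "accurate us" "length us < k" "extend us \<omega> \<noteq> us"
      "nearly_normal (real (4 * n) * (1 / 2) ^ (2 * x - 14 * E)) (trial us \<omega>)" for us \<omega>
      unfolding extend_neqD(1)[OF that(3)]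
      by (rule accurate_snoc[OF that(1) _ _ extend_neqD(3)[OF that(3)]])
         (use that(4) normn_candidate in \<open>simp_all add: trial_def\<close>)
  qed (use pos \<gamma> prog theta_pos o in \<open>auto simp: accurate_def\<close>)
  also have "\<dots> \<le> par_delta p" using failure_constants[OF pos(1) \<gamma> pos(4)] by simp
  finally have "measure iid_gauss (space iid_gauss - ?G) \<le> par_delta p"
    by (simp add: space_iid_gauss Compl_eq Collect_neg_eq[symmetric] set_diff_eq)
  then show ?thesis using gseq.prob_compl[OF G] by simp
qed

end

section \<open>Running time\<close>

text \<open>Rounding up costs at most \<open>1\<close>, and \<open>1 / ln 2 \<le> 2\<close> converts
  to the natural logarithm.\<close>

lemma lg_le: "real (lg v) \<le> 1 + 2 * log1 v"
proof (cases "v \<le> 1")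
  case True
  then have "lg v \<le> 0" unfolding lg_def by (intro Least_le) simp
  then show ?thesis by (simp add: log1_def)
next
  case False
  let ?e = "nat \<lceil>log 2 v\<rceil>"
  have l: "0 < log 2 v" using False by simp
  have "v = 2 powr log 2 v" using False by simp
  also have "\<dots> \<le> 2 powr ?e" using l by (intro powr_mono) auto
  finally have "v \<le> 2 ^ ?e" by (simp add: powr_realpow)
  then have "lg v \<le> ?e" unfolding lg_def by (rule Least_le)
  then have "real (lg v) \<le> log 2 v + 1" using l by linarith
  also have "log 2 v = ln v * (1 / ln 2)" by (simp add: log_def)
  also have "\<dots> \<le> ln v * 2"
    using False ln2_ge_two_thirds by (intro mult_left_mono) (auto simp: field_simps)
  finally show ?thesis by (simp add: log1_def)
qed

lemma gcount_le: "0 < \<gamma> \<Longrightarrow> real (gcount \<gamma>) \<le> 1 / \<gamma> + 1"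
proof -
  assume \<gamma>: "0 < \<gamma>"
  then have "1 / \<gamma> \<le> real (nat \<lceil>1 / \<gamma>\<rceil>)" by linarith
  then have "1 / \<gamma> * \<gamma> \<le> real (nat \<lceil>1 / \<gamma>\<rceil>) * \<gamma>" using \<gamma> by (intro mult_right_mono) auto
  then have "1 \<le> real (nat \<lceil>1 / \<gamma>\<rceil>) * \<gamma>" using \<gamma> by simp
  then have "gcount \<gamma> \<le> nat \<lceil>1 / \<gamma>\<rceil>" unfolding gcount_def by (rule Least_le)
  moreover have "0 < 1 / \<gamma>" using \<gamma> by simp
  ultimately show ?thesis by linarith
qed

text \<open>Positive \<open>\<gamma>\<close> makes \<open>gcount\<close> comparable with
  \<open>1 / \<gamma>\<close>; \<open>0 < par_n p\<close> is what the locale \<open>machine\<close>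
  demands before \<open>round_time\<close> can be unfolded.\<close>

definition poly_bounded :: "(params \<Rightarrow> nat) \<Rightarrow> bool" where
  "poly_bounded f \<longleftrightarrow> (\<exists>q. \<forall>p. 0 < par_gamma p \<and> 0 < par_n p \<longrightarrow> real (f p) \<le> poly q (problem_size p))"

lemma poly_boundedI:
  "(\<And>p. 0 < par_gamma p \<Longrightarrow> 0 < par_n p \<Longrightarrow> real (f p) \<le> poly q (problem_size p)) \<Longrightarrow> poly_bounded f"
  unfolding poly_bounded_def by blast

lemma poly_bounded_const: "poly_bounded (\<lambda>_. c)"
  by (rule poly_boundedI[where q = "[:real c:]"]) simp

lemma poly_bounded_add: "poly_bounded f \<Longrightarrow> poly_bounded g \<Longrightarrow> poly_bounded (\<lambda>p. f p + g p)"
proof -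
  assume "poly_bounded f" "poly_bounded g"
  then obtain q r where
    "\<And>p. 0 < par_gamma p \<Longrightarrow> 0 < par_n p \<Longrightarrow> real (f p) \<le> poly q (problem_size p)"
    "\<And>p. 0 < par_gamma p \<Longrightarrow> 0 < par_n p \<Longrightarrow> real (g p) \<le> poly r (problem_size p)"
    unfolding poly_bounded_def by blast
  then show ?thesis by (intro poly_boundedI[where q = "q + r"]) (simp add: add_mono)
qed

lemma poly_bounded_mult: "poly_bounded f \<Longrightarrow> poly_bounded g \<Longrightarrow> poly_bounded (\<lambda>p. f p * g p)"
proof -
  assume "poly_bounded f" "poly_bounded g"
  then obtain q r where qr:
    "\<And>p. 0 < par_gamma p \<Longrightarrow> 0 < par_n p \<Longrightarrow> real (f p) \<le> poly q (problem_size p)"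
    "\<And>p. 0 < par_gamma p \<Longrightarrow> 0 < par_n p \<Longrightarrow> real (g p) \<le> poly r (problem_size p)"
    unfolding poly_bounded_def by blast
  show ?thesis
  proof (rule poly_boundedI[where q = "q * r"])
    fix p :: params assume p: "0 < par_gamma p" "0 < par_n p"
    have "real (f p) * real (g p) \<le> poly q (problem_size p) * poly r (problem_size p)"
      \<comment> \<open>The bounding polynomials are nonnegative at these arguments because they
        dominate natural numbers.\<close>
      using qr[OF p] by (intro mult_mono) (auto intro: order_trans[of 0 "real (f p)"])
    then show "real (f p * g p) \<le> poly (q * r) (problem_size p)" by simp
  qed
qed

lemma poly_bounded_diff: "poly_bounded f \<Longrightarrow> poly_bounded (\<lambda>p. f p - g p)"
proof -
  assume "poly_bounded f"
  then obtain q where "\<And>p. 0 < par_gamma p \<Longrightarrow> 0 < par_n p \<Longrightarrow> real (f p) \<le> poly q (problem_size p)"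
    unfolding poly_bounded_def by blast
  then show ?thesis by (intro poly_boundedI[where q = q]) (meson diff_le_self of_nat_mono order_trans)
qed

lemma poly_bounded_linear:
  assumes "\<And>p. 0 < par_gamma p \<Longrightarrow> real (f p) \<le> 1 + 3 * problem_size p"
  shows "poly_bounded f"
  by (rule poly_boundedI[where q = "[:1, 3:]"]) (use assms in \<open>simp add: mult.commute\<close>)

lemma size_parts:
  assumes "0 < par_gamma p"
  shows "real (par_n p) \<le> problem_size p" "real (par_k p) \<le> problem_size p" "1 / par_gamma p \<le> problem_size p"
    "(\<Sum>i<par_d p. log1 (par_L p i)) \<le> problem_size p" "log1 (1 / par_eta p) \<le> problem_size p"
    "log1 (1 / par_eps p) \<le> problem_size p" "log1 (1 / par_delta p) \<le> problem_size p"
    "log1 (par_scale p) \<le> problem_size p" "0 \<le> problem_size p"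
proof -
  have l: "1 \<le> log1 v" for v by (simp add: log1_def)
  have s: "0 \<le> (\<Sum>i<par_d p. log1 (f i))" for f
    using l by (intro sum_nonneg) (meson order_trans zero_le_one)
  have "0 < 1 / par_gamma p" using assms by simp
  note * = s[of "par_L p"] s[of "par_kappa p"] l[of "1 / par_eta p"] l[of "1 / par_eps p"]
    l[of "1 / par_delta p"] l[of "par_scale p"] this
  show "real (par_n p) \<le> problem_size p" "real (par_k p) \<le> problem_size p" "1 / par_gamma p \<le> problem_size p"
    "(\<Sum>i<par_d p. log1 (par_L p i)) \<le> problem_size p" "log1 (1 / par_eta p) \<le> problem_size p"
    "log1 (1 / par_eps p) \<le> problem_size p" "log1 (1 / par_delta p) \<le> problem_size p"
    "log1 (par_scale p) \<le> problem_size p" "0 \<le> problem_size p"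
    unfolding problem_size_def using * by linarith+
qed

lemma poly_bounded_parts:
  "poly_bounded par_n" "poly_bounded par_k" "poly_bounded par_d"
  "poly_bounded (\<lambda>p. gcount (par_gamma p))" "poly_bounded (\<lambda>p. lg (1 / par_eta p))"
  "poly_bounded (\<lambda>p. lg (1 / par_eps p))" "poly_bounded (\<lambda>p. lg (1 / par_delta p))"
  "poly_bounded (\<lambda>p. lg (par_scale p))" "poly_bounded (\<lambda>p. \<Sum>i<par_d p. lg (par_L p i))"
proof -
  have d: "real (par_d p) \<le> (\<Sum>i<par_d p. log1 (par_L p i))" for p
    using sum_mono[of "{..<par_d p}" "\<lambda>_. 1" "\<lambda>i. log1 (par_L p i)"] by (simp add: log1_def)
  show "poly_bounded par_n" "poly_bounded par_k" "poly_bounded par_d"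
    by (rule poly_bounded_linear; use size_parts d in \<open>smt (verit)\<close>)+
  show "poly_bounded (\<lambda>p. gcount (par_gamma p))"
    by (rule poly_bounded_linear) (use size_parts gcount_le in \<open>smt (verit)\<close>)
  show "poly_bounded (\<lambda>p. lg (1 / par_eta p))" "poly_bounded (\<lambda>p. lg (1 / par_eps p))"
    "poly_bounded (\<lambda>p. lg (1 / par_delta p))" "poly_bounded (\<lambda>p. lg (par_scale p))"
    by (rule poly_bounded_linear; use size_parts lg_le in \<open>smt (verit)\<close>)+
  show "poly_bounded (\<lambda>p. \<Sum>i<par_d p. lg (par_L p i))"
  proof (rule poly_bounded_linear)
    fix p :: params assume p: "0 < par_gamma p"
    have "real (\<Sum>i<par_d p. lg (par_L p i)) \<le> (\<Sum>i<par_d p. 1 + 2 * log1 (par_L p i))"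
      unfolding of_nat_sum by (intro sum_mono lg_le)
    also have "\<dots> = par_d p + 2 * (\<Sum>i<par_d p. log1 (par_L p i))"
      by (simp add: sum.distrib sum_distrib_left)
    also have "\<dots> \<le> 1 + 3 * problem_size p" using d[of p] size_parts(4,9)[OF p] by linarith
    finally show "real (\<Sum>i<par_d p. lg (par_L p i)) \<le> 1 + 3 * problem_size p" .
  qed
qed

text \<open>\<open>round_time\<close> unfolds only in an instance of its locale. As it depends on
  \<open>n\<close>, \<open>b\<close>, \<open>m\<close> and \<open>k\<close> alone, a dummy instance
  for the rest will do.\<close>

lemma round_time_eq:
  assumes "0 < n"
  shows "machine.round_time n b m k = (n * 4 + 2) + (1 + ((n * 5 + 2) + ((k * (n * 18 + 13) + 2)
    + (1 + ((n * 5 + 2) + ((n * 5 + 2)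
    + (2 + ((b * (n * 10 + 9) + 2) + (1 + ((n * 5 + 2)
    + ((n * ((1 + ((n * 5 + 2) + (5 + ((b * (n * 10 + 9) + 2) + 2)))) + 2) + 2)
    + (1 + ((m * (((n * 4 + 2) + ((n * 6 + 3) + (1 + ((n * 10 + 6) + (n * 10 + 4))))) + 2) + 2)
    + (1 + ((n * 5 + 2) + ((k * (n * 18 + 13) + 2) + ((n * 6 + 3)
    + (((n * 5 + 6) + 1) + 1))))))))))))))))))"
proof -
  interpret machine n b m 0 0 0 0 "\<lambda>_. True" 0 k 0 "\<lambda>_. 1" "\<lambda>_. 0"
    by unfold_locales (use assms in simp_all)
  show ?thesis by (simp only: round_time_def coord_time_def test_time_def)
qed

lemma poly_bounded_recovery_time: "poly_bounded recovery_time"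
proof -
  note intro = poly_bounded_add poly_bounded_mult poly_bounded_diff poly_bounded_const poly_bounded_parts
  have N: "poly_bounded round_count" unfolding round_count_def[abs_def] by (intro intro)
  then have m: "poly_bounded test_count" unfolding test_count_def[abs_def] by (intro intro)
  have E: "poly_bounded scale_exp" unfolding scale_exp_def[abs_def] lip_exp_def by (intro intro m)
  have r: "poly_bounded rate" unfolding rate_def[abs_def] by (intro intro)
  have "poly_bounded powers_time" unfolding powers_time_def[abs_def] Let_def by (intro intro E r)
  moreover have "poly_bounded (\<lambda>p. machine.round_time (par_n p) (2 * (scale_exp p * rate p)) (test_count p) (par_k p))"
    (is "poly_bounded ?t")
  proof -
    let ?b = "\<lambda>p. 2 * (scale_exp p * rate p)"
    have "poly_bounded (\<lambda>p. (par_n p * 4 + 2) + (1 + ((par_n p * 5 + 2) + ((par_k p * (par_n p * 18 + 13) + 2)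
      + (1 + ((par_n p * 5 + 2) + ((par_n p * 5 + 2)
      + (2 + ((?b p * (par_n p * 10 + 9) + 2) + (1 + ((par_n p * 5 + 2)
      + ((par_n p * ((1 + ((par_n p * 5 + 2) + (5 + ((?b p * (par_n p * 10 + 9) + 2) + 2)))) + 2) + 2)
      + (1 + ((test_count p * (((par_n p * 4 + 2) + ((par_n p * 6 + 3) + (1 + ((par_n p * 10 + 6) + (par_n p * 10 + 4))))) + 2) + 2)
      + (1 + ((par_n p * 5 + 2) + ((par_k p * (par_n p * 18 + 13) + 2) + ((par_n p * 6 + 3)
      + (((par_n p * 5 + 6) + 1) + 1)))))))))))))))))))"
      by (intro intro E r m)
    then show ?thesis unfolding poly_bounded_def using round_time_eq by simp
  qed
  ultimately show ?thesis unfolding recovery_time_def[abs_def] by (intro intro N)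
qed

section \<open>From accurate lists to recovery\<close>

context recovery_problem
begin

lemma kernel_invariant:
  assumes "\<And>i. i < k \<Longrightarrow> dotn n (\<lambda>j. A $$ (i, j)) w = 0"
  shows "invariant_dir w"
proof -
  have "A *\<^sub>v vec n (\<lambda>j. f j + c * w j) = A *\<^sub>v vec n f" for f c
  proof (rule eq_vecI)
    fix i assume "i < dim_vec (A *\<^sub>v vec n f)"
    then have i: "i < k" using A by simp
    have "(A *\<^sub>v vec n g) $ i = dotn n (\<lambda>j. A $$ (i, j)) g" for g
      using A i by (simp add: scalar_prod_def dotn_def atLeast0LessThan)
    then show "(A *\<^sub>v vec n (\<lambda>j. f j + c * w j)) $ i = (A *\<^sub>v vec n f) $ i"
      using assms[OF i] by (simp add: dotn_right)
  qed simp
  then show ?thesis unfolding invariant_dir_def by (simp add: F_def)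
qed

text \<open>The success condition as a predicate of the list alone, so that
  \<open>simple_function_rounds\<close> makes it an event.\<close>

definition recovered :: "(nat \<Rightarrow> real) list \<Rightarrow> bool" where
  "recovered us \<longleftrightarrow> (let V = span_of n {vec n (\<lambda>j. flat n us (i * n + j)) | i. i < k} in
     subspace_dim n V = k \<and>
     (\<forall>y\<in>V. (1 - par_eps p) * euclid_norm y \<le> euclid_norm (orth_proj (vec_space.row_space n A) y)))"

lemma recovered_state:
  assumes "\<And>j. mem s (idx s 0 + j) = flat n us j"
  shows "recovers A p s \<longleftrightarrow> recovered us"
  by (simp add: recovers_def recovered_def output_space_def Let_def add.assoc assms)

text \<open>The part \<open>w\<close> of \<open>f\<close> orthogonal to the row span is an invariant
  direction, and its squared norm is its inner product with \<open>f\<close>. Accuracy of the list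
  bounds this by \<open>\<epsilon>\<close> times the product of the norms, hence \<open>w\<close> is
  at most \<open>\<epsilon>\<close> times as long as \<open>f\<close>; the triangle inequality does
  the rest.\<close>

lemma accurate_recovered:
  assumes acc: "accurate us" and len: "length us = k"
  shows "recovered us"
proof -
  have o: "orthogonal_list n us" using acc by (simp add: accurate_def)
  have "{vec n (\<lambda>j. flat n us (i * n + j)) | i. i < k} = {vec n (us ! i) | i. i < k}"
  proof -
    have "vec n (\<lambda>j. flat n us (i * n + j)) = vec n (us ! i)" if "i < k" for i
      using that len by (auto simp: flat_row)
    then show ?thesis unfolding setcompr_eq_image by (intro image_cong) auto
  qed
  also have "\<dots> = vec n ` set us" by (auto simp: set_conv_nth len)
  finally have V: "{vec n (\<lambda>j. flat n us (i * n + j)) | i. i < k} = vec n ` set us" .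
  have "(1 - par_eps p) * euclid_norm y \<le> euclid_norm (orth_proj (vec_space.row_space n A) y)"
    if y_span: "y \<in> span_of n (vec n ` set us)" for y
  proof -
    obtain c where y: "y = vec n (\<lambda>i. \<Sum>u\<leftarrow>us. c u * u i)" by (rule span_of_listE[OF o y_span])
    define f where "f = (\<lambda>i. \<Sum>u\<leftarrow>us. c u * u i)"
    obtain q where q: "orth_proj (vec_space.row_space n A) (vec n f) = vec n q"
      "\<And>i. i < k \<Longrightarrow> dotn n (\<lambda>j. A $$ (i, j)) (\<lambda>i. f i - q i) = 0" "dotn n q (\<lambda>i. f i - q i) = 0"
      by (rule row_space_projection[OF A, of f]) blast
    define w where "w = (\<lambda>i. f i - q i)"
    have inv: "invariant_dir w" using q(2) unfolding w_def by (rule kernel_invariant)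
    have "(1 / 2 :: real) ^ x * (2 ^ E) ^ (17 + 6 * k) = (1 / 2) ^ (E * 3)"
      using half_power_scale[of "17 + 6 * k" "rate p" E] by (simp add: rate_def)
    also have "\<dots> \<le> (1 / 2) ^ E" by (intro power_decreasing) auto
    also have "\<dots> \<le> par_eps p" using scale_constants(6)[OF pos(3)] by (simp add: power_one_over field_simps)
    finally have e: "(1 / 2 :: real) ^ x * (2 ^ E) ^ (17 + 6 * k) \<le> par_eps p" .
    have "(normn n w)\<^sup>2 = dotn n f w"
      using q(3) by (simp add: dotn_self[symmetric] w_def dotn_diff_left)
    also have "\<dots> \<le> (1 / 2) ^ x * (2 ^ E) ^ (17 + 6 * k) * normn n f * normn n w"
      using accurate_span[OF acc inv len, of c] by (simp add: f_def)
    also have "\<dots> \<le> par_eps p * normn n f * normn n w"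
      using e by (intro mult_right_mono normn_nonneg)
    finally have sq: "normn n w * normn n w \<le> par_eps p * normn n f * normn n w" by (simp add: power2_eq_square)
    have w: "normn n w \<le> par_eps p * normn n f"
    proof (cases "normn n w = 0")
      case True
      then show ?thesis using pos(3) normn_nonneg[of f n] by simp
    next
      case False
      then have "0 < normn n w" using normn_nonneg[of w n] by linarith
      with sq show ?thesis by (rule mult_right_le_imp_le)
    qed
    have "normn n f = normn n (\<lambda>i. q i + w i)" by (simp add: w_def)
    also have "\<dots> \<le> normn n q + normn n w" by (rule L2_set_triangle_ineq)
    finally have "(1 - par_eps p) * normn n f \<le> normn n q" using w by (simp add: algebra_simps)
    then show ?thesis unfolding y f_def[symmetric] q(1) euclid_norm_vec .
  qed
  then show ?thesis unfolding recovered_def Let_def V using dim_span_of[OF o] len by simp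
qed

lemma recovery_exec:
  "\<exists>s. exec (\<lambda>f. classifier A ls (vec n f)) \<omega> recovery_com (input_state p) s \<and>
     steps s \<le> recovery_time p \<and> queries s \<le> recovery_time p \<and>
     (recovers A p s \<longleftrightarrow> recovered (rounds k (round_count p) [] \<omega>))"
proof -
  have Q: "(\<lambda>f. classifier A ls (vec n f)) = (\<lambda>f. if 1 \<le> F f then 1 else 0)"
    by (simp add: classifier_def threshold_def F_def)
  have "runs (\<lambda>f. if 1 \<le> F f then 1 else 0) \<omega> (\<lambda>\<sigma>. \<sigma> = conf_of (input_state p)) recovery_com (recovery_time p)
    (\<lambda>(I, m, d). \<forall>j. m (I 0 + j) = flat n (rounds k (round_count p) [] \<omega>) j)"
    using recovery_runs[OF pos(1) n_pos, of "\<lambda>f. 1 \<le> F f" \<omega>] M_cong by blast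
  then obtain s where s: "exec (\<lambda>f. classifier A ls (vec n f)) \<omega> recovery_com (input_state p) s"
    "steps s \<le> steps (input_state p) + recovery_time p"
    "\<And>j. mem s (idx s 0 + j) = flat n (rounds k (round_count p) [] \<omega>) j"
    unfolding runs_def Q conf_of_def by auto
  have "steps (input_state p) = 0" "queries (input_state p) = 0"
    by (simp_all add: input_state_def Let_def)
  then show ?thesis
    using s exec_queries_le_steps[OF s(1)] recovered_state[OF s(3)] by (intro exI[of _ s]) auto
qed

lemma recovery_probability:
  "1 - par_delta p \<le> measure (gauss_seq UNIV) {\<omega> \<in> space (gauss_seq UNIV).
     \<exists>s. exec (\<lambda>f. classifier A ls (vec n f)) \<omega> recovery_com (input_state p) s \<and> recovers A p s}"
proof -
  let ?us = "rounds k (round_count p) []"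
  have eq: "{\<omega> \<in> space (gauss_seq UNIV). \<exists>s. exec (\<lambda>f. classifier A ls (vec n f)) \<omega> recovery_com (input_state p) s \<and>
      recovers A p s} = {\<omega>. recovered (?us \<omega>)}"
  proof -
    have "(\<exists>s. exec (\<lambda>f. classifier A ls (vec n f)) \<omega> recovery_com (input_state p) s \<and> recovers A p s)
        \<longleftrightarrow> recovered (?us \<omega>)" for \<omega>
      using recovery_exec[of \<omega>] exec_deterministic by blast
    then show ?thesis by (simp add: gauss_seq_def space_iid_gauss)
  qed
  have "{\<omega>. recovered (?us \<omega>)} \<in> sets iid_gauss"
    using simple_functionD(2)[OF simple_function_rounds, of k "round_count p" "[]" "{us. recovered us}"]
    by (simp add: vimage_def space_iid_gauss)
  then have "measure iid_gauss {\<omega>. accurate (?us \<omega>) \<and> length (?us \<omega>) = k} \<le> measure iid_gauss {\<omega>. recovered (?us \<omega>)}"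
    using accurate_recovered by (intro gseq.finite_measure_mono) auto
  with accurate_probability show ?thesis unfolding eq by (simp add: gauss_seq_def)
qed

end

theorem theorem2:
  shows "\<exists>(alg :: com) (q :: real poly).
    \<forall>(A :: real mat) (ls :: layers) (p :: params).
      let n = par_n p; k = par_k p; d = par_d p;
          \<gamma> = par_gamma p; \<eta> = par_eta p; \<epsilon> = par_eps p; \<delta> = par_delta p;
          oracle = (\<lambda>f. classifier A ls (vec n f))
      in
        A \<in> carrier_mat k n \<longrightarrow> vec_space.rank k A = k \<longrightarrow> k < n \<longrightarrow>
        network k ls \<longrightarrow> length ls = d \<longrightarrow>
        0 < \<gamma> \<longrightarrow> 0 < \<eta> \<longrightarrow> 0 < \<epsilon> \<longrightarrow> 0 < \<delta> \<longrightarrow>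
        (\<forall>i<d. smooth_activation (snd (ls ! i)) (par_L p i)) \<longrightarrow>
        (\<forall>V. subspace_of n V \<longrightarrow> subspace_dim n V < k \<longrightarrow>
              gauss_prob n (\<lambda>g. net_off A ls V g \<ge> 1) \<ge> \<gamma>) \<longrightarrow>
        (\<forall>V. subspace_of n V \<longrightarrow> subspace_dim n V < k \<longrightarrow>
              gauss_prob n (\<lambda>g.
                (\<forall>c>0. net_off A ls V (c \<cdot>\<^sub>v g) = 1 \<longrightarrow>
                        \<bar>dir_deriv (net_off A ls V) g (c \<cdot>\<^sub>v g)\<bar> \<ge> \<eta>) \<and>
                net_off A ls V g \<ge> 1) \<ge> \<gamma>) \<longrightarrow>
        (\<forall>i<d. (\<forall>s\<in>singular_values (fst (ls ! i)). 0 < s) \<and>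
               par_kappa p i = condition_number (fst (ls ! i))) \<longrightarrow>
        (\<forall>s\<in>singular_values A. s \<le> par_scale p) \<longrightarrow>
        (\<forall>i<d. \<forall>s\<in>singular_values (fst (ls ! i)). s \<le> par_scale p) \<longrightarrow>
        (\<forall>\<omega>. \<exists>s. exec oracle \<omega> alg (input_state p) s \<and>
              real (steps s) \<le> poly q (problem_size p) \<and>
              real (queries s) \<le> poly q (problem_size p)) \<and>
        measure (gauss_seq UNIV)
          {\<omega> \<in> space (gauss_seq UNIV).
             \<exists>s. exec oracle \<omega> alg (input_state p) s \<and> recovers A p s} \<ge> 1 - \<delta>"
proof -
  obtain q where q: "\<And>p. 0 < par_gamma p \<Longrightarrow> 0 < par_n p \<Longrightarrow> real (recovery_time p) \<le> poly q (problem_size p)"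
    using poly_bounded_recovery_time unfolding poly_bounded_def by blast
  show ?thesis
    unfolding Let_def
  \<comment> \<open>Program and polynomial are fixed before the network and the parameters, so
    neither depends on them.\<close>
  proof (rule exI[of _ recovery_com], rule exI[of _ q], intro allI impI)
    fix A :: "real mat" and ls :: layers and p :: params
    assume "A \<in> carrier_mat (par_k p) (par_n p)" "par_k p < par_n p" "network (par_k p) ls" "length ls = par_d p"
      "0 < par_gamma p" "0 < par_eta p" "0 < par_eps p" "0 < par_delta p"
      "\<forall>i<par_d p. smooth_activation (snd (ls ! i)) (par_L p i)"
      "\<forall>V. subspace_of (par_n p) V \<longrightarrow> subspace_dim (par_n p) V < par_k p \<longrightarrow>
        gauss_prob (par_n p) (\<lambda>g.
          (\<forall>c>0. net_off A ls V (c \<cdot>\<^sub>v g) = 1 \<longrightarrow> \<bar>dir_deriv (net_off A ls V) g (c \<cdot>\<^sub>v g)\<bar> \<ge> par_eta p) \<and>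
          net_off A ls V g \<ge> 1) \<ge> par_gamma p"
      "\<forall>s\<in>singular_values A. s \<le> par_scale p"
      "\<forall>i<par_d p. \<forall>s\<in>singular_values (fst (ls ! i)). s \<le> par_scale p"
    then interpret recovery_problem A ls p by unfold_locales blast+
    have t: "real (recovery_time p) \<le> poly q (problem_size p)" using q pos(1) n_pos by blast
    have "\<exists>s. exec (\<lambda>f. classifier A ls (vec (par_n p) f)) \<omega> recovery_com (input_state p) s \<and>
        real (steps s) \<le> poly q (problem_size p) \<and> real (queries s) \<le> poly q (problem_size p)" for \<omega>
    proof -
      obtain s where "exec (\<lambda>f. classifier A ls (vec (par_n p) f)) \<omega> recovery_com (input_state p) s"
        "steps s \<le> recovery_time p" "queries s \<le> recovery_time p"
        using recovery_exec by blast
      then show ?thesis using t by (intro exI[of _ s]) auto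
    qed
    with recovery_probability
    show "(\<forall>\<omega>. \<exists>s. exec (\<lambda>f. classifier A ls (vec (par_n p) f)) \<omega> recovery_com (input_state p) s \<and>
        real (steps s) \<le> poly q (problem_size p) \<and> real (queries s) \<le> poly q (problem_size p)) \<and>
      1 - par_delta p \<le> measure (gauss_seq UNIV) {\<omega> \<in> space (gauss_seq UNIV).
        \<exists>s. exec (\<lambda>f. classifier A ls (vec (par_n p) f)) \<omega> recovery_com (input_state p) s \<and> recovers A p s}"
      by blast
  qed
qed

end
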